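(* Let $(A,\mathbf{e})$ be a properly stratified Gorenstein algebra with standard modules $\Delta=\{\Delta(1),\ldots,\Delta(n)\}$. Then: (1) Every Gorenstein projective $A$-module is properly stratified, i.e. it belongs to $\mathcal{F}(\overline{\Delta})$. (2) A module $M$ is in $\mathcal{F}(\Delta)$ if and only if $M$ is in $\mathcal{F}(\overline{\Delta})$ and has finite projective dimension. (3) All endomorphism rings $\operatorname{End}_A(\Delta(i))$ are Frobenius algebras.
   Context: All algebras are finite dimensional over a field $K$; modules are finitely generated right modules; $\operatorname{mod} A$ is the category of such modules; $D=\operatorname{Hom}_K(-,K)$. $A$ is Gorenstein if the left and right injective dimensions of the regular module $A$ are both finite. A module $M$ over a Gorenstein algebra $A$ is Gorenstein projective if $\operatorname{Ext}_A^i(M,A)=0$ for all $i>0$. An algebra $B$ is a Frobenius algebra if $D(B)\cong B$ as right $B$-modules. Stratification. Let $\mathbf{e}=\{e_1,\ldots,e_n\}$ be a linearly ordered complete set of primitive orthogonal idempotents of $A$ (so $e_1+\cdots+e_n=1$), the simple modules $S(i)=\operatorname{top}(e_iA)$ being pairwise non-isomorphic. Put $P(i)=e_iA$ and $\Delta(i)=P(i)/e_iA(e_{i+1}+\cdots+e_n)A$ (standard modules), i.e. the maximal quotient of $P(i)$ without composition factors $S(j)$, $j>i$. Let $\overline{\Delta}(i)$ (proper standard module) be the maximal quotient of $\Delta(i)$ having $S(i)$ only once as a composition factor. Write $\Delta,\overline{\Delta}$ for the sets of these modules. For a set $\Theta$ of modules, $\mathcal{F}(\Theta)$ is the full subcategory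 of $\operatorname{mod} A$ of modules having a finite filtration with subquotients isomorphic to modules in $\Theta$. $(A,\mathbf{e})$ is properly stratified if $A_A\in\mathcal{F}(\Delta)\cap\mathcal{F}(\overline{\Delta})$. *)

theory Defs
  imports "HOL-Algebra.Module" "HOL-Algebra.AbelCoset" "HOL-Algebra.Generated_Groups"
    "HOL-Algebra.Elementary_Groups"
begin

section \<open>Finite dimensional algebras and right modules\<close>

definition finitely_generated :: "('r, 's) ring_scheme \<Rightarrow> ('r, 'm) module \<Rightarrow> bool" where
  "finitely_generated R M \<longleftrightarrow>
     (\<exists>S. finite S \<and> S \<subseteq> carrier M \<and>
        (\<forall>x\<in>carrier M. \<exists>c\<in>S \<rightarrow> carrier R. x = (\<Oplus>\<^bsub>M\<^esub>s\<in>S. c s \<odot>\<^bsub>M\<^esub> s)))"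

text \<open>The library's \<open>algebra\<close> locale is restricted to commutative algebras, hence this variant.\<close>

locale fd_algebra = K?: field K + A?: ring A + Module.module K A
  for K :: "'k ring" and A :: "('k, 'a) module" +
  assumes smult_mult_left:
      "\<lbrakk>l \<in> carrier K; x \<in> carrier A; y \<in> carrier A\<rbrakk>
        \<Longrightarrow> (l \<odot>\<^bsub>A\<^esub> x) \<otimes>\<^bsub>A\<^esub> y = l \<odot>\<^bsub>A\<^esub> (x \<otimes>\<^bsub>A\<^esub> y)"
    and smult_mult_right:
      "\<lbrakk>l \<in> carrier K; x \<in> carrier A; y \<in> carrier A\<rbrakk>
        \<Longrightarrow> x \<otimes>\<^bsub>A\<^esub> (l \<odot>\<^bsub>A\<^esub> y) = l \<odot>\<^bsub>A\<^esub> (x \<otimes>\<^bsub>A\<^esub> y)"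
    and finite_dimensional: "finitely_generated K A"

text \<open>For right modules we reuse the library's record, reading \<open>a \<odot>\<^bsub>M\<^esub> x\<close> as \<open>x \<cdot> a\<close>.
  As in the library, the record fields for multiplication and one of a module are irrelevant.\<close>

locale right_module = R?: ring R + M?: abelian_group M
  for R :: "('a, 'b) ring_scheme" and M :: "('a, 'm) module" +
  assumes act_closed:
      "\<lbrakk>a \<in> carrier R; x \<in> carrier M\<rbrakk> \<Longrightarrow> a \<odot>\<^bsub>M\<^esub> x \<in> carrier M"
    and act_add_ring:
      "\<lbrakk>a \<in> carrier R; b \<in> carrier R; x \<in> carrier M\<rbrakk>
        \<Longrightarrow> (a \<oplus>\<^bsub>R\<^esub> b) \<odot>\<^bsub>M\<^esub> x = a \<odot>\<^bsub>M\<^esub> x \<oplus>\<^bsub>M\<^esub> b \<odot>\<^bsub>M\<^esub> x"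
    and act_add_module:
      "\<lbrakk>a \<in> carrier R; x \<in> carrier M; y \<in> carrier M\<rbrakk>
        \<Longrightarrow> a \<odot>\<^bsub>M\<^esub> (x \<oplus>\<^bsub>M\<^esub> y) = a \<odot>\<^bsub>M\<^esub> x \<oplus>\<^bsub>M\<^esub> a \<odot>\<^bsub>M\<^esub> y"
    and act_mult:
      "\<lbrakk>a \<in> carrier R; b \<in> carrier R; x \<in> carrier M\<rbrakk>
        \<Longrightarrow> (a \<otimes>\<^bsub>R\<^esub> b) \<odot>\<^bsub>M\<^esub> x = b \<odot>\<^bsub>M\<^esub> (a \<odot>\<^bsub>M\<^esub> x)"
    and act_one: "x \<in> carrier M \<Longrightarrow> \<one>\<^bsub>R\<^esub> \<odot>\<^bsub>M\<^esub> x = x"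

definition fg_right_module :: "('a, 'b) ring_scheme \<Rightarrow> ('a, 'm) module \<Rightarrow> bool" where
  "fg_right_module R M \<longleftrightarrow> right_module R M \<and> finitely_generated R M"

definition regular_module :: "('a, 'b) ring_scheme \<Rightarrow> ('a, 'a) module" where
  "regular_module R =
     \<lparr>carrier = carrier R, monoid.mult = monoid.mult R, monoid.one = monoid.one R,
      ring.zero = ring.zero R, ring.add = ring.add R, smult = (\<lambda>a x. x \<otimes>\<^bsub>R\<^esub> a)\<rparr>"

definition opposite_algebra :: "('k, 'a) module \<Rightarrow> ('k, 'a) module" where
  "opposite_algebra A = A\<lparr>monoid.mult := (\<lambda>x y. y \<otimes>\<^bsub>A\<^esub> x)\<rparr>"

text \<open>Homomorphisms are extensional on the carrier, so that equality in \<open>module_homs\<close>,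
  and hence in Hom groups and endomorphism rings, is equality of maps on the carrier.\<close>

definition module_homs :: "('a, 'b) ring_scheme \<Rightarrow> ('a, 'm) module \<Rightarrow> ('a, 'n) module
    \<Rightarrow> ('m \<Rightarrow> 'n) set" where
  "module_homs R M N =
     {f \<in> carrier M \<rightarrow>\<^sub>E carrier N.
        (\<forall>x\<in>carrier M. \<forall>y\<in>carrier M. f (x \<oplus>\<^bsub>M\<^esub> y) = f x \<oplus>\<^bsub>N\<^esub> f y) \<and>
        (\<forall>a\<in>carrier R. \<forall>x\<in>carrier M. f (a \<odot>\<^bsub>M\<^esub> x) = a \<odot>\<^bsub>N\<^esub> f x)}"

definition module_iso :: "('a, 'b) ring_scheme \<Rightarrow> ('a, 'm) module \<Rightarrow> ('a, 'n) module \<Rightarrow> bool" where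
  "module_iso R M N \<longleftrightarrow> (\<exists>f\<in>module_homs R M N. bij_betw f (carrier M) (carrier N))"

definition quotient_module :: "('a, 'm) module \<Rightarrow> 'm set \<Rightarrow> ('a, 'm set) module" where
  "quotient_module M U =
     \<lparr>carrier = a_rcosets\<^bsub>M\<^esub> U, monoid.mult = undefined, monoid.one = undefined,
      ring.zero = U, ring.add = set_add M, smult = (\<lambda>a X. \<Union>x\<in>X. U +>\<^bsub>M\<^esub> (a \<odot>\<^bsub>M\<^esub> x))\<rparr>"

definition subquotient :: "('a, 'm) module \<Rightarrow> 'm set \<Rightarrow> 'm set \<Rightarrow> ('a, 'm set) module" where
  "subquotient M V U = quotient_module (M\<lparr>carrier := V\<rparr>) U"


section \<open>Filtrations and composition factors\<close>

definition submodule_chain ::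
    "('a, 'b) ring_scheme \<Rightarrow> ('a, 'm) module \<Rightarrow> nat \<Rightarrow> (nat \<Rightarrow> 'm set) \<Rightarrow> bool" where
  "submodule_chain R M l c \<longleftrightarrow>
     c 0 = {\<zero>\<^bsub>M\<^esub>} \<and> c l = carrier M \<and>
     (\<forall>i\<le>l. submodule (c i) R M) \<and> (\<forall>i<l. c i \<subseteq> c (Suc i))"

definition filtered_by ::
    "('a, 'b) ring_scheme \<Rightarrow> ('a, 't) module set \<Rightarrow> ('a, 'm) module set" where
  "filtered_by R \<Theta> =
     {M. fg_right_module R M \<and>
         (\<exists>l c. submodule_chain R M l c \<and>
            (\<forall>i<l. \<exists>T\<in>\<Theta>. module_iso R (subquotient M (c (Suc i)) (c i)) T))}"

definition simple_module :: "('a, 'b) ring_scheme \<Rightarrow> ('a, 'm) module \<Rightarrow> bool" where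
  "simple_module R M \<longleftrightarrow>
     right_module R M \<and> carrier M \<noteq> {\<zero>\<^bsub>M\<^esub>} \<and>
     (\<forall>U. submodule U R M \<longrightarrow> U = {\<zero>\<^bsub>M\<^esub>} \<or> U = carrier M)"

definition composition_series ::
    "('a, 'b) ring_scheme \<Rightarrow> ('a, 'm) module \<Rightarrow> nat \<Rightarrow> (nat \<Rightarrow> 'm set) \<Rightarrow> bool" where
  "composition_series R M l c \<longleftrightarrow>
     submodule_chain R M l c \<and>
     (\<forall>i<l. simple_module R (subquotient M (c (Suc i)) (c i)))"

text \<open>\<open>S\<close> occurs exactly \<open>m\<close> times as a composition factor of \<open>M\<close>;
  by Jordan--Hoelder the choice of the series does not matter.\<close>

definition composition_multiplicity ::
    "('a, 'b) ring_scheme \<Rightarrow> ('a, 'm) module \<Rightarrow> ('a, 's) module \<Rightarrow> nat \<Rightarrow> bool" where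
  "composition_multiplicity R M S m \<longleftrightarrow>
     (\<exists>l c. composition_series R M l c \<and>
        card {i. i < l \<and> module_iso R (subquotient M (c (Suc i)) (c i)) S} = m)"

definition maximal_submodule :: "('a, 'b) ring_scheme \<Rightarrow> ('a, 'm) module \<Rightarrow> 'm set \<Rightarrow> bool" where
  "maximal_submodule R M U \<longleftrightarrow>
     submodule U R M \<and> U \<noteq> carrier M \<and>
     (\<forall>V. submodule V R M \<and> U \<subseteq> V \<longrightarrow> V = U \<or> V = carrier M)"

definition radical :: "('a, 'b) ring_scheme \<Rightarrow> ('a, 'm) module \<Rightarrow> 'm set" where
  "radical R M = carrier M \<inter> \<Inter>{U. maximal_submodule R M U}"

definition top_module :: "('a, 'b) ring_scheme \<Rightarrow> ('a, 'm) module \<Rightarrow> ('a, 'm set) module" where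
  "top_module R M = quotient_module M (radical R M)"


section \<open>Homological notions\<close>

text \<open>In the following, modules that are quantified over inside a definition live in the type
  \<^typ>\<open>nat \<Rightarrow> 'k\<close>, where \<^typ>\<open>'k\<close> is the type of scalars of the algebra. If \<open>A\<close> is a finite
  dimensional \<open>K\<close>-algebra, then every module in \<open>mod A\<close> is isomorphic to one whose underlying
  vector space is some \<open>K\<^sup>d\<close>, and thus to one in this type; so nothing is lost. Other modules
  may live in arbitrary types.\<close>

definition projective_module :: "('k, 'a) module \<Rightarrow> ('a, 'm) module \<Rightarrow> bool" where
  "projective_module A P \<longleftrightarrow>
     fg_right_module A P \<and>
     (\<forall>(X :: ('a, nat \<Rightarrow> 'k) module) (Y :: ('a, nat \<Rightarrow> 'k) module).
        fg_right_module A X \<longrightarrow> fg_right_module A Y \<longrightarrow>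
        (\<forall>f\<in>module_homs A X Y. f ` carrier X = carrier Y \<longrightarrow>
           (\<forall>g\<in>module_homs A P Y. \<exists>h\<in>module_homs A P X. \<forall>x\<in>carrier P. f (h x) = g x)))"

definition injective_module :: "('k, 'a) module \<Rightarrow> ('a, 'm) module \<Rightarrow> bool" where
  "injective_module A I \<longleftrightarrow>
     fg_right_module A I \<and>
     (\<forall>(X :: ('a, nat \<Rightarrow> 'k) module) (Y :: ('a, nat \<Rightarrow> 'k) module).
        fg_right_module A X \<longrightarrow> fg_right_module A Y \<longrightarrow>
        (\<forall>f\<in>module_homs A X Y. inj_on f (carrier X) \<longrightarrow>
           (\<forall>g\<in>module_homs A X I. \<exists>h\<in>module_homs A Y I. \<forall>x\<in>carrier X. h (f x) = g x)))"

text \<open>The complex \<open>\<dots> \<rightarrow> P 2 \<rightarrow> P 1 \<rightarrow> P 0 \<rightarrow> M \<rightarrow> 0\<close> is exact, with maps \<open>d i : P (i + 1) \<rightarrow> P i\<close>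
  and \<open>\<epsilon> : P 0 \<rightarrow> M\<close>.\<close>

definition projective_resolution ::
    "('k, 'a) module \<Rightarrow> ('a, 'm) module \<Rightarrow> (nat \<Rightarrow> ('a, nat \<Rightarrow> 'k) module)
      \<Rightarrow> (nat \<Rightarrow> (nat \<Rightarrow> 'k) \<Rightarrow> (nat \<Rightarrow> 'k)) \<Rightarrow> ((nat \<Rightarrow> 'k) \<Rightarrow> 'm) \<Rightarrow> bool" where
  "projective_resolution A M P d \<epsilon> \<longleftrightarrow>
     (\<forall>i. projective_module A (P i)) \<and>
     \<epsilon> \<in> module_homs A (P 0) M \<and> (\<forall>i. d i \<in> module_homs A (P (Suc i)) (P i)) \<and>
     \<epsilon> ` carrier (P 0) = carrier M \<and>
     d 0 ` carrier (P 1) = a_kernel (P 0) M \<epsilon> \<and>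
     (\<forall>i. d (Suc i) ` carrier (P (Suc (Suc i))) = a_kernel (P (Suc i)) (P i) (d i))"

text \<open>The complex \<open>0 \<rightarrow> M \<rightarrow> I 0 \<rightarrow> I 1 \<rightarrow> I 2 \<rightarrow> \<dots>\<close> is exact, with maps \<open>\<eta> : M \<rightarrow> I 0\<close>
  and \<open>d i : I i \<rightarrow> I (i + 1)\<close>.\<close>

definition injective_coresolution ::
    "('k, 'a) module \<Rightarrow> ('a, 'm) module \<Rightarrow> (nat \<Rightarrow> ('a, nat \<Rightarrow> 'k) module)
      \<Rightarrow> (nat \<Rightarrow> (nat \<Rightarrow> 'k) \<Rightarrow> (nat \<Rightarrow> 'k)) \<Rightarrow> ('m \<Rightarrow> (nat \<Rightarrow> 'k)) \<Rightarrow> bool" where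
  "injective_coresolution A M I d \<eta> \<longleftrightarrow>
     (\<forall>i. injective_module A (I i)) \<and>
     \<eta> \<in> module_homs A M (I 0) \<and> (\<forall>i. d i \<in> module_homs A (I i) (I (Suc i))) \<and>
     inj_on \<eta> (carrier M) \<and>
     \<eta> ` carrier M = a_kernel (I 0) (I 1) (d 0) \<and>
     (\<forall>i. d i ` carrier (I i) = a_kernel (I (Suc i)) (I (Suc (Suc i))) (d (Suc i)))"

definition finite_projective_dimension :: "('k, 'a) module \<Rightarrow> ('a, 'm) module \<Rightarrow> bool" where
  "finite_projective_dimension A M \<longleftrightarrow>
     (\<exists>P d \<epsilon> l. projective_resolution A M P d \<epsilon> \<and> (\<forall>i>l. carrier (P i) = {\<zero>\<^bsub>P i\<^esub>}))"

definition finite_injective_dimension :: "('k, 'a) module \<Rightarrow> ('a, 'm) module \<Rightarrow> bool" where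
  "finite_injective_dimension A M \<longleftrightarrow>
     (\<exists>I d \<eta> l. injective_coresolution A M I d \<eta> \<and> (\<forall>i>l. carrier (I i) = {\<zero>\<^bsub>I i\<^esub>}))"

definition hom_group ::
    "('a, 'b) ring_scheme \<Rightarrow> ('a, 'm) module \<Rightarrow> ('a, 'n) module \<Rightarrow> ('m \<Rightarrow> 'n) monoid" where
  "hom_group R M N =
     \<lparr>carrier = module_homs R M N,
      monoid.mult = (\<lambda>f g. \<lambda>x\<in>carrier M. f x \<oplus>\<^bsub>N\<^esub> g x),
      monoid.one = (\<lambda>x\<in>carrier M. \<zero>\<^bsub>N\<^esub>)\<rparr>"

definition hom_cocycles ::
    "('a, 'b) ring_scheme \<Rightarrow> (nat \<Rightarrow> ('a, 'm) module) \<Rightarrow> (nat \<Rightarrow> 'm \<Rightarrow> 'm)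
      \<Rightarrow> ('a, 'n) module \<Rightarrow> nat \<Rightarrow> ('m \<Rightarrow> 'n) set" where
  "hom_cocycles R P d N i =
     kernel (hom_group R (P i) N) (hom_group R (P (Suc i)) N)
       (\<lambda>f. compose (carrier (P (Suc i))) f (d i))"

definition hom_coboundaries ::
    "('a, 'b) ring_scheme \<Rightarrow> (nat \<Rightarrow> ('a, 'm) module) \<Rightarrow> (nat \<Rightarrow> 'm \<Rightarrow> 'm)
      \<Rightarrow> ('a, 'n) module \<Rightarrow> nat \<Rightarrow> ('m \<Rightarrow> 'n) set" where
  "hom_coboundaries R P d N i =
     (case i of 0 \<Rightarrow> {monoid.one (hom_group R (P 0) N)}
      | Suc j \<Rightarrow> (\<lambda>f. compose (carrier (P (Suc j))) f (d j)) ` module_homs R (P j) N)"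

text \<open>\<open>Ext A i M N\<close> is the \<open>i\<close>-th cohomology group of \<open>Hom(P, N)\<close>, where \<open>P\<close> is a chosen
  projective resolution of \<open>M\<close>; up to isomorphism it does not depend on the choice.\<close>

definition Ext :: "('k, 'a) module \<Rightarrow> nat \<Rightarrow> ('a, 'm) module \<Rightarrow> ('a, 'n) module
    \<Rightarrow> ((nat \<Rightarrow> 'k) \<Rightarrow> 'n) set monoid" where
  "Ext A i M N =
     (let (P, d) = (SOME (P, d). \<exists>\<epsilon>. projective_resolution A M P d \<epsilon>)
      in (hom_group A (P i) N)\<lparr>carrier := hom_cocycles A P d N i\<rparr> Mod hom_coboundaries A P d N i)"

text \<open>Left \<open>A\<close>-modules are right modules over the opposite algebra.\<close>

definition gorenstein_algebra :: "('k, 'a) module \<Rightarrow> bool" where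
  "gorenstein_algebra A \<longleftrightarrow>
     finite_injective_dimension A (regular_module A) \<and>
     finite_injective_dimension (opposite_algebra A) (regular_module (opposite_algebra A))"

definition gorenstein_projective :: "('k, 'a) module \<Rightarrow> ('a, 'm) module \<Rightarrow> bool" where
  "gorenstein_projective A M \<longleftrightarrow>
     fg_right_module A M \<and> (\<forall>i>0. trivial_group (Ext A i M (regular_module A)))"


section \<open>Endomorphism algebras and Frobenius algebras\<close>

text \<open>A scalar \<open>l\<close> acts on a right \<open>A\<close>-module as \<open>l \<cdot> 1\<close>.\<close>

definition End_algebra :: "('k, 'a) module \<Rightarrow> ('a, 'm) module \<Rightarrow> ('k, 'm \<Rightarrow> 'm) module" where
  "End_algebra A M =
     \<lparr>carrier = module_homs A M M,
      monoid.mult = (\<lambda>f g. compose (carrier M) f g),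
      monoid.one = (\<lambda>x\<in>carrier M. x),
      ring.zero = (\<lambda>x\<in>carrier M. \<zero>\<^bsub>M\<^esub>),
      ring.add = (\<lambda>f g. \<lambda>x\<in>carrier M. f x \<oplus>\<^bsub>M\<^esub> g x),
      smult = (\<lambda>l f. \<lambda>x\<in>carrier M. (l \<odot>\<^bsub>A\<^esub> \<one>\<^bsub>A\<^esub>) \<odot>\<^bsub>M\<^esub> f x)\<rparr>"

text \<open>\<open>D(B) = Hom\<^sub>K(B, K)\<close> with the right action \<open>(\<phi> \<cdot> b)(x) = \<phi>(b x)\<close>.\<close>

definition dual_module :: "'k ring \<Rightarrow> ('k, 'b) module \<Rightarrow> ('b, 'b \<Rightarrow> 'k) module" where
  "dual_module K B =
     \<lparr>carrier = module_homs K B (regular_module K),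
      monoid.mult = undefined, monoid.one = undefined,
      ring.zero = (\<lambda>x\<in>carrier B. \<zero>\<^bsub>K\<^esub>),
      ring.add = (\<lambda>\<phi> \<psi>. \<lambda>x\<in>carrier B. \<phi> x \<oplus>\<^bsub>K\<^esub> \<psi> x),
      smult = (\<lambda>b \<phi>. \<lambda>x\<in>carrier B. \<phi> (b \<otimes>\<^bsub>B\<^esub> x))\<rparr>"

definition frobenius_algebra :: "'k ring \<Rightarrow> ('k, 'b) module \<Rightarrow> bool" where
  "frobenius_algebra K B \<longleftrightarrow>
     fd_algebra K B \<and> module_iso B (dual_module K B) (regular_module B)"


section \<open>Stratification\<close>

definition primitive_idempotent :: "('a, 'b) ring_scheme \<Rightarrow> 'a \<Rightarrow> bool" where
  "primitive_idempotent R e \<longleftrightarrow>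
     e \<in> carrier R \<and> e \<noteq> \<zero>\<^bsub>R\<^esub> \<and> e \<otimes>\<^bsub>R\<^esub> e = e \<and>
     (\<forall>f\<in>carrier R. \<forall>g\<in>carrier R.
        f \<otimes>\<^bsub>R\<^esub> f = f \<and> g \<otimes>\<^bsub>R\<^esub> g = g \<and> f \<otimes>\<^bsub>R\<^esub> g = \<zero>\<^bsub>R\<^esub> \<and> g \<otimes>\<^bsub>R\<^esub> f = \<zero>\<^bsub>R\<^esub> \<and>
        e = f \<oplus>\<^bsub>R\<^esub> g \<longrightarrow> f = \<zero>\<^bsub>R\<^esub> \<or> g = \<zero>\<^bsub>R\<^esub>)"

text \<open>The idempotents are \<open>e 1, \<dots>, e n\<close>, in this order.\<close>

definition indec_projective :: "('a, 'b) ring_scheme \<Rightarrow> (nat \<Rightarrow> 'a) \<Rightarrow> nat \<Rightarrow> ('a, 'a) module" where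
  "indec_projective R e i =
     (regular_module R)\<lparr>carrier := (\<lambda>a. e i \<otimes>\<^bsub>R\<^esub> a) ` carrier R\<rparr>"

definition simple_top :: "('a, 'b) ring_scheme \<Rightarrow> (nat \<Rightarrow> 'a) \<Rightarrow> nat \<Rightarrow> ('a, 'a set) module" where
  "simple_top R e i = top_module R (indec_projective R e i)"

definition idempotent_system :: "('a, 'b) ring_scheme \<Rightarrow> nat \<Rightarrow> (nat \<Rightarrow> 'a) \<Rightarrow> bool" where
  "idempotent_system R n e \<longleftrightarrow>
     (\<forall>i\<in>{1..n}. primitive_idempotent R (e i)) \<and>
     (\<forall>i\<in>{1..n}. \<forall>j\<in>{1..n}. i \<noteq> j \<longrightarrow> e i \<otimes>\<^bsub>R\<^esub> e j = \<zero>\<^bsub>R\<^esub>) \<and>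
     (\<Oplus>\<^bsub>R\<^esub>i\<in>{1..n}. e i) = \<one>\<^bsub>R\<^esub> \<and>
     (\<forall>i\<in>{1..n}. \<forall>j\<in>{1..n}. i \<noteq> j \<longrightarrow> \<not> module_iso R (simple_top R e i) (simple_top R e j))"

definition standard_module ::
    "('a, 'b) ring_scheme \<Rightarrow> nat \<Rightarrow> (nat \<Rightarrow> 'a) \<Rightarrow> nat \<Rightarrow> ('a, 'a set) module" where
  "standard_module R n e i =
     (let \<epsilon> = (\<Oplus>\<^bsub>R\<^esub>j\<in>{i<..n}. e j)
      in quotient_module (indec_projective R e i)
           (generate (add_monoid R)
              {e i \<otimes>\<^bsub>R\<^esub> a \<otimes>\<^bsub>R\<^esub> \<epsilon> \<otimes>\<^bsub>R\<^esub> b | a b. a \<in> carrier R \<and> b \<in> carrier R}))"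

text \<open>The maximal quotient of \<open>\<Delta>(i)\<close> with the required property is the quotient by the least
  such submodule, where least refers to inclusion.\<close>

definition proper_standard_module ::
    "('a, 'b) ring_scheme \<Rightarrow> nat \<Rightarrow> (nat \<Rightarrow> 'a) \<Rightarrow> nat \<Rightarrow> ('a, 'a set set) module" where
  "proper_standard_module R n e i =
     quotient_module (standard_module R n e i)
       (LEAST U. submodule U R (standard_module R n e i) \<and>
          composition_multiplicity R (quotient_module (standard_module R n e i) U)
            (simple_top R e i) 1)"

definition standard_modules ::
    "('a, 'b) ring_scheme \<Rightarrow> nat \<Rightarrow> (nat \<Rightarrow> 'a) \<Rightarrow> ('a, 'a set) module set" where
  "standard_modules R n e = standard_module R n e ` {1..n}"

definition proper_standard_modules ::
    "('a, 'b) ring_scheme \<Rightarrow> nat \<Rightarrow> (nat \<Rightarrow> 'a) \<Rightarrow> ('a, 'a set set) module set" where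
  "proper_standard_modules R n e = proper_standard_module R n e ` {1..n}"

definition properly_stratified :: "('k, 'a) module \<Rightarrow> nat \<Rightarrow> (nat \<Rightarrow> 'a) \<Rightarrow> bool" where
  "properly_stratified A n e \<longleftrightarrow>
     idempotent_system A n e \<and>
     regular_module A \<in> filtered_by A (standard_modules A n e) \<inter>
                        filtered_by A (proper_standard_modules A n e)"

end

theory Submission
 imports Defs
begin

text \<open>Call \<open>M\<close> exact at \<open>t\<close> if the multiplication map \<open>M e\<^sub>t \<otimes> e\<^sub>t A \<rightarrow> M\<close> is injective modulo the
  trace of \<open>P(t+1), \<dots>, P(n)\<close>. Then \<open>M\<close> has a filtration by proper standard modules iff it is exact at
  every \<open>t\<close>, and one by standard modules iff, in addition, \<open>M e\<^sub>t\<close> is free over \<open>End \<Delta>(t)\<close> modulo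
  that trace. A Gorenstein projective module \<open>G\<close> embeds into a projective module with Gorenstein projective
  cokernel, since homomorphisms from \<open>G\<close> to modules of finite projective dimension, such as \<open>D(A)\<close>,
  factor through free modules. By descending induction on \<open>t\<close>, exactness of the cokernel makes this embedding
  respect traces, so that exactness passes from \<open>A\<close> to \<open>G\<close>. Freeness at \<open>t\<close> passes from the terms of
  a finite projective resolution to the resolved module, because \<open>End \<Delta>(t)\<close> is local and has a left socle.
  Finally, homomorphisms from a Gorenstein projective module to the dual of \<open>A e\<^sub>t\<close> modulo the trace factor
  through free modules; so this dual has finite projective dimension, and freeness at \<open>t\<close> yields a nondegenerate
  functional on \<open>End \<Delta>(t)\<close>.\<close>

\<comment> \<open>The obstacle is that taking traces is not left exact: for a surjection from
  \<open>M\<close> onto \<open>T\<close> with kernel \<open>U\<close>, the trace of \<open>U\<close>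
  may be smaller than the intersection of \<open>U\<close> with the trace of \<open>M\<close>.
  \<open>kernel_trace\<close> shows that both agree if \<open>T\<close> is exact at all larger
  indices, and the inductions are arranged so that this hypothesis is at hand. Finite projective
  dimension is handled through \<open>zclass\<close>, a condition on homomorphisms from Gorenstein
  projective modules. Its closure under extensions, cokernels and syzygies needs no comparison of
  resolutions. It also yields that modules filtered by standard modules have finite projective
  dimension: the layer of \<open>A\<close> at \<open>t\<close> is filtered by copies of the standard
  module at \<open>t\<close>, which is a summand of \<open>A\<close> modulo the next trace ideal, so
  descending induction puts the trace ideals and the standard modules into the class. Groups
  \<open>Ext\<close> occur only on entering the coinductive predicate \<open>gp\<close>. Tensor
  products and residue rings are replaced by coefficients: generation, bases and dual bases are
  stated for representatives, modulo a submodule \<open>U\<close> and an ideal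
  \<open>J\<close>.\<close>
text \<open>The structure of an indexed operation is written after a dot or, for constants, after \<open>@\<close>.\<close>

syntax "_index" :: "logic => index"  ("._" [1000] 1000)
no_notation map_add (infixl "++" 100)
notation monoid.mult (infixl "**\<index>" 70) and ring.add (infixl "++\<index>" 65)
 and a_minus (infixl "--\<index>" 65) and a_inv ("~-\<index> _" [81] 80) and smult (infixl "*>\<index>" 70)
notation (input) HOL.iff (infixr "<->" 25) and funcset (infixr "->" 60)
abbreviation (input) "car == carrier"
lemmas (in right_module) rax = right_module_axioms
abbreviation (input) "reg == regular_module"
abbreviation (input) "rmod == right_module"
abbreviation (input) "fgm == fg_right_module"
abbreviation (input) "subm == submodule"
abbreviation (input) "akr == a_kernel"
abbreviation (input) cmem (infix ":." 50) where "x :. M == x : carrier M"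
syntax "_osum" :: "index => idt => 'a => 'b => 'c"  ("(3+'/__<_. _)" [1000,0,51,10] 10)
 "_oset" :: "index => idt => 'a => 'b => 'c"  ("(3+'/__:_. _)" [1000,0,51,10] 10)
syntax "_rlam" :: "pttrn => 'a set => 'b => 'c"  ("(3%_:_./ _)" [0,0,3] 3)
translations "%x:S. b" => "CONST restrict (%x. b) S"
 "_osum G i p b" => "CONST finsum G (%i. b) {..<p}"
 "_oset G i S b" => "CONST finsum G (%i. b) S"
abbreviation (input) fam (infix "->." 60) where "p ->. M == {..<p} -> carrier M"
abbreviation (input) zero_at ("0@_" [1000] 1000) where "0@M == ring.zero M"
abbreviation (input) one_at ("1@_" [1000] 1000) where "1@M == monoid.one M"

section \<open>Right modules\<close>

lemma (in abelian_group) minus_zero: "~- \<zero> = \<zero>" using minus_equality[of "\<zero>" "\<zero>"] by simp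

lemmas (in abelian_group) abelian_group_simprules
 [algebra abelian_group "zero G" "add G" "a_inv G" "a_minus G"] =
 a_closed zero_closed a_inv_closed minus_closed a_assoc l_zero l_neg a_comm minus_eq
 r_zero r_neg r_neg2 r_neg1 minus_add minus_minus minus_zero a_lcomm

lemma (in abelian_group) diff_add_cancel: "x :. G ==> y :. G ==> (x -- y) ++ y = x" by algebra

lemma (in abelian_group) diff_self [simp]: "x :. G ==> x -- x = \<zero>" by algebra

lemma (in abelian_group) diff_eq_zero_iff:
 "x :. G ==> y :. G ==> x -- y = \<zero> <-> x = y" by (metis diff_add_cancel diff_self l_zero)

lemma (in abelian_group) diff_zero [simp]: "x :. G ==> x -- \<zero> = x" by algebra

context right_module
begin

declare act_closed [simp, intro]

lemma act_zero [simp]: "a :. R ==> a *>.M 0@M = 0@M" using act_add_module[of a "0@M" "0@M"] by (simp add: M.add.l_cancel_one)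

lemma zero_act [simp]: "x :. M ==> 0@R *>.M x = 0@M" using act_add_ring[of "0@R" "0@R" x] by (simp add: M.add.l_cancel_one)

lemma act_minus: "[|a :. R; x :. M|] ==> a *>.M (~-.M x) = ~-.M (a *>.M x)" using act_add_module[of a "~-.M x" x]
 by (metis M.add.inv_closed M.l_neg M.minus_equality act_closed act_zero)

lemma minus_act: "[|a :. R; x :. M|] ==> (~-.R a) *>.M x = ~-.M (a *>.M x)" using act_add_ring[of "~-.R a" a x]
 by (metis R.add.inv_closed R.l_neg M.minus_equality act_closed zero_act)

lemma act_diff: "[|a :. R; x :. M; y :. M|]
  ==> a *>.M (x --.M y) = a *>.M x --.M a *>.M y" by (simp add: a_minus_def act_add_module act_minus)

lemma diff_act: "[|a :. R; b :. R; x :. M|]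
  ==> (a --.R b) *>.M x = a *>.M x --.M b *>.M x" by (simp add: a_minus_def act_add_ring minus_act)

lemma act_finsum: "[|a :. R; f : I -> car M|]
  ==> a *>.M (+/.M i:I. f i) = (+/.M i:I. a *>.M f i)"
proof (induct I rule: infinite_finite_induct)
 case (insert i I)
 hence "f : I -> car M" "f i :. M" by auto
 with insert show ?case by (simp add: act_add_module Pi_def)
qed (simp_all add: M.finsum_infinite)

lemma finsum_act: "[|x :. M; f : I -> car R|]
  ==> (+/.R i:I. f i) *>.M x = (+/.M i:I. f i *>.M x)"
proof (induct I rule: infinite_finite_induct)
 case (insert i I)
 hence "f : I -> car R" "f i :. R" by auto
 with insert show ?case by (simp add: act_add_ring Pi_def)
qed (simp_all add: M.finsum_infinite R.finsum_infinite)

text \<open>Closure under negation, which \<open>submodule\<close> asks for, comes from the action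
  of \<open>-1\<close>.\<close>

lemma submodI:
 assumes "U <= car M" "0@M : U" "!!x y. x : U ==> y : U ==> x ++.M y : U"
  "!!a x. a :. R ==> x : U ==> a *>.M x : U" shows "subm U R M"
proof -
 have inv: "~-.M x : U" if "x : U" for x using assms(4)[of "~-.R 1@R" x] that assms(1) minus_act[of "1@R" x] act_one[of x] by auto
 show ?thesis by (intro submodule.intro subgroup.intro submodule_axioms.intro) (use assms inv in "auto simp: a_inv_def")
qed

lemma submodD:
 assumes "subm U R M" shows submod_subset: "U <= car M" and submod_zero: "0@M : U" and submod_add: "!!x y. x : U ==> y : U ==> x ++.M y : U"
  and submod_act: "!!a x. a :. R ==> x : U ==> a *>.M x : U" and submod_minus: "!!x. x : U ==> ~-.M x : U"
proof -
 interpret submodule U R M by fact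
 show "U <= car M" using subset by simp
 show "0@M : U" using one_closed by simp
 show "x ++.M y : U" if "x : U" "y : U" for x y using m_closed[OF that] by simp
 show "a *>.M x : U" if "a :. R" "x : U" for a x using smult_closed[OF that] .
 show "~-.M x : U" if "x : U" for x using m_inv_closed[OF that] by (simp add: a_inv_def)
qed

lemma submod_carrier: "subm U R M ==> x : U ==> x :. M" using submod_subset by blast

lemma submod_diff: "subm U R M ==> x : U ==> y : U ==> x --.M y : U" by (simp add: a_minus_def submod_add submod_minus)

lemma submod_finsum:
 assumes "subm U R M" "!!i. i : I ==> f i : U" shows "(+/.M i:I. f i) : U" using assms(2)
proof (induct I rule: infinite_finite_induct)
 case (insert i I)
 hence "f : I -> car M" "f i :. M" using submod_carrier[OF assms(1)] by auto
 with insert show ?case by (simp add: submod_add[OF assms(1)])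
qed (simp_all add: M.finsum_infinite submod_zero[OF assms(1)])

lemma submod_diff_iff:
 assumes "subm U R M" "x --.M y : U" "x :. M" "y :. M" shows "x : U <-> y : U"
proof
 assume "x : U"
 hence "x --.M (x --.M y) : U" using assms submod_diff by blast
 moreover have "x --.M (x --.M y) = y" using assms(3,4) by algebra
 ultimately show "y : U" by simp
next
 assume "y : U"
 hence "(x --.M y) ++.M y : U" using assms submod_add by blast
 moreover have "(x --.M y) ++.M y = x" using assms(3,4) by algebra
 ultimately show "x : U" by simp
qed

lemma submod_zero_set: "subm {0@M} R M" by (rule submodI) auto

lemma submod_self: "subm (car M) R M" by (rule submodI) auto

lemma submod_Int: "subm U R M ==> subm V R M ==> subm (U Int V) R M" by (rule submodI) (auto dest: submodD)

lemma submod_abelian_group: 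
 assumes "subm U R M" shows "abelian_group (M(|carrier := U|))"
proof (rule abelian_groupI)
 show "EX y:car (M(|carrier := U|)). y ++.(M(|carrier := U|)) x = 0@(M(|carrier := U|))"
  if "x :. (M(|carrier := U|))" for x by (rule bexI[of _ "~-.M x"]) (use that assms submod_minus submod_carrier in "auto simp: M.l_neg")
qed (use submodD[OF assms] in "auto simp: M.a_ac subset_iff")

lemma submod_right_module:
 assumes "subm U R M" shows "rmod R (M(|carrier := U|))"
proof -
 interpret U: abelian_group "M(|carrier := U|)" by (rule submod_abelian_group[OF assms])
 show ?thesis by unfold_locales (use submodD[OF assms] in
   "auto simp: act_add_ring act_add_module act_mult act_one subset_iff")
qed

lemma finsum_submod:
 assumes "subm U R M" "f : I -> U" shows "finsum (M(|carrier := U|)) f I = finsum M f I"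
proof -
 interpret U: abelian_group "M(|carrier := U|)" by (rule submod_abelian_group[OF assms(1)])
 show ?thesis using assms(2)
 proof (induct I rule: infinite_finite_induct)
  case (insert i I)
  hence "f : I -> car M" "f i :. M" using submod_carrier[OF assms(1)] by auto
  with insert show ?case by (simp add: Pi_def)
 qed (simp_all add: M.finsum_infinite U.finsum_infinite)
qed

lemma minus_submod:
 assumes "subm U R M" "x : U" shows "~-.(M(|carrier := U|)) x = ~-.M x"
proof -
 interpret U: abelian_group "M(|carrier := U|)" by (rule submod_abelian_group[OF assms(1)])
 show ?thesis using U.minus_equality[of "~-.M x" x] assms submod_minus submod_carrier by (simp add: M.l_neg)
qed

lemma submod_submod_iff:
 assumes "subm V R M" "U <= V" shows "subm U R (M(|carrier := V|)) <-> subm U R M"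
proof -
 interpret V: right_module R "M(|carrier := V|)" by (rule submod_right_module[OF assms(1)])
 show ?thesis
 proof
  assume "subm U R (M(|carrier := V|))"
  from V.submodD[OF this] show "subm U R M" by (intro submodI) (use assms(2) submod_subset[OF assms(1)] in auto)
 next
  assume "subm U R M"
  from submodD[OF this] show "subm U R (M(|carrier := V|))" by (intro V.submodI) (use assms(2) in auto)
 qed
qed

end

section \<open>Linear maps\<close>

text \<open>This is \<open>module_homs\<close> without extensionality: homomorphisms can be plain
  lambda terms that are composed and cut down freely, and \<open>restrict_module_hom\<close> leads
  back to the official notion.\<close>

definition lin :: "('a, 'b) ring_scheme => ('a, 'm) module => ('a, 'n) module => ('m => 'n) => bool" where
 "lin R M N f <-> f : car M -> car N &
  (ALL x:car M. ALL y:car M. f (x ++.M y) = f x ++.N f y) &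
  (ALL a:car R. ALL x:car M. f (a *>.M x) = a *>.N f x)"

lemma module_homs_iff: "f : module_homs R M N <-> lin R M N f & f : extensional (car M)" by (auto simp: module_homs_def lin_def PiE_def)

lemma linI:
 assumes "!!x. x :. M ==> f x :. N"
  "!!x y. x :. M ==> y :. M ==> f (x ++.M y) = f x ++.N f y"
  "!!a x. a :. R ==> x :. M ==> f (a *>.M x) = a *>.N f x" shows "lin R M N f" using assms by (simp add: lin_def)

lemma lin_closed: "lin R M N f ==> x :. M ==> f x :. N" and lin_add: "lin R M N f ==> x :. M ==> y :. M ==> f (x ++.M y) = f x ++.N f y"
 and lin_act: "lin R M N f ==> a :. R ==> x :. M ==> f (a *>.M x) = a *>.N f x" by (auto simp: lin_def)

lemma lin_cong: "(!!x. x :. M ==> f x = g x) ==> rmod R M ==> lin R M N f <-> lin R M N g"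
proof -
 assume eq: "!!x. x :. M ==> f x = g x" and "rmod R M"
 then interpret right_module R M by simp
 show ?thesis by (auto simp: lin_def eq Pi_iff)
qed

lemma restrict_module_hom:
 assumes "rmod R M" "lin R M N f" shows "restrict f (car M) : module_homs R M N"
proof -
 have "lin R M N (restrict f (car M))" by (subst lin_cong[of M _ f]) (use assms in auto)
 thus ?thesis by (simp add: module_homs_iff)
qed

lemma lin_comp: "lin R M N f ==> lin R N P g ==> lin R M P (%x. g (f x))" by (auto simp: lin_def Pi_def)

lemma lin_id: "lin R M M (%x. x)" by (auto simp: lin_def)

lemma lin_into: "lin R M N f ==> (!!x. x :. M ==> f x : V) ==> lin R M (N(|carrier := V|)) f" by (auto simp: lin_def)

lemma lin_out: "lin R M (N(|carrier := V|)) f ==> V <= car N ==> lin R M N f" by (auto simp: lin_def)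

lemma lin_restrict: "lin R M N f ==> U <= car M ==> lin R (M(|carrier := U|)) N f" by (auto simp: lin_def Pi_def subset_iff)

locale linear_map = M: right_module R M + N: right_module R N
 for R :: "('a, 'b) ring_scheme" and M :: "('a, 'm) module" and N :: "('a, 'n) module" +
 fixes f :: "'m => 'n"
 assumes lin: "lin R M N f"
begin

lemma closed [simp, intro]: "x :. M ==> f x :. N" and map_add: "x :. M ==> y :. M ==> f (x ++.M y) = f x ++.N f y"
 and map_act: "a :. R ==> x :. M ==> f (a *>.M x) = a *>.N f x" using lin by (auto simp: lin_def)

lemma map_zero [simp]: "f 0@M = 0@N" using map_add[of "0@M" "0@M"] by (simp add: N.add.l_cancel_one)

lemma map_minus: "x :. M ==> f (~-.M x) = ~-.N f x" using map_add[of "~-.M x" x] N.minus_equality[of "f (~-.M x)" "f x"] by (simp add: M.l_neg)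

lemma map_diff: "x :. M ==> y :. M ==> f (x --.M y) = f x --.N f y" by (simp add: a_minus_def map_add map_minus)

lemma map_finsum: "g : I -> car M ==> f (+/.M i:I. g i) = (+/.N i:I. f (g i))"
proof (induct I rule: infinite_finite_induct)
 case (insert i I)
 hence "g : I -> car M" "g i :. M" by auto
 with insert show ?case by (simp add: map_add Pi_def)
qed (simp_all add: M.finsum_infinite N.finsum_infinite)

lemma submod_image:
 assumes "subm U R M" shows "subm (f ` U) R N"
proof (rule N.submodI)
 show "0@N : f ` U" using M.submod_zero[OF assms] by (simp flip: map_zero)
 fix x y assume "x : f ` U" "y : f ` U"
 then obtain u v where "x = f u" "y = f v" "u : U" "v : U" by auto
 thus "x ++.N y : f ` U" using M.submod_add[OF assms] M.submod_carrier[OF assms] by (simp flip: map_add)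
next
 fix a x assume "a :. R" "x : f ` U"
 thus "a *>.N x : f ` U" using M.submod_act[OF assms] M.submod_carrier[OF assms] by (auto simp flip: map_act)
qed (use M.submod_subset[OF assms] in auto)

lemma submod_preimage:
 assumes "subm U R N" shows "subm {x : car M. f x : U} R M" by (rule M.submodI) (use N.submodD[OF assms] in "auto simp: map_add map_act")

lemma kernel_eq: "akr M N f = {x : car M. f x = 0@N}" by (simp add: a_kernel_def')

lemma submod_kernel: "subm (akr M N f) R M" using submod_preimage[OF N.submod_zero_set] by (simp add: kernel_eq)

lemma inj_iff: "inj_on f (car M) <-> (ALL x:car M. f x = 0@N --> x = 0@M)"
proof
 assume "inj_on f (car M)"
 thus "ALL x:car M. f x = 0@N --> x = 0@M" by (metis M.zero_closed inj_onD map_zero)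
next
 assume *: "ALL x:car M. f x = 0@N --> x = 0@M"
 show "inj_on f (car M)"
 proof (rule inj_onI)
  fix x y assume "x :. M" "y :. M" "f x = f y"
  thus "x = y" using *[rule_format, of "x --.M y"] by (simp add: map_diff M.diff_eq_zero_iff)
 qed
qed

text \<open>Two preimages of an element of \<open>N\<close> differ by an element of the kernel,
  where \<open>g\<close> vanishes, so any choice of preimages defines \<open>h\<close>. Surjections
  with a prescribed kernel thus serve as quotients below, without cosets.\<close>

lemma factor_through:
 assumes "rmod R P" "lin R M P g" "f ` car M = car N"
  "!!x. x :. M ==> f x = 0@N ==> g x = 0@P" shows "EX h. lin R N P h & (ALL x:car M. h (f x) = g x)"
proof -
 interpret g: linear_map R M P g using assms by (simp add: linear_map_def linear_map_axioms_def M.rax)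
 define h where "h y = g (inv_into (car M) f y)" for y
 have h: "h (f x) = g x" if "x :. M" for x
 proof -
  let ?x = "inv_into (car M) f (f x)"
  have x: "?x :. M" "f ?x = f x" using that by (auto intro: inv_into_into f_inv_into_f)
  hence "f (?x --.M x) = 0@N" using that by (simp add: map_diff)
  hence "g (?x --.M x) = 0@P" using assms(4) x that by simp
  thus ?thesis using x that by (simp add: h_def g.map_diff g.N.diff_eq_zero_iff)
 qed
 have "lin R N P h"
 proof (rule linI)
  fix y assume "y :. N"
  then obtain x where "x :. M" "y = f x" using assms(3) by auto
  thus "h y :. P" using h by simp
 next
  fix y y' assume "y :. N" "y' :. N"
  then obtain x x' where "x :. M" "y = f x" "x' :. M" "y' = f x'" using assms(3) by (metis imageE)
  thus "h (y ++.N y') = h y ++.P h y'" using h by (simp add: g.map_add flip: map_add)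
 next
  fix a y assume "a :. R" "y :. N"
  moreover then obtain x where "x :. M" "y = f x" using assms(3) by auto
  ultimately show "h (a *>.N y) = a *>.P h y" using h by (simp add: g.map_act flip: map_act)
 qed
 with h show ?thesis by blast
qed

end

abbreviation (input) "lmap == linear_map"

lemma lmapI: "rmod R M ==> rmod R N ==> lin R M N f ==> lmap R M N f" by (simp add: linear_map_def linear_map_axioms_def)

context right_module
begin

lemma lin_pointwise_add:
 assumes "lin R N M f" "lin R N M g" shows "lin R N M (%x. f x ++.M g x)"
 by (rule linI) (use assms in "auto simp: lin_def Pi_iff act_add_module M.a_ac")

lemma lin_pointwise_minus:
 assumes "lin R N M f" shows "lin R N M (%x. ~-.M f x)" by (rule linI) (use assms in "auto simp: lin_def Pi_iff act_minus M.minus_add")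

lemma lin_pointwise_diff:
 assumes "lin R N M f" "lin R N M g" shows "lin R N M (%x. f x --.M g x)" unfolding a_minus_def by (intro lin_pointwise_add lin_pointwise_minus assms)

lemma lin_pointwise_zero: "lin R N M (%x. 0@M)" by (rule linI) auto

lemma lin_pointwise_finsum:
 assumes "!!i. i : I ==> lin R N M (f i)" shows "lin R N M (%x. +/.M i:I. f i x)"
proof (rule linI)
 fix x y assume xy: "x :. N" "y :. N"
 have "(+/.M i:I. f i (x ++.N y)) = (+/.M i:I. f i x ++.M f i y)" by (rule M.finsum_cong') (use assms xy in "auto simp: lin_def Pi_iff")
 thus "(+/.M i:I. f i (x ++.N y)) = (+/.M i:I. f i x) ++.M (+/.M i:I. f i y)" using assms xy by (simp add: M.finsum_addf Pi_iff lin_closed[OF assms])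
next
 fix a x assume ax: "a :. R" "x :. N"
 have "(+/.M i:I. f i (a *>.N x)) = (+/.M i:I. a *>.M f i x)" by (rule M.finsum_cong') (use assms ax in "auto simp: lin_def Pi_iff")
 thus "(+/.M i:I. f i (a *>.N x)) = a *>.M (+/.M i:I. f i x)" using assms ax by (subst act_finsum) (auto intro: lin_closed)
qed (use assms in "auto intro!: M.finsum_closed intro: lin_closed")

section \<open>Quotient modules and transport of structure\<close>

lemma coset_eq_iff:
 assumes "subm U R M" "x :. M" "y :. M" shows "U +>.M x = U +>.M y <-> x --.M y : U"
proof -
 have mem: "z : U +>.M x <-> z :. M & z --.M x : U" if x: "x :. M" for x z
 proof
  assume "z : U +>.M x"
  then obtain u where u: "u : U" "z = u ++.M x" unfolding a_r_coset_def' by blast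
  have "u :. M" using u submod_carrier[OF assms(1)] by simp
  hence "u ++.M x --.M x = u" using x by algebra
  thus "z :. M & z --.M x : U" using u x `u : car M` by simp
 next
  assume *: "z :. M & z --.M x : U"
  hence "z = (z --.M x) ++.M x" using x by (simp add: M.diff_add_cancel)
  with * show "z : U +>.M x" unfolding a_r_coset_def' by blast
 qed
 have self: "x : U +>.M x" if "x :. M" for x using that mem[OF that] submod_zero[OF assms(1)] by simp
 show ?thesis
 proof
  assume "U +>.M x = U +>.M y"
  thus "x --.M y : U" using self assms mem by blast
 next
  assume xy: "x --.M y : U"
  have "z --.M x : U <-> z --.M y : U" if z: "z :. M" for z
  proof -
   have "(z --.M y) --.M (z --.M x) = x --.M y" using z assms(2,3) by algebra
   thus ?thesis using submod_diff_iff[OF assms(1), of "z --.M y" "z --.M x"] xy z assms by simp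
  qed
  thus "U +>.M x = U +>.M y" using mem assms by blast
 qed
qed

lemma coset_zero: "subm U R M ==> U +>.M 0@M = U" using submod_subset[of U] unfolding a_r_coset_def' by (force simp: subset_iff)

lemma coset_add:
 assumes "subm U R M" "x :. M" "y :. M" shows "(U +>.M x) <+>.M (U +>.M y) = U +>.M (x ++.M y)"
proof (intro equalityI subsetI)
 fix z assume "z : (U +>.M x) <+>.M (U +>.M y)"
 then obtain u v where "u : U" "v : U" "z = (u ++.M x) ++.M (v ++.M y)" unfolding set_add_def' a_r_coset_def' by blast
 hence "z = (u ++.M v) ++.M (x ++.M y)" "u ++.M v : U" using assms submodD[OF assms(1)] by (auto simp: M.a_ac subset_iff)
 thus "z : U +>.M (x ++.M y)" unfolding a_r_coset_def' by blast
next
 fix z assume "z : U +>.M (x ++.M y)"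
 then obtain u where "u : U" "z = u ++.M (x ++.M y)" unfolding a_r_coset_def' by blast
 hence "z = (u ++.M x) ++.M (0@M ++.M y)"  using assms submodD[OF assms(1)] by (auto simp: M.a_ac subset_iff)
 with `u : U` show "z : (U +>.M x) <+>.M (U +>.M y)" using submod_zero[OF assms(1)] unfolding set_add_def' a_r_coset_def' by blast
qed

text \<open>The action sends representatives of one coset into one coset, so all sets in the union
  that defines \<open>quotient_module\<close> coincide.\<close>

lemma coset_act:
 assumes "subm U R M" "x :. M" "a :. R" shows "(\<Union>y\<in>U +>.M x. U +>.M (a *>.M y)) = U +>.M (a *>.M x)"
proof -
 have "U +>.M (a *>.M y) = U +>.M (a *>.M x)" if y: "y : U +>.M x" for y
 proof -
  obtain u where u: "u : U" "y = u ++.M x" using y unfolding a_r_coset_def' by blast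
  have "u :. M" using u submod_carrier[OF assms(1)] by simp
  hence au: "a *>.M u :. M" "a *>.M x :. M" using assms by auto
  have "a *>.M y --.M a *>.M x = (a *>.M u ++.M a *>.M x) --.M a *>.M x" using u `u : car M` assms by (simp add: act_add_module)
  also have "... = a *>.M u" using au by algebra
  finally have "a *>.M y --.M a *>.M x = a *>.M u" .
  moreover have "a *>.M u : U" using u assms submod_act by blast
  ultimately show ?thesis using assms u `u : car M` by (simp add: coset_eq_iff)
 qed
 moreover have "0@M ++.M x : U +>.M x" using submod_zero[OF assms(1)] unfolding a_r_coset_def' by blast
 ultimately show ?thesis by blast
qed

lemma quotient_sel [simp]:
 "0@(quotient_module M U) = U"
 "car (quotient_module M U) = (%x. U +>.M x) ` car M" by (auto simp: quotient_module_def A_RCOSETS_def')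

lemma quotient_add:
 assumes "subm U R M" "x :. M" "y :. M" shows "(U +>.M x) ++.(quotient_module M U) (U +>.M y) = U +>.M (x ++.M y)"
 using coset_add[OF assms] by (simp add: quotient_module_def)

lemma quotient_act:
 assumes "subm U R M" "x :. M" "a :. R" shows "a *>.(quotient_module M U) (U +>.M x) = U +>.M (a *>.M x)"
 using coset_act[OF assms] by (simp add: quotient_module_def)

text \<open>The module axioms are essentially equations and therefore pass to every image under a
  map that respects the operations. Quotients and copies of a module along an injective map are the
  two uses.\<close>

lemma image_right_module:
 fixes N :: "('a, 'n) module"
 assumes "f ` car M = car N" "0@N = f 0@M"
  "!!x y. x :. M ==> y :. M ==> f (x ++.M y) = f x ++.N f y"
  "!!a x. a :. R ==> x :. M ==> f (a *>.M x) = a *>.N f x" shows "rmod R N" "lin R M N f"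
proof -
 have ex: "EX x:car M. y = f x" if "y :. N" for y using that assms(1) by auto
 have cl: "f x :. N" if "x :. M" for x using that assms(1) by auto
 have "abelian_group N"
 proof (rule abelian_groupI)
  fix x y z assume "x :. N" "y :. N" "z :. N"
  then obtain a b c where *: "a :. M" "x = f a" "b :. M" "y = f b" "c :. M" "z = f c" using ex by metis
  show "x ++.N y ++.N z = x ++.N (y ++.N z)" using * by (simp add: M.a_assoc flip: assms(3))
 next
  fix x y assume "x :. N" "y :. N"
  then obtain a b where *: "a :. M" "x = f a" "b :. M" "y = f b" using ex by metis
  show "x ++.N y = y ++.N x" using * by (simp add: M.a_comm flip: assms(3))
  show "x ++.N y :. N" using * by (simp add: cl flip: assms(3))
 next
  fix x assume "x :. N"
  then obtain a where *: "a :. M" "x = f a" using ex by metis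
  show "0@N ++.N x = x" using * by (simp add: assms(2) flip: assms(3))
  show "EX y:car N. y ++.N x = 0@N" by (rule bexI[of _ "f (~-.M a)"]) (use * in "simp_all add: cl M.l_neg assms(2) flip: assms(3)")
 qed (simp add: assms(2) cl)
 then interpret N: abelian_group N .
 show "rmod R N"
 proof (unfold_locales)
  fix a b x assume "a :. R" "b :. R" "x :. N"
  moreover then obtain x' where "x' :. M" "x = f x'" using ex by metis
  ultimately show "(a ++.R b) *>.N x = a *>.N x ++.N b *>.N x"
   "(a **.R b) *>.N x = b *>.N (a *>.N x)" by (simp_all add: act_add_ring act_mult flip: assms(3,4))
 next
  fix a x assume "a :. R" "x :. N"
  moreover then obtain x' where "x' :. M" "x = f x'" using ex by metis
  ultimately show "a *>.N x :. N" by (simp add: cl flip: assms(4))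
 next
  fix a x y assume "a :. R" "x :. N" "y :. N"
  moreover then obtain x' y' where "x' :. M" "x = f x'" "y' :. M" "y = f y'" using ex by metis
  ultimately show "a *>.N (x ++.N y) = a *>.N x ++.N a *>.N y" by (simp add: act_add_module flip: assms(3,4))
 next
  fix x assume "x :. N"
  moreover then obtain x' where "x' :. M" "x = f x'" using ex by metis
  ultimately show "1@R *>.N x = x" by (simp add: act_one flip: assms(4))
 qed
 show "lin R M N f" by (rule linI) (use assms cl in auto)
qed

lemma quotient_right_module:
 assumes "subm U R M" shows "rmod R (quotient_module M U)" "lin R M (quotient_module M U) (%x. U +>.M x)"
 by (rule image_right_module[of "%x. U +>.M x"],
   use assms in "simp_all add: quotient_add quotient_act coset_zero")+

lemma coset_zero_iff:
 "subm U R M ==> x :. M ==> U +>.M x = U <-> x : U" using coset_eq_iff[of U x "0@M"] by (simp add: coset_zero)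

lemma transport_right_module:
 fixes f :: "'m => 'n"
 assumes "inj_on f (car M)" shows "EX N :: ('a, 'n) module. rmod R N & lin R M N f & f ` car M = car N"
proof -
 define g where "g = inv_into (car M) f"
 have g: "g (f x) = x" if "x :. M" for x using that assms by (simp add: g_def)
 define N :: "('a, 'n) module" where "N = (|carrier = f ` car M, monoid.mult = undefined, monoid.one = undefined,
   ring.zero = f 0@M, ring.add = (%x y. f (g x ++.M g y)), smult = (%a x. f (a *>.M g x))|)"
 have "rmod R N" "lin R M N f" by (rule image_right_module[of f]; simp add: N_def g)+
 thus ?thesis by (intro exI[of _ N]) (simp add: N_def)
qed

end

section \<open>Minimal generating families\<close>

context abelian_group
begin

lemma finsum_minus: "f : I -> car G ==> (+/i:I. ~- f i) = ~- (+/i:I. f i)"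
proof (induct I rule: infinite_finite_induct)
 case (insert i I)
 hence "f : I -> car G" "f i :. G" by auto
 with insert show ?case by (simp add: minus_add Pi_def)
qed (simp_all add: finsum_infinite minus_zero)

lemma finsum_diff:
 assumes "f : I -> car G" "g : I -> car G" shows "(+/i:I. f i -- g i) = (+/i:I. f i) -- (+/i:I. g i)"
proof -
 have "(+/i:I. f i -- g i) = (+/i:I. f i) ++ (+/i:I. ~- g i)" unfolding a_minus_def using assms by (intro finsum_addf) auto
 thus ?thesis using assms by (simp add: finsum_minus a_minus_def)
qed

lemma finsum_remove:
 assumes "finite I" "k : I" "f : I -> car G" shows "(+/i:I. f i) = f k ++ (+/i:I - {k}. f i)"
proof -
 have "(+/i:insert k (I - {k}). f i) = f k ++ (+/i:I - {k}. f i)" by (rule finsum_insert) (use assms in auto)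
 moreover have "insert k (I - {k}) = I" using assms by auto
 ultimately show ?thesis by simp
qed

lemma finsum_all_zero: "(!!i. i : I ==> f i = \<zero>) ==> (+/i:I. f i) = \<zero>" using finsum_cong'[of I I "%_. \<zero>" f] by simp

lemma finsum_single:
 assumes "finite I" "k : I" "f k :. G" "!!i. i : I ==> i ~= k ==> f i = \<zero>" shows "(+/i:I. f i) = f k"
proof -
 have "f : I -> car G" using assms(3,4) zero_closed by (metis Pi_I)
 moreover have "(+/i:I - {k}. f i) = \<zero>" using assms(4) by (intro finsum_all_zero) auto
 ultimately show ?thesis using assms by (simp add: finsum_remove[of I k])
qed

lemma finsum_swap:
 assumes "!!i j. i : I ==> j : J ==> f i j :. G" "finite I" shows "(+/i:I. +/j:J. f i j) = (+/j:J. +/i:I. f i j)" using assms(2,1)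
proof (induct I)
 case empty
 show ?case by (simp add: finsum_all_zero)
next
 case (insert k I)
 have "(+/j:J. +/i:insert k I. f i j) = (+/j:J. f k j ++ (+/i:I. f i j))"
  by (rule finsum_cong') (use insert in "auto intro!: finsum_insert finsum_closed")
 also have "... = (+/j:J. f k j) ++ (+/j:J. +/i:I. f i j)" by (rule finsum_addf) (use insert in "auto intro!: finsum_closed")
 also have "... = (+/i:insert k I. +/j:J. f i j)" using insert by (subst finsum_insert) (auto intro!: finsum_closed)
 finally show ?case by simp
qed

lemma finsum_split:
 fixes p q :: nat
 assumes "f : (p + q) ->. G" shows "(+/i:{..<p + q}. f i) = (+/i<p. f i) ++ (+/i<q. f (p + i))"
proof -
 have eq: "{..<p + q} = {..<p} \<union> (+) p ` {..<q}"
 proof (intro equalityI subsetI)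
  fix x assume "x : {..<p + q}"
  thus "x : {..<p} \<union> (+) p ` {..<q}" by (cases "x < p") (auto simp: image_iff intro!: bexI[of _ "x - p"])
 qed auto
 have "(+/i:{..<p + q}. f i) = (+/i<p. f i) ++ (+/i:(+) p ` {..<q}. f i)" unfolding eq by (rule finsum_Un_disjoint) (use assms in auto)
 moreover have "(+/i:(+) p ` {..<q}. f i) = (+/i<q. f (p + i))" using assms by (subst finsum_reindex) auto
 ultimately show ?thesis by simp
qed

end

definition spans_mod :: "('a, 'b) ring_scheme => ('a, 'm) module => 'm set => (nat => 'm) => nat => bool" where
 "spans_mod R M U z p <-> z : p ->. M &
  (ALL x:car M. EX c:p ->. R. x --.M (+/.M i<p. c i *>.M z i) : U)"

text \<open>No relation modulo \<open>U\<close> can be solved for one of the generators. Over a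
  local ring this expresses minimality of a generating family of \<open>M / U\<close>.\<close>

definition nonunit_relations ::
  "('a, 'b) ring_scheme => ('a, 'm) module => 'm set => (nat => 'm) => nat => bool" where
 "nonunit_relations R M U z p <->
  (ALL c:p ->. R. (+/.M i<p. c i *>.M z i) : U --> (ALL i<p. c i ~: Units R))"

context right_module
begin

lemma spans_mod_from_set:
 assumes "finite S" "S <= car M"
  "!!x. x :. M ==> EX c:S -> car R. x --.M (+/.M s:S. c s *>.M s) : U" shows "EX z. bij_betw z {..<card S} S & spans_mod R M U z (card S)"
proof -
 obtain z where z: "bij_betw z {..<card S} S" using ex_bij_betw_nat_finite[OF assms(1)] by (auto simp: atLeast0LessThan)
 have zi: "z : card S ->. M" using z assms(2) by (auto simp: bij_betw_def)
 have "EX c:card S ->. R. x --.M (+/.M i:{..<card S}. c i *>.M z i) : U"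
  if "x :. M" for x
 proof -
  obtain c where c: "c : S -> car R" "x --.M (+/.M s:S. c s *>.M s) : U" using assms(3)[OF `x : car M`] by blast
  have "(+/.M s:z ` {..<card S}. c s *>.M s) = (+/.M i:{..<card S}. c (z i) *>.M z i)"
   by (rule M.finsum_reindex) (use z c assms(2) in "auto simp: bij_betw_def Pi_def subset_iff")
  hence "(+/.M i:{..<card S}. c (z i) *>.M z i) = (+/.M s:S. c s *>.M s)" using z by (simp add: bij_betw_def)
  moreover have "(%i. c (z i)) : card S ->. R" using c z by (auto simp: bij_betw_def)
  ultimately show ?thesis using c(2) by (intro bexI[of _ "%i. c (z i)"]) simp_all
 qed
 with z zi show ?thesis by (auto simp: spans_mod_def)
qed

lemma fg_spans: "finitely_generated R M <-> (EX z p. spans_mod R M {0@M} z p)"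
proof
 assume "finitely_generated R M"
 then obtain S where S: "finite S" "S <= car M"
  "!!x. x :. M ==> EX c:S -> car R. x = (+/.M s:S. c s *>.M s)" unfolding finitely_generated_def by blast
 have "EX c:S -> car R. x --.M (+/.M s:S. c s *>.M s) : {0@M}" if "x :. M" for x using S(3)[OF that] that by (metis M.diff_self singletonI)
 from spans_mod_from_set[OF S(1,2) this] show "EX z p. spans_mod R M {0@M} z p" by blast
next
 assume "EX z p. spans_mod R M {0@M} z p"
 then obtain z and p :: nat where z: "z : p ->. M" and sp: "!!x. x :. M ==> EX c:p ->. R. x --.M (+/.M i<p. c i *>.M z i) : {0@M}"
  unfolding spans_mod_def by blast
 let ?S = "z ` {..<p}"
 have sub: "(+/.M i<q. c i *>.M z i) : {(+/.M s:?S. d s *>.M s) | d. d : ?S -> car R}"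
  if "c : p ->. R" "q <= p" for c q using that(2)
 proof (induct q)
  case 0
  show ?case by (rule CollectI, rule exI[of _ "%_. 0@R"]) (use z in "auto intro!: M.finsum_all_zero[symmetric] simp: Pi_def")
 next
  case (Suc q)
  then obtain d where d: "d : ?S -> car R"
   "(+/.M i<q. c i *>.M z i) = (+/.M s:?S. d s *>.M s)" by auto
  have q: "c q :. R" "z q :. M" "d (z q) :. R" using that(1) z Suc(2) d by (auto simp: Pi_def)
  \<comment> \<open>A family may repeat an element, whose coefficients then have to be added
    up.\<close>
  let ?d = "d(z q := c q ++.R d (z q))"
  have d': "?d : ?S -> car R" using d q by auto
  have inS: "z q : ?S" using Suc(2) by auto
  have cl: "(%s. d s *>.M s) : ?S -> car M" using d z by (auto simp: Pi_def)
  have cl': "(%s. ?d s *>.M s) : ?S -> car M" using d' z by (auto simp: Pi_def)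
  have rest: "(+/.M s:?S - {z q}. ?d s *>.M s) = (+/.M s:?S - {z q}. d s *>.M s)" by (rule M.finsum_cong') (use cl in auto)
  have cl2: "(+/.M s:?S - {z q}. d s *>.M s) :. M" using cl by (intro M.finsum_closed) auto
  have "(+/.M i:{..<Suc q}. c i *>.M z i) = c q *>.M z q ++.M (+/.M i<q. c i *>.M z i)" using that(1) z Suc(2) q by (simp add: lessThan_Suc Pi_def)
  also have "... = (c q ++.R d (z q)) *>.M z q ++.M (+/.M s:?S - {z q}. d s *>.M s)"
   unfolding d(2) using M.finsum_remove[OF _ inS cl] q cl2 by (simp add: act_add_ring M.a_assoc)
  also have "... = (+/.M s:?S. ?d s *>.M s)" using M.finsum_remove[OF _ inS cl'] rest by simp
  finally show ?case using d' by blast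
 qed
 show "finitely_generated R M" unfolding finitely_generated_def
 proof (intro exI[of _ ?S] conjI ballI)
  fix x assume x: "x :. M"
  then obtain c where c: "c : p ->. R" "x --.M (+/.M i<p. c i *>.M z i) = 0@M" using sp by blast
  have "(+/.M i<p. c i *>.M z i) :. M" using c z by (intro M.finsum_closed) (auto simp: Pi_def)
  hence "x = (+/.M i<p. c i *>.M z i)" using c(2) x M.diff_eq_zero_iff by blast
  with sub[OF c(1), of p] show "EX c:?S -> car R. x = (+/.M s:?S. c s *>.M s)" by auto
 qed (use z in auto)
qed

lemma sum_closed [simp, intro]: "c : I -> car R ==> z : I -> car M ==> (+/.M i:I. c i *>.M z i) :. M" by (intro M.finsum_closed) (auto simp: Pi_def)

lemma sum_add:
 assumes "c : I -> car R" "d : I -> car R" "z : I -> car M"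
 shows "(+/.M i:I. (c i ++.R d i) *>.M z i) = (+/.M i:I. c i *>.M z i) ++.M (+/.M i:I. d i *>.M z i)"
proof -
 have "(+/.M i:I. (c i ++.R d i) *>.M z i) = (+/.M i:I. c i *>.M z i ++.M d i *>.M z i)"
  by (rule M.finsum_cong') (use assms in "auto simp: Pi_def act_add_ring")
 thus ?thesis using assms by (simp add: M.finsum_addf Pi_def)
qed

lemma sum_diff:
 assumes "c : I -> car R" "d : I -> car R" "z : I -> car M"
 shows "(+/.M i:I. (c i --.R d i) *>.M z i) = (+/.M i:I. c i *>.M z i) --.M (+/.M i:I. d i *>.M z i)"
proof -
 have "(+/.M i:I. (c i --.R d i) *>.M z i) = (+/.M i:I. c i *>.M z i --.M d i *>.M z i)"
  by (rule M.finsum_cong') (use assms in "auto simp: Pi_def diff_act")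
 thus ?thesis using assms by (simp add: M.finsum_diff Pi_def)
qed

lemma sum_act:
 assumes "c : I -> car R" "a :. R" "z : I -> car M" shows "(+/.M i:I. (c i **.R a) *>.M z i) = a *>.M (+/.M i:I. c i *>.M z i)"
proof -
 have "(+/.M i:I. (c i **.R a) *>.M z i) = (+/.M i:I. a *>.M (c i *>.M z i))" by (rule M.finsum_cong') (use assms in "auto simp: Pi_def act_mult")
 thus ?thesis using assms by (subst act_finsum) (auto simp: Pi_def)
qed

text \<open>If \<open>c k\<close> were a unit, the relation would express \<open>z k\<close> by the
  other generators, and a family of length \<open>q - 1\<close> would suffice.\<close>

lemma least_spans_nonunit:
 assumes U: "subm U R M" and z: "spans_mod R M U z q" and least: "!!z' p. spans_mod R M U z' p ==> q <= p" shows "nonunit_relations R M U z q"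
proof -
 have zi: "z : q ->. M" using z by (simp add: spans_mod_def)
 show ?thesis unfolding nonunit_relations_def
 proof (intro ballI impI allI notI)
  fix c k assume c: "c : q ->. R" and rel: "(+/.M i<q. c i *>.M z i) : U" and k: "k < q" and unit: "c k : Units R"
  obtain u where u: "u :. R" "c k **.R u = 1@R" using unit by (auto simp: Units_def)
  let ?I = "{..<q} - {k}"
  have red: "EX d:?I -> car R. x --.M (+/.M i:?I. d i *>.M z i) : U" if x: "x :. M" for x
  proof -
   obtain d where d: "d : q ->. R" "x --.M (+/.M i<q. d i *>.M z i) : U" using z x unfolding spans_mod_def by blast
   have dk: "d k :. R" using d k by auto
   \<comment> \<open>The multiple of the relation that is subtracted here makes the coefficient at
     \<open>k\<close> vanish.\<close>
   define g where "g i = d i --.R c i **.R (u **.R d k)" for i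
   have ud: "u **.R d k :. R" using u dk by simp
   have gi: "g : q ->. R" using d c ud by (auto simp: g_def Pi_def)
   have "c k **.R (u **.R d k) = d k" using u c k dk by (simp add: R.m_assoc[symmetric] Pi_def)
   hence gk: "g k = 0@R" using dk by (simp add: g_def)
   have "(+/.M i<q. g i *>.M z i) = (+/.M i<q. d i *>.M z i) --.M (u **.R d k) *>.M (+/.M i<q. c i *>.M z i)"
    unfolding g_def using d c zi ud by (subst sum_diff) (auto simp: sum_act Pi_def)
   moreover define y where "y = (u **.R d k) *>.M (+/.M i<q. c i *>.M z i)"
   moreover have "y : U" unfolding y_def using submod_act[OF U ud rel] .
   moreover define s where "s = (+/.M i<q. d i *>.M z i)"
   moreover have "s :. M" unfolding s_def using d zi by blast
   moreover have "x --.M (s --.M y) = (x --.M s) ++.M y" using x `s : car M` submod_carrier[OF U `y : U`] by algebra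
   ultimately have "x --.M (+/.M i<q. g i *>.M z i) : U" using d(2) submod_add[OF U] by simp
   moreover have "(+/.M i<q. g i *>.M z i) = (+/.M i:?I. g i *>.M z i)"
   proof -
    have "(+/.M i:?I. g i *>.M z i) :. M" using gi zi by (intro sum_closed) auto
    thus ?thesis using k gk gi zi by (subst M.finsum_remove[of _ k]) (auto simp: Pi_def)
   qed
   ultimately show ?thesis using gi by (intro bexI[of _ g]) auto
  qed
  define h where "h i = (if i < k then i else Suc i)" for i
  have h: "h ` {..<q - 1} = ?I" "inj_on h {..<q - 1}"
  proof -
   have "x : h ` {..<q - 1}" if "x : ?I" for x using that k by (cases "x < k") (auto simp: h_def image_iff intro: bexI[of _ x] bexI[of _ "x - 1"])
   thus "h ` {..<q - 1} = ?I" using k by (auto simp: h_def split: if_splits)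
  qed (auto simp: h_def inj_on_def split: if_splits)
  have "spans_mod R M U (%i. z (h i)) (q - 1)" unfolding spans_mod_def
  proof (intro conjI ballI)
   show "(%i. z (h i)) : (q - 1) ->. M" using h(1) zi by auto
   fix x assume "x :. M"
   with red obtain d where d: "d : ?I -> car R" "x --.M (+/.M i:?I. d i *>.M z i) : U" by blast
   have "(+/.M i:h ` {..<q - 1}. d i *>.M z i) = (+/.M i:{..<q - 1}. d (h i) *>.M z (h i))"
    by (rule M.finsum_reindex) (use h d zi in "auto simp: Pi_def")
   moreover have "(%i. d (h i)) : (q - 1) ->. R" using h(1) d by auto
   ultimately show "EX c:(q - 1) ->. R. x --.M (+/.M i:{..<q - 1}. c i *>.M z (h i)) : U" using d(2) h(1) by (intro bexI[of _ "%i. d (h i)"]) simp_all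
  qed
  from least[OF this] k show False by simp
 qed
qed

lemma minimal_generators:
 assumes U: "subm U R M" and ex: "EX z p. spans_mod R M U z p"
 shows "EX z p. spans_mod R M U z p & nonunit_relations R M U z p & (ALL z' p'. spans_mod R M U z' p' --> p <= p')"
proof -
 define q where "q = (LEAST p. EX z. spans_mod R M U z p)"
 have "EX z. spans_mod R M U z q" unfolding q_def using ex by (intro LeastI_ex[of "%p. EX z. spans_mod R M U z p"]) blast
 then obtain z where z: "spans_mod R M U z q" by blast
 have "q <= p" if "spans_mod R M U z' p" for z' p unfolding q_def using that by (blast intro: Least_le)
 with least_spans_nonunit[OF U z] z show ?thesis by blast
qed

end

section \<open>Linear algebra over a field\<close>

context abelian_group
begin

lemma diff_diff_diff:
 "[|s :. G; t :. G; x :. G|] ==> s -- t = (x -- t) -- (x -- s)" by algebra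

lemma add_diff_add:
 "[|x :. G; y :. G; s :. G; t :. G|]
  ==> (x ++ y) -- (s ++ t) = (x -- s) ++ (y -- t)" by algebra

lemma diff_add_diff:
 "[|x :. G; y :. G; z :. G|] ==> (x -- y) ++ (y -- z) = x -- z" by algebra

lemma add_diff_cancel: "[|x :. G; y :. G|] ==> (x ++ y) -- y = x" by algebra

lemma diff_diff_cancel: "[|x :. G; y :. G|] ==> x -- (x -- y) = y" by algebra

end

lemma regular_module_sel [simp]:
 "car (reg R) = car R" "0@(reg R) = 0@R"
 "x ++.(reg R) y = x ++.R y" "a *>.(reg R) x = x **.R a" by (simp_all add: regular_module_def)

lemma finsum_regular [simp]: "finsum (reg R) f I = finsum R f I" by (simp add: finsum_def finprod_def regular_module_def)

lemma minus_regular [simp]: "~-.(reg R) x = ~-.R x" "x --.(reg R) y = x --.R y" by (simp_all add: a_inv_def a_minus_def m_inv_def regular_module_def)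

lemma (in ring) regular_right_module: "rmod R (reg R)"
proof -
 interpret G: abelian_group "reg R" by (rule abelian_groupI) (auto simp: a_ac intro: bexI[of _ "~- x" for x] l_neg)
 show ?thesis by unfold_locales (simp_all add: l_distr r_distr m_assoc)
qed

lemma spans_mod_mono: "spans_mod R M U z p ==> U <= W ==> spans_mod R M W z p" unfolding spans_mod_def by blast

lemma nonunit_relationsD:
 "[|nonunit_relations R M U z p; (+/.M i<p. c i *>.M z i) : U; c : p ->. R; i < p|]
  ==> c i ~: Units R" unfolding nonunit_relations_def by blast

abbreviation functional :: "('k, 'b) ring_scheme => ('k, 'm) module => ('m => 'k) => bool" where
 "functional K V \<equiv> lin K V (reg K)"

locale fin_vector_space = K?: field K + right_module K V
 for K :: "('k, 'b) ring_scheme" and V :: "('k, 'm) module" +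
 assumes fin_gen: "finitely_generated K V"
begin

text \<open>Over a field nonunits are zero, so a shortest generating family of \<open>V / U\<close>
  satisfies no nontrivial relation. Coefficients modulo \<open>U\<close> are then unique, hence
  linear, and they are the functionals \<open>phi\<close>.\<close>

lemma dual_basis_mod:
 assumes U: "subm U K V" shows "EX z p phi. z : (p::nat) ->. V & (ALL i<p. functional K V (phi i)) &
  (ALL i<p. ALL u:U. phi i u = 0@K) &
  (ALL x:car V. x --.V (+/.V i<p. phi i x *>.V z i) : U) &
  (ALL i<p. ALL j<p. phi i (z j) = (if i = j then 1@K else 0@K)) &
  (ALL z' p'. spans_mod K V U z' p' --> p <= p')"
proof -
 obtain z0 p0 where z0: "spans_mod K V {0@V} z0 p0" using fin_gen fg_spans by blast
 hence "spans_mod K V U z0 p0" using submod_zero[OF U] by (auto intro: spans_mod_mono)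
 hence "EX z p. spans_mod K V U z p" by blast
 from minimal_generators[OF U this] obtain z p where sp: "spans_mod K V U z p" and rel: "nonunit_relations K V U z p"
  and le: "ALL z' p'. spans_mod K V U z' p' --> p <= p'" by (elim exE conjE) (rule that)
 have z: "z : p ->. V" using sp by (simp add: spans_mod_def)
 let ?S = "%c. +/.V i<p. c i *>.V z i"
 have uniq: "c i = d i" if cd: "c : p ->. K" "d : p ->. K" and "x :. V" "x --.V ?S c : U" "x --.V ?S d : U" and "i < p" for c d x i
 proof -
  have S: "?S c :. V" "?S d :. V" using cd z by auto
  have "?S (%i. c i --.K d i) = ?S c --.V ?S d" using cd z by (rule sum_diff)
  also have "... = (x --.V ?S d) --.V (x --.V ?S c)" using S `x : car V` by (rule M.diff_diff_diff)
  also have "... : U" using that submod_diff[OF U] by blast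
  finally have "?S (%i. c i --.K d i) : U" .
  moreover have "(%i. c i --.K d i) : p ->. K" using cd by auto
  ultimately have "c i --.K d i ~: Units K" using nonunit_relationsD[OF rel] `i < p` by fast
  moreover have ci: "c i :. K" "d i :. K" using cd `i < p` by auto
  ultimately show ?thesis using K.field_Units K.diff_eq_zero_iff by auto
 qed
 define gam where "gam x = (SOME c. c : p ->. K & x --.V ?S c : U)" for x
 have gam: "gam x : p ->. K" "x --.V ?S (gam x) : U" if "x :. V" for x
 proof -
  have "EX c. c : p ->. K & x --.V ?S c : U" using sp that unfolding spans_mod_def by blast
  from someI_ex[OF this] show "gam x : p ->. K" "x --.V ?S (gam x) : U" unfolding gam_def by blast+
 qed
 have gam_eq: "gam x i = c i" if "x :. V" "c : p ->. K" "x --.V ?S c : U" "i < p" for x c i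
  using uniq[OF gam(1)[OF that(1)] that(2,1) gam(2)[OF that(1)] that(3,4)] .
 have coord: "functional K V (%x. gam x i)" if i: "i < p" for i
 proof (rule linI)
  fix x assume "x :. V"
  thus "gam x i :. (reg K)" using gam i by auto
 next
  fix x y assume xy: "x :. V" "y :. V"
  have S: "?S (gam x) :. V" "?S (gam y) :. V" using xy gam z by auto
  have "?S (%i. gam x i ++.K gam y i) = ?S (gam x) ++.V ?S (gam y)" using gam xy z by (intro sum_add) auto
  moreover have "(x ++.V y) --.V (?S (gam x) ++.V ?S (gam y)) = (x --.V ?S (gam x)) ++.V (y --.V ?S (gam y))" using xy S by (rule M.add_diff_add)
  ultimately have "(x ++.V y) --.V ?S (%i. gam x i ++.K gam y i) : U" using submod_add[OF U gam(2)[OF xy(1)] gam(2)[OF xy(2)]] by simp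
  thus "gam (x ++.V y) i = gam x i ++.(reg K) gam y i" using gam xy i by (subst gam_eq[where c = "%i. gam x i ++.K gam y i"]) (auto simp: Pi_def)
 next
  fix a x assume ax: "a :. K" "x :. V"
  have S: "?S (gam x) :. V" using ax gam z by auto
  have "?S (%i. gam x i **.K a) = a *>.V ?S (gam x)" using gam ax z by (intro sum_act) auto
  hence "a *>.V x --.V ?S (%i. gam x i **.K a) = a *>.V (x --.V ?S (gam x))" using S ax by (simp add: act_diff)
  hence "a *>.V x --.V ?S (%i. gam x i **.K a) : U" using submod_act[OF U ax(1) gam(2)[OF ax(2)]] by simp
  thus "gam (a *>.V x) i = a *>.(reg K) gam x i" using gam ax i by (subst gam_eq[where c = "%i. gam x i **.K a"]) (auto simp: Pi_def)
 qed
 have zero: "gam u i = 0@K" if "i < p" "u : U" for i u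
 proof (rule gam_eq[where c = "%_. 0@K"])
  have "?S (%_. 0@K) = 0@V" using z by (intro M.finsum_all_zero) (auto simp: Pi_def)
  thus "u --.V ?S (%_. 0@K) : U" using that submod_carrier[OF U] by simp
 qed (use that submod_carrier[OF U] in auto)
 have delta: "gam (z j) i = (if i = j then 1@K else 0@K)" if "i < p" "j < p" for i j
 proof -
  have "?S (%i. if i = j then 1@K else 0@K) = z j" using that z by (subst M.finsum_single[of _ j]) (auto simp: Pi_def act_one)
  hence "z j --.V ?S (%i. if i = j then 1@K else 0@K) : U" using that z submod_zero[OF U] by (simp add: Pi_def)
  thus ?thesis using that z by (subst gam_eq) (auto simp: Pi_def)
 qed
 show ?thesis by (rule exI[of _ z], rule exI[of _ p], rule exI[of _ "%i x. gam x i"]) (use z coord zero delta gam(2) le in auto)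
qed

text \<open>Subtracting the part of a vector that its coordinates modulo \<open>U\<close> describe
  leaves a vector of \<open>U\<close>, and vectors of \<open>U\<close> have zero
  coordinates.\<close>

lemma projection:
 assumes U: "subm U K V" shows "EX pi. lin K V V pi & (ALL x:car V. pi x : U) & (ALL u:U. pi u = u)"
proof -
 from dual_basis_mod[OF U] obtain z phi and p :: nat where z: "z : p ->. V" and *: "ALL i<p. functional K V (phi i)" "ALL i<p. ALL u:U. phi i u = 0@K"
   "ALL x:car V. x --.V (+/.V i<p. phi i x *>.V z i) : U" by (elim exE conjE) (rule that; assumption)
 note phi = *(1)[rule_format] and zero = *(2)[rule_format] and sp = *(3)[rule_format]
 have "lin K V V (%x. phi i x *>.V z i)" if "i < p" for i
  by (rule linI) (use phi[OF that] z that in "auto simp: lin_def Pi_def act_add_ring act_mult")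
 hence "lin K V V (%x. x --.V (+/.V i<p. phi i x *>.V z i))" by (intro lin_pointwise_diff lin_pointwise_finsum lin_id) auto
 moreover have "u --.V (+/.V i<p. phi i u *>.V z i) = u" if "u : U" for u
 proof -
  have "(+/.V i<p. phi i u *>.V z i) = 0@V" using zero[OF _ that] z by (intro M.finsum_all_zero) (auto simp: Pi_def)
  thus ?thesis using submod_carrier[OF U that] by simp
 qed
 ultimately show ?thesis using sp by blast
qed

lemma extend_lin:
 assumes U: "subm U K V" and psi: "lin K (V(|carrier := U|)) W psi" shows "EX psi'. lin K V W psi' & (ALL u:U. psi' u = psi u)"
proof -
 obtain pi where pi: "lin K V V pi" "!!x. x :. V ==> pi x : U" "!!u. u : U ==> pi u = u" using projection[OF U] by blast
 have "lin K V W (%x. psi (pi x))" using lin_comp[OF lin_into[OF pi(1,2)] psi] .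
 with pi(3) show ?thesis by (intro exI[of _ "%x. psi (pi x)"]) auto
qed

lemma separate:
 assumes U: "subm U K V" and x: "x :. V" "x ~: U" shows "EX phi. functional K V phi & (ALL u:U. phi u = 0@K) & phi x ~= 0@K"
proof -
 from dual_basis_mod[OF U] obtain z phi and p :: nat where z: "z : p ->. V" and *: "ALL i<p. functional K V (phi i)" "ALL i<p. ALL u:U. phi i u = 0@K"
   "ALL x:car V. x --.V (+/.V i<p. phi i x *>.V z i) : U" by (elim exE conjE) (rule that; assumption)
 note phi = *(1)[rule_format] and zero = *(2)[rule_format] and sp = *(3)[rule_format]
 have "EX i<p. phi i x ~= 0@K"
 proof (rule ccontr)
  assume "~ (EX i<p. phi i x ~= 0@K)"
  hence "(+/.V i<p. phi i x *>.V z i) = 0@V" using z by (intro M.finsum_all_zero) (auto simp: Pi_def)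
  with sp[OF x(1)] x show False by simp
 qed
 with phi zero show ?thesis by blast
qed

end

lemma spans_image:
 assumes "lmap R M N f" "f ` car M = car N" "spans_mod R M {0@M} z p" shows "spans_mod R N {0@N} (%i. f (z i)) p"
proof -
 interpret linear_map R M N f by fact
 have z: "z : p ->. M" using assms(3) by (simp add: spans_mod_def)
 have "EX c:p ->. R. y --.N (+/.N i<p. c i *>.N f (z i)) : {0@N}" if y: "y :. N" for y
 proof -
  obtain x where x: "x :. M" "y = f x" using assms(2) y by auto
  obtain c where c: "c : p ->. R" "x --.M (+/.M i<p. c i *>.M z i) = 0@M" using assms(3) x unfolding spans_mod_def by blast
  have S: "(+/.M i<p. c i *>.M z i) :. M" using c z by auto
  have "f (+/.M i<p. c i *>.M z i) = (+/.N i<p. f (c i *>.M z i))" using c z by (intro map_finsum) (auto simp: Pi_def)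
  also have "... = (+/.N i<p. c i *>.N f (z i))" using c z by (intro N.M.finsum_cong') (auto simp: Pi_def map_act)
  finally have "y --.N (+/.N i<p. c i *>.N f (z i)) = f (x --.M (+/.M i<p. c i *>.M z i))" using x S by (simp add: map_diff)
  with c show ?thesis by auto
 qed
 with z show ?thesis by (auto simp: spans_mod_def)
qed

lemma fg_image:
 assumes "lmap R M N f" "f ` car M = car N" "finitely_generated R M" shows "finitely_generated R N"
proof -
 interpret linear_map R M N f by fact
 obtain z p where "spans_mod R M {0@M} z p" using assms(3) M.fg_spans by blast
 from spans_image[OF assms(1,2) this] show ?thesis using N.fg_spans by blast
qed

text \<open>The dimension, defined through generation alone. Its basic properties are
  \<open>rank_image_le\<close> and the strict inequality \<open>rank_less\<close>; together they
  take the place of the theory of bases.\<close>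

definition rank :: "('k, 'b) ring_scheme => ('k, 'm) module => nat" where
 "rank K V = (LEAST p. EX z. spans_mod K V {0@V} z p)"

lemma rank_le: "spans_mod K V {0@V} z p ==> rank K V <= p" unfolding rank_def by (rule Least_le) blast

lemma (in right_module) rank_spans:
 assumes "finitely_generated R M" shows "EX z. spans_mod R M {0@M} z (rank R M)"
proof -
 have "EX p z. spans_mod R M {0@M} z p" using assms fg_spans by blast
 thus ?thesis unfolding rank_def by (rule LeastI_ex)
qed

lemma rank_image_le:
 assumes "lmap R M N f" "f ` car M = car N" "finitely_generated R M" shows "rank R N <= rank R M"
proof -
 interpret linear_map R M N f by fact
 obtain z where "spans_mod R M {0@M} z (rank R M)" using M.rank_spans assms(3) by blast
 from rank_le[OF spans_image[OF assms(1,2) this]] show ?thesis .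
qed

context fin_vector_space
begin

lemma subspace_fg:
 assumes U: "subm U K V" shows "finitely_generated K (V(|carrier := U|))"
proof -
 obtain pi where pi: "lin K V V pi" "!!x. x :. V ==> pi x : U" "!!u. u : U ==> pi u = u" using projection[OF U] by blast
 have "lmap K V (V(|carrier := U|)) pi" by (intro lmapI rax submod_right_module U lin_into pi)
 moreover have "pi ` car V = car (V(|carrier := U|))" using pi(2,3) submod_carrier[OF U] by (auto simp: image_iff) (metis)
 ultimately show ?thesis using fin_gen by (rule fg_image)
qed

lemma subspace: "subm U K V ==> fin_vector_space K (V(|carrier := U|))"
 by (intro fin_vector_space.intro fin_vector_space_axioms.intro submod_right_module subspace_fg K.field_axioms)

text \<open>A projection onto \<open>U\<close> maps a shortest generating family of \<open>V\<close>
  to a generating family of \<open>U\<close>. If this were shortest too, it would have only trivial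
  relations; but the coefficients of a nonzero vector \<open>w\<close> in the kernel of the
  projection form a relation.\<close>

lemma rank_less:
 assumes U: "subm U K V" and neq: "U ~= car V" shows "rank K (V(|carrier := U|)) < rank K V"
proof -
 let ?U = "V(|carrier := U|)"
 interpret U: fin_vector_space K ?U using subspace[OF U] .
 obtain pi where pi: "lin K V V pi" "!!x. x :. V ==> pi x : U" "!!u. u : U ==> pi u = u" using projection[OF U] by blast
 interpret pi: linear_map K V ?U pi by (intro lmapI rax submod_right_module U lin_into pi)
 have onto: "pi ` car V = car ?U" using pi(2,3) submod_carrier[OF U] by (auto simp: image_iff) (metis)
 obtain z where z: "spans_mod K V {0@V} z (rank K V)" using rank_spans[OF fin_gen] by blast
 let ?p = "rank K V"
 have zi: "z : ?p ->. V" using z by (simp add: spans_mod_def)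
 have sp: "spans_mod K ?U {0@V} (%i. pi (z i)) ?p" using spans_image[OF pi.linear_map_axioms onto z] by simp
 hence "rank K ?U <= ?p" using rank_le[of K ?U] by simp
 moreover have "rank K ?U ~= ?p"
 proof
  assume eq: "rank K ?U = ?p"
  have "nonunit_relations K ?U {0@V} (%i. pi (z i)) ?p"
  proof (rule U.least_spans_nonunit)
   show "subm {0@V} K ?U" using U.submod_zero_set by simp
   show "?p <= p" if "spans_mod K ?U {0@V} z' p" for z' p using rank_le[of K ?U z' p] that eq by simp
  qed (rule sp)
  obtain x where x: "x :. V" "x ~: U" using neq submod_subset[OF U] by blast
  define w where "w = x --.V pi x"
  have w: "w :. V" "w ~= 0@V"
  proof -
   have px: "pi x : U" "pi x :. V" using x pi(2) submod_carrier[OF U] by auto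
   show "w :. V" using px x by (simp add: w_def)
   show "w ~= 0@V" using px x by (auto simp: w_def M.diff_eq_zero_iff)
  qed
  have "pi w = 0@V"
  proof -
   interpret p: linear_map K V V pi by (intro lmapI rax pi)
   show ?thesis using x pi(2,3) submod_carrier[OF U] by (simp add: w_def p.map_diff)
  qed
  obtain c where c: "c : ?p ->. K" "w --.V (+/.V i:{..<?p}. c i *>.V z i) = 0@V" using z w unfolding spans_mod_def by blast
  have S: "(+/.V i:{..<?p}. c i *>.V z i) :. V" using c zi by auto
  hence weq: "w = (+/.V i:{..<?p}. c i *>.V z i)" using c w M.diff_eq_zero_iff by blast
  have "(+/.?U i:{..<?p}. c i *>.?U pi (z i)) = (+/.?U i:{..<?p}. pi (c i *>.V z i))"
   by (rule U.M.finsum_cong') (use c zi pi.closed submod_act[OF U] in "auto simp: Pi_def pi.map_act")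
  also have "... = pi w" unfolding weq by (rule pi.map_finsum[symmetric]) (use c zi in "auto simp: Pi_def")
  finally have "(+/.?U i:{..<?p}. c i *>.?U pi (z i)) : {0@V}" using `pi w = 0@V ` by simp
  with `nonunit_relations K ?U {0@V} (%i. pi (z i)) ?p` c(1)
  have nu: "!!i. i < ?p ==> c i ~: Units K" using nonunit_relationsD by blast
  have "c i *>.V z i = 0@V" if "i < ?p" for i
  proof -
   have "c i = 0@K" "z i :. V" using nu[OF that] c(1) zi that K.field_Units by auto
   thus ?thesis by simp
  qed
  hence "w = 0@V" unfolding weq by (intro M.finsum_all_zero) auto
  with w show False by simp
 qed
 ultimately show ?thesis by simp
qed

text \<open>A left inverse of \<open>f\<close> shows that the image has at least the rank of
  \<open>V\<close>, whereas a proper subspace of \<open>W\<close> has smaller rank than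
  \<open>W\<close>.\<close>

lemma injective_onto:
 assumes f: "lmap K V W f" and inj: "inj_on f (car V)" and W: "finitely_generated K W" and le: "rank K W <= rank K V" shows "f ` car V = car W"
proof (rule ccontr)
 assume neq: "f ` car V ~= car W"
 interpret f: linear_map K V W f by fact
 interpret W: fin_vector_space K W by (intro fin_vector_space.intro fin_vector_space_axioms.intro f.N.rax W K.field_axioms)
 have im: "subm (f ` car V) K W" using f.submod_image[OF submod_self] .
 let ?I = "W(|carrier := f ` car V|)"
 interpret I: fin_vector_space K ?I using W.subspace[OF im] .
 interpret f': linear_map K V ?I f by (intro lmapI rax I.rax lin_into f.lin) auto
 obtain h where h: "lin K ?I V h" "ALL x:car V. h (f x) = x" using f'.factor_through[OF rax lin_id] inj f.inj_iff by auto
 have "rank K V <= rank K ?I"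
 proof (rule rank_image_le[of K ?I V h])
  show "lmap K ?I V h" by (intro lmapI rax I.rax h)
  show "h ` car ?I = car V" using h(2) by (simp add: image_image)
 qed (rule I.fin_gen)
 also have "... < rank K W" using W.rank_less[OF im neq] .
 finally show False using le by simp
qed

end

section \<open>Finitely generated modules over finite dimensional algebras\<close>

text \<open>Generation is expressed by submodules instead of coefficients; in this form it can be
  compared between the algebra and the field.\<close>

lemma (in right_module) fgI:
 assumes S: "finite S" "S <= car M" and gen: "!!U. subm U R M ==> S <= U ==> U = car M" shows "finitely_generated R M"
proof -
 let ?U = "{(+/.M s:S. c s *>.M s) | c. c : S -> car R}"
 have id: "(%s. s) : S -> car M" using S by auto
 have "subm ?U R M"
 proof (rule submodI)
  show "?U <= car M" using id by auto
  have "(+/.M s:S. 0@R *>.M s) = 0@M" using S by (intro M.finsum_all_zero) auto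
  thus "0@M : ?U" by (intro CollectI exI[of _ "%_. 0@R"]) auto
 next
  fix x y assume "x : ?U" "y : ?U"
  then obtain c d where cd: "c : S -> car R" "d : S -> car R" and eq: "x = (+/.M s:S. c s *>.M s)" "y = (+/.M s:S. d s *>.M s)" by blast
  show "x ++.M y : ?U" using cd sum_add[OF cd id] eq by (intro CollectI exI[of _ "%s. c s ++.R d s"]) auto
 next
  fix a x assume "x : ?U" and a: "a :. R"
  then obtain c where c: "c : S -> car R" "x = (+/.M s:S. c s *>.M s)" by blast
  show "a *>.M x : ?U" using c a sum_act[OF c(1) a id] by (intro CollectI exI[of _ "%s. c s **.R a"]) auto
 qed
 moreover have "S <= ?U"
 proof
  fix t assume t: "t : S"
  have "(+/.M s:S. (if s = t then 1@R else 0@R) *>.M s) = t" using t S by (subst M.finsum_single[of _ t]) (auto simp: act_one)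
  thus "t : ?U" by (intro CollectI exI[of _ "%s. if s = t then 1@R else 0@R"]) auto
 qed
 ultimately have U: "?U = car M" by (rule gen)
 show ?thesis unfolding finitely_generated_def
 proof (intro exI[of _ S] conjI ballI S)
  fix x assume "x :. M"
  hence "x : ?U" using U by simp
  thus "EX c:S -> car R. x = (+/.M s:S. c s *>.M s)" by blast
 qed
qed

lemma (in right_module) fgE:
 assumes "finitely_generated R M" shows "EX S. finite S & S <= car M & (ALL U. subm U R M --> S <= U --> U = car M)"
proof -
 obtain S where S: "finite S" "S <= car M"
  "!!x. x :. M ==> EX c:S -> car R. x = (+/.M s:S. c s *>.M s)" using assms unfolding finitely_generated_def by blast
 have "U = car M" if U: "subm U R M" "S <= U" for U
 proof
  show "car M <= U"
  proof
   fix x assume "x :. M"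
   then obtain c where c: "c : S -> car R" "x = (+/.M s:S. c s *>.M s)" using S(3) by blast
   show "x : U" unfolding c(2) by (rule submod_finsum[OF U(1)]) (use c U in "auto intro: submod_act")
  qed
 qed (rule submod_subset[OF U(1)])
 with S show ?thesis by blast
qed

text \<open>The underlying vector space of a module over a \<open>K\<close>-algebra.\<close>

definition kmod :: "('k, 'a) module => ('a, 'm) module => ('k, 'm) module" where
 "kmod A M = (|carrier = car M, monoid.mult = monoid.mult M, monoid.one = monoid.one M,
  ring.zero = ring.zero M, ring.add = ring.add M, smult = (%l x. (l *>.A 1@A) *>.M x)|)"

lemma kmod_sel [simp]:
 "car (kmod A M) = car M" "0@(kmod A M) = 0@M"
 "x ++.(kmod A M) y = x ++.M y" "l *>.(kmod A M) x = (l *>.A 1@A) *>.M x" by (simp_all add: kmod_def)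

lemma finsum_kmod [simp]: "finsum (kmod A M) f I = finsum M f I" by (simp add: finsum_def finprod_def kmod_def)

lemma minus_kmod [simp]: "~-.(kmod A M) x = ~-.M x" "x --.(kmod A M) y = x --.M y" by (simp_all add: a_inv_def a_minus_def m_inv_def kmod_def)

lemma kmod_carrier_update: "kmod A (M(|carrier := U|)) = (kmod A M)(|carrier := U|)" by (simp add: kmod_def)

lemma abelian_group_cong:
 assumes "abelian_group M" "car N = car M" "0@N = 0@M" "!!x y. x ++.N y = x ++.M y" shows "abelian_group N"
proof -
 interpret abelian_group M by fact
 show ?thesis by (rule abelian_groupI) (auto simp: assms a_ac intro: bexI[of _ "~-.M x" for x] l_neg)
qed

context fd_algebra
begin

lemma A_rmod: "rmod A (reg A)" by (rule A.regular_right_module)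

lemma scalar_one [simp, intro]: "l :. K ==> l *>.A 1@A :. A" by (rule smult_closed) auto

lemma mult_scalar: "[|l :. K; x :. A|] ==> x **.A (l *>.A 1@A) = l *>.A x" and scalar_mult: "[|l :. K; x :. A|] ==> (l *>.A 1@A) **.A x = l *>.A x"
 by (simp_all add: smult_mult_left smult_mult_right)

lemma scalar_central: "[|l :. K; x :. A|] ==> x **.A (l *>.A 1@A) = (l *>.A 1@A) **.A x" by (simp add: mult_scalar scalar_mult)

lemma kmod_right_module:
 assumes "rmod A M" shows "rmod K (kmod A M)"
proof -
 interpret M: right_module A M by fact
 have scm: "(k *>.A 1@A) **.A (l *>.A 1@A) = (k **.K l) *>.A 1@A"
  if "k :. K" "l :. K" for k l using that by (simp add: scalar_mult smult_assoc1)
 interpret G: abelian_group "kmod A M" by (rule abelian_group_cong[OF M.M.abelian_group_axioms]) auto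
 show ?thesis
 proof (unfold_locales)
  fix a b x assume "a :. K" "b :. K" "x :. (kmod A M)"
  thus "(a ++.K b) *>.(kmod A M) x = a *>.(kmod A M) x ++.(kmod A M) b *>.(kmod A M) x"
   "(a **.K b) *>.(kmod A M) x = b *>.(kmod A M) (a *>.(kmod A M) x)" by (simp_all add: smult_l_distr M.act_add_ring flip: scm M.act_mult)
 qed (auto simp: M.act_add_module M.act_one)
qed

lemma kmod_lin: "lin A M N f ==> lin K (kmod A M) (kmod A N) f" by (auto simp: lin_def)

lemma kmod_submodule:
 assumes "rmod A M" "subm U A M" shows "subm U K (kmod A M)"
proof -
 interpret M: right_module A M by fact
 interpret K: right_module K "kmod A M" by (rule kmod_right_module[OF assms(1)])
 show ?thesis by (rule K.submodI) (use M.submodD[OF assms(2)] in auto)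
qed

lemma kmod_linear_map:
 assumes "lmap A M N f" shows "lmap K (kmod A M) (kmod A N) f"
proof -
 interpret linear_map A M N f by fact
 show ?thesis by (intro lmapI kmod_right_module kmod_lin lin M.rax N.rax)
qed

lemma kmod_regular_fg: "finitely_generated K (kmod A (reg A))"
proof -
 have fs: "finsum (kmod A (reg A)) f I = finsum A f I" for f and I :: "'c set" by simp
 obtain S where S: "finite S" "S <= car A"
  "!!x. x :. A ==> EX c:S -> car K. x = (+/.A s:S. c s *>.A s)" using finite_dimensional unfolding finitely_generated_def by blast
 show ?thesis unfolding finitely_generated_def
 proof (intro exI[of _ S] conjI ballI)
  fix x assume "x :. (kmod A (reg A))"
  then obtain c where c: "c : S -> car K" "x = (+/.A s:S. c s *>.A s)" using S(3) by auto
  have "(+/.A s:S. c s *>.A s) = (+/.A s:S. c s *>.(kmod A (reg A)) s)"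
   by (rule A.finsum_cong') (use c S(2) in "auto simp: mult_scalar subset_iff Pi_iff")
  with c show "EX c:S -> car K. x = (+/.(kmod A (reg A)) s:S. c s *>.(kmod A (reg A)) s)" by (intro bexI[of _ c]) simp_all
 qed (use S in auto)
qed

text \<open>If \<open>S\<close> generates \<open>M\<close> over \<open>A\<close> and
  \<open>T\<close> generates \<open>A\<close> over \<open>K\<close>, then the elements
  \<open>t *>.M s\<close> generate \<open>M\<close> over \<open>K\<close>. Conversely, every
  \<open>A\<close>-submodule is a subspace.\<close>

lemma fg_iff_kmod: 
 assumes "rmod A M" shows "finitely_generated A M <-> finitely_generated K (kmod A M)"
proof -
 interpret M: right_module A M by fact
 interpret KM: right_module K "kmod A M" by (rule kmod_right_module[OF assms])
 interpret KA: right_module K "kmod A (reg A)" by (rule kmod_right_module[OF A_rmod])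
 show ?thesis
 proof
  assume "finitely_generated A M"
  then obtain S where S: "finite S" "S <= car M"
   "!!x. x :. M ==> EX c:S -> car A. x = (+/.M s:S. c s *>.M s)" unfolding finitely_generated_def by blast
  obtain T where T: "finite T" "T <= car A"
   "!!U. subm U K (kmod A (reg A)) ==> T <= U ==> U = car A" using KA.fgE[OF kmod_regular_fg] by auto
  show "finitely_generated K (kmod A M)"
  proof (rule KM.fgI)
   show "finite ((%(t, s). t *>.M s) ` (T \<times> S))" using S T by auto
   show "(%(t, s). t *>.M s) ` (T \<times> S) <= car (kmod A M)" using S T by auto
   fix U assume U: "subm U K (kmod A M)" and sub: "(%(t, s). t *>.M s) ` (T \<times> S) <= U"
   have act: "a *>.M s : U" if s: "s : S" and a: "a :. A" for a s
   proof -
    have sM: "s :. M" using s S by auto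
    have "subm {a : car A. a *>.M s : U} K (kmod A (reg A))"
    proof (rule KA.submodI)
     fix l a assume l: "l :. K" and "a : {a : car A. a *>.M s : U}"
     hence a: "a :. A" "a *>.M s : U" by auto
     have "(l *>.A 1@A) *>.M (a *>.M s) : U" using KM.submod_act[OF U l a(2)] by simp
     thus "l *>.(kmod A (reg A)) a : {a : car A. a *>.M s : U}" using l a(1) sM by (simp add: M.act_mult)
    qed (use KM.submodD[OF U] sM in "auto simp: M.act_add_ring")
    hence "{a : car A. a *>.M s : U} = car A" by (rule T(3)) (use T(2) s sub in auto)
    with a show ?thesis by auto
   qed
   have "x : U" if x: "x :. M" for x
   proof -
    obtain c where c: "c : S -> car A" "x = (+/.M s:S. c s *>.M s)" using S(3)[OF x] by blast
    have "(+/.(kmod A M) s:S. c s *>.M s) : U" by (rule KM.submod_finsum[OF U]) (use c act in auto)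
    with c show ?thesis by simp
   qed
   thus "U = car (kmod A M)" using KM.submod_subset[OF U] by auto
  qed
 next
  assume "finitely_generated K (kmod A M)"
  then obtain S where S: "finite S" "S <= car M"
   "!!U. subm U K (kmod A M) ==> S <= U ==> U = car M" using KM.fgE by auto
  show "finitely_generated A M" by (rule M.fgI[OF S(1,2)]) (use S(3) kmod_submodule[OF assms] in blast)
 qed
qed

lemma fg_right_module_iff: "fgm A M <-> rmod A M & fin_vector_space K (kmod A M)" using fg_iff_kmod kmod_right_module K.field_axioms
 by (auto simp: fg_right_module_def fin_vector_space_def fin_vector_space_axioms_def)

lemma fg_regular: "fgm A (reg A)" using A_rmod fg_iff_kmod[OF A_rmod] kmod_regular_fg by (simp add: fg_right_module_def)

lemma fg_submodule:
 assumes "fgm A M" "subm U A M" shows "fgm A (M(|carrier := U|))"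
proof -
 interpret M: right_module A M using assms by (simp add: fg_right_module_def)
 interpret V: fin_vector_space K "kmod A M" using assms fg_right_module_iff by blast
 show ?thesis using V.subspace[OF kmod_submodule[OF M.rax assms(2)]] M.submod_right_module[OF assms(2)]
  by (simp add: fg_right_module_iff kmod_carrier_update)
qed

lemma fg_lin_image:
 assumes "fgm A M" "rmod A N" "lin A M N f" "f ` car M = car N" shows "fgm A N"
 using assms fg_image[of A M N f] by (simp add: fg_right_module_def lmapI)

lemma fg_quotient:
 assumes "fgm A M" "subm U A M" shows "fgm A (quotient_module M U)"
proof -
 interpret M: right_module A M using assms by (simp add: fg_right_module_def)
 show ?thesis using fg_lin_image[OF assms(1) M.quotient_right_module[OF assms(2)]] by simp
qed

lemma rank_submodule_less:
 assumes "fgm A M" "subm U A M" "U ~= car M" shows "rank K (kmod A (M(|carrier := U|))) < rank K (kmod A M)"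
proof -
 interpret V: fin_vector_space K "kmod A M" using assms fg_right_module_iff by blast
 show ?thesis using V.rank_less[OF kmod_submodule[OF _ assms(2)]] assms by (simp add: kmod_carrier_update fg_right_module_def)
qed

text \<open>The dimension is the measure behind all chain arguments: \<open>simple_chain\<close>,
  \<open>socle\<close> and \<open>proper_layer\<close> descend or minimise along it.\<close>

lemma rank_submodule_mono:
 assumes "fgm A M" "subm U A M" "subm V A M" "U \<subset> V" shows "rank K (kmod A (M(|carrier := U|))) < rank K (kmod A (M(|carrier := V|)))"
proof -
 interpret M: right_module A M using assms by (simp add: fg_right_module_def)
 have "subm U A (M(|carrier := V|))" using M.submod_submod_iff[OF assms(3), of U] assms by auto
 from rank_submodule_less[OF fg_submodule[OF assms(1,3)] this] assms(4) show ?thesis by auto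
qed

text \<open>Resolutions live in the type \<open>nat => 'k\<close>, and coordinates embed every
  finitely generated module there. The chosen coordinates only have to be injective, since the
  module structure is carried along with them.\<close>

lemma copy_module:
 assumes "fgm A M" shows "EX (N :: ('a, nat => 'k) module) f. fgm A N & lin A M N f &
  bij_betw f (car M) (car N)"
proof -
 interpret M: right_module A M using assms by (simp add: fg_right_module_def)
 interpret V: fin_vector_space K "kmod A M" using assms fg_right_module_iff by blast
 obtain z p where sp: "spans_mod K (kmod A M) {0@M} z p" using V.fg_spans V.fin_gen by auto
 hence z: "z : p ->. M" by (simp add: spans_mod_def)
 define g where "g x = (SOME c. c : p ->. K &
  x --.M (+/.M i<p. c i *>.(kmod A M) z i) = 0@M)" for x
 have g: "x = (+/.M i<p. g x i *>.(kmod A M) z i)" if x: "x :. M" for x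
 proof -
  have "EX c. c : p ->. K & x --.M (+/.M i<p. c i *>.(kmod A M) z i) = 0@M" using sp x unfolding spans_mod_def Bex_def by simp
  from someI_ex[OF this] have *: "g x : p ->. K" "x --.M (+/.M i<p. g x i *>.(kmod A M) z i) = 0@M" unfolding g_def by blast+
  hence "(+/.M i<p. g x i *>.(kmod A M) z i) :. M" using V.sum_closed[of "g x" "{..<p}" z] z by simp
  with * x show ?thesis using M.M.diff_eq_zero_iff by blast
 qed
 have inj: "inj_on g (car M)"
 proof (rule inj_onI)
  fix x y assume "x :. M" "y :. M" and eq: "g x = g y"
  thus "x = y" using g[of x] g[of y] unfolding eq by simp
 qed
 obtain N :: "('a, nat => 'k) module" where N: "rmod A N" "lin A M N g" "g ` car M = car N" using M.transport_right_module[OF inj] by blast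
 thus ?thesis using fg_lin_image[OF assms N] inj by (auto simp: bij_betw_def)
qed

end

lemma opposite_sel [simp]:
 "car (opposite_algebra A) = car A" "0@(opposite_algebra A) = 0@A" "1@(opposite_algebra A) = 1@A"
 "x ++.(opposite_algebra A) y = x ++.A y" "x **.(opposite_algebra A) y = y **.A x"
 "l *>.(opposite_algebra A) x = l *>.A x" by (simp_all add: opposite_algebra_def)

lemma finsum_opposite [simp]: "finsum (opposite_algebra A) f I = finsum A f I" by (simp add: finsum_def finprod_def opposite_algebra_def)

lemma (in fd_algebra) opposite: "fd_algebra K (opposite_algebra A)"
proof -
 interpret G: abelian_group "opposite_algebra A" by (rule abelian_group_cong[OF A.abelian_group_axioms]) auto
 interpret R: ring "opposite_algebra A" by (rule ringI[OF G.abelian_group_axioms monoidI])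
   (auto simp: A.m_assoc A.l_distr A.r_distr)
 interpret M: Module.module K "opposite_algebra A" by (rule moduleI[OF K.is_cring G.abelian_group_axioms])
   (auto simp: smult_l_distr smult_r_distr smult_assoc1)
 show ?thesis by unfold_locales (use finite_dimensional in "auto simp: smult_mult_left smult_mult_right finitely_generated_def")
qed

section \<open>Projective modules\<close>

definition fre :: "('a, 'b) ring_scheme => nat => ('a, nat => 'a) module" where
 "fre R s =
  (|carrier = {..<s} \<rightarrow>\<^sub>E car R, monoid.mult = undefined, monoid.one = undefined,
   ring.zero = (%i:{..<s}. 0@R), ring.add = (%x y. %i:{..<s}. x i ++.R y i),
   smult = (%a x. %i:{..<s}. x i **.R a)|)"

lemma fre_sel [simp]:
 "car (fre R s) = {..<s} \<rightarrow>\<^sub>E car R" "0@(fre R s) = (%i:{..<s}. 0@R)"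
 "x ++.(fre R s) y = (%i:{..<s}. x i ++.R y i)"
 "a *>.(fre R s) x = (%i:{..<s}. x i **.R a)" by (simp_all add: fre_def)

definition unit_vector :: "('a, 'b) ring_scheme => nat => nat => nat => 'a" where
 "unit_vector R s u = (%i:{..<s}. if i = u then 1@R else 0@R)"

text \<open>The dual basis criterion for projectivity, which exhibits \<open>P\<close> as a retract
  of a free module of rank \<open>s\<close>. In contrast to the lifting property it involves no
  quantification over modules.\<close>

definition dual_basis :: "('a, 'b) ring_scheme => ('a, 'm) module => nat => (nat => 'm) => (nat => 'm => 'a) => bool" where
 "dual_basis R P s x f <->
  x : s ->. P & (ALL u<s. lin R P (reg R) (f u)) &
  (ALL p:car P. p = (+/.P u<s. f u p *>.P x u))"

definition fg_proj :: "('a, 'b) ring_scheme => ('a, 'm) module => bool" where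
 "fg_proj R P <-> fgm R P & (EX s x f. dual_basis R P s x f)"

lemma fg_proj_fg: "fg_proj R P ==> fgm R P" by (simp add: fg_proj_def)

lemma fgmD: "fgm R P ==> rmod R P" by (simp add: fg_right_module_def)

lemma dual_basisD:
 assumes "dual_basis R P s x f" shows dual_basis_vec: "x : s ->. P" "u < s ==> x u :. P" and dual_basis_lin: "u < s ==> lin R P (reg R) (f u)"
  and dual_basis_coef: "u < s ==> p :. P ==> f u p :. R" and dual_basis_sum: "p :. P ==> p = (+/.P u<s. f u p *>.P x u)"
 using assms lin_closed[of R P "reg R" "f u" p] unfolding dual_basis_def by auto

context ring
begin

lemma free_right_module: "rmod R (fre R s)"
proof -
 interpret G: abelian_group "fre R s"
 proof (rule abelian_groupI)
  fix x assume "x :. (fre R s)"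
  thus "EX y:car (fre R s). y ++.(fre R s) x = 0@(fre R s)"
   by (intro bexI[of _ "%i:{..<s}. ~- x i"]) (auto simp: l_neg PiE_def Pi_def intro!: restrict_ext)
  show "0@(fre R s) ++.(fre R s) x = x" using `x : car (fre R s)` by (auto simp: PiE_def extensional_def Pi_def fun_eq_iff)
 next
  fix x y z assume "x :. (fre R s)" "y :. (fre R s)" "z :. (fre R s)"
  thus "x ++.(fre R s) y ++.(fre R s) z = x ++.(fre R s) (y ++.(fre R s) z)" by (auto simp: PiE_def Pi_def a_assoc intro!: restrict_ext)
 next
  fix x y assume "x :. (fre R s)" "y :. (fre R s)"
  thus "x ++.(fre R s) y = y ++.(fre R s) x" by (auto simp: PiE_def Pi_def a_comm intro!: restrict_ext)
 qed (auto simp: PiE_def Pi_def)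
 show ?thesis
 proof (unfold_locales)
  fix x assume "x :. (fre R s)"
  thus "\<one> *>.(fre R s) x = x" by (auto simp: PiE_def extensional_def Pi_def fun_eq_iff)
 qed (auto simp: PiE_def Pi_def l_distr r_distr m_assoc intro!: restrict_ext)
qed

lemma free_proj_lin: "u < s ==> lin R (fre R s) (reg R) (%x. x u)" by (rule linI) (auto simp: PiE_def Pi_def)

lemma unit_vector_closed [simp]: "unit_vector R s u :. (fre R s)" by (auto simp: unit_vector_def)

lemma free_dual_basis: "dual_basis R (fre R s) s (unit_vector R s) (%u x. x u)"
proof -
 interpret F: right_module R "fre R s" by (rule free_right_module)
 have "p = (+/.(fre R s) u<s. p u *>.(fre R s) unit_vector R s u)"
  if p: "p :. (fre R s)" for p
 proof -
  have pu: "p u :. R" if "u < s" for u using p that by (auto simp: PiE_def Pi_def)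
  have tcl: "p u *>.(fre R s) unit_vector R s u :. (fre R s)" if "u < s" for u by (rule F.act_closed[OF pu[OF that] unit_vector_closed])
  have ev: "(+/.(fre R s) u<s. p u *>.(fre R s) unit_vector R s u) i = p i" if i: "i < s" for i
  proof -
   interpret e: linear_map R "fre R s" "reg R" "%x. x i" by (intro lmapI free_right_module regular_right_module free_proj_lin i)
   have "(+/.(fre R s) u<s. p u *>.(fre R s) unit_vector R s u) i =
     (+/u<s. (p u *>.(fre R s) unit_vector R s u) i)" using e.map_finsum[of "%u. p u *>.(fre R s) unit_vector R s u" "{..<s}"] tcl by auto
   also have "... = (p i *>.(fre R s) unit_vector R s i) i" by (rule finsum_single) (use i pu in "auto simp: unit_vector_def")
   also have "... = p i" using i pu by (simp add: unit_vector_def)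
   finally show ?thesis .
  qed
  have "(+/.(fre R s) u<s. p u *>.(fre R s) unit_vector R s u) :. (fre R s)" using tcl by (intro F.M.finsum_closed) blast
  with p ev show ?thesis by (intro PiE_ext[of p "{..<s}" "%_. car R"]) auto
 qed
 thus ?thesis using free_proj_lin unit_vector_closed unfolding dual_basis_def by blast
qed

end

lemma (in right_module) lin_orbit: "x :. M ==> lin R (reg R) M (%a. a *>.M x)" by (rule linI) (auto simp: act_add_ring act_mult)

lemma (in right_module) lin_combination:
 assumes "!!u. u < s ==> lin R N (reg R) (f u)" "y : s ->. M" shows "lin R N M (%p. +/.M u<s. f u p *>.M y u)"
 by (rule lin_pointwise_finsum, rule lin_comp[OF assms(1) lin_orbit]) (use assms(2) in auto)

lemma dual_basis_map:
 assumes "dual_basis R P s x f" "lmap R P M g" "p :. P" shows "g p = (+/.M u<s. f u p *>.M g (x u))"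
proof -
 interpret linear_map R P M g by fact
 have "g p = g (+/.P u<s. f u p *>.P x u)" using dual_basis_sum[OF assms(1,3)] by simp
 also have "... = (+/.M u<s. g (f u p *>.P x u))" by (rule map_finsum) (use dual_basisD[OF assms(1)] assms(3) in auto)
 also have "... = (+/.M u<s. f u p *>.M g (x u))" by (rule N.M.finsum_cong') (use dual_basisD[OF assms(1)] assms(3) in "auto simp: map_act")
 finally show ?thesis .
qed

lemma dual_basis_lift:
 assumes P: "dual_basis R P s x f" and q: "lmap R X Y q" "q ` car X = car Y" and g: "lmap R P Y g"
 shows "EX h. lin R P X h & (ALL p:car P. q (h p) = g p)"
proof -
 interpret q: linear_map R X Y q by fact
 interpret g: linear_map R P Y g by fact
 have "ALL u:{..<s}. EX y. y :. X & q y = g (x u)"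
 proof
  fix u assume "u : {..<s}"
  hence "g (x u) : q ` car X" using dual_basis_vec(2)[OF P] q(2) by simp
  thus "EX y. y :. X & q y = g (x u)" by auto
 qed
 from bchoice[OF this] obtain y where y: "!!u. u < s ==> y u :. X & q (y u) = g (x u)" by auto
 let ?h = "%p. +/.X u<s. f u p *>.X y u"
 have "lin R P X ?h" by (rule q.M.lin_combination) (use y dual_basis_lin[OF P] in auto)
 moreover have "q (?h p) = g p" if p: "p :. P" for p
 proof -
  have "q (?h p) = (+/.Y u<s. q (f u p *>.X y u))" by (rule q.map_finsum) (use y dual_basis_coef[OF P _ p] in auto)
  also have "... = (+/.Y u<s. f u p *>.Y g (x u))" by (rule q.N.M.finsum_cong')
    (use y dual_basis_coef[OF P _ p] dual_basis_vec(2)[OF P] in "auto simp: q.map_act")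
  finally show ?thesis using dual_basis_map[OF P g p] by simp
 qed
 ultimately show ?thesis by blast
qed

lemma dual_basis_retract:
 assumes P: "dual_basis R P s x f" and i: "lin R M P i" and r: "lmap R P M r" and ri: "!!m. m :. M ==> r (i m) = m"
 shows "dual_basis R M s (%u. r (x u)) (%u m. f u (i m))"
proof -
 interpret r: linear_map R P M r by fact
 have "m = (+/.M u<s. f u (i m) *>.M r (x u))" if "m :. M" for m using dual_basis_map[OF P r lin_closed[OF i that]] ri[OF that] by simp
 moreover have "lin R M (reg R) (%m. f u (i m))" if "u < s" for u using lin_comp[OF i dual_basis_lin[OF P that]] .
 ultimately show ?thesis using dual_basis_vec[OF P] unfolding dual_basis_def by auto
qed

lemma bij_lin_inverse:
 assumes "lmap R M N f" "bij_betw f (car M) (car N)" shows "EX g. lmap R N M g & bij_betw g (car N) (car M) &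
  (ALL x:car M. g (f x) = x) & (ALL y:car N. f (g y) = y)"
proof -
 interpret linear_map R M N f by fact
 have onto: "f ` car M = car N" and inj: "inj_on f (car M)" using assms(2) by (auto simp: bij_betw_def)
 obtain g where g: "lin R N M g" "ALL x:car M. g (f x) = x" using factor_through[OF M.rax lin_id onto] inj inj_iff by auto
 have fg: "f (g y) = y" if "y :. N" for y using that g(2) onto by (metis imageE)
 have "bij_betw g (car N) (car M)" by (rule bij_betwI[where g = f]) (use g fg lin_closed[OF g(1)] in auto)
 thus ?thesis using g fg lmapI[OF N.rax M.rax g(1)] by blast
qed

context fd_algebra
begin

lemma fg_free: "fgm A (fre A s)"
proof -
 interpret F: right_module A "fre A s" by (rule A.free_right_module)
 note db = A.free_dual_basis[of s]
 have "finitely_generated A (fre A s)"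
 proof (rule F.fgI[of "unit_vector A s ` {..<s}"])
  fix U assume U: "subm U A (fre A s)" "unit_vector A s ` {..<s} <= U"
  have "p : U" if p: "p :. (fre A s)" for p by (subst dual_basis_sum[OF db p], rule F.submod_finsum[OF U(1)], rule F.submod_act[OF U(1)])
    (use U(2) p in auto)
  thus "U = car (fre A s)" using F.submod_subset[OF U(1)] by blast
 qed (use A.unit_vector_closed in blast)+
 thus ?thesis using F.rax by (simp add: fg_right_module_def)
qed

lemma free_cover:
 assumes "fgm A M" shows "EX s f. lin A (fre A s) M f & f ` car (fre A s) = car M"
proof -
 interpret M: right_module A M using assms by (rule fgmD)
 obtain z p where sp: "spans_mod A M {0@M} z p" using assms M.fg_spans by (auto simp: fg_right_module_def)
 hence z: "z : p ->. M" by (simp add: spans_mod_def)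
 let ?f = "%x. +/.M u<p. x u *>.M z u"
 have lin: "lin A (fre A p) M ?f" by (rule M.lin_combination) (use z A.free_proj_lin in auto)
 have "y : ?f ` car (fre A p)" if y: "y :. M" for y
 proof -
  obtain c where c: "c : p ->. A" "y --.M (+/.M i<p. c i *>.M z i) = 0@M" using sp y unfolding spans_mod_def by blast
  have "y = (+/.M i<p. c i *>.M z i)" using c(2) M.M.diff_eq_zero_iff[OF y M.sum_closed[OF c(1) z]] by simp
  also have "... = ?f (restrict c {..<p})" by (rule M.M.finsum_cong') (use c z in "auto simp: Pi_iff")
  finally show ?thesis using c by (intro image_eqI[of _ _ "restrict c {..<p}"]) auto
 qed
 thus ?thesis using lin lin_closed[OF lin] by (intro exI[of _ p] exI[of _ ?f]) blast
qed

lemma fg_proj_iso: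
 assumes "fg_proj A P" "rmod A M" "lin A P M f" "bij_betw f (car P) (car M)" shows "fg_proj A M"
proof -
 obtain s x phi where db: "dual_basis A P s x phi" using assms(1) by (auto simp: fg_proj_def)
 have lm: "lmap A P M f" by (intro lmapI fgmD fg_proj_fg assms)
 obtain g where g: "lmap A M P g" "!!y. y :. M ==> f (g y) = y" using bij_lin_inverse[OF lm assms(4)] by blast
 from dual_basis_retract[OF db linear_map.lin[OF g(1)] lm g(2)] show ?thesis
  using fg_lin_image[OF fg_proj_fg[OF assms(1)] assms(2,3)] assms(4) by (auto simp: fg_proj_def bij_betw_def)
qed

text \<open>A free cover lives in the type \<open>nat => 'a\<close>; its copy has the type of the
  modules in a resolution.\<close>

lemma proj_cover:
 assumes "fgm A M" shows "EX (P :: ('a, nat => 'k) module) f. fg_proj A P & lmap A P M f & f ` car P = car M"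
proof -
 obtain s f where f: "lin A (fre A s) M f" "f ` car (fre A s) = car M" using free_cover[OF assms] by blast
 obtain N :: "('a, nat => 'k) module" and g where g: "fgm A N" "lin A (fre A s) N g"
  "bij_betw g (car (fre A s)) (car N)" using copy_module[OF fg_free] by blast
 have "fg_proj A (fre A s)" using A.free_dual_basis fg_free by (auto simp: fg_proj_def)
 hence N: "fg_proj A N" using fg_proj_iso g fgmD by blast
 have lm: "lmap A (fre A s) N g" by (intro lmapI A.free_right_module g fgmD)
 obtain h where h: "lmap A N (fre A s) h" "bij_betw h (car N) (car (fre A s))" using bij_lin_inverse[OF lm g(3)] by blast
 have "lmap A N M (%x. f (h x))" by (intro lmapI lin_comp[OF _ f(1)] linear_map.lin[OF h(1)] fgmD g assms)
 moreover have "(%x. f (h x)) ` car N = car M" using f(2) h(2) unfolding bij_betw_def by (simp flip: image_image[of f h])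
 ultimately show ?thesis using N by blast
qed

text \<open>Lifting the identity along a cover that has a dual basis makes \<open>P\<close> a
  retract of this cover.\<close>

lemma projective_imp_fg_proj:
 fixes P :: "('a, nat => 'k) module"
 assumes "projective_module A P" shows "fg_proj A P"
proof -
 have fg: "fgm A P" using assms by (simp add: projective_module_def)
 interpret P: right_module A P by (rule fgmD[OF fg])
 obtain X :: "('a, nat => 'k) module" and f where X: "fg_proj A X" and f: "lmap A X P f" "f ` car X = car P" using proj_cover[OF fg] by blast
 interpret f: linear_map A X P f by fact
 have "restrict f (car X) : module_homs A X P" "restrict f (car X) ` car X = car P"
  "restrict (%x. x) (car P) : module_homs A P P" using restrict_module_hom[OF f.M.rax f.lin]
   restrict_module_hom[OF P.rax lin_id] f(2) by simp_all
 then obtain h where h: "h : module_homs A P X" "ALL x:car P. restrict f (car X) (h x) = restrict (%x. x) (car P) x"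
  using assms fg_proj_fg[OF X] fg unfolding projective_module_def by blast
 have hl: "lin A P X h" using h(1) by (simp add: module_homs_iff)
 obtain s x phi where "dual_basis A X s x phi" using X by (auto simp: fg_proj_def)
 from dual_basis_retract[OF this hl f(1)] h(2) lin_closed[OF hl] show ?thesis using fg by (auto simp: fg_proj_def)
qed

lemma fg_proj_imp_projective:
 assumes "fg_proj A P" shows "projective_module A P" unfolding projective_module_def
proof (intro conjI allI impI ballI fg_proj_fg[OF assms])
 fix X Y :: "('a, nat => 'k) module" and f g
 assume X: "fgm A X" and Y: "fgm A Y" and f: "f : module_homs A X Y" and onto: "f ` car X = car Y" and g: "g : module_homs A P Y"
 obtain s x phi where db: "dual_basis A P s x phi" using assms by (auto simp: fg_proj_def)
 have P: "rmod A P" using assms fg_proj_fg fgmD by blast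
 obtain h where h: "lin A P X h" "ALL p:car P. f (h p) = g p"
  using dual_basis_lift[OF db _ onto, of g] f g X Y P by (auto simp: module_homs_iff lmapI fgmD)
 thus "EX h:module_homs A P X. ALL x:car P. f (h x) = g x" using restrict_module_hom[OF P h(1)] by (intro bexI[of _ "restrict h (car P)"]) auto
qed

end

section \<open>Resolutions and Gorenstein projective modules\<close>

text \<open>If \<open>P\<close> is projective and \<open>U\<close> is the kernel of a map from
  \<open>P\<close> onto \<open>X\<close>, this says that the first extension group of
  \<open>X\<close> by \<open>N\<close> vanishes.\<close>

definition hom_extends :: "('a, 'b) ring_scheme => ('a, 'm) module => 'm set => ('a, 'n) module => bool" where
 "hom_extends R P U N <->
  (ALL f. lin R (P(|carrier := U|)) N f --> (EX g. lin R P N g & (ALL x:U. g x = f x)))"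

text \<open>A projective resolution that keeps its syzygies \<open>X i\<close> as modules of their
  own, so that induction and coinduction can run over them.\<close>

definition resolution :: "('k, 'a) module => (nat => ('a, nat => 'k) module) =>
  (nat => ('a, nat => 'k) module) => (nat => (nat => 'k) => nat => 'k) => bool" where
 "resolution A X P p <->
  (ALL i. fg_proj A (P i) & lmap A (P i) (X i) (p i) & p i ` car (P i) = car (X i) &
    X (Suc i) = (P i)(|carrier := akr (P i) (X i) (p i)|))"

text \<open>The coinductive form of the condition \<open>Ext\<^sup>i(X, A) = 0\<close> for all \<open>i > 0\<close>.\<close>

coinductive gp :: "('k, 'a) module => ('a, nat => 'k) module => bool" for A where
 gpI: "[|fg_proj A P; lmap A P X p; p ` car P = car X;
  hom_extends A P (akr P X p) (reg A);
  gp A (P(|carrier := akr P X p|))|] ==> gp A (X :: ('a, nat => 'k) module)"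

lemma a_kernel_iff: "x : akr M N f <-> x :. M & f x = 0@N" by (simp add: a_kernel_def')

lemma gp_right_module: "gp A X ==> rmod A X" by (erule gp.cases) (simp add: linear_map_def)

lemma gp_iso:
 assumes "gp A X" "lmap A X Y f" "bij_betw f (car X) (car Y)" shows "gp A Y" using assms(1)
proof cases
 case (gpI P p)
 interpret f: linear_map A X Y f by fact
 interpret p: linear_map A P X p by fact
 have *: "f x = 0@Y <-> x = 0@X" if "x :. X" for x using that assms(3) f.inj_iff f.map_zero by (auto simp: bij_betw_def)
 have ker: "akr P Y (%x. f (p x)) = akr P X p" by (auto simp: a_kernel_iff *)
 show ?thesis
 proof (rule gp.gpI[where P = P and p = "%x. f (p x)"])
  show "lmap A P Y (%x. f (p x))" by (intro lmapI lin_comp[OF p.lin f.lin] p.M.rax f.N.rax)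
  show "(%x. f (p x)) ` car P = car Y" using gpI(3) assms(3) by (simp add: bij_betw_def flip: image_image[of f p])
 qed (use gpI ker in simp_all)
qed

text \<open>The tail of the resolution is itself the invariant of the coinduction. The bound
  \<open>m\<close> serves the case of a module of which only high syzygies are known to satisfy the
  condition.\<close>

lemma resolution_gp:
 assumes "resolution A X P p" "!!i. i >= m ==> hom_extends A (P i) (akr (P i) (X i) (p i)) (reg A)" and "i >= m" shows "gp A (X i)" using assms(3)
proof (coinduction arbitrary: i)
 case gp
 thus ?case using assms(1,2) unfolding resolution_def
  by (intro exI[of _ "P i"] exI[of _ "X i"] exI[of _ "p i"]) (auto intro!: exI[of _ "Suc i"] simp flip: )
qed

context fd_algebra
begin

lemma gp_fg: "gp A X ==> fgm A X" by (erule gp.cases) (auto intro: fg_lin_image simp: linear_map_def linear_map_axioms_def dest: fg_proj_fg)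

lemma iso_kernel_zero:
 assumes "lmap A M N f" "inj_on f (car M)" shows "akr M N f = {0@M}"
proof -
 interpret linear_map A M N f by fact
 show ?thesis using assms(2) inj_iff by (auto simp: a_kernel_iff)
qed

text \<open>Covering a projective module by itself makes the resolution stop.\<close>

lemma resolution_exists:
 fixes M :: "('a, nat => 'k) module"
 assumes "fgm A M" shows "EX X P p. resolution A X P p & X 0 = M &
  (ALL i. fg_proj A (X i) --> car (X (Suc i)) = {0@(X (Suc i))} & P i = X i)"
proof -
 define good where "good = (%(X :: ('a, nat => 'k) module) (P :: ('a, nat => 'k) module) p.
  fg_proj A P & lmap A P X p & p ` car P = car X &
  (fg_proj A X --> P = X & (ALL x:car X. p x = x)))"
 have ex: "EX Pp. good X (fst Pp) (snd Pp)" if "fgm A X" for X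
 proof (cases "fg_proj A X")
  case True
  have "lmap A X X (%x. x)" by (intro lmapI lin_id fgmD that)
  thus ?thesis using True by (intro exI[of _ "(X, %x. x)"]) (simp add: good_def)
 next
  case False
  thus ?thesis using proj_cover[OF that] by (auto simp: good_def)
 qed
 define cov where "cov X = (SOME Pp. good X (fst Pp) (snd Pp))" for X
 have cov: "good X (fst (cov X)) (snd (cov X))" if "fgm A X" for X unfolding cov_def by (rule someI_ex[OF ex[OF that]])
 define X where "X = rec_nat M (%_ X. (fst (cov X))(|carrier := akr (fst (cov X)) X (snd (cov X))|))"
 define P where "P i = fst (cov (X i))" for i
 define p where "p i = snd (cov (X i))" for i
 have X0: "X 0 = M" and XS: "X (Suc i) = (P i)(|carrier := akr (P i) (X i) (p i)|)" for i by (simp_all add: X_def P_def p_def)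
 have fg: "fgm A (X i)" for i
 proof (induct i)
  case 0
  show ?case using assms by (simp add: X0)
 next
  case (Suc i)
  hence "good (X i) (P i) (p i)" unfolding P_def p_def by (rule cov)
  thus ?case unfolding XS by (intro fg_submodule fg_proj_fg linear_map.submod_kernel) (auto simp: good_def)
 qed
 have good: "good (X i) (P i) (p i)" for i unfolding P_def p_def by (rule cov[OF fg])
 have stop: "car (X (Suc i)) = {0@(X (Suc i))}" if "fg_proj A (X i)" for i
 proof -
  have "P i = X i" "!!x. x :. (X i) ==> p i x = x" using good[of i] that by (auto simp: good_def)
  moreover have "0@(X i) :. (X i)"
  proof -
   interpret right_module A "X i" using fg by (rule fgmD)
   show ?thesis by simp
  qed
  ultimately show ?thesis by (auto simp: XS a_kernel_iff)
 qed
 show ?thesis by (rule exI[of _ X], rule exI[of _ P], rule exI[of _ p]) (use good XS X0 stop in "auto simp: resolution_def good_def")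
qed

text \<open>The isomorphism \<open>f\<close> bridges the types: \<open>M\<close> may live anywhere,
  while the syzygies live in \<open>nat => 'k\<close>.\<close>

lemma resolution_to_projective_resolution:
 assumes res: "resolution A X P p" and f: "lmap A (X 0) M f" "bij_betw f (car (X 0)) (car M)"
 shows "projective_resolution A M P (%i. restrict (p (Suc i)) (car (P (Suc i)))) (restrict (%x. f (p 0 x)) (car (P 0)))"
proof -
 interpret f: linear_map A "X 0" M f by fact
 have r: "fg_proj A (P i)" "lmap A (P i) (X i) (p i)" "p i ` car (P i) = car (X i)"
  "X (Suc i) = (P i)(|carrier := akr (P i) (X i) (p i)|)" for i using res by (auto simp: resolution_def)
 have rm: "rmod A (P i)" for i using r(2) by (simp add: linear_map_def)
 have l: "lin A (P (Suc i)) (P i) (p (Suc i))" for i using linear_map.lin[OF r(2)[of "Suc i"]] unfolding r(4)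
  by (rule lin_out) (auto simp: a_kernel_iff)
 have l0: "lin A (P 0) M (%x. f (p 0 x))" using lin_comp[OF linear_map.lin[OF r(2)] f.lin] .
 have f0: "f x = 0@M <-> x = 0@(X 0)" if "x :. (X 0)" for x using that f(2) f.inj_iff f.map_zero by (auto simp: bij_betw_def)
 have im: "p (Suc i) ` car (P (Suc i)) = akr (P i) (X i) (p i)" for i using r(3)[of "Suc i"] unfolding r(4) by simp
 have p0: "p 0 x :. (X 0)" if "x :. (P 0)" for x using r(3)[of 0] that by blast
 show ?thesis unfolding projective_resolution_def
 proof (intro conjI allI)
  show "restrict (%x. f (p 0 x)) (car (P 0)) ` car (P 0) = car M" using r(3)[of 0] f(2) by (simp add: bij_betw_def flip: image_image[of f "p 0"])
  show "restrict (p (Suc 0)) (car (P (Suc 0))) ` car (P 1) = akr (P 0) M (restrict (%x. f (p 0 x)) (car (P 0)))"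
   using im[of 0] f0 p0 by (auto simp: a_kernel_iff)
  fix i
  show "restrict (p (Suc (Suc i))) (car (P (Suc (Suc i)))) ` car (P (Suc (Suc i))) =
   akr (P (Suc i)) (P i) (restrict (p (Suc i)) (car (P (Suc i))))" using im[of "Suc i"] by (auto simp: a_kernel_iff r(4))
 qed (use restrict_module_hom[OF rm l] restrict_module_hom[OF rm l0] fg_proj_imp_projective r(1) in auto)
qed

lemma projective_resolution_to_resolution:
 assumes res: "projective_resolution A M P d eps" and M: "rmod A M" and f: "lmap A M N f" "bij_betw f (car M) (car N)"
 shows "resolution A (%i. case i of 0 => N
   | Suc j => (P j)(|carrier := (case j of 0 => akr (P 0) M eps | Suc k => akr (P j) (P k) (d k))|))
  P (%i. case i of 0 => (%x. f (eps x)) | Suc j => d j)" (is "resolution A ?X P ?p")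
proof -
 interpret f: linear_map A M N f by fact
 have proj: "fg_proj A (P i)" for i using res projective_imp_fg_proj by (simp add: projective_resolution_def)
 have rm: "rmod A (P i)" for i using proj fg_proj_fg fgmD by blast
 have e: "lin A (P 0) M eps" and d: "lin A (P (Suc i)) (P i) (d i)" for i using res by (auto simp: projective_resolution_def module_homs_iff)
 have f0: "f x = 0@N <-> x = 0@M" if "x :. M" for x using that f(2) f.inj_iff f.map_zero by (auto simp: bij_betw_def)
 have im: "d j ` car (P (Suc j)) = car (?X (Suc j))" for j using res by (cases j) (auto simp: projective_resolution_def)
 have sub: "subm (car (?X (Suc j))) A (P j)" for j using linear_map.submod_image[OF lmapI[OF rm rm d] right_module.submod_self[OF rm]] im by metis
 have X_Suc: "?X (Suc j) = (P j)(|carrier := car (?X (Suc j))|)" for j by simp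
 have rX: "rmod A (?X (Suc j))" for j using right_module.submod_right_module[OF rm sub[of j]] by simp
 have k0: "akr (P 0) N (%x. f (eps x)) = akr (P 0) M eps" using f0 lin_closed[OF e] by (auto simp: a_kernel_iff)
 show ?thesis unfolding resolution_def
 proof (intro allI conjI)
  fix i
  show "fg_proj A (P i)" by (rule proj)
  show "lmap A (P i) (?X i) (?p i)"
  proof (cases i)
   case 0
   thus ?thesis using lin_comp[OF e f.lin] rm by (auto intro: lmapI f.N.rax)
  next
   case (Suc j)
   have "lin A (P (Suc j)) ((P j)(|carrier := car (?X (Suc j))|)) (d j)" by (rule lin_into[OF d]) (use im[of j] in blast)
   thus ?thesis using Suc lmapI[OF rm rX[of j], of "Suc j" "d j"] by simp
  qed
  show "?p i ` car (P i) = car (?X i)"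
  proof (cases i)
   case 0
   have "eps ` car (P 0) = car M" using res by (simp add: projective_resolution_def)
   thus ?thesis using 0 f(2) by (simp add: bij_betw_def flip: image_image[of f eps])
  next
   case (Suc j)
   thus ?thesis using im[of j] by simp
  qed
  show "?X (Suc i) = (P i)(|carrier := akr (P i) (?X i) (?p i)|)" using k0 by (cases i) (auto simp: a_kernel_def')
 qed
qed

text \<open>A homomorphism from a syzygy to \<open>A\<close>, pulled back to the next projective, is
  a cocycle. It is a coboundary because the group is trivial, and this means that the homomorphism
  extends to the projective containing the syzygy.\<close>

lemma gorenstein_projective_imp_gp:
 fixes M :: "('a, 'm) module"
 assumes gpM: "gorenstein_projective A M" and N: "lmap A M N f" "bij_betw f (car M) (car N)" shows "gp A N"
proof -
 have fg: "fgm A M" and triv: "!!i. i > 0 ==> trivial_group (Ext A i M (reg A))" using gpM by (auto simp: gorenstein_projective_def)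
 obtain M' :: "('a, nat => 'k) module" and g where M': "fgm A M'" "lin A M M' g" "bij_betw g (car M) (car M')" using copy_module[OF fg] by blast
 have lmg: "lmap A M M' g" by (intro lmapI fgmD fg M')
 obtain g' where g': "lmap A M' M g'" "bij_betw g' (car M') (car M)" using bij_lin_inverse[OF lmg M'(3)] by blast
 obtain X0 P0 p0 where "resolution A X0 P0 p0" "X0 0 = M'" using resolution_exists[OF M'(1)] by blast
 \<comment> \<open>Existence of some resolution ensures that the one chosen in \<open>Ext\<close> is
   a resolution.\<close>
 hence "EX Pd. (case Pd of (P, d) => EX eps. projective_resolution A M P d eps)"
  using resolution_to_projective_resolution[of X0 P0 p0 M g'] g' by auto
 note some = someI_ex[OF this]
 obtain P d where Pd: "(SOME (P, d). EX eps. projective_resolution A M P d eps) = (P, d)" by (rule prod.exhaust)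
 obtain eps where res: "projective_resolution A M P d eps" using some unfolding Pd by auto
 let ?X = "%i. case i of 0 => N
   | Suc j => (P j)(|carrier := (case j of 0 => akr (P 0) M eps | Suc k => akr (P j) (P k) (d k))|)"
 let ?p = "%i. case i of 0 => (%x. f (eps x)) | Suc j => d j"
 have r: "resolution A ?X P ?p" by (rule projective_resolution_to_resolution[OF res fgmD[OF fg] N])
 have proj: "fg_proj A (P i)" for i using res projective_imp_fg_proj by (simp add: projective_resolution_def)
 have rm: "rmod A (P i)" for i using proj fg_proj_fg fgmD by blast
 have d: "lin A (P (Suc i)) (P i) (d i)" for i using res by (auto simp: projective_resolution_def module_homs_iff)
 have ext: "hom_extends A (P j) (akr (P j) (?X j) (?p j)) (reg A)" for j unfolding hom_extends_def
 proof (intro allI impI)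
  fix h assume h: "lin A ((P j)(|carrier := akr (P j) (?X j) (?p j)|)) (reg A) h"
  have XS: "?X (Suc j) = (P j)(|carrier := akr (P j) (?X j) (?p j)|)" using r by (simp add: resolution_def)
  have dj: "lmap A (P (Suc j)) (?X (Suc j)) (d j)" "d j ` car (P (Suc j)) = akr (P j) (?X j) (?p j)"
   using r XS unfolding resolution_def by (metis (no_types, lifting) nat.simps(5) partial_object.select_convs(1) partial_object.surjective partial_object.update_convs(1))+
  \<comment> \<open>The cocycle of degree \<open>j + 1\<close> that belongs to
    \<open>h\<close>.\<close>
  define u where "u = compose (car (P (Suc j))) h (d j)"
  have hd: "lin A (P (Suc j)) (reg A) (%x. h (d j x))" using lin_comp[OF linear_map.lin[OF dj(1)], unfolded XS, OF h] .
  have u: "u : module_homs A (P (Suc j)) (reg A)" unfolding u_def compose_def by (rule restrict_module_hom[OF rm hd])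
  have dd: "d j (d (Suc j) x) = 0@(P j)" if "x : car (P (Suc (Suc j)))" for x
  proof -
   have "d (Suc j) x : akr (P (Suc j)) (P j) (d j)" using res that unfolding projective_resolution_def by blast
   thus ?thesis by (simp add: a_kernel_iff)
  qed
  have hz: "h 0@(P j) = 0@A"
  proof -
   interpret linear_map A "(P j)(|carrier := akr (P j) (?X j) (?p j)|)" "reg A" h using lmapI[OF _ A_rmod h] dj(1) XS by (simp add: linear_map_def)
   show ?thesis using map_zero by simp
  qed
  have uc: "u : hom_cocycles A P d (reg A) (Suc j)" unfolding hom_cocycles_def kernel_def
   using u dd hz lin_closed[OF d[of "Suc j"]] by (auto simp: hom_group_def u_def compose_def)
  have "trivial_group (Ext A (Suc j) M (reg A))" by (rule triv) simp
  hence tg: "trivial_group ((hom_group A (P (Suc j)) (reg A))(|carrier := hom_cocycles A P d (reg A) (Suc j)|)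
    Mod hom_coboundaries A P d (reg A) (Suc j))" unfolding Ext_def Pd by simp
  \<comment> \<open>\<open>F x\<close> is the coset of \<open>x\<close> modulo the coboundaries. The
    quotient being trivial, \<open>F u\<close> is the set of coboundaries; it contains
    \<open>u\<close> because the zero map is a coboundary.\<close>
  define F where "F x = (\<Union>k\<in>hom_coboundaries A P d (reg A) (Suc j).
    {k **.(hom_group A (P (Suc j)) (reg A)) x})" for x
  have "(\<Union>x\<in>hom_cocycles A P d (reg A) (Suc j). {F x}) =
    {hom_coboundaries A P d (reg A) (Suc j)}" using tg unfolding trivial_group_def FactGroup_def F_def by (simp add: RCOSETS_def r_coset_def)
  moreover have "F u : (\<Union>x\<in>hom_cocycles A P d (reg A) (Suc j). {F x})" using uc by (rule UN_I) simp
  ultimately have Fu: "F u = hom_coboundaries A P d (reg A) (Suc j)" by simp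
  have "compose (car (P (Suc j))) (restrict (%x. 0@A) (car (P j))) (d j)
    : hom_coboundaries A P d (reg A) (Suc j)" (is "?z : _")
  proof -
   have "lin A (P j) (reg A) (%x. 0@A)" using right_module.lin_pointwise_zero[OF A_rmod] by simp
   from restrict_module_hom[OF rm this] show ?thesis by (simp add: hom_coboundaries_def)
  qed
  hence "?z **.(hom_group A (P (Suc j)) (reg A)) u : F u" unfolding F_def by (rule UN_I) simp
  hence "?z **.(hom_group A (P (Suc j)) (reg A)) u : hom_coboundaries A P d (reg A) (Suc j)" by (simp only: Fu)
  moreover have "?z **.(hom_group A (P (Suc j)) (reg A)) u = u"
  proof
   fix x
   show "(?z **.(hom_group A (P (Suc j)) (reg A)) u) x = u x"
    using lin_closed[OF hd] lin_closed[OF d] by (cases "x :. (P (Suc j))") (auto simp: hom_group_def compose_def u_def)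
  qed
  ultimately obtain g where g: "g : module_homs A (P j) (reg A)" "u = compose (car (P (Suc j))) g (d j)" by (auto simp: hom_coboundaries_def)
  have "g x = h x" if x: "x : akr (P j) (?X j) (?p j)" for x
  proof -
   obtain y where y: "y :. (P (Suc j))" "x = d j y" using x dj(2) by blast
   thus ?thesis using fun_cong[OF g(2), of y] by (simp add: u_def compose_def)
  qed
  thus "EX g. lin A (P j) (reg A) g & (ALL x:akr (P j) (?X j) (?p j). g x = h x)" using g(1) module_homs_iff by blast
 qed
 have "gp A (?X 0)" by (rule resolution_gp[OF r, of 0]) (use ext in auto)
 thus ?thesis by simp
qed

end

section \<open>Modules of finite projective dimension over a Gorenstein algebra\<close>

lemma lin_eq_on_generators:
 assumes f: "lmap R M N f" and g: "lmap R M N g" and sp: "spans_mod R M {0@M} z p" and eq: "!!i. i < p ==> f (z i) = g (z i)" and x: "x :. M"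
 shows "f x = g x"
proof -
 interpret f: linear_map R M N f by fact
 interpret g: linear_map R M N g by fact
 have z: "z : p ->. M" using sp by (simp add: spans_mod_def)
 obtain c where c: "c : p ->. R" "x --.M (+/.M i<p. c i *>.M z i) = 0@M" using sp x unfolding spans_mod_def by blast
 have xs: "x = (+/.M i<p. c i *>.M z i)" using c(2) iffD1[OF f.M.M.diff_eq_zero_iff[OF x f.M.sum_closed[OF c(1) z]]] by blast
 have tcl: "(%i. c i *>.M z i) : p ->. M" using c(1) z by (auto simp: Pi_iff)
 have "f x = (+/.N i<p. f (c i *>.M z i))" unfolding xs by (rule f.map_finsum[OF tcl])
 also have "... = (+/.N i<p. g (c i *>.M z i))" by (rule f.N.M.finsum_cong') (use c(1) z eq in "auto simp: f.map_act g.map_act Pi_iff")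
 also have "... = g x" unfolding xs by (rule g.map_finsum[OF tcl, symmetric])
 finally show ?thesis .
qed

lemma choose_preimages: "y : I -> f ` X ==> EX z. ALL k:I. z k : X & f (z k) = y k" by (rule bchoice) (auto simp: Pi_iff image_iff Bex_def eq_commute)

text \<open>The \<open>h k\<close> are the coordinates of a homomorphism from \<open>G\<close> to a
  free module of rank \<open>s\<close>, and the \<open>y k\<close> are the images of the unit
  vectors in \<open>X\<close>.\<close>

definition factors_free :: "('a, 'b) ring_scheme => ('a, 'm) module => ('a, 'n) module => ('m => 'n) => bool" where
 "factors_free R G X f <-> (EX (s :: nat) h y. (ALL k<s. lin R G (reg R) (h k)) &
  y : s ->. X & (ALL g:car G. f g = (+/.X k<s. h k g *>.X y k)))"

lemma factors_freeE:
 assumes "factors_free R G X f" obtains s h y where "!!k. k < (s :: nat) ==> lin R G (reg R) (h k)" "y : s ->. X"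
  "!!g. g :. G ==> f g = (+/.X k<s. h k g *>.X y k)"
proof -
 obtain s h y where *: "ALL k<(s :: nat). lin R G (reg R) (h k)" "y : s ->. X"
  "ALL g:car G. f g = (+/.X k<s. h k g *>.X y k)" using assms unfolding factors_free_def by (elim exE conjE)
 show thesis by (rule that[of s h y]) (use * in simp_all)
qed

lemma factors_freeI:
 assumes "!!k. k < (s :: nat) ==> lin R G (reg R) (h k)" "y : s ->. X"
  "!!g. g :. G ==> f g = (+/.X k<s. h k g *>.X y k)" shows "factors_free R G X f" unfolding factors_free_def
 by (intro exI[of _ s] exI[of _ h] exI[of _ y] conjI allI ballI impI) (use assms in simp_all)

lemma factors_add:
 assumes X: "rmod R X" and f: "factors_free R G X f" and g: "factors_free R G X g" shows "factors_free R G X (%x. f x ++.X g x)"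
proof -
 interpret X: right_module R X by fact
 obtain s h y where 1: "!!k. k < (s :: nat) ==> lin R G (reg R) (h k)" "y : s ->. X"
  "!!x. x :. G ==> f x = (+/.X k<s. h k x *>.X y k)" using f by (rule factors_freeE) blast
 obtain t i z where 2: "!!k. k < (t :: nat) ==> lin R G (reg R) (i k)" "z : t ->. X"
  "!!x. x :. G ==> g x = (+/.X k<t. i k x *>.X z k)" using g by (rule factors_freeE) blast
 let ?h = "%k. if k < s then h k else i (k - s)" and ?y = "%k. if k < s then y k else z (k - s)"
 have hcl: "h k x :. R" if "k < s" "x :. G" for k x using lin_closed[OF 1(1)[OF that(1)] that(2)] by simp
 have icl: "i k x :. R" if "k < t" "x :. G" for k x using lin_closed[OF 2(1)[OF that(1)] that(2)] by simp
 have hy: "(%k. ?h k x *>.X ?y k) : (s + t) ->. X" if x: "x :. G" for x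
 proof
  fix k assume "k : {..<s + t}"
  thus "?h k x *>.X ?y k :. X" using hcl[of k x] icl[of "k - s" x] 1(2) 2(2) x by (cases "k < s") (auto simp: Pi_iff)
 qed
 have "f x ++.X g x = (+/.X k:{..<s + t}. ?h k x *>.X ?y k)" if x: "x :. G" for x
 proof -
  have "(+/.X k<s. ?h k x *>.X ?y k) = f x" unfolding 1(3)[OF x] by (rule X.M.finsum_cong') (use 1(2) hcl x in "auto simp: Pi_iff")
  moreover have "(+/.X k<t. ?h (s + k) x *>.X ?y (s + k)) = g x"
   unfolding 2(3)[OF x] by (rule X.M.finsum_cong') (use 2(2) icl x in "auto simp: Pi_iff")
  ultimately show ?thesis using X.M.finsum_split[OF hy[OF x]] by simp
 qed
 thus ?thesis
 proof (intro factors_freeI[of "s + t" _ _ ?h ?y])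
  show "lin R G (reg R) (?h k)" if "k < s + t" for k using 1(1) 2(1) that by auto
  show "?y : (s + t) ->. X" using 1(2) 2(2) by (auto simp: Pi_iff)
 qed
qed

lemma factors_comp:
 assumes q: "lmap R X Y q" and f: "factors_free R G X f" shows "factors_free R G Y (%x. q (f x))"
proof -
 interpret q: linear_map R X Y q by fact
 obtain s h y where 1: "!!k. k < (s :: nat) ==> lin R G (reg R) (h k)" "y : s ->. X"
  "!!x. x :. G ==> f x = (+/.X k<s. h k x *>.X y k)" using f by (rule factors_freeE) blast
 have hcl: "h k x :. R" if "k < s" "x :. G" for k x using lin_closed[OF 1(1)[OF that(1)] that(2)] by simp
 show ?thesis
 proof (rule factors_freeI[of s _ _ h "%k. q (y k)"])
  show "q (f x) = (+/.Y k<s. h k x *>.Y q (y k))" if x: "x :. G" for x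
  proof -
   have "q (f x) = (+/.Y k<s. q (h k x *>.X y k))" unfolding 1(3)[OF x] by (rule q.map_finsum) (use 1(2) hcl x in "auto simp: Pi_iff")
   also have "... = (+/.Y k<s. h k x *>.Y q (y k))" by (rule q.N.M.finsum_cong') (use 1(2) hcl x in "auto simp: Pi_iff q.map_act")
   finally show ?thesis .
  qed
 qed (use 1 in auto)
qed

lemma factors_dual_basis:
 assumes P: "dual_basis R P s x f" and bet: "lin R G P bet" and alp: "lmap R P X alp" shows "factors_free R G X (%g. alp (bet g))"
proof (rule factors_freeI[of s _ _ "%u g. f u (bet g)" "%u. alp (x u)"])
 interpret linear_map R P X alp by fact
 show "lin R G (reg R) (%g. f k (bet g))" if "k < s" for k using lin_comp[OF bet dual_basis_lin[OF P that]] .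
 show "(%u. alp (x u)) : s ->. X" using dual_basis_vec[OF P] by auto
 show "alp (bet g) = (+/.X k<s. f k (bet g) *>.X alp (x k))" if "g :. G" for g by (rule dual_basis_map[OF P alp lin_closed[OF bet that]])
qed

lemma factors_cong: "factors_free R G X f ==> (!!g. g :. G ==> f' g = f g) ==> factors_free R G X f'" unfolding factors_free_def by simp

text \<open>Over a Gorenstein algebra these are the modules of finite projective dimension.\<close>

definition zclass :: "('k, 'a) module => ('a, 'm) module => bool" where
 "zclass A X <-> rmod A X & (ALL G f. gp A G --> lin A G X f --> factors_free A G X f)"

lemma zclassI: "rmod A X ==> (!!G f. gp A G ==> lin A G X f ==> factors_free A G X f) ==> zclass A X" by (simp add: zclass_def)

lemma zclassD: "zclass A X ==> gp A G ==> lin A G X f ==> factors_free A G X f" by (simp add: zclass_def)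

lemma zclass_right_module: "zclass A X ==> rmod A X" by (simp add: zclass_def)

lemma zclass_retract:
 assumes X: "zclass A X" and r: "lmap A X Y r" and i: "lin A Y X i" and ri: "!!y. y :. Y ==> r (i y) = y" shows "zclass A Y"
proof (rule zclassI)
 interpret r: linear_map A X Y r by fact
 show "rmod A Y" by (rule r.N.rax)
 fix G f assume G: "gp A G" and f: "lin A G Y f"
 have "factors_free A G Y (%g. r (i (f g)))" by (rule factors_comp[OF r zclassD[OF X G lin_comp[OF f i]]])
 thus "factors_free A G Y f" by (rule factors_cong) (simp add: ri lin_closed[OF f])
qed

lemma zclass_zero:
 assumes X: "rmod A X" "car X = {0@X}" shows "zclass A X"
proof (rule zclassI[OF X(1)])
 interpret X: right_module A X by (rule X(1))
 fix G f assume G: "gp A G" and f: "lin A G X f"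
 have "f g = 0@X" if "g :. G" for g using lin_closed[OF f that] X(2) by simp
 thus "factors_free A G X f" by (intro factors_freeI[of 0]) auto
qed

lemma zclass_iso:
 assumes "zclass A X" "lmap A X Y f" "bij_betw f (car X) (car Y)" shows "zclass A Y"
proof -
 obtain g where "lmap A Y X g" "ALL y:car Y. f (g y) = y" using bij_lin_inverse[OF assms(2,3)] by blast
 thus ?thesis using zclass_retract[OF assms(1,2), of g] by (simp add: linear_map_def linear_map_axioms_def)
qed

text \<open>A factorization of \<open>q\<close> after \<open>f\<close> lifts to a homomorphism
  \<open>f1\<close> into \<open>X\<close> that factors as well. The difference of \<open>f\<close>
  and \<open>f1\<close> has values in the kernel of \<open>q\<close>, where the second hypothesis
  applies.\<close>

lemma zclass_extension:
 assumes q: "lmap A X Y q" "q ` car X = car Y" and Y: "zclass A Y" and U: "zclass A (X(|carrier := akr X Y q|))" shows "zclass A X"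
proof (rule zclassI)
 interpret q: linear_map A X Y q by fact
 let ?U = "X(|carrier := akr X Y q|)"
 show "rmod A X" by (rule q.M.rax)
 fix G f assume G: "gp A G" and f: "lin A G X f"
 obtain s h y where 1: "!!k. k < (s :: nat) ==> lin A G (reg A) (h k)" "y : s ->. Y"
  "!!x. x :. G ==> q (f x) = (+/.Y k<s. h k x *>.Y y k)" using zclassD[OF Y G lin_comp[OF f q.lin]] by (rule factors_freeE) blast
 have "y : {..<s} -> q ` car X" using 1(2) q(2) by simp
 from choose_preimages[OF this] obtain z where z: "!!k. k < s ==> z k :. X" "!!k. k < s ==> q (z k) = y k" by auto
 define f1 where "f1 x = (+/.X k<s. h k x *>.X z k)" for x
 have f1: "factors_free A G X f1" by (rule factors_freeI[of s _ _ h z]) (use 1 z f1_def in auto)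
 have f1l: "lin A G X f1" unfolding f1_def by (rule q.M.lin_combination) (use 1 z in auto)
 have hcl: "h k x :. A" if "k < s" "x :. G" for k x using lin_closed[OF 1(1)[OF that(1)] that(2)] by simp
 have qf1: "q (f1 x) = q (f x)" if x: "x :. G" for x
 proof -
  have "q (f1 x) = (+/.Y k<s. q (h k x *>.X z k))" unfolding f1_def by (rule q.map_finsum) (use z hcl x in "auto simp: Pi_iff")
  also have "... = (+/.Y k<s. h k x *>.Y y k)" by (rule q.N.M.finsum_cong') (use z hcl x 1(2) in "auto simp: Pi_iff q.map_act")
  finally show ?thesis using 1(3)[OF x] by simp
 qed
 have fcl: "f x :. X" "f1 x :. X" if "x :. G" for x using lin_closed[OF f that] lin_closed[OF f1l that] by auto
 have "lin A G ?U (%x. f x --.X f1 x)" by (rule lin_into[OF q.M.lin_pointwise_diff[OF f f1l]]) (use fcl qf1 in "auto simp: a_kernel_iff q.map_diff")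
 hence "factors_free A G ?U (%x. f x --.X f1 x)" by (rule zclassD[OF U G])
 hence "factors_free A G X (%x. f x --.X f1 x)" by (rule factors_comp[rotated, where q = "%x. x"])
   (auto intro!: lmapI zclass_right_module[OF U] q.M.rax lin_restrict lin_id simp: a_kernel_iff)
 from factors_add[OF q.M.rax this f1] show "factors_free A G X f" by (rule factors_cong) (use fcl q.M.M.diff_add_cancel in simp)
qed

text \<open>The point is to lift \<open>f\<close> to \<open>X\<close>. On a projective
  \<open>P\<close> over \<open>G\<close> there is a lift \<open>F\<close>. It maps the syzygy into
  the kernel of \<open>q\<close>, hence factors there through a free module, and this factorization
  extends to \<open>P\<close> as some \<open>F1\<close> because \<open>G\<close> is Gorenstein
  projective. The difference of \<open>F\<close> and \<open>F1\<close> vanishes on the syzygy and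
  descends to the required lift.\<close>

lemma zclass_cokernel:
 assumes q: "lmap A X Y q" "q ` car X = car Y" and X: "zclass A X" and U: "zclass A (X(|carrier := akr X Y q|))" shows "zclass A Y"
proof (rule zclassI)
 interpret q: linear_map A X Y q by fact
 let ?U = "X(|carrier := akr X Y q|)"
 show "rmod A Y" by (rule q.N.rax)
 fix G f assume G: "gp A G" and f: "lin A G Y f"
 obtain P p where P: "fg_proj A P" and p: "lmap A P G p" "p ` car P = car G"
  and ext: "hom_extends A P (akr P G p) (reg A)" and Om: "gp A (P(|carrier := akr P G p|))" using G by cases blast
 interpret p: linear_map A P G p by fact
 let ?Om = "P(|carrier := akr P G p|)"
 interpret f: linear_map A G Y f by (intro lmapI p.N.rax q.N.rax f)
 obtain n x g where db: "dual_basis A P n x g" using P by (auto simp: fg_proj_def)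
 obtain F where F: "lin A P X F" "!!y. y :. P ==> q (F y) = f (p y)"
  using dual_basis_lift[OF db q lmapI[OF p.M.rax q.N.rax lin_comp[OF p.lin f]]] by blast
 have "lin A ?Om ?U F" by (rule lin_into[OF lin_restrict[OF F(1)]]) (use F lin_closed[OF F(1)] in "auto simp: a_kernel_iff")
 from zclassD[OF U Om this] obtain s h y where 1: "!!k. k < (s :: nat) ==> lin A ?Om (reg A) (h k)" "y : {..<s} -> car ?U"
  "!!x. x : car ?Om ==> F x = (+/.?U k<s. h k x *>.?U y k)" by (rule factors_freeE) blast
 have y: "y : s ->. X" "!!k. k < s ==> q (y k) = 0@Y" using 1(2) by (auto simp: a_kernel_iff Pi_iff)
 have "ALL k:{..<s}. EX g. lin A P (reg A) g & (ALL om:akr P G p. g om = h k om)" using ext 1(1) unfolding hom_extends_def by blast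
 from bchoice[OF this] obtain h' where h': "!!k. k < s ==> lin A P (reg A) (h' k)"
  "!!k om. k < s ==> om : akr P G p ==> h' k om = h k om" by auto
 have h'cl: "h' k x :. A" if "k < s" "x :. P" for k x using lin_closed[OF h'(1)[OF that(1)] that(2)] by simp
 define F1 where "F1 x = (+/.X k<s. h' k x *>.X y k)" for x
 have F1: "lin A P X F1" unfolding F1_def by (rule q.M.lin_combination) (use h' y in auto)
 have eqF: "F x = F1 x" if x: "x : akr P G p" for x
 proof -
  have tcl: "(%k. h k x *>.X y k) : {..<s} -> akr X Y q" using 1(2) lin_closed[OF 1(1)] x q.M.submod_act[OF q.submod_kernel] by (auto simp: Pi_iff)
  have "F x = (+/.X k<s. h k x *>.X y k)" using 1(3)[of x] x q.M.finsum_submod[OF q.submod_kernel tcl] by simp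
  also have "... = F1 x" unfolding F1_def by (rule q.M.M.finsum_cong') (use h'(2) x y h'cl[of _ x] in "auto simp: Pi_iff a_kernel_iff")
  finally show ?thesis .
 qed
 have Fcl: "F x :. X" "F1 x :. X" if "x :. P" for x using lin_closed[OF F(1) that] lin_closed[OF F1 that] by auto
 have "F x --.X F1 x = 0@X" if "x :. P" "p x = 0@G" for x using eqF[of x] Fcl(2)[OF that(1)] that by (simp add: a_kernel_iff)
 then obtain F2 where F2: "lin A G X F2" "!!x. x :. P ==> F2 (p x) = F x --.X F1 x"
  using p.factor_through[OF q.M.rax q.M.lin_pointwise_diff[OF F(1) F1] p(2)] by blast
 have "q (F2 g) = f g" if g: "g :. G" for g
 proof -
  obtain x where x: "x :. P" "g = p x" using g p(2) by auto
  have "q (F1 x) = (+/.Y k<s. q (h' k x *>.X y k))" unfolding F1_def by (rule q.map_finsum) (use y h'cl x in "auto simp: Pi_iff")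
  also have "... = 0@Y" by (rule q.N.M.finsum_all_zero) (use y h'cl x in "auto simp: Pi_iff q.map_act")
  finally show ?thesis using F2(2)[OF x(1)] F(2)[OF x(1)] Fcl[OF x(1)] x by (simp add: q.map_diff)
 qed
 thus "factors_free A G Y f" using factors_cong[OF factors_comp[OF q(1) zclassD[OF X G F2(1)]]] by simp
qed

lemma (in ring) lin_left_mult: "c :. R ==> lin R (reg R) (reg R) (%x. c ** x)" by (rule linI) (auto simp: r_distr m_assoc)

lemma (in fd_algebra) zclass_regular: "zclass A (reg A)"
proof (rule zclassI[OF A_rmod])
 fix G f assume G: "gp A G" and f: "lin A G (reg A) f"
 show "factors_free A G (reg A) f" by (rule factors_freeI[of 1 _ _ "%_. f" "%_. 1@A"]) (use f lin_closed[OF f] in "auto simp: lessThan_Suc")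
qed

context fd_algebra
begin

text \<open>Evaluation at generators of \<open>M\<close> embeds the homomorphisms from
  \<open>M\<close> to \<open>A\<close> into a free module, so they form a space of finite dimension
  over \<open>K\<close>. A spanning family over \<open>K\<close> generates over \<open>A\<close> all
  the more.\<close>

lemma hom_to_regular_fg:
 assumes M: "fgm A M" shows "EX (s :: nat) h. (ALL k<s. lin A M (reg A) (h k)) &
  (ALL g. lin A M (reg A) g --> (EX c:s ->. A. ALL m:car M. g m = (+/.A k<s. c k **.A h k m)))"
proof -
 interpret M: right_module A M using M by (rule fgmD)
 interpret RA: right_module A "reg A" by (rule A_rmod)
 obtain z and p :: nat where sp: "spans_mod A M {0@M} z p" using M M.fg_spans by (auto simp: fg_right_module_def)
 have z: "z i :. M" if "i < p" for i using sp that by (auto simp: spans_mod_def Pi_iff)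
 let ?F = "fre A p"
 interpret F: right_module A ?F by (rule A.free_right_module)
 interpret VF: fin_vector_space K "kmod A ?F" using fg_free fg_right_module_iff by blast
 define ev where "ev g = (%i:{..<p}. g (z i))" for g :: "'b => 'a"
 let ?W = "{ev g | g. lin A M (reg A) g}"
 have gz: "g (z i) :. A" if "lin A M (reg A) g" "i < p" for g i using lin_closed[OF that(1) z[OF that(2)]] by simp
 have W: "subm ?W K (kmod A ?F)"
 proof (rule VF.submodI)
  show "?W <= car (kmod A ?F)" using gz by (auto simp: ev_def split: if_splits)
  have "0@(kmod A ?F) = ev (%_. 0@A)" by (simp add: ev_def)
  moreover have "lin A M (reg A) (%_. 0@A)" using RA.lin_pointwise_zero by simp
  ultimately show "0@(kmod A ?F) : ?W" by blast
 next
  fix x y assume "x : ?W" "y : ?W"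
  then obtain g g' where g: "lin A M (reg A) g" "lin A M (reg A) g'" "x = ev g" "y = ev g'" by blast
  have "x ++.(kmod A ?F) y = ev (%m. g m ++.A g' m)" unfolding g ev_def by (auto intro!: restrict_ext)
  moreover have "lin A M (reg A) (%m. g m ++.A g' m)" using RA.lin_pointwise_add[OF g(1,2)] by simp
  ultimately show "x ++.(kmod A ?F) y : ?W" by blast
 next
  fix l x assume l: "l :. K" and "x : ?W"
  then obtain g where g: "lin A M (reg A) g" "x = ev g" by blast
  have "l *>.(kmod A ?F) x = ev (%m. (l *>.A 1@A) **.A g m)"
   unfolding g ev_def using gz[OF g(1)] l by (auto intro!: restrict_ext simp: mult_scalar scalar_mult)
  moreover have "lin A M (reg A) (%m. (l *>.A 1@A) **.A g m)" by (rule lin_comp[OF g(1) A.lin_left_mult]) (use l in simp)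
  ultimately show "l *>.(kmod A ?F) x : ?W" by blast
 qed
 let ?V = "(kmod A ?F)(|carrier := ?W|)"
 interpret WV: fin_vector_space K ?V by (rule VF.subspace[OF W])
 obtain w and s :: nat where w: "spans_mod K ?V {0@?V} w s" using WV.fg_spans WV.fin_gen by blast
 hence wW: "w : {..<s} -> ?W" by (simp add: spans_mod_def)
 hence "ALL k:{..<s}. EX g. lin A M (reg A) g & w k = ev g" by (auto simp: Pi_iff)
 from bchoice[OF this] obtain h where h: "!!k. k < s ==> lin A M (reg A) (h k)" "!!k. k < s ==> w k = ev (h k)" by auto
 have hcl: "h k m :. A" if "k < s" "m :. M" for k m using lin_closed[OF h(1)[OF that(1)] that(2)] by simp
 have "EX c:s ->. A. ALL m:car M. g m = (+/.A k<s. c k **.A h k m)" if g: "lin A M (reg A) g" for g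
 proof -
  have "ev g : car ?V" using g by auto
  then obtain l where l: "l : s ->. K" "ev g --.?V (+/.?V k<s. l k *>.?V w k) = 0@?V" using w unfolding spans_mod_def by blast
  have wV: "w : {..<s} -> car ?V" using wW by simp
  have "ev g = (+/.?V k<s. l k *>.?V w k)" using l(2) iffD1[OF WV.M.diff_eq_zero_iff[OF `ev g : car ?V` WV.sum_closed[OF l(1) wV]]] by blast
  also have "... = (+/.(kmod A ?F) k<s. l k *>.(kmod A ?F) w k)"
   using VF.finsum_submod[OF W, of "%k. l k *>.(kmod A ?F) w k" "{..<s}"] VF.submod_act[OF W] l(1) wW
   by (simp add: Pi_iff del: kmod_sel(4) finsum_kmod)
  finally have evg: "ev g = (+/.?F k<s. (l k *>.A 1@A) *>.?F w k)" by simp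
  let ?c = "%k. l k *>.A 1@A"
  have c: "?c k :. A" if "k < s" for k using l(1) that by (auto simp: Pi_iff)
  let ?g = "%m. +/.A k<s. ?c k **.A h k m"
  have g': "lin A M (reg A) ?g"
  proof -
   have "lin A M (reg A) (%m. ?c k **.A h k m)" if "k : {..<s}" for k using lin_comp[OF h(1) A.lin_left_mult[OF c]] that by simp
   from RA.lin_pointwise_finsum[of "{..<s}", OF this] show ?thesis by simp
  qed
  have "g (z i) = ?g (z i)" if i: "i < p" for i
  proof -
   interpret e: linear_map A ?F "reg A" "%x. x i" by (intro lmapI A.free_right_module A_rmod A.free_proj_lin i)
   have wF: "w k : car ?F" if "k < s" for k using wW VF.submod_subset[OF W] that by (auto simp: Pi_iff)
   have "g (z i) = ev g i" using i by (simp add: ev_def)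
   also have "... = (+/.A k<s. (?c k *>.?F w k) i)"
    unfolding evg using e.map_finsum[of "%k. ?c k *>.?F w k" "{..<s}"] F.act_closed[OF c wF] by (simp add: Pi_iff del: fre_sel)
   also have "... = ?g (z i)"
   proof (rule A.finsum_cong')
    fix k assume k: "k : {..<s}"
    thus "(?c k *>.?F w k) i = ?c k **.A h k (z i)" using i h(2)[of k] hcl[of k "z i"] z[OF i] l(1) by (simp add: ev_def Pi_iff scalar_central)
   qed (use c hcl z[OF i] in auto)
   finally show ?thesis .
  qed
  hence "ALL m:car M. g m = ?g m" using lin_eq_on_generators[OF lmapI[OF M.rax A_rmod g] lmapI[OF M.rax A_rmod g'] sp] by blast
  thus ?thesis using c by (intro bexI[of _ ?c]) auto
 qed
 with h(1) show ?thesis by blast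
qed

end

section \<open>Duality\<close>

lemma functional_closed: "functional K V phi ==> x :. V ==> phi x :. K" using lin_closed[of K V "reg K" phi x] by simp

lemma dual_basis_spans:
 assumes "rmod R P" and P: "dual_basis R P s x f" shows "spans_mod R P {0@P} x s" unfolding spans_mod_def
proof (intro conjI ballI dual_basis_vec(1)[OF P])
 interpret P: right_module R P by fact
 fix y assume y: "y :. P"
 have "y --.P (+/.P u<s. f u y *>.P x u) = 0@P" using P.M.diff_self[OF y] dual_basis_sum[OF P y] by metis
 thus "EX c:s ->. R. y --.P (+/.P u<s. c u *>.P x u) : {0@P}" using dual_basis_coef[OF P _ y] by (intro bexI[of _ "%u. f u y"]) auto
qed

lemma (in fin_vector_space) coordinates: "EX p z phi. dual_basis K V p z phi & p <= rank K V"
proof -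
 obtain z phi and p :: nat where *: "z : p ->. V" "ALL i<p. functional K V (phi i)"
  "ALL x:car V. x --.V (+/.V i<p. phi i x *>.V z i) : {0@V}"
  "ALL z' p'. spans_mod K V {0@V} z' p' --> p <= p'" using dual_basis_mod[OF submod_zero_set] by (elim exE conjE) (rule that; assumption)
 have "x = (+/.V i<p. phi i x *>.V z i)" if x: "x :. V" for x
 proof -
  have "(%i. phi i x) : p ->. K" using *(2) x by (auto intro: functional_closed)
  hence "(+/.V i<p. phi i x *>.V z i) :. V" using *(1) by (rule sum_closed)
  thus ?thesis using iffD1[OF M.diff_eq_zero_iff[OF x]] *(3) x by blast
 qed
 with *(1,2) have "dual_basis K V p z phi" by (simp add: dual_basis_def)
 moreover have "p <= rank K V" using rank_spans[OF fin_gen] *(4) by blast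
 ultimately show ?thesis by blast
qed

lemma opposite_opposite [simp]: "opposite_algebra (opposite_algebra A) = A" by (simp add: opposite_algebra_def)

lemma kmod_opposite [simp]: "kmod (opposite_algebra A) Z = kmod A Z" by (simp add: kmod_def)

text \<open>For a left module \<open>Z\<close>, that is a right module over the opposite algebra, this is \<open>D(Z)\<close>.\<close>

definition kdual :: "'k ring => ('k, 'a) module => ('a, 'z) module => ('a, 'z => 'k) module" where
 "kdual K A Z = (|carrier = {xi. functional K (kmod A Z) xi & xi : extensional (car Z)},
  monoid.mult = undefined, monoid.one = undefined, ring.zero = (%z:car Z. 0@K),
  ring.add = (%xi zet. %z:car Z. xi z ++.K zet z), smult = (%a xi. %z:car Z. xi (a *>.Z z))|)"

lemma kdual_sel [simp]:
 "xi : car (kdual K A Z) <-> functional K (kmod A Z) xi & xi : extensional (car Z)"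
 "0@(kdual K A Z) = (%z:car Z. 0@K)"
 "xi ++.(kdual K A Z) zet = (%z:car Z. xi z ++.K zet z)"
 "a *>.(kdual K A Z) xi = (%z:car Z. xi (a *>.Z z))" by (simp_all add: kdual_def)

lemma kdual_opposite [simp]: "kdual K (opposite_algebra A) Z = kdual K A Z" by (simp add: kdual_def)

lemma kdual_closed: "xi :. (kdual K A Z) ==> z :. Z ==> xi z :. K" using functional_closed[of K "kmod A Z" xi z] by simp

lemma kdual_eqI:
 "[|xi :. (kdual K A Z); zet :. (kdual K A Z); !!z. z :. Z ==> xi z = zet z|] ==> xi = zet" by (rule extensionalityI[of _ "car Z"]) auto

context fd_algebra
begin

abbreviation "B \<equiv> opposite_algebra A"
abbreviation "VA \<equiv> kmod A (reg A)"

lemma VA_space: "fin_vector_space K VA" using fg_regular fg_right_module_iff by blast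

lemma VA_right_module: "rmod K VA" by (rule kmod_right_module[OF A_rmod])

lemma VA_mult_right: "b :. A ==> lin K VA VA (%a. a **.A b)" by (rule linI) (auto simp: A.l_distr A.m_assoc scalar_central)

lemma VA_mult_left: "b :. A ==> lin K VA VA (%a. b **.A a)" by (rule linI) (auto simp: A.r_distr A.m_assoc)

lemma functional_linear_map:
 "rmod K V ==> functional K V phi ==> lmap K V (reg K) phi" by (intro lmapI K.regular_right_module)

lemma opposite_kmod: "rmod B Z ==> rmod K (kmod A Z)" using fd_algebra.kmod_right_module[OF opposite, of Z] by simp

lemma opposite_space: "fgm B Z ==> fin_vector_space K (kmod A Z)" using fd_algebra.fg_right_module_iff[OF opposite, of Z] by simp

lemma kdual_restrict:
 "rmod B Z ==> functional K (kmod A Z) xi ==> (%z:car Z. xi z) :. (kdual K A Z)"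
 using lin_cong[of "kmod A Z" "%z:car Z. xi z" xi K "reg K"] opposite_kmod[of Z] by simp

lemma kdual_right_module:
 assumes Z: "rmod B Z" shows "rmod A (kdual K A Z)"
proof -
 let ?D = "kdual K A Z"
 interpret Z: right_module B Z by fact
 interpret KK: right_module K "reg K" by (rule K.regular_right_module)
 note res = kdual_restrict[OF Z] and cl = kdual_closed[of _ K A Z]
 have fn: "functional K (kmod A Z) xi" if "xi : car ?D" for xi using that by simp
 have "abelian_group ?D"
 proof (rule abelian_groupI)
  show "xi ++.?D zet : car ?D" if "xi : car ?D" "zet : car ?D" for xi zet
   using res[OF KK.lin_pointwise_add[OF fn[OF that(1)] fn[OF that(2)]]] by (simp del: kdual_sel(1))
  show "0@?D : car ?D" using res[OF KK.lin_pointwise_zero] by (simp del: kdual_sel(1))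
  show "EX y:car ?D. y ++.?D xi = 0@?D" if "xi : car ?D" for xi by (rule bexI[OF _ res[OF KK.lin_pointwise_minus[OF fn[OF that]]]])
    (use cl[OF that] in "auto intro!: restrict_ext simp: K.l_neg")
  show "0@?D ++.?D xi = xi" if "xi : car ?D" for xi using cl[OF that] that by (auto simp: fun_eq_iff extensional_def)
 qed (use cl in "auto intro!: restrict_ext simp: K.a_ac")
 then interpret D: abelian_group ?D .
 show ?thesis
 proof (unfold_locales)
  fix a xi assume a: "a :. A" and xi: "xi : car ?D"
  have "lin K (kmod A Z) (kmod A Z) (%z. a *>.Z z)"
   by (rule linI) (use a scalar_central[OF _ a] in "auto simp: Z.act_add_module simp flip: Z.act_mult")
  from res[OF lin_comp[OF this fn[OF xi]]] show "a *>.?D xi : car ?D" by (simp del: kdual_sel(1))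
  show "a *>.?D (xi ++.?D zet) = a *>.?D xi ++.?D a *>.?D zet" for zet using a by (auto intro!: restrict_ext)
  fix b assume b: "b :. A"
  show "(a ++.A b) *>.?D xi = a *>.?D xi ++.?D b *>.?D xi" using a b lin_add[OF fn[OF xi]] Z.act_add_ring[of a b] by (auto intro!: restrict_ext)
  show "(a **.A b) *>.?D xi = b *>.?D (a *>.?D xi)" using a b Z.act_mult[of b a] by (auto intro!: restrict_ext)
 next
  show "1@A *>.?D xi = xi" if "xi : car ?D" for xi using that Z.act_one by (auto simp: fun_eq_iff extensional_def)
 qed
qed

lemma kdual_eval:
 assumes Z: "rmod B Z" and z: "z :. Z" shows "functional K (kmod A (kdual K A Z)) (%xi. xi z)"
proof (rule linI)
 fix l xi assume "l :. K" "xi :. (kmod A (kdual K A Z))"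
 thus "(l *>.(kmod A (kdual K A Z)) xi) z = l *>.(reg K) xi z" using lin_act[of K "kmod A Z" "reg K" xi l z] z by simp
qed (use z kdual_closed[of _ K A Z] in auto)

lemma kdual_finsum:
 assumes Z: "rmod B Z" and z: "z :. Z" and F: "F : J -> car (kdual K A Z)" shows "(+/.(kdual K A Z) i:J. F i) z = (+/.K i:J. F i z)"
proof -
 interpret ev: linear_map K "kmod A (kdual K A Z)" "reg K" "%xi. xi z"
  by (intro functional_linear_map kmod_right_module kdual_right_module kdual_eval Z z)
 show ?thesis using ev.map_finsum[of F J] F by simp
qed

text \<open>Vectors and coordinate functionals exchange their roles.\<close>

lemma kdual_dual_basis:
 assumes Z: "rmod B Z" and db: "dual_basis K (kmod A Z) p z phi"
 shows "dual_basis K (kmod A (kdual K A Z)) p (%i. %z:car Z. phi i z) (%i xi. xi (z i))" unfolding dual_basis_def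
proof (intro conjI allI impI ballI)
 let ?D = "kdual K A Z"
 interpret D: right_module A ?D by (rule kdual_right_module[OF Z])
 interpret VD: right_module K "kmod A ?D" by (rule kmod_right_module[OF D.rax])
 have zi: "z i :. Z" if "i < p" for i using dual_basis_vec(2)[OF db that] by simp
 have phi: "(%z:car Z. phi i z) : car ?D" if "i < p" for i by (rule kdual_restrict[OF Z dual_basis_lin[OF db that]])
 thus "(%i. %z:car Z. phi i z) : p ->. (kmod A ?D)" by simp
 show "functional K (kmod A ?D) (%xi. xi (z i))" if "i < p" for i by (rule kdual_eval[OF Z zi[OF that]])
 fix xi assume "xi :. (kmod A ?D)"
 hence xi: "xi : car ?D" by simp
 have F: "(%i. xi (z i) *>.(kmod A ?D) (%z:car Z. phi i z)) : {..<p} -> car ?D"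
  using VD.act_closed kdual_closed[OF xi] zi phi by (simp del: kmod_sel(4) kdual_sel)
 show "xi = (+/.(kmod A ?D) i<p. xi (z i) *>.(kmod A ?D) (%z:car Z. phi i z))" unfolding finsum_kmod
 proof (rule kdual_eqI[OF xi D.M.finsum_closed[OF F]])
  fix y assume y: "y :. Z"
  have fx: "lmap K (kmod A Z) (reg K) xi" using functional_linear_map[OF opposite_kmod[OF Z]] xi by simp
  have "xi y = (+/.K i<p. xi (z i) **.K phi i y)" using dual_basis_map[OF db fx, of y] y by simp
  also have "... = (+/.K i<p. (xi (z i) *>.(kmod A ?D) (%z:car Z. phi i z)) y)"
  proof (rule K.finsum_cong')
   fix i assume i: "i : {..<p}"
   thus "xi (z i) **.K phi i y = (xi (z i) *>.(kmod A ?D) (%z:car Z. phi i z)) y"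
    using lin_act[OF kdual_eval[OF Z y], of "xi (z i)" "%z:car Z. phi i z"] phi kdual_closed[OF xi zi] y
     dual_basis_coef[OF db, of i y] K.m_comm by (simp del: kmod_sel(4) kdual_sel)
  qed (use F kdual_closed[OF _ y] in "auto simp: Pi_iff simp del: kmod_sel(4) kdual_sel")
  also have "... = (+/.?D i<p. xi (z i) *>.(kmod A ?D) (%z:car Z. phi i z)) y" by (rule kdual_finsum[OF Z y F, symmetric])
  finally show "xi y = ..." .
 qed
qed

lemma kdual_fg:
 assumes "fgm B Z" shows "fgm A (kdual K A Z)" "rank K (kmod A (kdual K A Z)) <= rank K (kmod A Z)"
proof -
 interpret V: fin_vector_space K "kmod A Z" by (rule opposite_space[OF assms])
 have Z: "rmod B Z" by (rule fgmD[OF assms])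
 interpret VD: right_module K "kmod A (kdual K A Z)" by (intro kmod_right_module kdual_right_module Z)
 obtain p z phi where db: "dual_basis K (kmod A Z) p z phi" and p: "p <= rank K (kmod A Z)" using V.coordinates by blast
 note sp = dual_basis_spans[OF VD.rax kdual_dual_basis[OF Z db]]
 show "rank K (kmod A (kdual K A Z)) <= rank K (kmod A Z)" using rank_le[OF sp] p by simp
 show "fgm A (kdual K A Z)" using fg_iff_kmod[OF kdual_right_module[OF Z]] VD.fg_spans sp kdual_right_module[OF Z]
  unfolding fg_right_module_def by blast
qed

text \<open>The witness has the values of \<open>Psi\<close> on the coordinate functionals as its
  coordinates; expanding \<open>xi\<close> in the dual basis gives the equation.\<close>

lemma kdual_reflexive:
 assumes Z: "fgm B Z" and Psi: "functional K (kmod A (kdual K A Z)) Psi" shows "EX z:car Z. ALL xi:car (kdual K A Z). Psi xi = xi z"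
proof -
 interpret V: fin_vector_space K "kmod A Z" by (rule opposite_space[OF Z])
 note Zr = fgmD[OF Z]
 let ?D = "kdual K A Z"
 obtain p z phi where db: "dual_basis K (kmod A Z) p z phi" using V.coordinates by blast
 let ?c = "%i. Psi (%z:car Z. phi i z)"
 have c: "?c i :. K" if "i < p" for i using functional_closed[OF Psi] kdual_restrict[OF Zr dual_basis_lin[OF db that]] by simp
 have zi: "z i :. Z" if "i < p" for i using dual_basis_vec(2)[OF db that] by simp
 let ?w = "+/.(kmod A Z) i<p. ?c i *>.(kmod A Z) z i"
 have w: "?w :. Z" using V.sum_closed[of ?c "{..<p}" z] c zi by simp
 have "Psi xi = xi ?w" if xi: "xi : car ?D" for xi
 proof -
  interpret xi: linear_map K "kmod A Z" "reg K" xi using functional_linear_map[OF V.rax] xi by simp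
  have "xi ?w = (+/.(reg K) i<p. xi (?c i *>.(kmod A Z) z i))" by (rule xi.map_finsum) (use V.act_closed[OF c] zi in "simp del: kmod_sel(4)")
  also have "... = (+/.(reg K) i<p. xi (z i) *>.(reg K) ?c i)"
   by (rule xi.N.M.finsum_cong') (use c zi xi.map_act xi.closed K.m_comm in "auto simp del: kmod_sel(4)")
  also have "... = Psi xi"
   by (rule dual_basis_map[OF kdual_dual_basis[OF Zr db] functional_linear_map[OF kmod_right_module[OF kdual_right_module[OF Zr]] Psi], symmetric])
    (use xi in simp)
  finally show ?thesis ..
 qed
 with w show ?thesis by blast
qed

lemma kdual_separate:
 assumes Z: "fgm B Z" and z: "z :. Z" "z ~= 0@Z" shows "EX xi:car (kdual K A Z). xi z ~= 0@K"
proof -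
 interpret V: fin_vector_space K "kmod A Z" by (rule opposite_space[OF Z])
 obtain phi where "functional K (kmod A Z) phi" "phi z ~= 0@K" using V.separate[OF V.submod_zero_set, of z] z by auto
 thus ?thesis using kdual_restrict[OF fgmD[OF Z], of phi] z(1) by (intro bexI[of _ "%z:car Z. phi z"]) auto
qed

lemma kdual_cancel:
 assumes Z: "fgm B Z" and z: "z :. Z" "z' :. Z" and eq: "!!xi. xi :. (kdual K A Z) ==> xi z = xi z'" shows "z = z'"
proof (rule ccontr)
 assume ne: "z ~= z'"
 interpret V: fin_vector_space K "kmod A Z" by (rule opposite_space[OF Z])
 have d: "z --.Z z' :. Z" "z --.Z z' ~= 0@Z" using V.M.minus_closed[of z z'] V.M.diff_eq_zero_iff[of z z'] z ne by simp_all
 obtain xi where xi: "xi :. (kdual K A Z)" "xi (z --.Z z') ~= 0@K" using kdual_separate[OF Z d] by blast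
 interpret xi: linear_map K "kmod A Z" "reg K" xi using functional_linear_map[OF V.rax] xi(1) by simp
 show False using xi(2) xi.map_diff[of z z'] z eq[OF xi(1)] xi.closed[of z'] by simp
qed

lemma kdual_map:
 assumes f: "lmap B Z W f" shows "lmap A (kdual K A W) (kdual K A Z) (%xi. %z:car Z. xi (f z))"
proof (intro lmapI linI)
 interpret f: linear_map B Z W f by fact
 show "rmod A (kdual K A W)" "rmod A (kdual K A Z)" by (intro kdual_right_module f.M.rax f.N.rax)+
 show "(%z:car Z. xi (f z)) :. (kdual K A Z)" if "xi :. (kdual K A W)" for xi
  using that kdual_restrict[OF f.M.rax lin_comp[of K "kmod A Z" "kmod A W" f _ xi]]
   fd_algebra.kmod_lin[OF opposite f.lin] by simp
qed (auto intro!: restrict_ext simp: linear_map.closed[OF f] linear_map.map_act[OF f] right_module.act_closed[of B Z] linear_map_def[of B Z] f[unfolded linear_map_def])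

lemma injective_extends:
 fixes X Y :: "('a, nat => 'k) module"
 assumes I: "injective_module A I" and X: "fgm A X" and Y: "fgm A Y" and f: "lin A X Y f" "inj_on f (car X)" and g: "lin A X I g"
 shows "EX h. lin A Y I h & (ALL x:car X. h (f x) = g x)"
proof -
 note r = restrict_module_hom[OF fgmD[OF X]]
 obtain h where h: "h : module_homs A Y I" "ALL x:car X. h (restrict f (car X) x) = restrict g (car X) x"
  using I X Y r[OF f(1)] r[OF g] f(2) unfolding injective_module_def by (metis inj_on_restrict_eq)
 thus ?thesis by (intro exI[of _ h]) (auto simp: module_homs_iff)
qed

text \<open>A free cover of the dual of \<open>I\<close> dualises to an embedding of
  \<open>I\<close> into the dual of a free module. This embedding splits by injectivity, and the
  dual of the splitting is a section of the cover.\<close>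

lemma kdual_injective:
 fixes I :: "('a, nat => 'k) module"
 assumes inj: "injective_module B I" shows "fg_proj A (kdual K A I)"
proof -
 interpret op: fd_algebra K B by (rule opposite)
 have fgI: "fgm B I" using inj by (simp add: injective_module_def)
 note Ir = fgmD[OF fgI]
 let ?D = "kdual K A I"
 note Dr = kdual_right_module[OF Ir]
 note fgD = kdual_fg(1)[OF fgI]
 obtain s p where p: "lin A (fre A s) ?D p" "p ` car (fre A s) = car ?D" using free_cover[OF fgD] by blast
 let ?F = "fre A s" and ?N = "kdual K A (fre A s)"
 interpret F: right_module A ?F by (rule A.free_right_module)
 have fgN: "fgm B ?N" using op.kdual_fg(1)[of ?F] fg_free by simp
 interpret N: right_module B ?N by (rule fgmD[OF fgN])
 interpret I: right_module B I by (rule Ir)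
 interpret p: linear_map A ?F ?D p by (intro lmapI F.rax Dr p)
 have pl: "functional K (kmod A I) (p x)" if "x : car ?F" for x using p.closed[OF that] by simp
 define eta where "eta y = (%x:car ?F. p x y)" for y
 have etaN: "eta y : car ?N" if y: "y :. I" for y
  unfolding eta_def using op.kdual_restrict[of ?F "%x. p x y"] lin_comp[OF kmod_lin[OF p(1)] kdual_eval[OF Ir y]]
   F.rax by (simp del: kdual_sel(1))
 have eta: "lin B I ?N eta"
 proof (rule linI[OF etaN])
  show "eta (x ++.I y) = eta x ++.?N eta y" if "x :. I" "y :. I" for x y using that lin_add[OF pl] by (auto simp: eta_def intro!: restrict_ext)
  show "eta (b *>.I y) = b *>.?N eta y" if "b :. B" "y :. I" for b y
   using that p.map_act[of b] F.act_closed[of b] by (auto simp: eta_def intro!: restrict_ext simp del: fre_sel)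
 qed
 interpret eta: linear_map B I ?N eta by (intro lmapI Ir N.rax eta)
 have etai: "inj_on eta (car I)" unfolding eta.inj_iff
 proof (intro ballI impI, rule ccontr)
  fix y assume y: "y :. I" "eta y = 0@?N" "y ~= 0@I"
  obtain xi where "xi : car ?D" "xi y ~= 0@K" using kdual_separate[OF fgI y(1,3)] by blast
  moreover then obtain x where "x : car ?F" "xi = p x" using p(2) by (metis imageE)
  ultimately show False using fun_cong[OF y(2), of x] by (simp add: eta_def)
 qed
 \<comment> \<open>Injectivity of \<open>I\<close> speaks of modules in the type
   \<open>nat => 'k\<close>, so the retraction is built on a copy of \<open>?N\<close>.\<close>
 obtain N' :: "('a, nat => 'k) module" and g where N': "fgm B N'" "lin B ?N N' g"
  "bij_betw g (car ?N) (car N')" using op.copy_module[OF fgN] by blast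
 have "inj_on (%y. g (eta y)) (car I)" using etai N'(3) etaN unfolding bij_betw_def inj_on_def by blast
 from op.injective_extends[OF inj fgI N'(1) lin_comp[OF eta N'(2)] this lin_id]
 obtain h where h: "lin B N' I h" "ALL y:car I. h (g (eta y)) = y" by blast
 define rho where "rho zet = h (g zet)" for zet
 have rho: "lin B ?N I rho" unfolding rho_def by (rule lin_comp[OF N'(2) h(1)])
 \<comment> \<open>Composition with the retraction \<open>rho\<close> turns \<open>xi\<close> into a
   functional on the dual of \<open>?F\<close>. By reflexivity it is evaluation at an element of
   \<open>?F\<close>, and this element is the value of the section at \<open>xi\<close>.\<close>
 have "ALL xi:car ?D. EX x. x : car ?F & (ALL zet:car ?N. xi (rho zet) = zet x)"
 proof
  fix xi assume xi: "xi : car ?D"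
  have "functional K (kmod A ?N) (%zet. xi (rho zet))" by (rule lin_comp[of _ _ "kmod A I"]) (use op.kmod_lin[OF rho] xi in auto)
  thus "EX x. x : car ?F & (ALL zet:car ?N. xi (rho zet) = zet x)" using op.kdual_reflexive[of ?F "%zet. xi (rho zet)"] fg_free by auto
 qed
 from bchoice[OF this] obtain sig where sig: "!!xi. xi : car ?D ==> sig xi : car ?F"
  "!!xi zet. xi : car ?D ==> zet : car ?N ==> zet (sig xi) = xi (rho zet)" by metis
 have sep: "x = y" if "x : car ?F" "y : car ?F" "!!zet. zet : car ?N ==> zet x = zet y" for x y using op.kdual_cancel[of ?F x y] that fg_free by simp
 have sigl: "lin A ?D ?F sig"
 proof (rule linI[OF sig(1)])
  fix xi xi' assume xi: "xi : car ?D" "xi' : car ?D"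
  show "sig (xi ++.?D xi') = sig xi ++.?F sig xi'"
  proof (rule sep)
   fix zet assume zet: "zet : car ?N"
   have 1: "zet (sig (xi ++.?D xi')) = xi (rho zet) ++.K xi' (rho zet)" using sig(2)[OF p.N.M.a_closed[OF xi] zet] lin_closed[OF rho zet] by simp
   have 2: "zet (sig xi ++.?F sig xi') = zet (sig xi) ++.K zet (sig xi')"
    using lin_add[of K "kmod A ?F" "reg K" zet "sig xi" "sig xi'"] sig(1)[OF xi(1)] sig(1)[OF xi(2)] zet by simp
   show "zet (sig (xi ++.?D xi')) = zet (sig xi ++.?F sig xi')" unfolding 1 2 sig(2)[OF xi(1) zet] sig(2)[OF xi(2) zet] ..
  qed (use sig(1) xi p.N.M.a_closed[OF xi] F.M.a_closed in auto)
 next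
  fix a xi assume a: "a :. A" and xi: "xi : car ?D"
  show "sig (a *>.?D xi) = a *>.?F sig xi"
  proof (rule sep)
   fix zet assume zet: "zet : car ?N"
   have azet: "a *>.?N zet : car ?N" using N.act_closed[of a zet] a zet by simp
   have "zet (sig (a *>.?D xi)) = xi (rho (a *>.?N zet))"
    using sig(2)[OF p.N.act_closed[OF a xi] zet] lin_closed[OF rho zet] lin_act[OF rho _ zet, of a] a by (simp del: kdual_sel(1))
   thus "zet (sig (a *>.?D xi)) = zet (a *>.?F sig xi)" using sig(2)[OF xi azet] sig(1)[OF xi] by (simp del: kdual_sel(1) fre_sel)
  qed (use sig(1) xi p.N.act_closed[OF a xi] F.act_closed[OF a] in auto)
 qed
 have psig: "p (sig xi) = xi" if xi: "xi : car ?D" for xi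
 proof (rule kdual_eqI[OF p.closed[OF sig(1)[OF xi]] xi])
  fix y assume y: "y :. I"
  have "eta y (sig xi) = p (sig xi) y" using sig(1)[OF xi] by (simp add: eta_def)
  moreover have "rho (eta y) = y" using h(2) y by (simp add: rho_def)
  ultimately show "p (sig xi) y = xi y" using sig(2)[OF xi etaN[OF y]] by simp
 qed
 have "dual_basis A ?D s (%u. p (unit_vector A s u)) (%u xi. sig xi u)"
  by (rule dual_basis_retract[OF A.free_dual_basis sigl p.linear_map_axioms]) (rule psig)
 with fgD show ?thesis unfolding fg_proj_def by blast
qed

lemma fg_proj_zclass:
 assumes "fg_proj A P" shows "zclass A P"
proof (rule zclassI)
 show P: "rmod A P" using assms fg_proj_fg fgmD by blast
 obtain s x f where db: "dual_basis A P s x f" using assms by (auto simp: fg_proj_def)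
 show "factors_free A G P g" if "lin A G P g" for G g by (rule factors_dual_basis[OF db that lmapI[OF P P lin_id]])
qed

end

section \<open>Injective coresolutions and dimension shifting\<close>

definition short_exact :: "('a, 'b) ring_scheme => ('a, 'm) module => ('a, 'n) module => ('a, 'p) module
  => ('m => 'n) => ('n => 'p) => bool" where
 "short_exact R Z I W i q <-> lmap R Z I i & inj_on i (car Z) & lmap R I W q &
  q ` car I = car W & akr I W q = i ` car Z"

text \<open>The coresolution is cut into short exact sequences between the kernels
  \<open>Z i\<close> of its maps. The first one starts at \<open>M\<close> itself, which need not
  have the type of the other modules.\<close>

lemma injective_coresolution_steps:
 fixes A :: "('k, 'a) module" and M :: "('a, 'm) module"
 assumes M: "rmod A M" and dim: "finite_injective_dimension A M"
 obtains I Z :: "nat => ('a, nat => 'k) module" and d eta l where "!!i. injective_module A (I i)"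
  "!!i. short_exact A (Z i) (I i) (Z (Suc i)) (%x. x) (d i)"
  "short_exact A M (I 0) (Z (Suc 0)) eta (d 0)" "car (Z (Suc l)) = {0@(Z (Suc l))}"
proof -
 obtain I :: "nat => ('a, nat => 'k) module" and d eta l where co: "injective_coresolution A M I d eta"
  and zero: "!!i. i > l ==> car (I i) = {0@(I i)}" using dim unfolding finite_injective_dimension_def by blast
 have inj: "injective_module A (I i)" and d: "lin A (I i) (I (Suc i)) (d i)"
  and im: "d i ` car (I i) = akr (I (Suc i)) (I (Suc (Suc i))) (d (Suc i))" for i using co by (auto simp: injective_coresolution_def module_homs_iff)
 have eta: "lin A M (I 0) eta" "inj_on eta (car M)" "eta ` car M = akr (I 0) (I 1) (d 0)"
  using co by (auto simp: injective_coresolution_def module_homs_iff)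
 have Ir: "rmod A (I i)" for i using inj[of i] by (auto simp: injective_module_def fg_right_module_def)
 have dlm: "lmap A (I i) (I (Suc i)) (d i)" for i by (intro lmapI Ir d)
 define Z where "Z i = (I i)(|carrier := akr (I i) (I (Suc i)) (d i)|)" for i
 have Zr: "rmod A (Z i)" for i unfolding Z_def by (rule right_module.submod_right_module[OF Ir linear_map.submod_kernel[OF dlm]])
 have dZ: "lmap A (I i) (Z (Suc i)) (d i)" "d i ` car (I i) = car (Z (Suc i))" for i
 proof -
  have "lin A (I i) (Z (Suc i)) (d i)" unfolding Z_def by (rule lin_into[OF d]) (use im in blast)
  thus "lmap A (I i) (Z (Suc i)) (d i)" by (intro lmapI Ir Zr)
 qed (use im in "simp add: Z_def")
 have "lin A (Z i) (I i) (%x. x)" for i unfolding Z_def by (rule lin_restrict[OF lin_id]) (auto simp: a_kernel_iff)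
 from lmapI[OF Zr Ir this] have "short_exact A (Z i) (I i) (Z (Suc i)) (%x. x) (d i)" for i
  using dZ[of i] unfolding short_exact_def by (simp add: Z_def a_kernel_def')
 moreover have "short_exact A M (I 0) (Z (Suc 0)) eta (d 0)" using dZ[of 0] eta by (auto simp: short_exact_def lmapI[OF M Ir] Z_def a_kernel_def')
 moreover have "car (Z (Suc l)) = {0@(Z (Suc l))}"
 proof -
  interpret Z: right_module A "Z (Suc l)" by (rule Zr)
  have "x = 0@(Z (Suc l))" if "x :. (Z (Suc l))" for x using that zero[of "Suc l"] by (auto simp: Z_def a_kernel_iff)
  thus ?thesis using Z.M.zero_closed by blast
 qed
 ultimately show thesis using inj by (intro that[of I Z d eta l])
qed

context fd_algebra
begin

text \<open>Functionals extend from subspaces, so duality makes the sequence a short exact sequence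
  from the dual of \<open>W\<close> to the dual of \<open>Z\<close>, and
  \<open>zclass_cokernel\<close> applies to it.\<close>

lemma zclass_kdual_step:
 assumes ex: "short_exact B Z I W i q" and I: "fgm B I" and "zclass A (kdual K A I)" "zclass A (kdual K A W)" shows "zclass A (kdual K A Z)"
proof -
 interpret i: linear_map B Z I i using ex by (simp add: short_exact_def)
 interpret q: linear_map B I W q using ex by (simp add: short_exact_def)
 have ii: "inj_on i (car Z)" and qo: "q ` car I = car W" and k: "akr I W q = i ` car Z" using ex by (simp_all add: short_exact_def)
 interpret V: fin_vector_space K "kmod A I" by (rule opposite_space[OF I])
 note i' = kdual_map[OF i.linear_map_axioms] and q' = kdual_map[OF q.linear_map_axioms]
 let ?i = "%xi. %z:car Z. xi (i z)" and ?q = "%xi. %z:car I. xi (q z)"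
 interpret i': linear_map A "kdual K A I" "kdual K A Z" ?i by (rule i')
 interpret q': linear_map A "kdual K A W" "kdual K A I" ?q by (rule q')
 note Zr = i.M.rax
 interpret ki: linear_map K "kmod A Z" "kmod A I" i using fd_algebra.kmod_linear_map[OF opposite i.linear_map_axioms] by simp
 interpret kq: linear_map K "kmod A I" "kmod A W" q using fd_algebra.kmod_linear_map[OF opposite q.linear_map_axioms] by simp
 have onto: "?i ` car (kdual K A I) = car (kdual K A Z)"
 proof (intro equalityI subsetI)
  fix psi assume psi: "psi :. (kdual K A Z)"
  have im: "subm (i ` car Z) K (kmod A I)" using ki.submod_image[OF ki.M.submod_self] by simp
  let ?J = "(kmod A I)(|carrier := i ` car Z|)"
  interpret j: linear_map K "kmod A Z" ?J i by (intro lmapI ki.M.rax V.submod_right_module im lin_into ki.lin) auto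
  obtain h where h: "lin K ?J (kmod A Z) h" "ALL x:car Z. h (i x) = x" using j.factor_through[OF ki.M.rax lin_id] ii ki.inj_iff by auto
  obtain phi where phi: "functional K (kmod A I) phi" "ALL u:i ` car Z. phi u = psi (h u)"
   using V.extend_lin[OF im lin_comp[OF h(1), of _ psi]] psi by (auto simp del: regular_module_sel)
  have "psi = ?i (restrict phi (car I))" using psi phi(2) h(2) i.closed by (auto simp: fun_eq_iff extensional_def)
  thus "psi : ?i ` car (kdual K A I)" using kdual_restrict[OF i.N.rax phi(1)] by blast
 qed (use i'.closed in blast)
 let ?U = "akr (kdual K A I) (kdual K A Z) ?i"
 have "?q xi : ?U" if xi: "xi :. (kdual K A W)" for xi
 proof -
  have "xi (q (i z)) = 0@K" if "z :. Z" for z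
  proof -
   have "i z : akr I W q" using k that by blast
   thus ?thesis using linear_map.map_zero[OF functional_linear_map[OF kq.N.rax], of xi] xi by (simp add: a_kernel_iff)
  qed
  thus ?thesis using q'.closed[OF xi] i.closed by (auto simp: a_kernel_iff simp del: kdual_sel(1) intro!: restrict_ext)
 qed
 hence ql: "lmap A (kdual K A W) ((kdual K A I)(|carrier := ?U|)) ?q"
  by (intro lmapI q'.M.rax i'.M.submod_right_module i'.submod_kernel lin_into[OF q'.lin])
 have "bij_betw ?q (car (kdual K A W)) ?U" unfolding bij_betw_def
 proof (intro conjI equalityI subsetI)
  show "inj_on ?q (car (kdual K A W))"
  proof (rule inj_onI)
   fix xi zet assume *: "xi :. (kdual K A W)" "zet :. (kdual K A W)" "?q xi = ?q zet"
   show "xi = zet"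
   proof (rule kdual_eqI[OF *(1,2)])
    fix w assume "w :. W"
    then obtain y where "y :. I" "w = q y" using qo by (metis imageE)
    thus "xi w = zet w" using fun_cong[OF *(3), of y] by simp
   qed
  qed
  fix xi assume "xi : ?U"
  hence xi: "xi :. (kdual K A I)" "?i xi = 0@(kdual K A Z)" by (auto simp: a_kernel_iff)
  have "xi y = 0@K" if "y :. I" "q y = 0@W" for y
  proof -
   have "y : i ` car Z" using that unfolding k[symmetric] by (simp add: a_kernel_iff)
   then obtain z where "z :. Z" "y = i z" by blast
   thus ?thesis using fun_cong[OF xi(2), of z] by simp
  qed
  then obtain h where h: "functional K (kmod A W) h" "ALL x:car I. h (q x) = xi x"
   using kq.factor_through[OF K.regular_right_module, of xi] xi(1) qo by auto
  have "xi = ?q (restrict h (car W))" using h(2) xi(1) q.closed by (auto simp: fun_eq_iff extensional_def)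
  thus "xi : ?q ` car (kdual K A W)" using kdual_restrict[OF q.N.rax h(1)] by blast
 qed (use `!!xi. xi :. (kdual K A W) ==> ?q xi : ?U` in blast)
 hence "zclass A ((kdual K A I)(|carrier := ?U|))" using zclass_iso[OF assms(4) ql] by simp
 from zclass_cokernel[OF i' onto assms(3) this] show ?thesis .
qed

text \<open>Duality turns a finite injective coresolution of \<open>Z\<close> into a finite
  resolution of its dual by projective modules. The class is then reached from the zero module by
  taking cokernels.\<close>

lemma zclass_kdual:
 assumes Z: "rmod B Z" and dim: "finite_injective_dimension B Z" shows "zclass A (kdual K A Z)"
proof -
 obtain I Y :: "nat => ('a, nat => 'k) module" and d eta l where inj: "!!i. injective_module B (I i)"
  and st: "!!i. short_exact B (Y i) (I i) (Y (Suc i)) (%x. x) (d i)" "short_exact B Z (I 0) (Y (Suc 0)) eta (d 0)"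
  and zero: "car (Y (Suc l)) = {0@(Y (Suc l))}" by (rule injective_coresolution_steps[OF Z dim]) (rule that; assumption)
 have fgI: "fgm B (I i)" for i using inj[of i] by (simp add: injective_module_def)
 note I = fg_proj_zclass[OF kdual_injective[OF inj]]
 have "zclass A (kdual K A (Y i))" if "i <= Suc l" for i using that
 proof (induct rule: inc_induct)
  case base
  have "rmod B (Y (Suc l))" using st(1)[of "Suc l"] by (simp add: short_exact_def linear_map_def)
  note D = kdual_right_module[OF this]
  interpret D: right_module A "kdual K A (Y (Suc l))" by (rule D)
  have V: "rmod K (kmod A (Y (Suc l)))" by (rule opposite_kmod) fact
  have z: "xi = 0@(kdual K A (Y (Suc l)))" if "xi : car (kdual K A (Y (Suc l)))" for xi by (rule kdual_eqI[OF that D.M.zero_closed])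
    (use that zero linear_map.map_zero[OF functional_linear_map[OF V, of xi]] in auto)
  show ?case by (rule zclass_zero[OF D]) (use z D.M.zero_closed in blast)
 next
  case (step i)
  show ?case by (rule zclass_kdual_step[OF st(1) fgI I step(3)])
 qed
 from this[of "Suc 0"] show ?thesis by (intro zclass_kdual_step[OF st(2) fgI I]) simp
qed

lemma injective_hom_extends:
 fixes Y I :: "('a, nat => 'k) module"
 assumes I: "injective_module A I" and Y: "fgm A Y" and U: "subm U A Y" shows "hom_extends A Y U I" unfolding hom_extends_def
proof (intro allI impI)
 interpret Y: right_module A Y using Y by (rule fgmD)
 show "EX g. lin A Y I g & (ALL x:U. g x = f x)" if "lin A (Y(|carrier := U|)) I f" for f
  using injective_extends[OF I fg_submodule[OF Y U] Y lin_restrict[OF lin_id Y.submod_subset[OF U]] _ that] by simp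
qed

text \<open>Dimension shifting along a coresolution of the target.\<close>

lemma hom_extends_step:
 assumes res: "resolution A X P p" and se: "short_exact A Z I W i q" and I: "hom_extends A (P (Suc j)) (akr (P (Suc j)) (X (Suc j)) (p (Suc j))) I"
  and W: "hom_extends A (P j) (akr (P j) (X j) (p j)) W" shows "hom_extends A (P (Suc j)) (akr (P (Suc j)) (X (Suc j)) (p (Suc j))) Z"
 unfolding hom_extends_def
proof (intro allI impI)
 interpret i: linear_map A Z I i using se by (simp add: short_exact_def)
 interpret q: linear_map A I W q using se by (simp add: short_exact_def)
 have i: "inj_on i (car Z)" and q: "lmap A I W q" "q ` car I = car W" and k: "akr I W q = i ` car Z" using se by (simp_all add: short_exact_def)
 have ex: "q x = 0@W <-> x : i ` car Z" if "x :. I" for x using that unfolding k[symmetric] by (simp add: a_kernel_iff)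
 let ?P = "P (Suc j)" and ?U = "akr (P (Suc j)) (X (Suc j)) (p (Suc j))" and ?V = "akr (P j) (X j) (p j)"
 have r: "fg_proj A (P k)" "lmap A (P k) (X k) (p k)" "p k ` car (P k) = car (X k)"
  "X (Suc k) = (P k)(|carrier := akr (P k) (X k) (p k)|)" for k using res by (auto simp: resolution_def)
 interpret p: linear_map A ?P "X (Suc j)" "p (Suc j)" by (rule r)
 interpret p0: linear_map A "P j" "X j" "p j" by (rule r)
 fix f assume f: "lin A (?P(|carrier := ?U|)) Z f"
 have ifl: "lin A (?P(|carrier := ?U|)) I (%x. i (f x))" by (rule lin_comp[OF f i.lin])
 then obtain F where F: "lin A ?P I F" "!!x. x : ?U ==> F x = i (f x)" using I unfolding hom_extends_def by blast
 have fcl: "f x :. Z" if "x : ?U" for x using lin_closed[OF f] that by simp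
 have "q (F x) = 0@W" if "x : car ?P" "p (Suc j) x = 0@(X (Suc j))" for x
 proof -
  have x: "x : ?U" using that by (simp add: a_kernel_iff)
  show ?thesis using ex[of "i (f x)"] fcl[OF x] F(2)[OF x] by simp
 qed
 then obtain g where g: "lin A (X (Suc j)) W g" "!!x. x : car ?P ==> g (p (Suc j) x) = q (F x)"
  using p.factor_through[OF q.N.rax lin_comp[OF F(1) q.lin] r(3)] by blast
 obtain G where G: "lin A (P j) W G" "!!x. x : ?V ==> G x = g x" using W g(1) unfolding r(4)[of j] hom_extends_def by blast
 obtain n y phi where db: "dual_basis A (P j) n y phi" using r(1)[of j] by (auto simp: fg_proj_def)
 obtain G' where G': "lin A (P j) I G'" "!!x. x :. (P j) ==> q (G' x) = G x" using dual_basis_lift[OF db q lmapI[OF p0.M.rax q.N.rax G(1)]] by blast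
 have pV: "p (Suc j) x : ?V" if "x : car ?P" for x using p.closed[OF that] unfolding r(4)[of j] by simp
 have pl: "lin A ?P (P j) (p (Suc j))" using p.lin unfolding r(4)[of j] by (rule lin_out) (auto simp: a_kernel_iff)
 \<comment> \<open>The correction does not affect \<open>F\<close> on \<open>?U\<close>, where
   \<open>p (Suc j)\<close> vanishes. It moves the values of \<open>F\<close> into the image of
   \<open>Z\<close>, because \<open>q\<close> takes the same values on both terms.\<close>
 define F' where "F' x = F x --.I G' (p (Suc j) x)" for x
 have F'l: "lin A ?P I F'" unfolding F'_def by (rule i.N.lin_pointwise_diff[OF F(1) lin_comp[OF pl G'(1)]])
 have cl: "F x :. I" "G' (p (Suc j) x) :. I" if "x : car ?P" for x using lin_closed[OF F(1) that] lin_closed[OF lin_comp[OF pl G'(1)] that] by auto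
 have F'Z: "F' x : i ` car Z" if x: "x : car ?P" for x
 proof -
  have "p (Suc j) x :. (P j)" using lin_closed[OF pl x] .
  hence "q (F' x) = 0@W" using cl[OF x] G'(2) G(2)[OF pV[OF x]] g(2)[OF x] by (simp add: F'_def q.map_diff)
  thus ?thesis using ex[of "F' x"] lin_closed[OF F'l x] by simp
 qed
 let ?J = "I(|carrier := i ` car Z|)"
 have im: "subm (i ` car Z) A I" by (rule i.submod_image[OF i.M.submod_self])
 interpret i': linear_map A Z ?J i by (intro lmapI i.M.rax i.N.submod_right_module im lin_into i.lin) auto
 obtain h where h: "lin A ?J Z h" "ALL x:car Z. h (i x) = x" using i'.factor_through[OF i.M.rax lin_id] i i.inj_iff by auto
 have "lin A ?P Z (%x. h (F' x))" by (rule lin_comp[OF lin_into[OF F'l F'Z] h(1)])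
 moreover have "h (F' x) = f x" if x: "x : ?U" for x
 proof -
  have px: "x : car ?P" "p (Suc j) x = 0@(P j)" using x unfolding r(4)[of j] by (auto simp: a_kernel_iff)
  interpret G': linear_map A "P j" I G' by (intro lmapI p0.M.rax i.N.rax G')
  have "F' x = i (f x)" using px F(2)[OF x] fcl[OF x] by (simp add: F'_def)
  thus ?thesis using h(2) fcl[OF x] by simp
 qed
 ultimately show "EX g. lin A ?P Z g & (ALL x:?U. g x = f x)" by blast
qed

text \<open>Homomorphisms extend trivially into the zero cosyzygy and always into an injective
  module; dimension shifting leads from there back to \<open>A\<close>. The bound depends only on
  the length of the coresolution.\<close>

lemma resolution_eventually_extends:
 assumes dim: "finite_injective_dimension A (reg A)" and res: "resolution A X P p"
 shows "EX m. ALL j>=m. hom_extends A (P j) (akr (P j) (X j) (p j)) (reg A)"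
proof -
 let ?ext = "%j Z. hom_extends A (P j) (akr (P j) (X j) (p j)) Z"
 obtain I Z :: "nat => ('a, nat => 'k) module" and d eta l where inj: "!!i. injective_module A (I i)"
  and st: "!!i. short_exact A (Z i) (I i) (Z (Suc i)) (%x. x) (d i)" "short_exact A (reg A) (I 0) (Z (Suc 0)) eta (d 0)"
  and zero: "car (Z (Suc l)) = {0@(Z (Suc l))}" by (rule injective_coresolution_steps[OF A_rmod dim]) (rule that; assumption)
 have r: "fg_proj A (P k)" "lmap A (P k) (X k) (p k)" for k using res by (auto simp: resolution_def)
 have extI: "?ext j (I i)" for i j by (rule injective_hom_extends[OF inj fg_proj_fg[OF r(1)] linear_map.submod_kernel[OF r(2)]])
 \<comment> \<open>A step back along the coresolution raises the degree in the resolution by one, so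
   the sum \<open>j + i\<close> is preserved.\<close>
 have extZ: "ALL j. j + i > l --> ?ext j (Z i)" if "i <= Suc l" for i using that
 proof (induct rule: inc_induct)
  case base
  have Z: "rmod A (Z (Suc l))" using st(1)[of "Suc l"] by (simp add: short_exact_def linear_map_def)
  have "EX g. lin A (P j) (Z (Suc l)) g & (ALL x:akr (P j) (X j) (p j). g x = f x)"
   if f: "lin A ((P j)(|carrier := akr (P j) (X j) (p j)|)) (Z (Suc l)) f" for j f
   using right_module.lin_pointwise_zero[OF Z, of "P j"] lin_closed[OF f] zero by (intro exI[of _ "%_. 0@(Z (Suc l))"]) auto
  thus ?case by (simp add: hom_extends_def)
 next
  case (step i)
  show ?case
  proof (intro allI impI)
   fix j assume j: "j + i > l"
   with step(2) obtain k where k: "j = Suc k" by (cases j) auto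
   show "?ext j (Z i)" unfolding k by (rule hom_extends_step[OF res st(1) extI]) (use step j k in simp)
  qed
 qed
 have "?ext j (reg A)" if j: "j >= Suc (Suc l)" for j
 proof -
  obtain k where k: "j = Suc k" using j by (cases j) auto
  show ?thesis unfolding k by (rule hom_extends_step[OF res st(2) extI]) (use extZ[of "Suc 0"] j k in simp)
 qed
 thus ?thesis by blast
qed

end

section \<open>Gorenstein projective modules as submodules of projective modules\<close>

locale gorenstein_fd_algebra = fd_algebra K A
 for K :: "'k ring" and A :: "('k, 'a) module" +
 assumes gorenstein: "gorenstein_algebra A"
begin

text \<open>A functional on \<open>M\<close> is a homomorphism \<open>M \<rightarrow> D(A)\<close>, and this factors through a free module,
  because \<open>D(A)\<close> has a finite resolution by modules of the form \<open>D(I)\<close> with \<open>I\<close> injective, which are projective.\<close>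

lemma gp_torsionless:
 assumes M: "gp A M" and m: "m :. M" "m ~= 0@M" shows "EX h. lin A M (reg A) h & h m ~= 0@A"
proof -
 interpret op: fd_algebra K B by (rule opposite)
 interpret M: right_module A M by (rule gp_right_module[OF M])
 interpret V: fin_vector_space K "kmod A M" using gp_fg[OF M] fg_right_module_iff by blast
 obtain phi where phi: "functional K (kmod A M) phi" "phi m ~= 0@K" using V.separate[OF V.submod_zero_set, of m] m by auto
 let ?R = "reg B" and ?D = "kdual K A (reg B)"
 \<comment> \<open>The homomorphism into the dual of \<open>A\<close> that corresponds to
   \<open>phi\<close>; evaluation at one recovers \<open>phi\<close>.\<close>
 define f where "f x = (%a:car ?R. phi (a *>.M x))" for x
 interpret D: right_module A ?D by (rule kdual_right_module[OF op.A_rmod])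
 have f: "lin A M ?D f"
 proof (rule linI)
  fix x assume x: "x :. M"
  have "lin K (kmod A ?R) (kmod A M) (%a. a *>.M x)" by (rule linI) (use x in "auto simp: M.act_add_ring scalar_central simp flip: M.act_mult")
  from kdual_restrict[OF op.A_rmod lin_comp[OF this phi(1)]] show "f x : car ?D" unfolding f_def .
  show "f (a *>.M x) = a *>.?D f x" if "a :. A" for a using x that by (auto simp: f_def M.act_mult intro!: restrict_ext)
  show "f (x ++.M y) = f x ++.?D f y" if "y :. M" for y using x that lin_add[OF phi(1)] by (auto simp: f_def M.act_add_module intro!: restrict_ext)
 qed
 have "zclass A ?D" using zclass_kdual[OF op.A_rmod] gorenstein by (simp add: gorenstein_algebra_def)
 from zclassD[OF this M f] obtain s h y where *: "!!k. k < (s :: nat) ==> lin A M (reg A) (h k)"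
  "y : {..<s} -> car ?D" "!!x. x :. M ==> f x = (+/.?D k<s. h k x *>.?D y k)" by (rule factors_freeE) (rule that; assumption)
 show ?thesis
 proof (rule ccontr)
  assume "~ ?thesis"
  hence hz: "h k m = 0@A" if "k < s" for k using *(1)[OF that] by blast
  have "f m = 0@?D" unfolding *(3)[OF m(1)] by (rule D.M.finsum_all_zero) (use hz *(2) D.zero_act in "auto simp: Pi_iff simp del: kdual_sel")
  from fun_cong[OF this, of "1@A"] show False using phi(2) m(1) by (simp add: f_def M.act_one)
 qed
qed

text \<open>Generators \<open>h k\<close> of the homomorphisms from \<open>G\<close> to
  \<open>A\<close> are the coordinates of a map into a free module along which every homomorphism to
  \<open>A\<close> extends. It is injective by \<open>gp_torsionless\<close>, and the extension
  property is exactly the first condition that makes its cokernel Gorenstein projective; the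
  remaining ones hold for \<open>G\<close>.\<close>

lemma gp_coker:
 assumes G: "gp A G" shows "EX (P :: ('a, nat => 'k) module) eta G' q. fg_proj A P & lmap A G P eta &
  lmap A P G' q & q ` car P = car G' & akr P G' q = eta ` car G & gp A G' &
  (ALL h. lin A G (reg A) h --> (EX h'. lin A P (reg A) h' & (ALL g:car G. h' (eta g) = h g)))"
proof -
 have fgG: "fgm A G" by (rule gp_fg[OF G])
 interpret G: right_module A G by (rule gp_right_module[OF G])
 obtain s h where h: "!!k. k < (s :: nat) ==> lin A G (reg A) (h k)"
  and gen: "!!g. lin A G (reg A) g ==> EX c:s ->. A. ALL m:car G. g m = (+/.A k<s. c k **.A h k m)" using hom_to_regular_fg[OF fgG] by blast
 have hcl: "h k m :. A" if "k < s" "m :. G" for k m using lin_closed[OF h(1)[OF that(1)] that(2)] by simp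
 let ?F = "fre A s"
 interpret F: right_module A ?F by (rule A.free_right_module)
 define iot where "iot m = (%k:{..<s}. h k m)" for m
 have iot: "lmap A G ?F iot"
 proof (intro lmapI G.rax F.rax linI)
  show "iot x : car ?F" if "x :. G" for x using hcl that by (auto simp: iot_def)
 qed (use lin_add[OF h] lin_act[OF h] in "auto simp: iot_def intro!: restrict_ext")
 interpret iot: linear_map A G ?F iot by (rule iot)
 have inj: "inj_on iot (car G)" unfolding iot.inj_iff
 proof (intro ballI impI, rule ccontr)
  fix m assume m: "m :. G" "iot m = 0@?F" "m ~= 0@G"
  have hz: "h k m = 0@A" if "k < s" for k using fun_cong[OF m(2), of k] that by (simp add: iot_def)
  obtain g where g: "lin A G (reg A) g" "g m ~= 0@A" using gp_torsionless[OF G m(1,3)] by blast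
  obtain c where c: "c : s ->. A" "g m = (+/.A k<s. c k **.A h k m)" using gen[OF g(1)] m(1) by blast
  have "(+/.A k<s. c k **.A h k m) = 0@A" by (rule A.finsum_all_zero) (use c hz in "auto simp: Pi_iff")
  with g c show False by simp
 qed
 have fgF: "fg_proj A ?F" using A.free_dual_basis fg_free by (auto simp: fg_proj_def)
 obtain P :: "('a, nat => 'k) module" and kap where P: "fgm A P" "lin A ?F P kap" "bij_betw kap (car ?F) (car P)"
  using copy_module[OF fg_free] by blast
 interpret P: right_module A P using P(1) by (rule fgmD)
 have projP: "fg_proj A P" by (rule fg_proj_iso[OF fgF P.rax P(2,3)])
 interpret kap: linear_map A ?F P kap by (intro lmapI F.rax P.rax P)
 obtain kap' where kap': "lmap A P ?F kap'" "!!x. x : car ?F ==> kap' (kap x) = x" using bij_lin_inverse[OF kap.linear_map_axioms P(3)] by blast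
 define eta where "eta m = kap (iot m)" for m
 have eta: "lmap A G P eta" unfolding eta_def by (intro lmapI G.rax P.rax lin_comp[OF iot.lin kap.lin])
 interpret eta: linear_map A G P eta by (rule eta)
 have etainj: "inj_on eta (car G)"
 proof (rule inj_onI)
  fix x y assume xy: "x :. G" "y :. G" "eta x = eta y"
  hence "kap' (eta x) = kap' (eta y)" by simp
  hence "iot x = iot y" unfolding eta_def kap'(2)[OF iot.closed[OF xy(1)]] kap'(2)[OF iot.closed[OF xy(2)]] .
  thus "x = y" using inj xy by (auto simp: inj_on_def)
 qed
 let ?U = "eta ` car G"
 have U: "subm ?U A P" by (rule eta.submod_image[OF G.submod_self])
 have ext: "EX h'. lin A P (reg A) h' & (ALL g:car G. h' (eta g) = f g)" if f: "lin A G (reg A) f" for f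
 proof -
  obtain c where c: "c : s ->. A" "ALL m:car G. f m = (+/.A k<s. c k **.A h k m)" using gen[OF f] by blast
  have "lin A ?F (reg A) (%x. c k **.A x k)" if "k : {..<s}" for k using lin_comp[OF A.free_proj_lin A.lin_left_mult] c(1) that by (auto simp: Pi_iff)
  from right_module.lin_pointwise_finsum[where I = "{..<s}" and f = "%k x. c k **.A x k", OF A_rmod this]
  have "lin A ?F (reg A) (%x. +/.A k<s. c k **.A x k)" by simp
  from lin_comp[OF linear_map.lin[OF kap'(1)] this]
  have "lin A P (reg A) (%y. +/.A k<s. c k **.A kap' y k)" .
  moreover have "(+/.A k<s. c k **.A kap' (eta g) k) = f g" if g: "g :. G" for g
  proof -
   have "(+/.A k<s. c k **.A kap' (eta g) k) = (+/.A k<s. c k **.A h k g)" unfolding eta_def kap'(2)[OF iot.closed[OF g]]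
    by (rule A.finsum_cong') (use c hcl g in "auto simp: iot_def Pi_iff")
   thus ?thesis using c(2) g by simp
  qed
  ultimately show ?thesis by blast
 qed
 let ?Q = "quotient_module P ?U"
 have fgQ: "fgm A ?Q" by (rule fg_quotient[OF P(1) U])
 obtain G' :: "('a, nat => 'k) module" and mu where G': "fgm A G'" "lin A ?Q G' mu" "bij_betw mu (car ?Q) (car G')" using copy_module[OF fgQ] by blast
 interpret G': right_module A G' using G'(1) by (rule fgmD)
 note Q = P.quotient_right_module[OF U]
 interpret mu: linear_map A ?Q G' mu by (intro lmapI Q G'.rax G')
 let ?q = "%x. mu (?U +>.P x)"
 have q: "lmap A P G' ?q" by (intro lmapI P.rax G'.rax lin_comp[OF Q(2) mu.lin])
 have onto: "?q ` car P = car G'" using G'(3) by (auto simp: bij_betw_def image_image simp del: )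
 have ker: "akr P G' ?q = ?U"
 proof -
  have "?q x = 0@G' <-> x : ?U" if x: "x :. P" for x
  proof -
   have "?q x = 0@G' <-> ?U +>.P x = 0@?Q" using G'(3) mu.inj_iff x mu.map_zero unfolding bij_betw_def by auto
   thus ?thesis using P.coset_zero_iff[OF U x] by simp
  qed
  thus ?thesis using P.submod_subset[OF U] by (auto simp: a_kernel_iff)
 qed
 let ?PU = "P(|carrier := ?U|)"
 have etaU: "lmap A G ?PU eta" by (intro lmapI G.rax P.submod_right_module U lin_into eta.lin) auto
 have "gp A G'"
 proof (rule gp.gpI[OF projP q onto])
  show "gp A (P(|carrier := akr P G' ?q|))" unfolding ker by (rule gp_iso[OF G etaU]) (use etainj in "simp add: bij_betw_def")
  show "hom_extends A P (akr P G' ?q) (reg A)" unfolding ker hom_extends_def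
  proof (intro allI impI)
   fix f assume f: "lin A ?PU (reg A) f"
   obtain h' where "lin A P (reg A) h'" "ALL g:car G. h' (eta g) = f (eta g)" using ext[OF lin_comp[OF linear_map.lin[OF etaU] f]] by blast
   thus "EX g. lin A P (reg A) g & (ALL x:?U. g x = f x)" by blast
  qed
 qed
 thus ?thesis using projP eta q onto ker ext by (intro exI[of _ P] exI[of _ eta] exI[of _ G'] exI[of _ ?q]) blast
qed

text \<open>Embed \<open>G\<close> into a projective \<open>Q\<close> as in \<open>gp_coker\<close>
  and extend \<open>f\<close> to \<open>F\<close> on \<open>Q\<close>. Modulo the syzygy,
  \<open>F\<close> induces a map from the cokernel \<open>G'\<close> to \<open>X\<close>, which
  factors through a free module and so lifts to some \<open>F2\<close> on \<open>Q\<close> that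
  vanishes on \<open>G\<close>. The difference of \<open>F\<close> and \<open>F2\<close> has values
  in the syzygy and extends \<open>f\<close>, so that \<open>f\<close> factors through
  \<open>Q\<close>.\<close>

lemma zclass_syzygy:
 assumes X: "zclass A X" and P: "fg_proj A P" and p: "lmap A P X p" "p ` car P = car X" shows "zclass A (P(|carrier := akr P X p|))"
proof (rule zclassI)
 interpret p: linear_map A P X p by fact
 let ?U = "P(|carrier := akr P X p|)"
 show Ur: "rmod A ?U" by (rule p.M.submod_right_module[OF p.submod_kernel])
 fix G f assume G: "gp A G" and f: "lin A G ?U f"
 obtain Q :: "('a, nat => 'k) module" and eta G' q where *: "fg_proj A Q & lmap A G Q eta &
  lmap A Q G' q & q ` car Q = car G' & akr Q G' q = eta ` car G & gp A G' &
  (ALL h. lin A G (reg A) h --> (EX h'. lin A Q (reg A) h' & (ALL g:car G. h' (eta g) = h g)))" using gp_coker[OF G] by (elim exE) (rule that)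
 hence Q: "fg_proj A Q" and eta: "lmap A G Q eta" and q: "lmap A Q G' q" "q ` car Q = car G'"
  and ker: "akr Q G' q = eta ` car G" and G': "gp A G'" by simp_all
 have ext: "!!h. lin A G (reg A) h ==> EX h'. lin A Q (reg A) h' & (ALL g:car G. h' (eta g) = h g)" using * by simp
 interpret eta: linear_map A G Q eta by fact
 interpret q: linear_map A Q G' q by fact
 obtain n x phi where db: "dual_basis A P n x phi" using P by (auto simp: fg_proj_def)
 obtain n' x' phi' where db': "dual_basis A Q n' x' phi'" using Q by (auto simp: fg_proj_def)
 have fP: "lin A G P f" by (rule lin_out[OF f]) (auto simp: a_kernel_iff)
 have "ALL u:{..<n}. EX h'. lin A Q (reg A) h' & (ALL g:car G. h' (eta g) = phi u (f g))" using ext lin_comp[OF fP dual_basis_lin[OF db]] by blast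
 from bchoice[OF this] obtain psi where psi: "!!u. u < n ==> lin A Q (reg A) (psi u)"
  "!!u g. u < n ==> g :. G ==> psi u (eta g) = phi u (f g)" by auto
 define F where "F y = (+/.P u<n. psi u y *>.P x u)" for y
 have F: "lin A Q P F" unfolding F_def by (rule p.M.lin_combination) (use psi dual_basis_vec[OF db] in auto)
 have Feta: "F (eta g) = f g" if g: "g :. G" for g
 proof -
  have fg: "f g :. P" using lin_closed[OF fP g] .
  have "F (eta g) = (+/.P u<n. phi u (f g) *>.P x u)"
   unfolding F_def by (rule p.M.M.finsum_cong') (use psi(2)[OF _ g] dual_basisD[OF db] fg in "auto simp: Pi_iff")
  thus ?thesis using dual_basis_sum[OF db fg] by simp
 qed
 have "p (F y) = 0@X" if "y :. Q" "q y = 0@G'" for y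
 proof -
  have "y : akr Q G' q" using that by (simp add: a_kernel_iff)
  then obtain g where "g :. G" "y = eta g" unfolding ker by blast
  thus ?thesis using Feta lin_closed[OF f] by (auto simp: a_kernel_iff)
 qed
 then obtain F1 where F1: "lin A G' X F1" "!!y. y :. Q ==> F1 (q y) = p (F y)" using q.factor_through[OF p.N.rax lin_comp[OF F p.lin] q(2)] by blast
 obtain s h y where 1: "!!k. k < (s :: nat) ==> lin A G' (reg A) (h k)" "y : s ->. X"
  "!!g. g :. G' ==> F1 g = (+/.X k<s. h k g *>.X y k)" using zclassD[OF X G' F1(1)] by (rule factors_freeE) blast
 have "y : {..<s} -> p ` car P" using 1(2) p(2) by simp
 from choose_preimages[OF this] obtain z where z: "!!k. k < s ==> z k :. P" "!!k. k < s ==> p (z k) = y k" by auto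
 define F2 where "F2 v = (+/.P k<s. h k (q v) *>.P z k)" for v
 have F2: "lin A Q P F2" unfolding F2_def by (rule p.M.lin_combination) (use lin_comp[OF q.lin 1(1)] z in auto)
 have hcl: "h k g :. A" if "k < s" "g :. G'" for k g using lin_closed[OF 1(1)[OF that(1)] that(2)] by simp
 have pF2: "p (F2 v) = p (F v)" if v: "v :. Q" for v
 proof -
  have "p (F2 v) = (+/.X k<s. p (h k (q v) *>.P z k))" unfolding F2_def by (rule p.map_finsum) (use z hcl v in "auto simp: Pi_iff")
  also have "... = (+/.X k<s. h k (q v) *>.X y k)" by (rule p.N.M.finsum_cong') (use z hcl v 1(2) in "auto simp: Pi_iff p.map_act")
  finally show ?thesis using 1(3) F1(2) v by simp
 qed
 have Fcl: "F v :. P" "F2 v :. P" if "v :. Q" for v using lin_closed[OF F that] lin_closed[OF F2 that] .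
 have F3: "lin A Q ?U (%v. F v --.P F2 v)"
  by (rule lin_into[OF p.M.lin_pointwise_diff[OF F F2]]) (use Fcl pF2 in "auto simp: a_kernel_iff p.map_diff")
 have F2eta: "F2 (eta g) = 0@P" if g: "g :. G" for g
 proof -
  have "eta g : akr Q G' q" using ker g by blast
  hence "q (eta g) = 0@G'" by (simp add: a_kernel_iff)
  hence "h k (q (eta g)) = 0@A" if "k < s" for k using linear_map.map_zero[OF lmapI[OF q.N.rax A_rmod 1(1)[OF that]]] by simp
  thus ?thesis unfolding F2_def using z by (intro p.M.M.finsum_all_zero) simp
 qed
 have "factors_free A G ?U (%g. F (eta g) --.P F2 (eta g))" by (rule factors_dual_basis[OF db' eta.lin lmapI[OF eta.N.rax Ur F3]])
 thus "factors_free A G ?U f" by (rule factors_cong) (use Feta F2eta lin_closed[OF fP] in simp)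
qed

text \<open>All syzygies of \<open>M\<close> stay in the class, and high ones are Gorenstein
  projective. The identity of such a syzygy factors through a free module, which makes it
  projective.\<close>

lemma zclass_finite_projective_dimension:
 assumes M: "fgm A M" and Z: "zclass A M" shows "finite_projective_dimension A M"
proof -
 obtain N :: "('a, nat => 'k) module" and f where N: "fgm A N" "lin A M N f" "bij_betw f (car M) (car N)" using copy_module[OF M] by blast
 have lf: "lmap A M N f" by (intro lmapI fgmD M N)
 obtain g where g: "lmap A N M g" "bij_betw g (car N) (car M)" using bij_lin_inverse[OF lf N(3)] by blast
 obtain X P p where res: "resolution A X P p" and X0: "X 0 = N" and stop: "!!i. fg_proj A (X i) ==> car (X (Suc i)) = {0@(X (Suc i))} & P i = X i"
  using resolution_exists[OF N(1)] by blast
 have r: "fg_proj A (P k)" "lmap A (P k) (X k) (p k)" "p k ` car (P k) = car (X k)"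
  "X (Suc k) = (P k)(|carrier := akr (P k) (X k) (p k)|)" for k using res by (auto simp: resolution_def)
 have XZ: "zclass A (X i)" for i
 proof (induct i)
  case 0
  show ?case unfolding X0 by (rule zclass_iso[OF Z lf N(3)])
 next
  case (Suc i)
  show ?case unfolding r(4) by (rule zclass_syzygy[OF Suc r(1-3)])
 qed
 obtain m where m: "!!j. j >= m ==> hom_extends A (P j) (akr (P j) (X j) (p j)) (reg A)"
  using resolution_eventually_extends[OF _ res] gorenstein by (auto simp: gorenstein_algebra_def)
 have proj: "fg_proj A (X i)" if "i >= m" for i
 proof -
  have gpX: "gp A (X i)" by (rule resolution_gp[OF res m that])
  obtain s h y where "!!k. k < (s :: nat) ==> lin A (X i) (reg A) (h k)" "y : s ->. (X i)"
   "!!x. x :. (X i) ==> x = (+/.(X i) k<s. h k x *>.(X i) y k)" using zclassD[OF XZ gpX lin_id] by (rule factors_freeE) blast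
  hence "dual_basis A (X i) s y h" unfolding dual_basis_def by blast
  thus ?thesis using gp_fg[OF gpX] by (auto simp: fg_proj_def)
 qed
 \<comment> \<open>After a projective syzygy \<open>X j\<close> the next syzygy is zero, and the
   resolution covers zero by itself.\<close>
 have "car (P i) = {0@(P i)}" if "i > m" for i
 proof -
  obtain j where j: "i = Suc j" "j >= m" using `i > m` by (cases i) auto
  thus ?thesis using stop[OF proj[of j]] stop[OF proj[of i]] that by simp
 qed
 moreover have "projective_resolution A M P (%i. restrict (p (Suc i)) (car (P (Suc i)))) (restrict (%x. g (p 0 x)) (car (P 0)))"
  by (rule resolution_to_projective_resolution[OF res]) (use g X0 in auto)
 ultimately show ?thesis unfolding finite_projective_dimension_def by blast
qed

end

section \<open>Local corner rings\<close>

text \<open>Locality in terms of elements: the last two conditions make the nonunits a two-sided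
  ideal.\<close>

locale local_ring = ring R for R :: "('c, 'b) ring_scheme" (structure) +
 assumes one_neq_zero: "\<one> ~= \<zero>" and unit_factors: "[|a :. R; b :. R; a ** b : Units R|] ==> a : Units R & b : Units R"
  and nonunit_add: "[|a :. R; b :. R; a ~: Units R; b ~: Units R|] ==> a ++ b ~: Units R"
begin

lemma zero_nonunit: "\<zero> ~: Units R" using one_neq_zero by (auto simp: Units_def)

lemma nonunit_mult_left: "[|a :. R; b :. R; b ~: Units R|] ==> a ** b ~: Units R"
 and nonunit_mult_right: "[|a :. R; b :. R; a ~: Units R|] ==> a ** b ~: Units R" using unit_factors by blast+

lemma one_diff_nonunit:
 assumes "a :. R" "a ~: Units R" shows "\<one> -- a : Units R"
proof (rule ccontr)
 assume "\<one> -- a ~: Units R"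
 hence "(\<one> -- a) ++ a ~: Units R" using assms by (intro nonunit_add) auto
 thus False using assms by (simp add: diff_add_cancel)
qed

end

text \<open>The ring \<open>e R e\<close>. For an algebra the action of the scalars is inherited
  from the unchanged part of the record.\<close>

definition corner :: "('a, 'b) ring_scheme => 'a => ('a, 'b) ring_scheme" where
 "corner R e = R(|carrier := {x : car R. e **.R x = x & x **.R e = x}, monoid.one := e|)"

lemma corner_sel [simp]:
 "x : car (corner R e) <-> x :. R & e **.R x = x & x **.R e = x"
 "1@(corner R e) = e" "0@(corner R e) = 0@R" "x **.(corner R e) y = x **.R y" "x ++.(corner R e) y = x ++.R y" by (auto simp: corner_def)

context ring
begin

lemma corner_ring:
 assumes e: "e :. R" "e ** e = e" shows "ring (corner R e)"
proof (rule ringI)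
 show "abelian_group (corner R e)"
 proof (rule abelian_groupI)
  fix x assume "x :. (corner R e)"
  thus "EX y:car (corner R e). y ++.(corner R e) x = 0@(corner R e)" using e by (intro bexI[of _ "~- x"]) (auto simp: l_neg r_minus l_minus)
 qed (use e in "auto simp: a_ac l_distr r_distr")
 show "Group.monoid (corner R e)"
 proof (rule monoidI)
  fix x y assume xy: "x :. (corner R e)" "y :. (corner R e)"
  hence "e ** (x ** y) = x ** y" "(x ** y) ** e = x ** y" using e m_assoc[of e x y, symmetric] m_assoc[of x y e] by simp_all
  thus "x **.(corner R e) y :. (corner R e)" using xy e by auto
 qed (use e in "auto simp: m_assoc")
qed (auto simp: l_distr r_distr)

lemma corner_sandwich:
 assumes "e :. R" "e ** e = e" "x :. R" shows "e ** x ** e :. (corner R e)" using assms by (auto simp: m_assoc) (simp add: m_assoc[symmetric])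

lemma corner_minus: "e :. R ==> e ** e = e ==> x :. (corner R e) ==> ~-.(corner R e) x = ~- x"
proof -
 assume e: "e :. R" "e ** e = e" and x: "x :. (corner R e)"
 interpret C: ring "corner R e" by (rule corner_ring[OF e])
 show ?thesis by (rule C.minus_equality) (use x e in "auto simp: l_neg r_minus l_minus")
qed

lemma corner_diff: "[|e :. R; e ** e = e; x :. (corner R e); y :. (corner R e)|]
  ==> x --.(corner R e) y = x -- y" by (simp add: a_minus_def corner_minus del: corner_sel(1))

end

lemma module_imp_right_module:
 assumes "Module.module R M" shows "rmod R M"
proof -
 interpret Module.module R M by fact
 show ?thesis
 proof (unfold_locales)
  show "(a **.R b) *>.M x = b *>.M (a *>.M x)" if "a :. R" "b :. R" "x :. M" for a b x using smult_assoc1[of b a x] R.m_comm[of a b] that by simp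
 qed (simp_all add: smult_l_distr smult_r_distr)
qed

context fd_algebra
begin

lemma corner_fd:
 assumes e: "e :. A" "e **.A e = e" shows "fd_algebra K (corner A e)"
proof -
 interpret C: ring "corner A e" using e by (rule A.corner_ring)
 have sm: "l *>.(corner A e) x = l *>.A x" for l x by (simp add: corner_def)
 interpret M: Module.module K "corner A e" by (rule moduleI[OF K.is_cring C.abelian_group_axioms])
   (auto simp: sm smult_l_distr smult_r_distr smult_assoc1 smult_mult_left smult_mult_right e)
 note rm = module_imp_right_module[OF M.module_axioms]
 interpret V: fin_vector_space K VA by (rule VA_space)
 let ?C = "VA(|carrier := car (corner A e)|)"
 have sub: "subm (car (corner A e)) K VA" by (rule V.submodI) (auto simp: A.l_distr A.r_distr mult_scalar smult_mult_left smult_mult_right e)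
 have "lmap K ?C (corner A e) (%x. x)" by (intro lmapI V.submod_right_module sub rm linI) (auto simp: sm mult_scalar)
 from fg_image[OF this _ V.subspace_fg[OF sub]] have "finitely_generated K (corner A e)" by simp
 thus ?thesis by unfold_locales (auto simp: sm smult_mult_left smult_mult_right)
qed

text \<open>Let \<open>?Q\<close> be the centraliser of \<open>x\<close> and choose \<open>k\<close>
  such that \<open>x^k ?Q\<close> has least dimension. Then \<open>x^2k ?Q\<close> is the same
  space, and it contains \<open>x^k\<close>. Using the centraliser instead of \<open>A\<close> makes
  \<open>y\<close> commute with \<open>x\<close>.\<close>

lemma power_stable:
 assumes x: "x :. A" shows "EX (k::nat) y. k > 0 & y :. A & y **.A x = x **.A y &
  x [^].A k = x [^].A k **.A (x [^].A k **.A y)"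
proof -
 interpret V: fin_vector_space K VA by (rule VA_space)
 let ?Q = "{y : car A. y **.A x = x **.A y}"
 let ?S = "%k::nat. (%y. x [^].A k **.A y) ` ?Q"
 let ?r = "%k. rank K (VA(|carrier := ?S k|))"
 have Q: "subm ?Q K VA" by (rule V.submodI) (use x in "auto simp: A.l_distr A.r_distr mult_scalar smult_mult_left smult_mult_right")
 have S: "subm (?S k) K VA" for k using linear_map.submod_image[OF lmapI[OF VA_right_module VA_right_module VA_mult_left] Q, of "x [^].A k"] x by simp
 define k where "k = arg_min ?r (%k. k > 0)"
 have k: "k > 0" "?r k <= ?r (k + k)" unfolding k_def using arg_min_natI[of "%k. k > 0" 1 ?r] arg_min_nat_le[of "%k. k > 0" _ ?r] by auto
 have xc: "x [^].A n **.A x = x **.A x [^].A n" for n :: nat using A.nat_pow_Suc2[OF x, of n] by simp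
 have sub: "?S (k + k) <= ?S k"
 proof
  fix a assume "a : ?S (k + k)"
  then obtain y where y: "y : ?Q" "a = x [^].A k **.A (x [^].A k **.A y)" using x by (auto simp: A.m_assoc[symmetric] A.nat_pow_mult)
  have "x [^].A k **.A y : ?Q" using y(1) x xc[of k] by (auto simp: A.m_assoc) (simp add: A.m_assoc[symmetric])
  thus "a : ?S k" using y(2) by blast
 qed
 have "?S (k + k) = ?S k"
 proof (rule ccontr)
  assume "?S (k + k) ~= ?S k"
  interpret Sk: fin_vector_space K "VA(|carrier := ?S k|)" by (rule V.subspace[OF S])
  have "subm (?S (k + k)) K (VA(|carrier := ?S k|))" using V.submod_submod_iff[OF S] S sub by blast
  from Sk.rank_less[OF this] `?S (k + k) ~= ?S k` k(2) show False by simp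
 qed
 moreover have "x [^].A k : ?S k" by (rule image_eqI[of _ _ "1@A"]) (use x in simp_all)
 ultimately obtain y where y: "y : ?Q" "x [^].A k = x [^].A (k + k) **.A y" by blast
 have "x [^].A (k + k) **.A y = x [^].A k **.A (x [^].A k **.A y)" using x y(1) by (simp add: A.m_assoc[symmetric] A.nat_pow_mult)
 with y k(1) show ?thesis by (intro exI[of _ k] exI[of _ y]) (simp only: mem_Collect_eq simp_thms)
qed

text \<open>Fitting's lemma: \<open>x\<^sup>k y\<close> is idempotent if \<open>x\<^sup>k = x\<^sup>2\<^sup>k y\<close>.\<close>

lemma unit_or_nilpotent:
 assumes triv: "!!f. f :. A ==> f **.A f = f ==> f = 0@A | f = 1@A" and x: "x :. A" shows "x : Units A | (EX k::nat. x [^].A k = 0@A)"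
proof -
 obtain y and k :: nat where k: "k > 0" and y: "y :. A" "y **.A x = x **.A y" and e: "x [^].A k = x [^].A k **.A (x [^].A k **.A y)"
  using power_stable[OF x] by blast
 obtain m where m: "k = Suc m" using k by (cases k) auto
 define a b where "a = x [^].A k" and "b = x [^].A m"
 have ab: "a :. A" "b :. A" "a = b **.A x" "a = x **.A b" using x A.nat_pow_Suc2[OF x, of m] by (simp_all add: a_def b_def m)
 have "y **.A x [^].A n = x [^].A n **.A y" for n :: nat
 proof (induct n)
  case (Suc n)
  have "y **.A x [^].A Suc n = (y **.A x [^].A n) **.A x" using x y by (simp add: A.m_assoc)
  also have "... = x [^].A Suc n **.A y" unfolding Suc using x y by (simp add: A.m_assoc)
  finally show ?case .
 qed (use y in simp)
 hence c: "y **.A a = a **.A y" by (simp add: a_def)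
 have "(a **.A y) **.A (a **.A y) = (a **.A (a **.A y)) **.A y" using ab y c A.m_assoc[of y a y] by (simp add: A.m_assoc)
 hence "(a **.A y) **.A (a **.A y) = a **.A y" using e by (simp add: a_def)
 from triv[OF _ this] ab y consider "a **.A y = 0@A" | "a **.A y = 1@A" by auto
 thus ?thesis
 proof cases
  case 1
  hence "a = 0@A" using e ab(1) by (simp flip: a_def)
  thus ?thesis unfolding a_def by blast
 next
  case 2
  have "x **.A (b **.A y) = 1@A" unfolding 2[symmetric] ab(4) using x ab(2) y(1) by (simp add: A.m_assoc)
  moreover have "(b **.A y) **.A x = 1@A" unfolding 2[symmetric] ab(3) using x ab(2) y by (simp add: A.m_assoc)
  moreover have "b **.A y :. A" using ab(2) y(1) by simp
  ultimately show ?thesis using x unfolding Units_def by blast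
 qed
qed

text \<open>If \<open>a b = 1\<close>, then \<open>b a\<close> is a nonzero idempotent, so one-sided
  inverses are two-sided. If a sum of two nonunits were a unit, one could scale it to
  \<open>c + d = 1\<close> with \<open>c\<close> a nonunit; then \<open>c\<close> is nilpotent and
  \<open>d\<close> is invertible.\<close>

lemma trivial_idempotents_local:
 assumes triv: "!!f. f :. A ==> f **.A f = f ==> f = 0@A | f = 1@A" and ne: "1@A ~= 0@A" shows "local_ring A"
proof -
 have inv: "b **.A a = 1@A" if ab: "a :. A" "b :. A" "a **.A b = 1@A" for a b
 proof -
  have "(b **.A a) **.A (b **.A a) = b **.A ((a **.A b) **.A a)" using ab(1,2) by (simp add: A.m_assoc)
  hence "(b **.A a) **.A (b **.A a) = b **.A a" using ab by simp
  moreover have "b **.A a ~= 0@A"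
  proof
   assume z: "b **.A a = 0@A"
   have "(a **.A b) **.A (a **.A b) = a **.A (b **.A a) **.A b" using ab(1,2) by (simp add: A.m_assoc)
   thus False using ab z ne by simp
  qed
  ultimately show ?thesis using triv[of "b **.A a"] ab by simp
 qed
 have U: "a : Units A & b : Units A" if "a :. A" "b :. A" "a **.A b = 1@A" for a b using that inv[OF that] unfolding Units_def by blast
 have uf: "a : Units A & b : Units A" if ab: "a :. A" "b :. A" "a **.A b : Units A" for a b
 proof -
  obtain u where u: "u :. A" "u **.A (a **.A b) = 1@A" "(a **.A b) **.A u = 1@A" using ab(3) unfolding Units_def by auto
  thus ?thesis using U[of a "b **.A u"] U[of "u **.A a" b] ab(1,2) by (simp add: A.m_assoc)
 qed
 have "a ++.A b ~: Units A" if ab: "a :. A" "b :. A" "a ~: Units A" "b ~: Units A" for a b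
 proof
  assume "a ++.A b : Units A"
  then obtain u where u: "u :. A" "u **.A (a ++.A b) = 1@A" unfolding Units_def by blast
  define c d where "c = u **.A a" and "d = u **.A b"
  have cd: "c :. A" "d :. A" "c ++.A d = 1@A" using u ab by (simp_all add: c_def d_def A.r_distr)
  have "c ~: Units A" "d ~: Units A" using uf[OF u(1) ab(1)] uf[OF u(1) ab(2)] ab(3,4) by (auto simp: c_def d_def)
  then obtain k :: nat where k: "c [^].A k = 0@A" using unit_or_nilpotent[OF triv cd(1)] by blast
  have d: "d = 1@A --.A c" unfolding cd(3)[symmetric] using cd(1,2) by algebra
  \<comment> \<open>Partial sums of the geometric series in \<open>c\<close> invert \<open>d\<close>
    up to a power of \<open>c\<close>.\<close>
  have "EX w:car A. w **.A d = 1@A --.A c [^].A m" for m :: nat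
  proof (induct m)
   case 0
   show ?case by (rule bexI[of _ "0@A"]) (use cd in simp_all)
  next
   case (Suc m)
   then obtain w where w: "w :. A" "w **.A d = 1@A --.A c [^].A m" by blast
   define p where "p = c [^].A m"
   have p: "p :. A" using cd by (simp add: p_def)
   have "(w ++.A p) **.A d = w **.A d ++.A (p **.A 1@A --.A p **.A c)" unfolding d using w(1) p cd(1) by algebra
   also have "... = 1@A --.A p **.A c" unfolding w(2) p_def[symmetric] A.r_one[OF p] using p cd(1) by algebra
   finally show ?case using w p by (intro bexI[of _ "w ++.A p"]) (simp_all add: p_def)
  qed
  then obtain w where "w :. A" "w **.A d = 1@A --.A c [^].A k" by blast
  thus False using U[of w d] k cd(2) `d ~: Units A` by simp
 qed
 note add = this
 show ?thesis by unfold_locales (rule ne | (rule uf add; assumption))+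
qed

text \<open>An idempotent \<open>f\<close> of the corner splits \<open>e\<close> into the orthogonal
  idempotents \<open>f\<close> and \<open>e - f\<close>, so primitivity leaves only the trivial
  ones.\<close>

lemma corner_local:
 assumes pe: "primitive_idempotent A e" shows "local_ring (corner A e)"
proof -
 have e: "e :. A" "e **.A e = e" "e ~= 0@A" and prim: "!!f g. [|f :. A; g :. A; f **.A f = f; g **.A g = g;
   f **.A g = 0@A; g **.A f = 0@A; e = f ++.A g|] ==> f = 0@A | g = 0@A" using pe unfolding primitive_idempotent_def by blast+
 interpret C: fd_algebra K "corner A e" by (rule corner_fd[OF e(1,2)])
 have "f = 0@A | f = e" if f: "f :. A" "e **.A f = f" "f **.A e = f" "f **.A f = f" for f
 proof -
  define g where "g = e --.A f"
  have g: "g :. A" using e f by (simp add: g_def)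
  have eqs: "f **.A g = f **.A e --.A f **.A f" "g **.A f = e **.A f --.A f **.A f"
   "g **.A g = (e **.A e --.A e **.A f) --.A f **.A g" "e = f ++.A g" unfolding g_def using e(1) f(1) by algebra+
  have fg: "f **.A g = 0@A" "g **.A f = 0@A" using eqs(1,2) f by simp_all
  hence "g **.A g = g" using eqs(3) e f by (simp add: g_def)
  from prim[OF f(1) g f(4) this fg eqs(4)] show ?thesis using A.diff_eq_zero_iff[OF e(1) f(1)] by (auto simp: g_def)
 qed
 thus ?thesis using C.trivial_idempotents_local e(3) by simp
qed

end

section \<open>Free modules over a local ring, relative to an ideal\<close>

text \<open>If \<open>J\<close> maps \<open>V\<close> into \<open>U\<close>, this says that the
  \<open>z i\<close> represent a basis of \<open>V / U\<close> over \<open>R / J\<close>. Speaking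
  of representatives avoids forming either quotient.\<close>

definition basis_mod :: "('c, 'b) ring_scheme => ('c, 'm) module => 'm set => 'c set => (nat => 'm) => nat => bool" where
 "basis_mod R V U J z p <-> spans_mod R V U z p &
  (ALL c:p ->. R. (+/.V i<p. c i *>.V z i) : U --> (ALL i<p. c i : J))"

lemma basis_modD:
 assumes "basis_mod R V U J z p" shows "spans_mod R V U z p" "z : p ->. V" and "[|c : p ->. R; (+/.V i<p. c i *>.V z i) : U; i < p|] ==> c i : J"
 using assms unfolding basis_mod_def spans_mod_def by blast+

lemma spans_modE:
 assumes "spans_mod R V U z p" "x :. V" obtains c where "c : p ->. R" "x --.V (+/.V i<p. c i *>.V z i) : U"
 using assms unfolding spans_mod_def by blast

text \<open>Elements that form a module over \<open>R / J\<close> modulo \<open>U\<close>, with an explicit dual basis.\<close>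

locale relative_module = R?: local_ring R + V?: right_module R V
 for R :: "('c, 'b) ring_scheme" and V :: "('c, 'm) module" +
 fixes U :: "'m set" and J :: "'c set"
 assumes U: "subm U R V" and J_sub: "J <= car R" and J_zero: "0@R : J" and J_add: "!!a b. a : J ==> b : J ==> a ++.R b : J"
  and J_left: "!!a b. a :. R ==> b : J ==> a **.R b : J" and J_right: "!!a b. a : J ==> b :. R ==> a **.R b : J"
  and J_act: "!!a v. a : J ==> v :. V ==> a *>.V v : U"
begin

lemma J_carrier: "a : J ==> a :. R" using J_sub by blast

lemma J_minus: "a : J ==> ~-.R a : J" using J_left[of "~-.R 1@R" a] J_carrier[of a] by (simp add: R.l_minus)

lemma J_diff: "a : J ==> b : J ==> a --.R b : J" by (simp add: a_minus_def J_add J_minus)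

lemma J_finsum:
 assumes "!!i. i : I ==> f i : J" shows "(+/.R i:I. f i) : J" using assms
proof (induct I rule: infinite_finite_induct)
 case (insert i I)
 thus ?case using J_carrier by (simp add: Pi_iff J_add)
qed (simp_all add: R.finsum_infinite J_zero)

lemma J_diff_swap: "[|a :. R; b :. R; a --.R b : J; b : J|] ==> a : J" using J_add[of "a --.R b" b] by (simp add: R.diff_add_cancel)

lemma unit_J: "[|u : Units R; a :. R; u **.R a : J|] ==> a : J"
proof -
 assume u: "u : Units R" "a :. R" "u **.R a : J"
 have "inv\<^bsub>R\<^esub> u **.R (u **.R a) : J" by (rule J_left[OF _ u(3)]) (use u in simp)
 also have "inv\<^bsub>R\<^esub> u **.R (u **.R a) = inv\<^bsub>R\<^esub> u **.R u **.R a" using u by (intro R.m_assoc[symmetric]) auto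
 finally show "a : J" using u by simp
qed

text \<open>Gaussian elimination: \<open>1 - nu p p\<close> is a unit, so the last congruence can be
  solved for \<open>c p\<close>. Substituting the solution leaves a smaller system whose
  coefficients \<open>mu\<close> are again nonunits.\<close>

lemma nakayama:
 assumes "!!l. l < p ==> c l :. R" and "!!l k. l < p ==> k < (p :: nat) ==> nu l k :. R & nu l k ~: Units R"
  and "!!l. l < p ==> c l --.R (+/.R k<p. nu l k **.R c k) : J" and "l < p" shows "c l : J" using assms
proof (induct p arbitrary: nu l)
 case (Suc p)
 note c = Suc(2) and nu = Suc(3) and rel = Suc(4)
 have nuc: "nu l k **.R c k :. R" if "l < Suc p" "k < Suc p" for l k using c nu that by blast
 have cp: "c p :. R" "nu p p :. R" using c nu by auto
 have unit: "1@R --.R nu p p : Units R" using nu[of p p] R.one_diff_nonunit by simp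
 define u where "u = inv\<^bsub>R\<^esub> (1@R --.R nu p p)"
 have u: "u :. R" "u **.R (1@R --.R nu p p) = 1@R" using unit by (simp_all add: u_def)
 define S where "S l = (+/.R k<p. nu l k **.R c k)" for l
 have S: "S l :. R" if "l < Suc p" for l unfolding S_def using nuc that by (intro R.finsum_closed) auto
 have rel': "c l --.R (nu l p **.R c p ++.R S l) : J" if l: "l < Suc p" for l
 proof -
  have "(+/.R k:{..<Suc p}. nu l k **.R c k) = nu l p **.R c p ++.R S l" unfolding S_def lessThan_Suc using nuc l by (intro R.finsum_insert) auto
  thus ?thesis using rel[OF l] by simp
 qed
 have cpJ: "c p --.R u **.R S p : J"
 proof -
  define a where "a = S p"
  have a: "a :. R" using S by (simp add: a_def)
  have "u **.R (c p --.R (nu p p **.R c p ++.R a)) = (u **.R (1@R --.R nu p p)) **.R c p --.R u **.R a" using u(1) cp a by algebra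
  hence "u **.R (c p --.R (nu p p **.R c p ++.R a)) = c p --.R u **.R a" using u(2) cp by simp
  thus ?thesis using J_left[OF u(1) rel'[of p]] by (simp add: a_def)
 qed
 define mu where "mu l k = nu l k ++.R nu l p **.R (u **.R nu p k)" for l k
 have mu: "mu l k :. R & mu l k ~: Units R" if "l < p" "k < p" for l k
  using nu[of l k] nu[of l p] nu[of p k] u(1) that R.nonunit_add R.nonunit_mult_right unfolding mu_def by simp
 have rel2: "c l --.R (+/.R k<p. mu l k **.R c k) : J" if l: "l < p" for l
 proof -
  have nul: "nu l p :. R" using nu[of l p] l by simp
  have "(+/.R k<p. mu l k **.R c k) = (+/.R k<p. nu l k **.R c k ++.R (nu l p **.R u) **.R (nu p k **.R c k))"
   by (rule R.finsum_cong') (use nu c u(1) nul l in "auto simp: mu_def R.l_distr R.m_assoc")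
  also have "... = S l ++.R (+/.R k<p. (nu l p **.R u) **.R (nu p k **.R c k))" unfolding S_def by (rule R.finsum_addf) (use nuc nul u(1) l in auto)
  also have "(+/.R k<p. (nu l p **.R u) **.R (nu p k **.R c k)) = (nu l p **.R u) **.R S p"
   unfolding S_def by (rule R.finsum_rdistr[symmetric]) (use nuc nul u(1) in auto)
  finally have eq: "(+/.R k<p. mu l k **.R c k) = S l ++.R (nu l p **.R u) **.R S p" .
  define a b d where "a = S l" and "b = S p" and "d = c l"
  have ab: "a :. R" "b :. R" "d :. R" using S c l by (simp_all add: a_def b_def d_def)
  have "(d --.R (nu l p **.R c p ++.R a)) ++.R nu l p **.R (c p --.R u **.R b) = d --.R (a ++.R (nu l p **.R u) **.R b)"
   using ab nul cp(1) u(1) by algebra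
  thus ?thesis unfolding eq using J_add[OF rel'[of l] J_left[OF nul cpJ]] l by (simp add: a_def b_def d_def)
 qed
 have IH: "c l : J" if "l < p" for l by (rule Suc(1)[of mu]) (use c mu rel2 that in auto)
 have "u **.R S p : J" unfolding S_def using nu IH by (intro J_left[OF u(1)] J_finsum J_left) auto
 hence "c p : J" using J_diff_swap[OF cp(1) _ cpJ] u(1) S by simp
 with IH Suc(5) show ?case by (cases "l = p") auto
qed simp

text \<open>The dual basis criterion for projectivity of \<open>V / U\<close> over
  \<open>R / J\<close>, with every identity weakened to a congruence modulo \<open>U\<close> or
  \<open>J\<close>.\<close>

definition dual_basis_rel :: "nat => (nat => 'm) => (nat => 'm => 'c) => bool" where
 "dual_basis_rel m x gam <-> x : m ->. V &
  (ALL i<m. ALL v:car V. gam i v :. R) &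
  (ALL v:car V. v --.V (+/.V i<m. gam i v *>.V x i) : U) &
  (ALL i<m. ALL v:car V. ALL w:car V. gam i (v ++.V w) --.R (gam i v ++.R gam i w) : J) &
  (ALL i<m. ALL a:car R. ALL v:car V. gam i (a *>.V v) --.R gam i v **.R a : J) &
  (ALL i<m. ALL u:U. gam i u : J)"

text \<open>Projective modules over a local ring are free, in relative form. Expanding
  \<open>z k\<close> in the dual basis and the result in \<open>z\<close> again gives a matrix
  \<open>tau\<close>. It maps the coefficients of a relation into \<open>J\<close>, because the
  functionals do so already, and it differs from the identity by a matrix of nonunits. Hence
  \<open>nakayama\<close> applies to the coefficients.\<close>

lemma relations_in_J:
 assumes db: "dual_basis_rel m x gam" and sp: "spans_mod R V U z p" and nu: "nonunit_relations R V U z p"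
  and c: "c : p ->. R" and rel: "(+/.V k<p. c k *>.V z k) : U" and l: "l < p" shows "c l : J"
proof -
 have z: "z : p ->. V" using sp by (simp add: spans_mod_def)
 have x: "x : m ->. V" and gamcl: "!!i v. i < m ==> v :. V ==> gam i v :. R" and gamsum: "!!v. v :. V ==> v --.V (+/.V i<m. gam i v *>.V x i) : U"
  and gamadd: "!!i v w. i < m ==> v :. V ==> w :. V ==> gam i (v ++.V w) --.R (gam i v ++.R gam i w) : J"
  and gamact: "!!i a v. i < m ==> a :. R ==> v :. V ==> gam i (a *>.V v) --.R gam i v **.R a : J" and gamU: "!!i u. i < m ==> u : U ==> gam i u : J"
  using db unfolding dual_basis_rel_def by blast+
 have zk: "z k :. V" if "k < p" for k using z that by auto
 have xi: "x i :. V" if "i < m" for i using x that by auto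
 have ck: "c k :. R" if "k < p" for k using c that by auto
 have gamlin: "gam i (+/.V k<q. c k *>.V z k) --.R (+/.R k<q. gam i (z k) **.R c k) : J" if i: "i < m" and "q <= p" for i q using `q <= p`
 proof (induct q)
  case 0
  have "gam i 0@V : J" by (rule gamU[OF i V.submod_zero[OF U]])
  thus ?case using J_carrier by simp
 next
  case (Suc q)
  define s where "s = (+/.V k<q. c k *>.V z k)"
  define t where "t = (+/.R k<q. gam i (z k) **.R c k)"
  define w where "w = c q *>.V z q"
  have sV: "s :. V" unfolding s_def using c z Suc(2) by (intro V.sum_closed) auto
  have tR: "t :. R" unfolding t_def using gamcl[OF i zk] ck Suc(2) by (intro R.finsum_closed) auto
  have wV: "w :. V" unfolding w_def using ck zk Suc(2) by simp
  define r where "r = gam i (z q) **.R c q"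
  have rR: "r :. R" unfolding r_def using gamcl[OF i zk] ck Suc(2) by simp
  have e1: "(+/.V k:{..<Suc q}. c k *>.V z k) = w ++.V s" unfolding s_def w_def lessThan_Suc using ck zk Suc(2) by (intro V.M.finsum_insert) auto
  have e2: "(+/.R k:{..<Suc q}. gam i (z k) **.R c k) = r ++.R t"
   unfolding t_def r_def lessThan_Suc using ck gamcl[OF i zk] Suc(2) by (intro R.finsum_insert) auto
  have 1: "gam i s --.R t : J" using Suc by (simp add: s_def t_def)
  have 2: "gam i w --.R r : J" unfolding w_def r_def by (rule gamact[OF i]) (use ck zk Suc(2) in auto)
  have 3: "gam i (w ++.V s) --.R (gam i w ++.R gam i s) : J" by (rule gamadd[OF i wV sV])
  define A B C where "A = gam i s" and "B = gam i w" and "C = gam i (w ++.V s)"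
  have ABC: "A :. R" "B :. R" "C :. R" using gamcl[OF i] sV wV by (simp_all add: A_def B_def C_def)
  have "C --.R (r ++.R t) = (C --.R (B ++.R A)) ++.R ((B --.R r) ++.R (A --.R t))"
  proof -
   have "(B --.R r) ++.R (A --.R t) = (B ++.R A) --.R (r ++.R t)" by (rule R.add_diff_add[symmetric]) (use ABC rR tR in auto)
   thus ?thesis using R.diff_add_diff[of C "B ++.R A" "r ++.R t"] ABC rR tR by simp
  qed
  thus ?case unfolding e1 e2 using J_add[OF 3 J_add[OF 2 1]] by (simp add: A_def B_def C_def)
 qed
 define g where "g i k = gam i (z k)" for i k
 have g: "g i k :. R" if "i < m" "k < p" for i k using gamcl zk that by (simp add: g_def)
 define G where "G i = (+/.R k<p. g i k **.R c k)" for i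
 have Gcl: "G i :. R" if "i < m" for i unfolding G_def using g ck that by (intro R.finsum_closed) auto
 have GJ: "G i : J" if i: "i < m" for i
 proof -
  have a: "gam i (+/.V k<p. c k *>.V z k) : J" by (rule gamU[OF i rel])
  have "gam i (+/.V k<p. c k *>.V z k) --.R G i : J" using gamlin[OF i, of p] by (simp add: G_def g_def)
  from J_diff[OF a this] show ?thesis using J_carrier[OF a] Gcl[OF i] by (simp add: R.diff_diff_cancel)
 qed
 have "ALL i:{..<m}. EX d. d : p ->. R & x i --.V (+/.V l<p. d l *>.V z l) : U" using sp xi unfolding spans_mod_def by (metis lessThan_iff)
 from bchoice[OF this] obtain sig0 where sig0: "!!i. i < m ==> sig0 i : p ->. R"
  "!!i. i < m ==> x i --.V (+/.V l<p. sig0 i l *>.V z l) : U" by auto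
 define sig where "sig l i = sig0 i l" for l i
 have sig: "sig l i :. R" if "l < p" "i < m" for l i using sig0(1)[OF that(2)] that(1) by (auto simp: sig_def)
 define tau where "tau l k = (+/.R i<m. sig l i **.R g i k)" for l k
 have tau: "tau l k :. R" if "l < p" "k < p" for l k unfolding tau_def using sig g that by (intro R.finsum_closed) auto
 have ztau: "z k --.V (+/.V l<p. tau l k *>.V z l) : U" if k: "k < p" for k
 proof -
  have gx: "g i k *>.V x i :. V" if "i < m" for i using g xi k that by simp
  define X where "X i = (+/.V l<p. sig l i *>.V z l)" for i
  have X: "X i :. V" if "i < m" for i unfolding X_def using sig z that by (intro V.sum_closed) auto
  have "(+/.V i<m. g i k *>.V x i) --.V (+/.V i<m. g i k *>.V X i) = (+/.V i<m. g i k *>.V x i --.V g i k *>.V X i)"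
   by (rule V.M.finsum_diff[symmetric]) (use gx g X k in auto)
  also have "... : U"
  proof (rule V.submod_finsum[OF U])
   fix i assume i: "i : {..<m}"
   hence "g i k *>.V x i --.V g i k *>.V X i = g i k *>.V (x i --.V X i)" using g X xi k by (simp add: V.act_diff)
   thus "g i k *>.V x i --.V g i k *>.V X i : U" using V.submod_act[OF U g[of i k]] sig0(2)[of i] i k by (simp add: X_def sig_def)
  qed
  finally have 1: "(+/.V i<m. g i k *>.V x i) --.V (+/.V i<m. g i k *>.V X i) : U" .
  have 2: "z k --.V (+/.V i<m. g i k *>.V x i) : U" using gamsum[OF zk[OF k]] by (simp add: g_def)
  have "(+/.V i<m. g i k *>.V X i) = (+/.V i<m. +/.V l<p. (sig l i **.R g i k) *>.V z l)"
  proof (rule V.M.finsum_cong')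
   fix i assume i: "i : {..<m}"
   show "g i k *>.V X i = (+/.V l<p. (sig l i **.R g i k) *>.V z l)" unfolding X_def by (rule V.sum_act[symmetric]) (use sig g z i k in auto)
  qed (use sig g z k in "auto intro!: V.sum_closed")
  also have "... = (+/.V l<p. +/.V i<m. (sig l i **.R g i k) *>.V z l)" by (rule V.M.finsum_swap) (use sig g zk k in auto)
  also have "... = (+/.V l<p. tau l k *>.V z l)"
  proof (rule V.M.finsum_cong')
   fix l assume l: "l : {..<p}"
   thus "(+/.V i<m. (sig l i **.R g i k) *>.V z l) = tau l k *>.V z l" unfolding tau_def using sig g zk k by (intro V.finsum_act[symmetric]) auto
  qed (use tau zk k in auto)
  finally have 3: "(+/.V i<m. g i k *>.V X i) = (+/.V l<p. tau l k *>.V z l)" .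
  have cl: "(+/.V i<m. g i k *>.V x i) :. V" "(+/.V l<p. tau l k *>.V z l) :. V" using g x tau z k by (auto intro!: V.sum_closed)
  show ?thesis using V.submod_add[OF U 2 1[unfolded 3]] V.M.diff_add_diff[OF zk[OF k] cl] by simp
 qed
 \<comment> \<open>For fixed \<open>k\<close>, the entries \<open>nu l k\<close> are the
   coefficients of a relation among the \<open>z l\<close>, since \<open>tau\<close> reproduces
   \<open>z k\<close> modulo \<open>U\<close>. Minimality of \<open>z\<close> makes them
   nonunits.\<close>
 define nu where "nu l k = (if l = k then 1@R else 0@R) --.R tau l k" for l k
 have nucl: "nu l k :. R" if "l < p" "k < p" for l k using tau that by (simp add: nu_def)
 have nunu: "nu l k ~: Units R" if l: "l < p" and k: "k < p" for l k
 proof -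
  have "(+/.V l<p. nu l k *>.V z l) = (+/.V l<p. (if l = k then 1@R else 0@R) *>.V z l) --.V (+/.V l<p. tau l k *>.V z l)"
   unfolding nu_def by (rule V.sum_diff) (use tau z k in auto)
  also have "(+/.V l<p. (if l = k then 1@R else 0@R) *>.V z l) = z k" using k zk by (subst V.M.finsum_single[of _ k]) (auto simp: V.act_one)
  finally have "(+/.V l<p. nu l k *>.V z l) : U" using ztau[OF k] by simp
  from nonunit_relationsD[OF nu this _ l] show ?thesis using nucl k by blast
 qed
 show ?thesis
 proof (rule nakayama[where nu = nu and p = p and c = c, OF ck _ _ l])
  show "nu l k :. R & nu l k ~: Units R" if "l < p" "k < p" for l k using nucl nunu that by blast
  fix l assume l: "l < p"
  have "(+/.R k<p. nu l k **.R c k) = (+/.R k<p. (if l = k then 1@R else 0@R) **.R c k --.R tau l k **.R c k)"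
  proof (rule R.finsum_cong')
   fix k assume k: "k : {..<p}"
   define a b where "a = tau l k" and "b = c k"
   have ab: "a :. R" "b :. R" using tau l k ck by (auto simp: a_def b_def)
   show "nu l k **.R c k = (if l = k then 1@R else 0@R) **.R c k --.R tau l k **.R c k"
   proof -
    have "(e --.R a) **.R b = e **.R b --.R a **.R b" if "e :. R" for e using that ab by algebra
    thus ?thesis unfolding nu_def a_def b_def by simp
   qed
  qed (use tau ck l in auto)
  also have "... = (+/.R k<p. (if l = k then 1@R else 0@R) **.R c k) --.R (+/.R k<p. tau l k **.R c k)" by (rule R.finsum_diff) (use tau ck l in auto)
  also have "(+/.R k<p. (if l = k then 1@R else 0@R) **.R c k) = c l" using l ck by (subst R.finsum_single[of _ l]) auto
  finally have e: "(+/.R k<p. nu l k **.R c k) = c l --.R (+/.R k<p. tau l k **.R c k)" .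
  have "(+/.R k<p. tau l k **.R c k) = (+/.R k<p. +/.R i<m. sig l i **.R (g i k **.R c k))"
  proof (rule R.finsum_cong')
   fix k assume k: "k : {..<p}"
   have "tau l k **.R c k = (+/.R i<m. sig l i **.R g i k **.R c k)" unfolding tau_def by (rule R.finsum_ldistr) (use sig g ck l k in auto)
   also have "... = (+/.R i<m. sig l i **.R (g i k **.R c k))" by (rule R.finsum_cong') (use sig g ck l k in "auto simp: R.m_assoc")
   finally show "tau l k **.R c k = (+/.R i<m. sig l i **.R (g i k **.R c k))" .
  qed (use sig g ck l in "auto intro!: R.finsum_closed")
  also have "... = (+/.R i<m. +/.R k<p. sig l i **.R (g i k **.R c k))" by (rule R.finsum_swap) (use sig g ck l in auto)
  also have "... : J"
  proof (rule J_finsum)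
   fix i assume i: "i : {..<m}"
   have "(+/.R k<p. sig l i **.R (g i k **.R c k)) = sig l i **.R G i" unfolding G_def by (rule R.finsum_rdistr[symmetric]) (use sig g ck l i in auto)
   thus "(+/.R k<p. sig l i **.R (g i k **.R c k)) : J" using J_left[OF sig GJ] l i by simp
  qed
  finally have tJ: "(+/.R k<p. tau l k **.R c k) : J" .
  show "c l --.R (+/.R k<p. nu l k **.R c k) : J" unfolding e using tJ J_carrier[OF tJ] ck[OF l] by (simp add: R.diff_diff_cancel)
 qed
qed

text \<open>A quotient of a projective module by a free submodule is free: an element \<open>s\<close> of the left
  socle detects that a basis of the submodule stays part of a minimal generating family.\<close>

lemma quotient_basis:
 assumes db: "dual_basis_rel m x gam" and fg: "EX z p. spans_mod R V U z p" and Om: "subm Om R V" and W: "subm W R V"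
  and W_iff: "!!w. w :. V ==> w : W <-> (EX om:Om. w --.V om : U)" and y: "basis_mod R (V(|carrier := Om|)) (U Int Om) J y q"
  and s: "s :. R" "s ~: J" "!!n. n :. R ==> n ~: Units R ==> n **.R s : J" shows "EX v p. basis_mod R V W J v p"
proof -
 have UW: "U <= W"
 proof
  fix u assume u: "u : U"
  hence "u --.V 0@V : U" using V.submod_carrier[OF U] by simp
  thus "u : W" using W_iff[of u] V.submod_zero[OF Om] V.submod_carrier[OF U u] by blast
 qed
 have OmW: "Om <= W"
 proof
  fix w assume w: "w : Om"
  hence "w --.V w : U" using V.submod_carrier[OF Om] V.submod_zero[OF U] by simp
  thus "w : W" using W_iff[of w] w V.submod_carrier[OF Om w] by blast
 qed
 obtain v p where v: "spans_mod R V W v p" and vnu: "nonunit_relations R V W v p"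
  using V.minimal_generators[OF W] fg UW by (blast intro: spans_mod_mono)
 have vV: "v : p ->. V" using v by (simp add: spans_mod_def)
 have yO: "y : {..<q} -> Om" using basis_modD(2)[OF y] by simp
 have yV: "y : q ->. V" using yO V.submod_carrier[OF Om] by (auto simp: Pi_iff)
 have ysum: "(+/.(V(|carrier := Om|)) i<q. d i *>.(V(|carrier := Om|)) y i) = (+/.V i<q. d i *>.V y i)"
  if "d : q ->. R" for d using V.finsum_submod[OF Om, of "%i. d i *>.V y i" "{..<q}"] V.submod_act[OF Om] that yO by (simp add: Pi_iff)
 have yrel: "d i : J" if "d : q ->. R" "(+/.V i<q. d i *>.V y i) : U" "i < q" for d i
 proof -
  have "(+/.V i<q. d i *>.V y i) : Om" by (rule V.submod_finsum[OF Om]) (use V.submod_act[OF Om] that yO in auto)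
  thus ?thesis using basis_modD(3)[OF y that(1)] ysum[OF that(1)] that by simp
 qed
 \<comment> \<open>Minimal generators of \<open>V / W\<close> followed by the basis of
   \<open>Om\<close> generate \<open>V\<close> modulo \<open>U\<close>. Once all their relations
   have nonunit coefficients, \<open>relations_in_J\<close> applies to them.\<close>
 define z where "z i = (if i < p then v i else y (i - p))" for i
 have zV: "z : (p + q) ->. V" using vV yV by (auto simp: z_def Pi_iff)
 have zsum: "(+/.V i:{..<p + q}. c i *>.V z i) = (+/.V i<p. c i *>.V v i) ++.V (+/.V i<q. c (p + i) *>.V y i)"
  if c: "c : (p + q) ->. R" for c
 proof -
  have "(+/.V i:{..<p + q}. c i *>.V z i) = (+/.V i<p. c i *>.V z i) ++.V (+/.V i<q. c (p + i) *>.V z (p + i))"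
   by (rule V.M.finsum_split) (use c zV in "auto simp: Pi_iff")
  moreover have "(+/.V i<p. c i *>.V z i) = (+/.V i<p. c i *>.V v i)" by (rule V.M.finsum_cong') (use c vV in "auto simp: z_def Pi_iff")
  moreover have "(+/.V i<q. c (p + i) *>.V z (p + i)) = (+/.V i<q. c (p + i) *>.V y i)"
   by (rule V.M.finsum_cong') (use c yV in "auto simp: z_def Pi_iff")
  ultimately show ?thesis by simp
 qed
 have ext: "EX c:(p + q) ->. R. (ALL i<p. c i = a i) & w --.V (+/.V i:{..<p + q}. c i *>.V z i) : U"
  if a: "a : p ->. R" and w: "w :. V" "w --.V (+/.V i<p. a i *>.V v i) : W" for a w
 proof -
  define A where "A = (+/.V i<p. a i *>.V v i)"
  have A: "A :. V" unfolding A_def using a vV by (rule V.sum_closed)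
  obtain om where om: "om : Om" "(w --.V A) --.V om : U" using W_iff[of "w --.V A"] w A unfolding A_def by auto
  have omV: "om :. V" by (rule V.submod_carrier[OF Om om(1)])
  obtain d where d: "d : q ->. R"
   "om --.(V(|carrier := Om|)) (+/.(V(|carrier := Om|)) i<q. d i *>.(V(|carrier := Om|)) y i) : U Int Om"
   using spans_modE[OF basis_modD(1)[OF y], of om] om(1) by auto
  define D where "D = (+/.V i<q. d i *>.V y i)"
  have D: "D : Om" unfolding D_def by (rule V.submod_finsum[OF Om]) (use V.submod_act[OF Om] d(1) yO in auto)
  have DV: "D :. V" by (rule V.submod_carrier[OF Om D])
  have "om --.V D : U" using d(2) ysum[OF d(1)] V.minus_submod[OF Om D] by (simp add: a_minus_def D_def)
  hence "((w --.V A) --.V om) ++.V (om --.V D) : U" by (rule V.submod_add[OF U om(2)])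
  moreover have "((w --.V A) --.V om) ++.V (om --.V D) = w --.V (A ++.V D)" using w(1) A omV DV by algebra
  ultimately have U': "w --.V (A ++.V D) : U" by simp
  let ?c = "%i. if i < p then a i else d (i - p)"
  have c: "?c : (p + q) ->. R" using a d(1) by (auto simp: Pi_iff)
  have "(+/.V i<p. ?c i *>.V v i) = A" "(+/.V i<q. ?c (p + i) *>.V y i) = D"
   unfolding A_def D_def by (rule V.M.finsum_cong'; use a d(1) vV yV in "auto simp: Pi_iff")+
  thus ?thesis using c U' zsum[OF c] by (intro bexI[of _ ?c]) auto
 qed
 have zsp: "spans_mod R V U z (p + q)" unfolding spans_mod_def
 proof (intro conjI ballI zV)
  fix w assume w: "w :. V"
  obtain a where a: "a : p ->. R" "w --.V (+/.V i<p. a i *>.V v i) : W" using v w by (rule spans_modE)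
  from ext[OF a(1) w a(2)] show "EX c:(p + q) ->. R. w --.V (+/.V i:{..<p + q}. c i *>.V z i) : U" by blast
 qed
 have znu: "nonunit_relations R V U z (p + q)" unfolding nonunit_relations_def
 proof (intro ballI impI allI)
  fix c i assume c: "c : (p + q) ->. R" and rel: "(+/.V i:{..<p + q}. c i *>.V z i) : U" and i: "i < p + q"
  define A where "A = (+/.V i<p. c i *>.V v i)"
  define D where "D = (+/.V i<q. c (p + i) *>.V y i)"
  have c1: "c : p ->. R" "(%i. c (p + i)) : q ->. R" using c by (auto simp: Pi_iff)
  have A: "A :. V" unfolding A_def using c1(1) vV by (rule V.sum_closed)
  have D: "D : Om" unfolding D_def by (rule V.submod_finsum[OF Om]) (use V.submod_act[OF Om] c1(2) yO in auto)
  have DV: "D :. V" by (rule V.submod_carrier[OF Om D])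
  have AD: "A ++.V D : U" using rel zsum[OF c] by (simp add: A_def D_def)
  have "(A ++.V D) --.V D : W" using AD UW D OmW V.submod_diff[OF W] by blast
  hence "A : W" using A DV by (simp add: V.M.add_diff_cancel)
  hence anu: "c i ~: Units R" if "i < p" for i using nonunit_relationsD[OF vnu _ c1(1) that] by (simp add: A_def)
  \<comment> \<open>The coefficients of \<open>A\<close> are nonunits, so \<open>s\<close>
    annihilates \<open>A\<close> modulo \<open>U\<close>. The relation then leaves only the part
    \<open>D\<close> multiplied by \<open>s\<close>; freeness of \<open>y\<close> puts
    \<open>c (p + i) s\<close> into \<open>J\<close>, which is impossible for a unit
    \<open>c (p + i)\<close> because \<open>s\<close> is not in \<open>J\<close>.\<close>
  have sA: "s *>.V A : U"
  proof -
   have "s *>.V A = (+/.V i<p. (c i **.R s) *>.V v i)" unfolding A_def by (rule V.sum_act[symmetric, OF c1(1) s(1) vV])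
   also have "... : U" by (rule V.submod_finsum[OF U]) (use J_act s(3) c1(1) anu vV in "auto simp: Pi_iff")
   finally show ?thesis .
  qed
  have "s *>.V (A ++.V D) --.V s *>.V A : U" by (rule V.submod_diff[OF U V.submod_act[OF U s(1) AD] sA])
  moreover have "s *>.V (A ++.V D) --.V s *>.V A = s *>.V D"
  proof -
   have "(a ++.V d) --.V a = d" if "a :. V" "d :. V" for a d using that by algebra
   thus ?thesis using A DV s(1) by (simp add: V.act_add_module)
  qed
  moreover have "s *>.V D = (+/.V i<q. (c (p + i) **.R s) *>.V y i)" unfolding D_def by (rule V.sum_act[symmetric, OF c1(2) s(1) yV])
  ultimately have csJ: "c (p + i) **.R s : J" if "i < q" for i using yrel[of "%i. c (p + i) **.R s" i] c1(2) s(1) that by (auto simp: Pi_iff)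
  have bnu: "c (p + i) ~: Units R" if "i < q" for i using unit_J[OF _ s(1) csJ[OF that]] s(2) by blast
  show "c i ~: Units R" using anu bnu[of "i - p"] i by (cases "i < p") auto
 qed
 have "basis_mod R V W J v p" unfolding basis_mod_def
 proof (intro conjI v ballI impI allI)
  fix c i assume c: "c : p ->. R" and rel: "(+/.V i<p. c i *>.V v i) : W" and i: "i < p"
  let ?a = "%i. ~-.R c i"
  have a: "?a : p ->. R" using c by auto
  have S: "(+/.V i<p. c i *>.V v i) :. V" using c vV by (rule V.sum_closed)
  have "(+/.V i<p. ?a i *>.V v i) = (+/.V i<p. ~-.V (c i *>.V v i))" by (rule V.M.finsum_cong') (use c vV in "auto simp: Pi_iff V.minus_act")
  also have "... = ~-.V (+/.V i<p. c i *>.V v i)" by (rule V.M.finsum_minus) (use c vV in "auto simp: Pi_iff")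
  finally have "0@V --.V (+/.V i<p. ?a i *>.V v i) : W" using rel S by (simp add: a_minus_def)
  from ext[OF a V.M.zero_closed this] obtain d where d: "d : (p + q) ->. R" "!!i. i < p ==> d i = ~-.R c i"
   "0@V --.V (+/.V i:{..<p + q}. d i *>.V z i) : U" by blast
  have "(+/.V i:{..<p + q}. d i *>.V z i) :. V" using d(1) zV by (rule V.sum_closed)
  hence "(+/.V i:{..<p + q}. d i *>.V z i) : U" using V.submod_minus[OF U d(3)] by (simp add: a_minus_def)
  from relations_in_J[OF db zsp znu d(1) this, of i] have "~-.R c i : J" using d(2) i by simp
  thus "c i : J" using J_minus[of "~-.R c i"] c i R.minus_minus[of "c i"] by (simp add: Pi_iff)
 qed
 thus ?thesis by blast
qed

end

section \<open>Modules over corner algebras\<close>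

text \<open>The submodule \<open>U + m R\<close>.\<close>

definition adjoin :: "('a, 'b) ring_scheme => ('a, 'm) module => 'm set => 'm => 'm set" where
 "adjoin R M U m = {x : car M. EX a:car R. x --.M a *>.M m : U}"

context right_module
begin

lemma adjoin_submodule:
 assumes U: "subm U R M" and m: "m :. M" shows "subm (adjoin R M U m) R M" "U <= adjoin R M U m" "m : adjoin R M U m"
proof -
 show "subm (adjoin R M U m) R M"
 proof (rule submodI)
  show "0@M : adjoin R M U m" unfolding adjoin_def using m submod_zero[OF U] by (auto intro!: bexI[of _ "0@R"])
 next
  fix x y assume "x : adjoin R M U m" "y : adjoin R M U m"
  then obtain a b where x: "x :. M" "a :. R" "x --.M a *>.M m : U" and y: "y :. M" "b :. R" "y --.M b *>.M m : U" unfolding adjoin_def by blast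
  have "(x ++.M y) --.M (a ++.R b) *>.M m = (x --.M a *>.M m) ++.M (y --.M b *>.M m)" using x y m by (simp add: act_add_ring M.add_diff_add)
  thus "x ++.M y : adjoin R M U m" unfolding adjoin_def using x y submod_add[OF U x(3) y(3)] by (auto intro!: bexI[of _ "a ++.R b"])
 next
  fix c x assume c: "c :. R" and "x : adjoin R M U m"
  then obtain a where x: "x :. M" "a :. R" "x --.M a *>.M m : U" unfolding adjoin_def by blast
  have "c *>.M x --.M (a **.R c) *>.M m = c *>.M (x --.M a *>.M m)" using x c m by (simp add: act_mult act_diff)
  thus "c *>.M x : adjoin R M U m" unfolding adjoin_def using x c submod_act[OF U c x(3)] by (auto intro!: bexI[of _ "a **.R c"])
 qed (auto simp: adjoin_def)
 show "U <= adjoin R M U m" unfolding adjoin_def using submod_carrier[OF U] m by (auto intro!: bexI[of _ "0@R"])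
 show "m : adjoin R M U m" unfolding adjoin_def using submod_zero[OF U] m by (auto intro!: bexI[of _ "1@R"] simp: act_one)
qed

lemma adjoin_least:
 assumes "subm W R M" "U <= W" "m : W" shows "adjoin R M U m <= W" unfolding adjoin_def
proof clarify
 fix x a assume x: "x :. M" "a :. R" "x --.M a *>.M m : U"
 have "a *>.M m : W" by (rule submod_act[OF assms(1) x(2) assms(3)])
 thus "x : W" using submod_diff_iff[OF assms(1), of x "a *>.M m"] x assms submod_carrier[OF assms(1)] by blast
qed

end

text \<open>Choose \<open>m\<close> outside \<open>U\<close> such that \<open>U + m A\<close> has
  least dimension. If a nonunit \<open>a\<close> moved \<open>m\<close> to an element outside
  \<open>U\<close>, this element would generate the same submodule. That gives some \<open>b\<close>
  for which the unit \<open>1 - a b\<close> moves \<open>m\<close> into \<open>U\<close>, a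
  contradiction.\<close>

lemma (in fd_algebra) socle:
 assumes loc: "local_ring A" and V: "fgm A V" and U: "subm U A V" and neq: "U ~= car V"
 shows "EX m. m :. V & m ~: U & (ALL a:car A. a ~: Units A --> a *>.V m : U)"
proof -
 interpret V: right_module A V using V by (rule fgmD)
 let ?W = "%m. adjoin A V U m"
 let ?mu = "%m. rank K (kmod A (V(|carrier := ?W m|)))"
 obtain m0 where m0: "m0 : car V - U" using neq V.submod_subset[OF U] by blast
 obtain m where m: "m : car V - U" and least: "!!m'. m' : car V - U ==> ?mu m <= ?mu m'"
  using arg_min_natI[of "%m. m : car V - U" m0 ?mu] arg_min_nat_le[of "%m. m : car V - U" _ ?mu] m0 by meson
 have mV: "m :. V" using m by blast
 have "a *>.V m : U" if a: "a :. A" "a ~: Units A" for a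
 proof (rule ccontr)
  assume aU: "a *>.V m ~: U"
  have aV: "a *>.V m :. V" using a m by simp
  note A1 = V.adjoin_submodule[OF U mV] and A2 = V.adjoin_submodule[OF U aV]
  have sub: "?W (a *>.V m) <= ?W m" by (rule V.adjoin_least[OF A1(1,2) V.submod_act[OF A1(1) a(1) A1(3)]])
  have "~ ?W (a *>.V m) \<subset> ?W m" using rank_submodule_mono[OF V A2(1) A1(1)] least[of "a *>.V m"] aU aV by auto
  hence "m : ?W (a *>.V m)" using sub A1(3) by blast
  then obtain b where b: "b :. A" "m --.V b *>.V (a *>.V m) : U" unfolding adjoin_def by blast
  have u: "1@A --.A a **.A b : Units A" by (rule local_ring.one_diff_nonunit[OF loc]) (use a b local_ring.nonunit_mult_right[OF loc] in auto)
  have e: "m --.V b *>.V (a *>.V m) = (1@A --.A a **.A b) *>.V m" using a b mV by (simp add: V.diff_act V.act_one V.act_mult)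
  define v where "v = 1@A --.A a **.A b"
  have v: "v : Units A" "v *>.V m : U" using u b(2) unfolding v_def e by auto
  have "inv\<^bsub>A\<^esub> v *>.V (v *>.V m) : U" by (rule V.submod_act[OF U _ v(2)]) (use v(1) in simp)
  moreover have "inv\<^bsub>A\<^esub> v *>.V (v *>.V m) = (v **.A inv\<^bsub>A\<^esub> v) *>.V m" using v(1) mV by (intro V.act_mult[symmetric]) auto
  ultimately have "m : U" using v(1) mV by (simp add: V.act_one)
  thus False using m by blast
 qed
 thus ?thesis using m by blast
qed

text \<open>The module \<open>M e\<close> over the corner ring \<open>e A e\<close>.\<close>

definition crm :: "('a, 'm) module => 'a => ('a, 'm) module" where
 "crm M e = M(|carrier := {x : car M. e *>.M x = x}|)"

lemma crm_sel [simp]: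
 "x : car (crm M e) <-> x :. M & e *>.M x = x"
 "0@(crm M e) = 0@M" "x ++.(crm M e) y = x ++.M y" "a *>.(crm M e) x = a *>.M x" by (simp_all add: crm_def)

context fd_algebra
begin

text \<open>In general \<open>M e\<close> is no submodule over \<open>A\<close>, but it is a
  subspace over \<open>K\<close>, and this supplies its group structure, sums and negatives.\<close>

lemma corner_subspace:
 assumes M: "rmod A M" and e: "e :. A" shows "subm (car (crm M e)) K (kmod A M)"
proof -
 interpret M: right_module A M by fact
 interpret V: right_module K "kmod A M" using M by (rule kmod_right_module)
 have "e *>.M ((l *>.A 1@A) *>.M x) = (l *>.A 1@A) *>.M (e *>.M x)" if "l :. K" "x :. M" for l x
  using that e scalar_central[of l e] by (simp flip: M.act_mult)
 thus ?thesis by (intro V.submodI) (auto simp: e M.act_add_module)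
qed

lemma finsum_corner_module:
 assumes M: "rmod A M" and e: "e :. A" and f: "f : I -> car (crm M e)" shows "finsum (crm M e) f I = finsum M f I"
proof -
 interpret V: right_module K "kmod A M" using M by (rule kmod_right_module)
 have "finsum (crm M e) f I = finsum ((kmod A M)(|carrier := car (crm M e)|)) f I" by (simp add: finsum_def finprod_def kmod_def crm_def)
 thus ?thesis using V.finsum_submod[OF corner_subspace[OF M e] f] by simp
qed

lemma minus_corner_module:
 assumes M: "rmod A M" and e: "e :. A" and x: "x :. (crm M e)" shows "~-.(crm M e) x = ~-.M x" "y --.(crm M e) x = y --.M x"
proof -
 interpret V: right_module K "kmod A M" using M by (rule kmod_right_module)
 have "~-.(crm M e) x = ~-.((kmod A M)(|carrier := car (crm M e)|)) x" by (simp add: a_inv_def m_inv_def kmod_def crm_def)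
 thus 1: "~-.(crm M e) x = ~-.M x" using V.minus_submod[OF corner_subspace[OF M e] x] by simp
 show "y --.(crm M e) x = y --.M x" by (simp add: a_minus_def 1)
qed

lemma crm_right_module:
 assumes M: "rmod A M" and e: "e :. A" "e **.A e = e" shows "rmod (corner A e) (crm M e)"
proof -
 interpret M: right_module A M by fact
 interpret V: right_module K "kmod A M" using M by (rule kmod_right_module)
 interpret C: ring "corner A e" using e by (rule A.corner_ring)
 interpret G: abelian_group "crm M e" by (rule abelian_group_cong[OF V.submod_abelian_group[OF corner_subspace[OF M e(1)]]]) auto
 show ?thesis
 proof (unfold_locales)
  fix a x assume a: "a :. (corner A e)" and x: "x :. (crm M e)"
  have "e *>.M (a *>.M x) = (a **.A e) *>.M x" by (rule M.act_mult[symmetric]) (use a x e in auto)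
  thus "a *>.(crm M e) x :. (crm M e)" using a x by simp
 qed (simp_all add: M.act_add_ring M.act_add_module M.act_mult)
qed

lemma crm_fg:
 assumes M: "fgm A M" and e: "e :. A" "e **.A e = e" shows "fgm (corner A e) (crm M e)"
proof -
 interpret M: right_module A M using M by (rule fgmD)
 interpret C: fd_algebra K "corner A e" using e by (rule corner_fd)
 have rm: "rmod (corner A e) (crm M e)" by (rule crm_right_module[OF M.rax e])
 interpret F: fin_vector_space K "kmod A M" using M unfolding fg_right_module_iff by blast
 note sub = corner_subspace[OF M.rax e(1)]
 let ?V = "(kmod A M)(|carrier := car (crm M e)|)"
 have "lin K ?V (kmod (corner A e) (crm M e)) (%x. x)"
 proof (rule linI)
  fix l x assume l: "l :. K" and x: "x : car ?V"
  have "(l *>.A e) *>.M x = (e **.A (l *>.A 1@A)) *>.M x" using mult_scalar[OF l e(1)] by simp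
  also have "... = (l *>.A 1@A) *>.M x" using l x e M.act_mult[of e "l *>.A 1@A" x] by simp
  finally show "l *>.?V x = l *>.(kmod (corner A e) (crm M e)) x" by (simp add: corner_def)
 qed auto
 hence "lmap K ?V (kmod (corner A e) (crm M e)) (%x. x)" using F.submod_right_module[OF sub] C.kmod_right_module[OF rm] by (intro lmapI)
 from fg_image[OF this _ F.subspace_fg[OF sub]] have "finitely_generated K (kmod (corner A e) (crm M e))" by auto
 thus ?thesis using rm C.fg_iff_kmod[OF rm] unfolding fg_right_module_def by blast
qed

lemma crm_submodule:
 assumes M: "rmod A M" and U: "subm U A M" and e: "e :. A" "e **.A e = e" shows "subm (U Int car (crm M e)) (corner A e) (crm M e)"
proof -
 interpret M: right_module A M by fact
 interpret C: right_module "corner A e" "crm M e" using M e by (rule crm_right_module)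
 show ?thesis
 proof (rule C.submodI)
  fix c x assume c: "c :. (corner A e)" and x: "x : U Int car (crm M e)"
  have "c *>.(crm M e) x :. (crm M e)" using c x C.act_closed by blast
  thus "c *>.(crm M e) x : U Int car (crm M e)" using c x M.submod_act[OF U] by simp
 qed (use M.submod_zero[OF U] M.submod_add[OF U] e in "auto simp: M.act_add_module")
qed

end

section \<open>Filtrations as chains of steps\<close>

lemma module_isoI:
 assumes "rmod R M" "lin R M N f" "bij_betw f (car M) (car N)" shows "module_iso R M N" unfolding module_iso_def
proof
 show "restrict f (car M) : module_homs R M N" using assms(1,2) by (rule restrict_module_hom)
 show "bij_betw (restrict f (car M)) (car M) (car N)" using assms(3) by (simp cong: bij_betw_cong)
qed

lemma module_isoE:
 assumes "module_iso R M N" obtains f where "lin R M N f" "bij_betw f (car M) (car N)"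
 using assms unfolding module_iso_def Bex_def module_homs_iff by blast

lemma same_kernel_iso:
 assumes f: "lmap R P M f" "f ` car P = car M" and g: "lmap R P N g" "g ` car P = car N" and k: "!!x. x :. P ==> f x = 0@M <-> g x = 0@N"
 shows "module_iso R M N"
proof -
 interpret f: linear_map R P M f by fact
 interpret g: linear_map R P N g by fact
 obtain h where h: "lin R M N h" "ALL x:car P. h (f x) = g x" using f.factor_through[OF g.N.rax g.lin f(2)] k by blast
 interpret h: linear_map R M N h using f.N.rax g.N.rax h(1) by (rule lmapI)
 have "h ` car M = car N" using h(2) by (auto simp flip: f(2) g(2) simp: image_iff)
 moreover have "inj_on h (car M)" unfolding h.inj_iff using h(2) k by (auto simp flip: f(2))
 ultimately show ?thesis by (intro module_isoI[OF f.N.rax h(1)]) (auto simp: bij_betw_def)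
qed

context right_module
begin

lemma subquotient_map:
 assumes U: "subm U R M" and V: "subm V R M" and sub: "U <= V" shows "lmap R (M(|carrier := V|)) (subquotient M V U) (%x. U +>.(M(|carrier := V|)) x)"
  "(%x. U +>.(M(|carrier := V|)) x) ` V = car (subquotient M V U)"
  "x : V ==> U +>.(M(|carrier := V|)) x = 0@(subquotient M V U) <-> x : U"
proof -
 interpret V: right_module R "M(|carrier := V|)" using V by (rule submod_right_module)
 have U': "subm U R (M(|carrier := V|))" using U submod_submod_iff[OF V sub] by blast
 show "lmap R (M(|carrier := V|)) (subquotient M V U) (%x. U +>.(M(|carrier := V|)) x)"
  unfolding subquotient_def using V.quotient_right_module[OF U'] by (intro lmapI[OF V.rax])
 show "(%x. U +>.(M(|carrier := V|)) x) ` V = car (subquotient M V U)" by (simp add: subquotient_def)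
 show "x : V ==> U +>.(M(|carrier := V|)) x = 0@(subquotient M V U) <-> x : U" using V.coset_zero_iff[OF U', of x] by (simp add: subquotient_def)
qed

text \<open>This removes the cosets from filtrations: a factor becomes a surjection from
  \<open>V\<close> with kernel \<open>U\<close>.\<close>

lemma subquotient_iso_iff:
 assumes U: "subm U R M" and V: "subm V R M" and sub: "U <= V" and T: "rmod R T"
 shows "module_iso R (subquotient M V U) T <-> (EX q. lmap R (M(|carrier := V|)) T q & q ` V = car T &
  (ALL x:V. q x = 0@T <-> x : U))"
proof
 note pi = subquotient_map[OF U V sub]
 let ?p = "%x. U +>.(M(|carrier := V|)) x"
 interpret p: linear_map R "M(|carrier := V|)" "subquotient M V U" ?p by (rule pi(1))
 { assume "module_iso R (subquotient M V U) T"
  then obtain f where f: "lin R (subquotient M V U) T f" "bij_betw f (car (subquotient M V U)) (car T)" by (rule module_isoE)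
  interpret f: linear_map R "subquotient M V U" T f using p.N.rax T f(1) by (rule lmapI)
  have "f (?p x) = 0@T <-> x : U" if x: "x : V" for x
  proof -
   have "?p x :. (subquotient M V U)" using x pi(2) by blast
   hence "f (?p x) = 0@T <-> ?p x = 0@(subquotient M V U)" using f(2) f.inj_iff f.map_zero unfolding bij_betw_def by metis
   thus ?thesis using pi(3)[OF x] by blast
  qed
  moreover have "(%x. f (?p x)) ` V = car T" using f(2) pi(2) unfolding bij_betw_def by (metis image_image)
  ultimately show "EX q. lmap R (M(|carrier := V|)) T q & q ` V = car T & (ALL x:V. q x = 0@T <-> x : U)"
   using lmapI[OF p.M.rax T lin_comp[OF p.lin f(1)]] by blast }
 { assume "EX q. lmap R (M(|carrier := V|)) T q & q ` V = car T & (ALL x:V. q x = 0@T <-> x : U)"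
  thus "module_iso R (subquotient M V U) T" using pi by (elim exE) (rule same_kernel_iso[OF pi(1)], auto) }
qed

end

text \<open>Filtrations become paths of a relation: they are joined by transitivity and traversed by
  rule induction.\<close>

definition chain_step :: "('a, 'b) ring_scheme => ('a, 'm) module => (('a, 'm set) module => bool) => 'm set => 'm set => bool" where
 "chain_step R M Phi U V <-> subm U R M & subm V R M & U <= V & Phi (subquotient M V U)"

lemma (in right_module) chain_iff:
 "(EX l c. submodule_chain R M l c & (ALL i<l. Phi (subquotient M (c (Suc i)) (c i)))) <->
  (chain_step R M Phi)\<^sup>*\<^sup>* {0@M} (car M)" (is "?L <-> ?R")
proof
 assume ?L
 then obtain l c where "submodule_chain R M l c" "ALL i<l. Phi (subquotient M (c (Suc i)) (c i))" by blast
 hence "c 0 = {0@M}" "c l = car M" "ALL i<l. chain_step R M Phi (c i) (c (Suc i))" unfolding submodule_chain_def chain_step_def by auto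
 thus ?R using relpowp_fun_conv[of l "chain_step R M Phi"] relpowp_imp_rtranclp by metis
next
 assume ?R
 then obtain l where "(chain_step R M Phi ^^ l) {0@M} (car M)" using rtranclp_imp_relpowp by metis
 then obtain c where c: "c 0 = {0@M}" "c l = car M" "ALL i<l. chain_step R M Phi (c i) (c (Suc i))" unfolding relpowp_fun_conv by blast
 have "subm (c i) R M" if "i <= l" for i using c that submod_self by (cases "i = l") (auto simp: chain_step_def)
 thus ?L using c unfolding submodule_chain_def chain_step_def by blast
qed

lemma filtered_by_iff:
 "M : filtered_by R Th <-> fgm R M &
  (chain_step R M (%Q. EX T:Th. module_iso R Q T))\<^sup>*\<^sup>* {0@M} (car M)"
proof (cases "fgm R M")
 case True
 interpret right_module R M using True by (rule fgmD)
 show ?thesis unfolding filtered_by_def using chain_iff[of "%Q. EX T:Th. module_iso R Q T"] True by simp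
qed (simp add: filtered_by_def)

text \<open>A factor that is not simple has a submodule strictly between, and both halves have a
  smaller difference of dimensions.\<close>

lemma (in fd_algebra) simple_chain:
 assumes M: "fgm A M" shows "subm U A M ==> subm V A M ==> U <= V ==> (chain_step A M (simple_module A))\<^sup>*\<^sup>* U V"
proof -
 interpret M: right_module A M using M by (rule fgmD)
 let ?r = "%U. rank K (kmod A (M(|carrier := U|)))"
 show "subm U A M ==> subm V A M ==> U <= V ==> (chain_step A M (simple_module A))\<^sup>*\<^sup>* U V"
 proof (induct "?r V - ?r U" arbitrary: U V rule: less_induct)
  case less
  note U = less(2) and V = less(3) and sub = less(4)
  show ?case
  proof (cases "U = V | chain_step A M (simple_module A) U V")
   case False
   let ?Q = "subquotient M V U" and ?p = "%x. U +>.(M(|carrier := V|)) x"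
   note pi = M.subquotient_map[OF U V sub]
   interpret p: linear_map A "M(|carrier := V|)" ?Q ?p by (rule pi(1))
   obtain x0 where x0: "x0 : V" "x0 ~: U" using False sub by blast
   hence "?p x0 : car ?Q" "?p x0 ~= 0@?Q" using pi(2,3) by blast+
   hence "car ?Q ~= {0@?Q}" by (intro notI) (erule notE, drule subst[where P = "%S. ?p x0 : S"], assumption, erule singletonD)
   moreover have "~ simple_module A ?Q" using False U V sub unfolding chain_step_def by blast
   ultimately obtain W where W: "subm W A ?Q" "W ~= {0@?Q}" "W ~= car ?Q" using p.N.rax unfolding simple_module_def by blast
   define X where "X = {x : V. ?p x : W}"
   have "subm X A (M(|carrier := V|))" unfolding X_def using p.submod_preimage[OF W(1)] by simp
   hence X: "subm X A M" "X <= V" using M.submod_submod_iff[OF V, of X] X_def by blast+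
   have WX: "EX x:X. ?p x = w" if "w : W" for w
   proof -
    have "w : ?p ` V" unfolding pi(2) using p.N.submod_carrier[OF W(1) that] .
    thus ?thesis unfolding X_def using that by blast
   qed
   have W0: "0@?Q : W" using W(1) by (rule p.N.submod_zero)
   have UX: "U <= X"
   proof
    fix x assume "x : U"
    thus "x : X" unfolding X_def using pi(3)[of x] sub W0 by auto
   qed
   obtain w where w: "w : W" "w ~= 0@?Q" using W(2) W0 by blast
   have "X ~= U"
   proof
    assume "X = U"
    with WX[OF w(1)] show False using w(2) pi(3) sub by auto
   qed
   moreover have "X ~= V"
   proof
    assume "X = V"
    hence "?p ` V <= W" unfolding X_def by blast
    thus False using W(3) p.N.submod_subset[OF W(1)] unfolding pi(2) by blast
   qed
   ultimately have "?r U < ?r X" "?r X < ?r V" using rank_submodule_mono[OF M] U V X UX by blast+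
   hence "(chain_step A M (simple_module A))\<^sup>*\<^sup>* U X" "(chain_step A M (simple_module A))\<^sup>*\<^sup>* X V"
    by (intro less(1) U V X UX; linarith)+
   thus ?thesis by (rule rtranclp_trans)
  qed auto
 qed
qed

section \<open>Trace submodules and simple tops\<close>

locale idempotents = fd_algebra K A
 for K :: "'k ring" and A :: "('k, 'a) module" (structure) +
 fixes n :: nat and e :: "nat => 'a"
 assumes sys: "idempotent_system A n e"
begin

abbreviation "AA \<equiv> reg A"
abbreviation "C t \<equiv> corner A (e t)"
abbreviation "PP t \<equiv> indec_projective A e t"

text \<open>The trace of the projectives \<open>e j A\<close>, \<open>t \<le> j\<close>, in \<open>M\<close>; for \<open>M = A\<close> it is an ideal of the stratification.\<close>

definition tr :: "('a, 'm) module => nat => 'm set" where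
 "tr M t = \<Inter>{U. subm U A M & (ALL j:{t..n}. ALL x:car M. e j *>.M x : U)}"

lemma idem:
 assumes "t : {1..n}" shows "primitive_idempotent A (e t)" "e t :. A" "e t ** e t = e t" "e t ~= \<zero>"
 using sys assms unfolding idempotent_system_def primitive_idempotent_def by blast+

lemma orth: "i : {1..n} ==> j : {1..n} ==> i ~= j ==> e i ** e j = \<zero>" using sys unfolding idempotent_system_def by blast

lemma sum_e: "(+/i:{1..n}. e i) = \<one>" using sys unfolding idempotent_system_def by blast

lemma tr_least: "subm U A M ==> (!!j x. j : {t..n} ==> x :. M ==> e j *>.M x : U) ==> tr M t <= U" unfolding tr_def by blast

lemma tr_gen: "j : {t..n} ==> x :. M ==> e j *>.M x : tr M t" unfolding tr_def by blast

context
 fixes M :: "('a, 'm) module"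
 assumes M: "rmod A M"
begin

interpretation M: right_module A M by (rule M)

lemma tr_submodule: "1 <= t ==> subm (tr M t) A M"
proof -
 assume "1 <= t"
 hence c: "ALL j:{t..n}. ALL x:car M. e j *>.M x :. M" using idem(2) by simp
 show ?thesis
 proof (rule M.submodI)
  show "tr M t <= car M" unfolding tr_def using c M.submod_self by blast
 qed (auto simp: tr_def M.submod_zero M.submod_add M.submod_act)
qed

lemma tr_carrier: "1 <= t ==> x : tr M t ==> x :. M" using M.submod_carrier[OF tr_submodule] .

lemma tr_fix: "t : {1..n} ==> x :. M ==> e t *>.M x = x ==> s <= t ==> x : tr M s" using tr_gen[of t s x M] by simp

lemma tr_antimono: "1 <= s ==> s <= t ==> tr M t <= tr M s" by (rule tr_least[OF tr_submodule]) (auto intro: tr_gen)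

lemma tr_top: "n < t ==> tr M t = {0@M}" using tr_least[OF M.submod_zero_set, of t] M.submod_zero[OF tr_submodule, of t] by auto

lemma tr_bot: "tr M 1 = car M"
proof
 show "car M <= tr M 1"
 proof
  fix x assume x: "x :. M"
  have "x = \<one> *>.M x" using x by (simp add: M.act_one)
  also have "... = (+/.M i:{1..n}. e i *>.M x)" unfolding sum_e[symmetric] by (rule M.finsum_act) (use x idem(2) in auto)
  also have "... : tr M 1" by (rule M.submod_finsum[OF tr_submodule]) (use x tr_gen[of _ 1 x M] in auto)
  finally show "x : tr M 1" .
 qed
qed (use tr_carrier in auto)

lemma tr_lin:
 assumes "lmap A M N f" "1 <= t" "x : tr M t" shows "f x : tr N t"
proof -
 interpret f: linear_map A M N f by fact
 have N: "subm (\<Inter>{U. subm U A N & (ALL j:{t..n}. ALL x:car N. e j *>.N x : U)}) A N"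
 proof -
  have c: "ALL j:{t..n}. ALL x:car N. e j *>.N x :. N" using idem(2) assms(2) by simp
  show ?thesis
  proof (rule f.N.submodI)
   show "\<Inter>{U. subm U A N & (ALL j:{t..n}. ALL x:car N. e j *>.N x : U)} <= car N" using c f.N.submod_self by blast
  qed (auto simp: f.N.submod_zero f.N.submod_add f.N.submod_act)
 qed
 have "tr M t <= {x : car M. f x : tr N t}"
  by (rule tr_least[OF f.submod_preimage[OF N[folded tr_def]]]) (use assms(2) idem(2) in "auto simp: f.map_act intro: tr_gen")
 thus ?thesis using assms(3) by blast
qed

end

lemma tr_onto:
 assumes f: "lmap A M N f" "f ` car M = car N" and t: "1 <= t" and y: "y : tr N t" shows "EX x:tr M t. f x = y"
proof -
 interpret f: linear_map A M N f by fact
 have "tr N t <= f ` tr M t"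
 proof (rule tr_least[OF f.submod_image[OF tr_submodule[OF f.M.rax t]]])
  fix j y assume j: "j : {t..n}" and "y :. N"
  then obtain x where x: "x :. M" "y = f x" using f(2) by (metis imageE)
  hence "e j *>.N y = f (e j *>.M x)" using f.map_act idem(2)[of j] j t by simp
  thus "e j *>.N y : f ` tr M t" using tr_gen[OF j x(1)] by blast
 qed
 thus ?thesis using y by blast
qed

lemma tr_sub:
 assumes M: "rmod A M" and U: "subm U A M" and t: "1 <= t" and x: "x : tr (M(|carrier := U|)) t" shows "x : tr M t" "x : U"
proof -
 interpret M: right_module A M by fact
 interpret U: right_module A "M(|carrier := U|)" using U by (rule M.submod_right_module)
 have "lmap A (M(|carrier := U|)) M (%x. x)" by (intro lmapI U.rax M lin_restrict[OF lin_id] M.submod_subset[OF U])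
 from tr_lin[OF U.rax this t x] show "x : tr M t" .
 show "x : U" using tr_carrier[OF U.rax t x] by simp
qed

lemma tr_regular:
 assumes "1 <= t" shows "a : tr AA t ==> a :. A" and "[|rmod A M; a : tr AA t; x :. M|] ==> a *>.M x : tr M t"
  and "a : tr AA t ==> b :. A ==> b ** a : tr AA t" "a : tr AA t ==> b :. A ==> a ** b : tr AA t"
proof -
 interpret AA: right_module A AA by (rule A_rmod)
 note sub = tr_submodule[OF A_rmod assms]
 show c: "a : tr AA t ==> a :. A" using AA.submod_carrier[OF sub] by simp
 show act: "a *>.M x : tr M t" if "rmod A M" "a : tr AA t" "x :. M" for M x
 proof -
  interpret M: right_module A M by fact
  show ?thesis using tr_lin[OF A_rmod lmapI[OF A_rmod that(1) M.lin_orbit[OF that(3)]] assms that(2)] .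
 qed
 show "a : tr AA t ==> b :. A ==> b ** a : tr AA t" using act[OF A_rmod, of b] by simp
 show "a : tr AA t ==> b :. A ==> a ** b : tr AA t" using AA.submod_act[OF sub] by simp
qed

subsection \<open>The radical of an indecomposable projective\<close>

context
 fixes t assumes t: "t : {1..n}"
begin

interpretation C: local_ring "C t" using idem(1)[OF t] by (rule corner_local)
interpretation AA: right_module A AA by (rule A_rmod)

lemma et: "e t :. A" "e t ** e t = e t" "e t ~= \<zero>" using idem[OF t] by blast+

lemma P_sel:
 "x : car (PP t) <-> x :. A & e t ** x = x" "0@(PP t) = \<zero>" "x ++.(PP t) y = x ++ y" "a *>.(PP t) x = x ** a"
proof -
 have "x :. A & e t ** x = x" if x: "x = e t ** a" "a :. A" for a using x et by (simp flip: A.m_assoc)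
 moreover have "x :. (PP t)" if "x :. A" "e t ** x = x" unfolding indec_projective_def using that by (auto intro: image_eqI[of _ _ x])
 ultimately show "x : car (PP t) <-> x :. A & e t ** x = x" unfolding indec_projective_def by auto
qed (simp_all add: indec_projective_def)

lemma P_submodule: "subm (car (PP t)) A AA" by (rule AA.submodI) (use et in "auto simp: P_sel A.r_distr simp flip: A.m_assoc")

lemma P_right_module: "rmod A (PP t)" using AA.submod_right_module[OF P_submodule] by (simp add: indec_projective_def)

interpretation P: right_module A "PP t" by (rule P_right_module)

lemma P_submodule_iff: "subm U A (PP t) <-> subm U A AA & U <= car (PP t)"
proof -
 have "subm U A (PP t) ==> U <= car (PP t)" by (rule P.submod_subset)
 moreover have "U <= car (PP t) ==> subm U A (PP t) <-> subm U A AA" using AA.submod_submod_iff[OF P_submodule] by (simp add: indec_projective_def)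
 ultimately show ?thesis by blast
qed

lemma P_full: "subm U A (PP t) ==> e t : U ==> U = car (PP t)"
proof
 assume U: "subm U A (PP t)" "e t : U"
 show "car (PP t) <= U"
 proof
  fix x assume "x :. (PP t)"
  thus "x : U" using P.submod_act[OF U(1) _ U(2), of x] by (simp add: P_sel)
 qed
qed (rule P.submod_subset)

lemma P_map:
 assumes M: "rmod A M" and x: "x :. M" shows "lmap A (PP t) M (%a. a *>.M x)"
proof -
 interpret M: right_module A M by fact
 show ?thesis by (intro lmapI P_right_module M linI) (auto simp: P_sel x M.act_add_ring M.act_mult)
qed

text \<open>The elements of \<open>e t A\<close> that do not generate it. By
  \<open>proper_Rad\<close> this is the unique maximal submodule.\<close>

definition "Rad = {a : car (PP t). ALL b:car A. a ** b ** e t ~: Units (C t)}"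

lemma P_sandwich: "a :. (PP t) ==> b :. A ==> a ** b ** e t :. (C t)" using et by (simp add: P_sel A.m_assoc) (simp flip: A.m_assoc)

lemma Rad_submodule: "subm Rad A (PP t)"
proof (rule P.submodI)
 show "0@(PP t) : Rad" unfolding Rad_def using C.zero_nonunit et by (simp add: P_sel)
next
 fix x y assume x: "x : Rad" and y: "y : Rad"
 hence xy: "x :. (PP t)" "y :. (PP t)" unfolding Rad_def by auto
 have "(x ++ y) ** b ** e t ~: Units (C t)" if b: "b :. A" for b using C.nonunit_add[OF P_sandwich[OF xy(1) b] P_sandwich[OF xy(2) b]] x y xy b et
  unfolding Rad_def by (simp add: P_sel A.l_distr)
 thus "x ++.(PP t) y : Rad" unfolding Rad_def using P.M.a_closed[OF xy] by (simp add: P_sel)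
next
 fix a x assume a: "a :. A" and x: "x : Rad"
 hence xP: "x :. (PP t)" unfolding Rad_def by auto
 have "x ** a ** b ** e t ~: Units (C t)" if b: "b :. A" for b using x a b xP unfolding Rad_def by (simp add: P_sel A.m_assoc)
 thus "a *>.(PP t) x : Rad" unfolding Rad_def using P.act_closed[OF a xP] by (simp add: P_sel)
qed (auto simp: Rad_def)

lemma et_P: "e t :. (PP t)" "e t ~: Rad"
proof -
 show "e t :. (PP t)" using et by (simp add: P_sel)
 have "e t ** \<one> ** e t : Units (C t)" using C.Units_one_closed et by simp
 thus "e t ~: Rad" unfolding Rad_def by blast
qed

lemma proper_Rad:
 assumes U: "subm U A (PP t)" and neq: "e t ~: U" shows "U <= Rad"
proof
 fix a assume a: "a : U"
 hence aP: "a :. (PP t)" by (rule P.submod_carrier[OF U])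
 have "a ** b ** e t ~: Units (C t)" if b: "b :. A" for b
 proof
  assume u: "a ** b ** e t : Units (C t)"
  then obtain c where c: "c :. (C t)" "a ** b ** e t ** c = e t" using C.Units_r_inv_ex[OF u] by auto
  have "(b ** e t ** c) *>.(PP t) a : U" by (rule P.submod_act[OF U _ a]) (use b c et in auto)
  moreover have "(b ** e t ** c) *>.(PP t) a = e t" using aP b c et by (simp add: P_sel A.m_assoc)
  ultimately show False using neq by simp
 qed
 thus "a : Rad" unfolding Rad_def using aP by blast
qed

lemma radical_P: "radical A (PP t) = Rad"
proof -
 have max: "maximal_submodule A (PP t) Rad" unfolding maximal_submodule_def using Rad_submodule et_P proper_Rad P_full by blast
 have "U = Rad" if "maximal_submodule A (PP t) U" for U
  using that proper_Rad[of U] P_full[of U] Rad_submodule et_P unfolding maximal_submodule_def by blast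
 thus ?thesis unfolding radical_def using max P.submod_subset[OF Rad_submodule] by blast
qed

lemma top_map:
 "lmap A (PP t) (simple_top A e t) (%x. Rad +>.(PP t) x)"
 "(%x. Rad +>.(PP t) x) ` car (PP t) = car (simple_top A e t)"
 "x :. (PP t) ==> Rad +>.(PP t) x = 0@(simple_top A e t) <-> x : Rad" unfolding simple_top_def top_module_def radical_P
 using P.quotient_right_module[OF Rad_submodule] P.coset_zero_iff[OF Rad_submodule] by (auto intro: lmapI P_right_module)

text \<open>The element \<open>e t *>.S y\<close> is the image of \<open>e t\<close> under a map
  from \<open>e t A\<close> onto \<open>S\<close>. The kernel misses \<open>e t\<close> and so lies
  in \<open>Rad t\<close>. Conversely, the image of \<open>Rad t\<close> cannot be all of
  \<open>S\<close>, since otherwise \<open>e t\<close> would differ from an element of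
  \<open>Rad t\<close> by an element of the kernel.\<close>

lemma simple_iso_top:
 assumes S: "simple_module A S" and y: "y :. S" "e t *>.S y ~= 0@S" shows "module_iso A S (simple_top A e t)"
proof -
 interpret S: right_module A S using S unfolding simple_module_def by blast
 define x where "x = e t *>.S y"
 have x: "x :. S" "x ~= 0@S" "e t *>.S x = x" using y et S.act_mult[of "e t" "e t" y] by (simp_all add: x_def)
 let ?f = "%a. a *>.S x"
 interpret f: linear_map A "PP t" S ?f by (rule P_map[OF S.rax x(1)])
 have img: "?f ` U = {0@S} | ?f ` U = car S" if "subm U A (PP t)" for U using S f.submod_image[OF that] unfolding simple_module_def by blast
 have onto: "?f ` car (PP t) = car S"
 proof -
  have "x : ?f ` car (PP t)" using et_P(1) x(3) by (metis image_eqI)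
  thus ?thesis using img[OF P.submod_self] x(2) by auto
 qed
 define U where "U = {a : car (PP t). ?f a = 0@S}"
 have U: "subm U A (PP t)" unfolding U_def using f.submod_kernel unfolding f.kernel_eq .
 have "e t ~: U" using x(2,3) by (simp add: U_def)
 hence sub: "U <= Rad" by (rule proper_Rad[OF U])
 have "?f ` Rad ~= car S"
 proof
  assume "?f ` Rad = car S"
  then obtain r where r: "r : Rad" "?f r = x" using x(1) by (metis imageE)
  have rP: "r :. (PP t)" by (rule P.submod_carrier[OF Rad_submodule r(1)])
  have "?f (e t --.(PP t) r) = 0@S" using f.map_diff[OF et_P(1) rP] r(2) x by simp
  hence "e t --.(PP t) r : Rad" using sub et_P(1) rP by (auto simp: U_def)
  thus False using P.submod_diff_iff[OF Rad_submodule _ et_P(1) rP] r(1) et_P(2) by blast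
 qed
 hence "?f ` Rad = {0@S}" using img[OF Rad_submodule] by blast
 hence "Rad <= U" unfolding U_def using P.submod_subset[OF Rad_submodule] by blast
 hence "U = Rad" using sub by blast
 hence "!!a. a :. (PP t) ==> ?f a = 0@S <-> Rad +>.(PP t) a = 0@(simple_top A e t)" using top_map(3) unfolding U_def by blast
 thus ?thesis by (rule same_kernel_iso[OF f.linear_map_axioms onto top_map(1,2)])
qed

lemma simple_iso_top_iff:
 assumes S: "simple_module A S" shows "module_iso A S (simple_top A e t) <-> (EX y:car S. e t *>.S y ~= 0@S)"
proof
 interpret S: right_module A S using S unfolding simple_module_def by blast
 interpret p: linear_map A "PP t" "simple_top A e t" "%x. Rad +>.(PP t) x" by (rule top_map(1))
 assume "module_iso A S (simple_top A e t)"
 then obtain f where f: "lin A S (simple_top A e t) f" "bij_betw f (car S) (car (simple_top A e t))" by (rule module_isoE)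
 interpret f: linear_map A S "simple_top A e t" f using S.rax p.N.rax f(1) by (rule lmapI)
 have "Rad +>.(PP t) e t :. (simple_top A e t)" by (rule p.closed[OF et_P(1)])
 then obtain y where y: "y :. S" "f y = Rad +>.(PP t) e t" using f(2) unfolding bij_betw_def by (metis imageE)
 have "f (e t *>.S y) = Rad +>.(PP t) e t" using f.map_act[OF et(1) y(1)] p.map_act[OF et(1) et_P(1)] y(2) et by (simp add: P_sel)
 also have "... ~= 0@(simple_top A e t)" using top_map(3)[OF et_P(1)] et_P(2) by blast
 finally have "e t *>.S y ~= 0@S" using f.map_zero by metis
 thus "EX y:car S. e t *>.S y ~= 0@S" using y(1) by blast
qed (use simple_iso_top[OF S] in blast)

text \<open>Otherwise the image of \<open>y\<close> under \<open>c\<close> generates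
  \<open>S\<close>, so \<open>y\<close> is recovered from it by some \<open>a\<close>. Then
  \<open>y\<close> is fixed by \<open>c d\<close> with \<open>d = a e t\<close> and is therefore
  annihilated by the unit \<open>e t - c d\<close> of the corner.\<close>

lemma simple_socle:
 assumes S: "simple_module A S" and y: "y :. S" "e t *>.S y = y" and c: "c :. (C t)" "c ~: Units (C t)" shows "c *>.S y = 0@S"
proof (rule ccontr)
 interpret S: right_module A S using S unfolding simple_module_def by blast
 interpret f: linear_map A "PP t" S "%a. a *>.S (c *>.S y)" by (rule P_map[OF S.rax]) (use c y in simp)
 assume nz: "c *>.S y ~= 0@S"
 have cy: "e t *>.S (c *>.S y) = c *>.S y" using S.act_mult[of c "e t" y] c(1) et y by simp
 hence "c *>.S y : (%a. a *>.S (c *>.S y)) ` car (PP t)" using et_P(1) by (metis image_eqI)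
 moreover have "(%a. a *>.S (c *>.S y)) ` car (PP t) = {0@S} | (%a. a *>.S (c *>.S y)) ` car (PP t) = car S"
  using S f.submod_image[OF P.submod_self] unfolding simple_module_def by blast
 ultimately have "y : (%a. a *>.S (c *>.S y)) ` car (PP t)" using nz y(1) by auto
 then obtain a where a: "a :. (PP t)" "y = a *>.S (c *>.S y)" by blast
 have aA: "a :. A" using a(1) by (simp add: P_sel)
 define d where "d = a ** e t"
 have d: "d :. (C t)" using P_sandwich[OF a(1) A.one_closed] aA et by (simp add: d_def)
 have yd: "(c ** d) *>.S y = y"
 proof -
  have "(c ** d) *>.S y = e t *>.S (a *>.S (c *>.S y))" unfolding d_def using c(1) aA et y(1) by (simp add: S.act_mult)
  thus ?thesis using a(2) y(2) by simp
 qed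
 define v where "v = e t -- c ** d"
 have cd: "c ** d :. (C t)" using C.m_closed[OF c(1) d] by simp
 have "v : Units (C t)"
  using C.one_diff_nonunit[OF cd] C.nonunit_mult_right[OF c(1) d c(2)] A.corner_diff[OF et(1,2) _ cd, of "e t"] et by (simp add: v_def)
 from C.Units_r_inv_ex[OF this] obtain w where w: "w :. (C t)" "v ** w = e t" by auto
 have vA: "v :. A" "c ** d :. A" using cd et by (auto simp: v_def)
 have "v *>.S y = 0@S" unfolding v_def using S.diff_act[OF et(1) vA(2) y(1)] yd y by simp
 hence "(v ** w) *>.S y = 0@S" using S.act_mult[OF vA(1) _ y(1), of w] w(1) by simp
 hence "y = 0@S" using w(2) y(2) by simp
 thus False using nz c(1) by simp
qed

lemma simple_top_simple: "simple_module A (simple_top A e t)" unfolding simple_module_def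
proof (intro conjI allI impI)
 let ?p = "%x. Rad +>.(PP t) x"
 interpret p: linear_map A "PP t" "simple_top A e t" ?p by (rule top_map(1))
 show "rmod A (simple_top A e t)" by (rule p.N.rax)
 have "?p (e t) :. (simple_top A e t)" "?p (e t) ~= 0@(simple_top A e t)" using p.closed[OF et_P(1)] top_map(3)[OF et_P(1)] et_P(2) by blast+
 thus "car (simple_top A e t) ~= {0@(simple_top A e t)}" by (metis singletonD)
 fix W assume W: "subm W A (simple_top A e t)"
 have pre: "subm {x : car (PP t). ?p x : W} A (PP t)" by (rule p.submod_preimage[OF W])
 have Wp: "EX x:car (PP t). ?p x = w" if "w : W" for w using p.N.submod_carrier[OF W that] unfolding top_map(2)[symmetric] by blast
 show "W = {0@(simple_top A e t)} | W = car (simple_top A e t)"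
 proof (cases "?p (e t) : W")
  case True
  hence "{x : car (PP t). ?p x : W} = car (PP t)" using P_full[OF pre] et_P(1) by blast
  hence "?p ` car (PP t) <= W" by blast
  thus ?thesis using top_map(2) p.N.submod_subset[OF W] by simp
 next
  case False
  hence sub: "{x : car (PP t). ?p x : W} <= Rad" using proper_Rad[OF pre] by blast
  have "w = 0@(simple_top A e t)" if w: "w : W" for w
  proof -
   obtain x where x: "x :. (PP t)" "?p x = w" using Wp[OF w] by blast
   hence "x : Rad" using sub w by blast
   thus ?thesis using top_map(3)[OF x(1)] x(2) by blast
  qed
  thus ?thesis using p.N.submod_zero[OF W] by blast
 qed
qed

end

end

context idempotents
begin

context
 fixes t assumes t: "t : {1..n}"
begin

interpretation C: local_ring "C t" using idem(1)[OF t] by (rule corner_local)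
interpretation AA: right_module A AA by (rule A_rmod)
interpretation P: right_module A "PP t" by (rule P_right_module[OF t])

text \<open>An element outside \<open>Rad t\<close> would give a nonzero element of the simple top
  at \<open>t\<close> that is fixed by \<open>e j\<close>. By \<open>simple_iso_top\<close> the tops
  at \<open>t\<close> and \<open>j\<close> would be isomorphic; here the tops being pairwise
  non-isomorphic enters.\<close>

lemma off_diagonal_Rad:
 assumes j: "j : {1..n}" "j ~= t" and a: "a :. A" shows "e t ** a ** e j : Rad t"
proof (rule ccontr)
 assume neg: "e t ** a ** e j ~: Rad t"
 let ?p = "%x. Rad t +>.(PP t) x" and ?x = "e t ** a ** e j"
 interpret p: linear_map A "PP t" "simple_top A e t" ?p by (rule top_map(1)[OF t])
 have x: "?x :. (PP t)" using a et[OF t] idem[OF j(1)] A.m_assoc[of "e t" "e t" "a ** e j"] by (simp add: P_sel[OF t] A.m_assoc)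
 have xj: "e j *>.(PP t) ?x = ?x" using a et[OF t] idem[OF j(1)] by (simp add: P_sel[OF t] A.m_assoc)
 have "e j *>.(simple_top A e t) ?p ?x = ?p ?x" using p.map_act[OF idem(2)[OF j(1)] x] xj by simp
 moreover have "?p ?x ~= 0@(simple_top A e t)" using top_map(3)[OF t x] neg by blast
 ultimately have "module_iso A (simple_top A e t) (simple_top A e j)" using simple_iso_top[OF j(1) simple_top_simple[OF t] p.closed[OF x]] by simp
 moreover have "ALL i:{1..n}. ALL j:{1..n}. i ~= j --> ~ module_iso A (simple_top A e i) (simple_top A e j)"
  using sys unfolding idempotent_system_def by (elim conjE) assumption
 ultimately show False using t j(1) j(2)[symmetric] by (elim ballE[of _ _ t] ballE[of _ _ j]) simp_all
qed

lemma e_notin_trace: "e t ~: tr AA (Suc t)"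
proof -
 interpret l: linear_map A AA AA "%x. e t ** x" by (intro lmapI AA.rax A.lin_left_mult) (rule et(1)[OF t])
 have "subm (Rad t) A AA" using Rad_submodule[OF t] P_submodule_iff[OF t] by blast
 from l.submod_preimage[OF this] have "tr AA (Suc t) <= {x : car AA. e t ** x : Rad t}"
  by (rule tr_least) (use t idem et[OF t] off_diagonal_Rad in "auto simp flip: A.m_assoc")
 thus ?thesis using et_P[OF t] et[OF t] by auto
qed

lemma simple_factor:
 assumes Q: "rmod A Q" and U: "subm U A Q" and V: "subm V A Q" and sub: "U <= V" and S: "simple_module A (subquotient Q V U)"
 shows "module_iso A (subquotient Q V U) (simple_top A e t) <-> (EX y:V. e t *>.Q y ~: U)"
  and "[|y : V; e t *>.Q y = y; c :. (C t); c ~: Units (C t)|] ==> c *>.Q y : U" and "U ~= V"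
proof -
 interpret Q: right_module A Q by fact
 let ?p = "%x. U +>.(Q(|carrier := V|)) x" and ?S = "subquotient Q V U"
 note pi = Q.subquotient_map[OF U V sub]
 interpret p: linear_map A "Q(|carrier := V|)" ?S ?p by (rule pi(1))
 have act: "a *>.?S ?p y = ?p (a *>.Q y)" if "a :. A" "y : V" for a y using p.map_act[of a y] that by simp
 have ex: "(EX s:car ?S. e t *>.?S s ~= 0@?S) <-> (EX y:V. ?p (e t *>.Q y) ~= 0@?S)" unfolding pi(2)[symmetric] using act[OF et(1)[OF t]] by simp
 show "module_iso A ?S (simple_top A e t) <-> (EX y:V. e t *>.Q y ~: U)"
  unfolding simple_iso_top_iff[OF t S] ex using pi(3) Q.submod_act[OF V et(1)[OF t]] by blast
 { assume y: "y : V" "e t *>.Q y = y" and c: "c :. (C t)" "c ~: Units (C t)"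
  have cA: "c :. A" using c(1) by simp
  have "?p y : car ?S" "e t *>.?S ?p y = ?p y" using pi(2) y act[OF et(1)[OF t] y(1)] by auto
  from simple_socle[OF t S this c] have "?p (c *>.Q y) = 0@?S" using act[OF cA y(1)] by simp
  thus "c *>.Q y : U" using pi(3)[OF Q.submod_act[OF V cA y(1)]] by blast }
 show "U ~= V"
 proof
  assume "U = V"
  hence "s = 0@?S" if "s : car ?S" for s using that pi(3) unfolding pi(2)[symmetric] by blast
  hence "car ?S = {0@?S}" using p.N.M.zero_closed by blast
  thus False using S unfolding simple_module_def by blast
 qed
qed

text \<open>The simple top at \<open>t\<close> occurs in a layer iff \<open>e t\<close> acts on it
  nontrivially. If it occurs once, a nonunit moves \<open>x\<close> below that layer and then
  through all lower ones. Conversely, if nonunits annihilate \<open>x\<close>, every nonzero element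
  of \<open>Q\<close> fixed by \<open>e t\<close> is obtained from \<open>x\<close> by a unit, so
  only the layer in which \<open>x\<close> appears counts.\<close>

lemma multiplicity_one_iff:
 assumes Q: "fgm A Q" and x: "x :. Q" "e t *>.Q x = x" and gen: "!!y. y :. Q ==> EX a:car A. y = a *>.Q x"
 shows "composition_multiplicity A Q (simple_top A e t) 1 <->
  x ~= 0@Q & (ALL c:car (C t). c ~: Units (C t) --> c *>.Q x = 0@Q)" (is "?L <-> ?R")
proof
 interpret Q: right_module A Q using Q by (rule fgmD)
 assume ?L
 then obtain l c where c: "composition_series A Q l c"
  and card: "card {i. i < l & module_iso A (subquotient Q (c (Suc i)) (c i)) (simple_top A e t)} = 1"
  unfolding composition_multiplicity_def by (elim exE conjE) (rule that)
 from card obtain i where i: "{i. i < l & module_iso A (subquotient Q (c (Suc i)) (c i)) (simple_top A e t)} = {i}"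
  by (rule card_1_singletonE) (rule that)
 have c0: "c 0 = {0@Q}" and cl: "c l = car Q" and cs: "!!j. j <= l ==> subm (c j) A Q"
  and cm: "!!j. j < l ==> c j <= c (Suc j)" and simp: "!!j. j < l ==> simple_module A (subquotient Q (c (Suc j)) (c j))"
  using c unfolding composition_series_def submodule_chain_def by (simp_all only:)
 note fac = simple_factor[OF Q.rax cs cs cm simp]
 have il: "i < l" using i by blast
 \<comment> \<open>Elements fixed by \<open>e t\<close> drop through every layer that is not
   isomorphic to the simple top.\<close>
 have down: "y : c j" if j: "j < l" "j ~= i" and y: "y : c (Suc j)" "e t *>.Q y = y" for j y
 proof -
  have "~ module_iso A (subquotient Q (c (Suc j)) (c j)) (simple_top A e t)" using i j by blast
  hence "e t *>.Q y : c j" using fac(1)[of j] j(1) y(1) by simp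
  thus ?thesis using y(2) by simp
 qed
 have xi: "x : c (Suc i)"
 proof -
  have "Suc i <= l" using il by simp
  thus ?thesis by (induct rule: inc_induct) (use x cl down in auto)
 qed
 have "c' *>.Q x = 0@Q" if c': "c' :. (C t)" "c' ~: Units (C t)" for c'
 proof -
  have e: "e t *>.Q (c' *>.Q x) = c' *>.Q x" using Q.act_mult[of c' "e t" x] c'(1) et[OF t] x by simp
  have 1: "c' *>.Q x : c i" using fac(2)[of i x c'] il xi x(2) c' by simp
  have "c' *>.Q x : c 0"
  proof -
   have "0 <= i" by simp
   thus ?thesis by (induct rule: inc_induct) (use 1 e down il in auto)
  qed
  thus ?thesis using c0 by simp
 qed
 moreover have "x ~= 0@Q"
 proof
  assume "x = 0@Q"
  hence "car Q <= {0@Q}" using gen by force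
  hence "c (Suc i) = c i" using Q.submod_subset[OF cs] Q.submod_zero[OF cs] il by (metis Suc_leI less_imp_le_nat subset_singletonD subset_trans empty_iff)
  thus False using fac(3)[of i] il by simp
 qed
 ultimately show ?R by blast
next
 interpret Q: right_module A Q using Q by (rule fgmD)
 assume R: ?R
 obtain l c where c: "submodule_chain A Q l c" "!!i. i < l ==> simple_module A (subquotient Q (c (Suc i)) (c i))"
  using simple_chain[OF Q Q.submod_zero_set Q.submod_self] Q.chain_iff[of "simple_module A"] by auto
 have c0: "c 0 = {0@Q}" and cl: "c l = car Q" and cs: "!!j. j <= l ==> subm (c j) A Q" and cm: "!!j. j < l ==> c j <= c (Suc j)"
  using c unfolding submodule_chain_def by auto
 note fac = simple_factor(1)[OF Q.rax cs cs cm c(2)]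
 have x_iff: "module_iso A (subquotient Q (c (Suc i)) (c i)) (simple_top A e t) <-> x : c (Suc i) & x ~: c i" if i: "i < l" for i
 proof -
  have "x : c (Suc i) & x ~: c i" if y: "y : c (Suc i)" "e t *>.Q y ~: c i" for y
  proof -
   obtain a where a: "a :. A" "e t *>.Q y = a *>.Q x" using gen[of "e t *>.Q y"] Q.submod_carrier[OF cs, of "Suc i" y] i y(1) et[OF t] by auto
   define d where "d = e t ** a ** e t"
   have d: "d :. (C t)" unfolding d_def by (rule A.corner_sandwich[OF et(1,2)[OF t] a(1)])
   have yV: "y :. Q" using Q.submod_carrier[OF cs, of "Suc i" y] i y(1) by simp
   have dx: "d *>.Q x = e t *>.Q y"
   proof -
    have "d *>.Q x = e t *>.Q (a *>.Q x)" unfolding d_def using Q.act_mult a(1) et[OF t] x by simp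
    also have "... = e t *>.Q (e t *>.Q y)" using a(2) by simp
    finally show ?thesis using Q.act_mult[of "e t" "e t" y] et[OF t] yV by simp
   qed
   have "d : Units (C t)" using R d dx y(2) Q.submod_zero[OF cs, of i] i by (metis less_imp_le_nat)
   from C.Units_r_inv_ex[OF this] obtain w where w: "w :. (C t)" "d ** w = e t" by auto
   have "w *>.Q (e t *>.Q y) = x" using Q.act_mult[of d w x] d w x by (simp flip: dx)
   moreover have "w *>.Q (e t *>.Q y) : c (Suc i)" using Q.submod_act[OF cs, of "Suc i"] i y(1) w(1) et[OF t] by simp
   moreover have "x : c i ==> e t *>.Q y : c i" using Q.submod_act[OF cs, of i d x] i d dx by simp
   ultimately show ?thesis using y(2) by auto
  qed
  moreover have "x : c (Suc i) & x ~: c i ==> EX y:c (Suc i). e t *>.Q y ~: c i" using x(2) by metis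
  ultimately show ?thesis using fac[of i] i by auto
 qed
 \<comment> \<open>The chain increases, so \<open>x\<close> enters it at exactly one step, and
   \<open>x_iff\<close> identifies this step as the only one that counts.\<close>
 define k where "k = (LEAST k. x : c k)"
 have xl: "x : c l" using cl x(1) by simp
 have xk: "x : c k" "!!j. j < k ==> x ~: c j" "k <= l"
  unfolding k_def using LeastI[of "%k. x : c k", OF xl] not_less_Least[of _ "%k. x : c k"] Least_le[of "%k. x : c k", OF xl] by blast+
 have "k ~= 0" using xk(1) c0 R by (metis singletonD)
 then obtain i where i: "k = Suc i" using not0_implies_Suc by blast
 have up: "x : c j" if "k <= j" "j <= l" for j using that
 proof (induct rule: dec_induct)
  case (step m)
  hence "x : c m" "m < l" by simp_all
  thus ?case using cm[of m] by (meson subsetD)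
 qed (rule xk(1))
 have un: "j = i" if "j < l" "x : c (Suc j)" "x ~: c j" for j
  using up[of j] xk(2)[of "Suc j"] that i by (meson Suc_leI less_SucE linorder_not_less less_imp_le_nat Suc_less_eq)
 have xi: "i < l" "x : c (Suc i)" "x ~: c i" using xk(1,3) xk(2)[of i] by (simp_all add: i)
 have "{j. j < l & module_iso A (subquotient Q (c (Suc j)) (c j)) (simple_top A e t)} = {j. j < l & x : c (Suc j) & x ~: c j}"
  using x_iff by (intro Collect_cong conj_cong refl)
 also have "... = {i}" using un xi by blast
 finally have 1: "card {j. j < l & module_iso A (subquotient Q (c (Suc j)) (c j)) (simple_top A e t)} = 1" by simp
 show ?L unfolding composition_multiplicity_def composition_series_def by (intro exI[of _ l] exI[of _ c] conjI allI impI c 1)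
qed

end

section \<open>Standard and proper standard modules as quotients\<close>

definition "std_ker t = car (PP t) Int tr AA (Suc t)"

definition "nonunits t = {c : car (C t). c ~: Units (C t)}"

text \<open>The submodule of \<open>e t A\<close> that is generated by the radical of
  \<open>C t\<close> together with \<open>std_ker t\<close>.\<close>

definition "pstd_ker t = \<Inter>{W. subm W A (PP t) & nonunits t <= W & std_ker t <= W}"

text \<open>\<open>T\<close> is the quotient of \<open>e t A\<close> by \<open>D\<close>, up to isomorphism.\<close>

definition "cyclic t D T <-> (EX q. lmap A (PP t) T q & q ` car (PP t) = car T &
 (ALL a:car (PP t). q a = 0@T <-> a : D))"

lemma cyclicE:
 assumes "cyclic t D T" obtains q where "lmap A (PP t) T q" "q ` car (PP t) = car T"
  "!!a. a :. (PP t) ==> q a = 0@T <-> a : D"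
proof -
 obtain q where q: "lmap A (PP t) T q & q ` car (PP t) = car T &
   (ALL a:car (PP t). q a = 0@T <-> a : D)" using assms unfolding cyclic_def by (rule exE)
 show thesis by (rule that[of q]) (use q in simp_all)
qed

context
 fixes t assumes t: "t : {1..n}"
begin

interpretation C: local_ring "C t" using idem(1)[OF t] by (rule corner_local)
interpretation AA: right_module A AA by (rule A_rmod)
interpretation P: right_module A "PP t" by (rule P_right_module[OF t])

lemma std_ker_submodule: "subm (std_ker t) A (PP t)" using AA.submod_Int[OF P_submodule[OF t] tr_submodule[OF A_rmod, of "Suc t"]]
 unfolding P_submodule_iff[OF t] std_ker_def by simp

text \<open>Let \<open>?eps\<close> be the sum of the later idempotents. The products generate a
  group that is closed under right multiplication. It contains \<open>e t x e j\<close> for all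
  later \<open>j\<close>, because \<open>?eps e j = e j\<close>; hence it absorbs the whole trace
  multiplied by \<open>e t\<close>.\<close>

lemma standard_generate:
 "generate (add_monoid A) {e t ** a ** (+/j:{t<..n}. e j) ** b | a b. a :. A & b : car A} = std_ker t"
  (is "generate _ ?H = _")
proof
 let ?eps = "+/j:{t<..n}. e j" and ?G = "generate (add_monoid A) ?H"
 note J = tr_submodule[OF A_rmod, of "Suc t"]
 have ej: "e j :. A" if "j : {t<..n}" for j using idem(2)[of j] that t by simp
 have eps: "?eps :. A" by (rule A.finsum_closed) (use ej in blast)
 have epsJ: "?eps : tr AA (Suc t)" using AA.submod_finsum[OF J, of "{t<..n}" e] tr_gen[of _ "Suc t" "\<one>" AA] ej by simp
 have HS: "?H <= std_ker t"
 proof clarify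
  fix a b assume ab: "a :. A" "b :. A"
  have "e t ** a ** ?eps ** b : tr AA (Suc t)" using tr_regular(3,4)[of "Suc t"] epsJ ab et[OF t] by simp
  moreover have "e t ** (e t ** a ** ?eps ** b) = e t ** a ** ?eps ** b" using ab eps et[OF t] by (simp flip: A.m_assoc)
  ultimately show "e t ** a ** ?eps ** b : std_ker t" unfolding std_ker_def using ab eps et[OF t] by (simp add: P_sel[OF t])
 qed
 have HA: "?H <= car A" using eps et[OF t] by auto
 have S: "subm (std_ker t) A AA" using std_ker_submodule P_submodule_iff[OF t] by blast
 have "subgroup (std_ker t) (add_monoid A)"
 proof (rule A.add.subgroupI)
  fix x assume "x : std_ker t"
  thus "~- x : std_ker t" using AA.submod_minus[OF S, of x] by simp
 next
  fix x y assume "x : std_ker t" "y : std_ker t"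
  thus "x ++ y : std_ker t" using AA.submod_add[OF S, of x y] by simp
 qed (use AA.submod_subset[OF S] AA.submod_zero[OF S] in auto)
 thus "?G <= std_ker t" by (rule A.add.generate_subgroup_incl[OF HS])
 have GA: "g :. A" if "g : ?G" for g using A.add.generate_incl[of ?H] HA that by auto
 have Gmult: "g ** a : ?G" if "g : ?G" and a: "a :. A" for g a using that(1)
 proof (induct g rule: generate.induct)
  case one
  show ?case using a generate.one[of "add_monoid A" ?H] by simp
 next
  case (incl h)
  then obtain c b where h: "h = e t ** c ** ?eps ** b" "c :. A" "b :. A" by blast
  have "h ** a = e t ** c ** ?eps ** (b ** a)" using h a eps et[OF t] by (simp add: A.m_assoc)
  hence "h ** a : ?H" using h a by blast
  thus ?case by (rule generate.incl)
 next
  case (inv h)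
  then obtain c b where h: "h = e t ** c ** ?eps ** b" "c :. A" "b :. A" by blast
  have "h ** a = e t ** c ** ?eps ** (b ** a)" using h a eps et[OF t] by (simp add: A.m_assoc)
  hence "h ** a : ?H" using h a by blast
  moreover have "(~- h) ** a = ~- (h ** a)" using h a eps et[OF t] by (simp add: A.l_minus)
  ultimately show ?case using generate.inv[of "h ** a" ?H "add_monoid A"] unfolding a_inv_def[symmetric] by simp
 next
  case (eng g h)
  have "(g ++ h) ** a = g ** a ++ h ** a" by (rule A.l_distr[OF GA[OF eng(1)] GA[OF eng(3)] a])
  thus ?case using generate.eng[OF eng(2,4)] by (simp only: monoid.select_convs)
 qed
 let ?W = "{x : car AA. e t ** x : ?G}"
 have "subm ?W A AA"
 proof (rule AA.submodI)
  show "0@AA : ?W" using generate.one[of "add_monoid A" ?H] et[OF t] by simp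
 next
  fix x y assume "x : ?W" "y : ?W"
  thus "x ++.AA y : ?W" using generate.eng[of "e t ** x" "add_monoid A" ?H "e t ** y"] et[OF t] by (simp add: A.r_distr)
 next
  fix a x assume a: "a :. A" and "x : ?W"
  thus "a *>.AA x : ?W" using Gmult[of "e t ** x" a] et[OF t] by (simp add: A.m_assoc)
 qed auto
 hence "tr AA (Suc t) <= ?W"
 proof (rule tr_least)
  fix j x assume j: "j : {Suc t..n}" and x: "x :. AA"
  have jn: "j : {1..n}" "j : {t<..n}" using j t by auto
  have "?eps ** e j = (+/i:{t<..n}. e i ** e j)" by (rule A.finsum_ldistr) (use ej jn in auto)
  also have "... = e j ** e j" by (rule A.finsum_single) (use jn ej orth t in auto)
  finally have "?eps ** e j = e j" using idem(3)[OF jn(1)] by simp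
  hence "e t ** (x ** e j) = e t ** x ** ?eps ** e j" using x eps et[OF t] idem(2)[OF jn(1)] by (simp add: A.m_assoc)
  hence "e t ** (x ** e j) : ?G" using x idem(2)[OF jn(1)] generate.incl[of "e t ** x ** ?eps ** e j" ?H] by auto
  thus "e j *>.AA x : ?W" using x idem(2)[OF jn(1)] by simp
 qed
 thus "std_ker t <= ?G" unfolding std_ker_def by (auto simp: P_sel[OF t])
qed

lemma standard_cyclic: "cyclic t (std_ker t) (standard_module A n e t)"
proof -
 have "standard_module A n e t = quotient_module (PP t) (std_ker t)" unfolding standard_module_def Let_def standard_generate ..
 thus ?thesis unfolding cyclic_def using P.quotient_right_module[OF std_ker_submodule] P.coset_zero_iff[OF std_ker_submodule]
  by (intro exI[of _ "%x. std_ker t +>.(PP t) x"]) (auto intro: lmapI P.rax)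
qed

lemma pstd_ker: shows "subm (pstd_ker t) A (PP t)" "nonunits t <= pstd_ker t" "std_ker t <= pstd_ker t" "e t ~: pstd_ker t"
  and "[|subm W A (PP t); nonunits t <= W; std_ker t <= W|] ==> pstd_ker t <= W"
proof -
 show least: "[|subm W A (PP t); nonunits t <= W; std_ker t <= W|] ==> pstd_ker t <= W" for W unfolding pstd_ker_def by blast
 have NR: "nonunits t <= Rad t"
 proof
  fix c assume "c : nonunits t"
  hence c: "c :. (C t)" "c ~: Units (C t)" unfolding nonunits_def by auto
  have "c ** b ** e t ~: Units (C t)" if b: "b :. A" for b
  proof -
   have "c ** b ** e t = c ** (e t ** b ** e t)" using c b et[OF t] by (simp flip: A.m_assoc)
   thus ?thesis using C.nonunit_mult_right[OF c(1) A.corner_sandwich[OF et(1,2)[OF t] b] c(2)] by simp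
  qed
  thus "c : Rad t" unfolding Rad_def[OF t] using c by (simp add: P_sel[OF t])
 qed
 have "e t ~: std_ker t" using e_notin_trace[OF t] unfolding std_ker_def by blast
 hence SR: "std_ker t <= Rad t" by (rule proper_Rad[OF t std_ker_submodule])
 note R = Rad_submodule[OF t] NR SR
 have sub: "pstd_ker t <= Rad t" by (rule least[OF R])
 thus "e t ~: pstd_ker t" using et_P[OF t] by blast
 show "nonunits t <= pstd_ker t" "std_ker t <= pstd_ker t" unfolding pstd_ker_def by blast+
 show "subm (pstd_ker t) A (PP t)"
 proof (rule P.submodI)
  show "pstd_ker t <= car (PP t)" using sub P.submod_subset[OF Rad_submodule[OF t]] by blast
 qed (auto simp: pstd_ker_def P.submod_zero P.submod_add P.submod_act)
qed

text \<open>By \<open>multiplicity_one_iff\<close> the simple top occurs once in a quotient of the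
  standard module iff the kernel contains the images of the nonunits but not that of
  \<open>e t\<close>. The least such kernel is the image of \<open>pstd_ker t\<close>.\<close>

lemma proper_standard_cyclic: "cyclic t (pstd_ker t) (proper_standard_module A n e t)"
proof -
 let ?S = "standard_module A n e t"
 obtain q where q: "lmap A (PP t) ?S q" "q ` car (PP t) = car ?S" and k: "!!a. a :. (PP t) ==> q a = 0@?S <-> a : std_ker t"
  by (rule cyclicE[OF standard_cyclic]) (rule that, simp_all)
 interpret q: linear_map A "PP t" ?S q by (rule q(1))
 have fgS: "fgm A ?S"
 proof (rule fg_lin_image[OF _ q.N.rax q.lin q(2)])
  show "fgm A (PP t)" using fg_submodule[OF fg_regular P_submodule[OF t]] by (simp add: indec_projective_def)
 qed
 have crit: "composition_multiplicity A (quotient_module ?S U) (simple_top A e t) 1 <-> q (e t) ~: U & q ` nonunits t <= U"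
  if U: "subm U A ?S" for U
 proof -
  let ?Q = "quotient_module ?S U" and ?r = "%y. U +>.?S y"
  interpret r: linear_map A ?S ?Q ?r using q.N.quotient_right_module[OF U] by (intro lmapI q.N.rax)
  have x: "?r (q (e t)) : car ?Q" using et_P(1)[OF t] by blast
  have act: "a *>.?Q ?r (q (e t)) = ?r (q (e t ** a))" if "a :. A" for a
   using r.map_act[OF that q.closed[OF et_P(1)[OF t]]] q.map_act[OF that et_P(1)[OF t]] by (simp add: P_sel[OF t])
  have gen: "EX a:car A. y = a *>.?Q ?r (q (e t))" if y: "y : car ?Q" for y
  proof -
   obtain s where s: "s : car ?S" "y = ?r s" using y by auto
   obtain a where a: "a :. (PP t)" "s = q a" using s(1) q(2) by (metis imageE)
   thus ?thesis using s(2) act[of a] by (auto simp: P_sel[OF t])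
  qed
  have z: "?r (q a) = 0@?Q <-> q a : U" if "a :. (PP t)" for a using q.N.coset_zero_iff[OF U q.closed[OF that]] by simp
  have N: "c *>.?Q ?r (q (e t)) = 0@?Q <-> q c : U" if "c :. (C t)" for c using act[of c] z[of c] that by (simp add: P_sel[OF t])
  have "e t *>.?Q ?r (q (e t)) = ?r (q (e t))" using act[of "e t"] et[OF t] by simp
  from multiplicity_one_iff[OF t fg_quotient[OF fgS U] x this gen] show ?thesis using z[OF et_P(1)[OF t]] N unfolding nonunits_def by blast
 qed
 let ?U0 = "q ` pstd_ker t"
 note D = pstd_ker
 have D_iff: "q a : ?U0 <-> a : pstd_ker t" if a: "a :. (PP t)" for a
 proof
  assume "q a : ?U0"
  then obtain d where d: "d : pstd_ker t" "q a = q d" by blast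
  have dP: "d :. (PP t)" by (rule P.submod_carrier[OF D(1) d(1)])
  have "q (a --.(PP t) d) = 0@?S" using q.map_diff[OF a dP] d(2) dP by simp
  hence "a --.(PP t) d : pstd_ker t" using k[of "a --.(PP t) d"] a dP D(3) by auto
  thus "a : pstd_ker t" using P.submod_diff_iff[OF D(1) _ a dP] d(1) by blast
 qed blast
 note U0 = q.submod_image[OF D(1)]
 have "(LEAST U. subm U A ?S & composition_multiplicity A (quotient_module ?S U) (simple_top A e t) 1) = ?U0"
 proof (rule Least_equality)
  show "subm ?U0 A ?S & composition_multiplicity A (quotient_module ?S ?U0) (simple_top A e t) 1"
   using U0 crit[OF U0] D_iff[OF et_P(1)[OF t]] D(2,4) by blast
  fix U assume "subm U A ?S & composition_multiplicity A (quotient_module ?S U) (simple_top A e t) 1"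
  hence U: "subm U A ?S" "q ` nonunits t <= U" using crit by blast+
  have "pstd_ker t <= {a : car (PP t). q a : U}"
  proof (rule D(5)[OF q.submod_preimage[OF U(1)]])
   show "nonunits t <= {a : car (PP t). q a : U}" using U(2) P.submod_subset[OF D(1)] D(2) by blast
   show "std_ker t <= {a : car (PP t). q a : U}"
   proof
    fix x assume x: "x : std_ker t"
    have xP: "x :. (PP t)" by (rule P.submod_carrier[OF std_ker_submodule x])
    have "q x : U" using k[OF xP] x q.N.submod_zero[OF U(1)] by simp
    with xP show "x : {a : car (PP t). q a : U}" by blast
   qed
  qed
  thus "?U0 <= U" by blast
 qed
 hence eq: "proper_standard_module A n e t = quotient_module ?S ?U0" unfolding proper_standard_module_def by simp
 let ?r = "%y. ?U0 +>.?S y"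
 have r: "lmap A ?S (quotient_module ?S ?U0) ?r" using q.N.quotient_right_module[OF U0] by (intro lmapI q.N.rax)
 interpret r: linear_map A ?S "quotient_module ?S ?U0" ?r by (rule r)
 show ?thesis unfolding cyclic_def eq
 proof (intro exI[of _ "%a. ?r (q a)"] conjI ballI)
  show "lmap A (PP t) (quotient_module ?S ?U0) (%a. ?r (q a))" by (intro lmapI P.rax r.N.rax lin_comp[OF q.lin r.lin])
  have "(%a. ?r (q a)) ` car (PP t) = ?r ` q ` car (PP t)" by (rule image_image[symmetric])
  thus "(%a. ?r (q a)) ` car (PP t) = car (quotient_module ?S ?U0)" by (simp add: q(2))
  fix a assume a: "a :. (PP t)"
  show "?r (q a) = 0@(quotient_module ?S ?U0) <-> a : pstd_ker t" using q.N.coset_zero_iff[OF U0 q.closed[OF a]] D_iff[OF a] by simp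
 qed
qed

end

end

section \<open>Layers of the trace filtration\<close>

text \<open>For each \<open>t\<close> the \<open>b t j\<close> minimally generate \<open>e t A\<close> as a left module over \<open>e t A e t\<close>, modulo the
  next ideal of the stratification.\<close>

locale generators = idempotents K A n e
 for K :: "'k ring" and A :: "('k, 'a) module" (structure) and n e +
 fixes b :: "nat => nat => 'a" and r :: "nat => nat"
 assumes b_closed: "[|t : {1..n}; j < r t|] ==> b t j :. (PP t)" and b_span: "[|t : {1..n}; a :. (PP t)|] ==>
   EX c:r t ->. (C t). a -- (+/j:{..<r t}. c j ** b t j) : tr AA (Suc t)"
  and b_nonunit: "[|t : {1..n}; c : r t ->. (C t); (+/j:{..<r t}. c j ** b t j) : tr AA (Suc t); j < r t|]
   ==> c j ~: Units (C t)"

lemma Units_corner_opposite: "Units (corner (opposite_algebra A) e) = Units (corner A e)" unfolding Units_def by (auto simp: corner_def)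

text \<open>As a left module over \<open>C t\<close>, the ideal \<open>e t A\<close> is the corner
  of the regular right module over the opposite algebra; there \<open>minimal_generators\<close>
  applies.\<close>

lemma (in idempotents) generators_exist: "EX b r. generators K A n e b r"
proof -
 let ?B = "opposite_algebra A"
 interpret B: fd_algebra K ?B by (rule opposite)
 define ok where "ok t z p <-> z : p ->. (PP t) &
   (ALL a:car (PP t). EX c:p ->. (C t). a -- (+/j<p. c j ** z j) : tr AA (Suc t)) &
   (ALL c:p ->. (C t). (+/j<p. c j ** z j) : tr AA (Suc t) --> (ALL j<p. c j ~: Units (C t)))"
  for t z and p :: nat
 have "EX z p. ok t z p" if t: "t : {1..n}" for t
 proof -
  let ?L = "crm (reg ?B) (e t)" and ?D = "corner ?B (e t)"
  have eB: "e t : car ?B" "e t **.?B e t = e t" using et[OF t] by simp_all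
  interpret L: right_module ?D ?L by (rule B.crm_right_module[OF B.A_rmod eB])
  interpret AA: right_module A AA by (rule A_rmod)
  note J = tr_submodule[OF A_rmod, of "Suc t"]
  let ?U = "tr AA (Suc t) Int car ?L"
  have Lc: "x : car ?L <-> x :. (PP t)" for x using et[OF t] by (simp add: P_sel[OF t])
  have D: "car ?D = car (C t)" by auto
  have U: "subm ?U ?D ?L"
  proof (rule L.submodI)
   fix a x assume a: "a : car ?D" and x: "x : ?U"
   have "a *>.?L x : car ?L" using a x L.act_closed by blast
   thus "a *>.?L x : ?U" using a x tr_regular(3)[of "Suc t" x a] by simp
  qed (use AA.submod_zero[OF J] AA.submod_add[OF J] et[OF t] in "auto simp: A.r_distr")
  have "EX z p. spans_mod ?D ?L {0@?L} z p" using B.crm_fg[OF B.fg_regular eB] L.fg_spans unfolding fg_right_module_def by blast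
  hence "EX z p. spans_mod ?D ?L ?U z p" using spans_mod_mono[of ?D ?L _ _ _ ?U] L.submod_zero[OF U] by blast
  from L.minimal_generators[OF U this] obtain z p where z: "spans_mod ?D ?L ?U z p" "nonunit_relations ?D ?L ?U z p" by blast
  have zL: "z : {..<p} -> car ?L" using z(1) unfolding spans_mod_def by blast
  have cz: "(%j. c j ** z j) : {..<p} -> car ?L" if "c : p ->. (C t)" for c
  proof -
   have "(%j. c j *>.?L z j) : {..<p} -> car ?L" using that zL L.act_closed unfolding D[symmetric] by blast
   thus ?thesis by simp
  qed
  have sum: "(+/.?L j<p. c j *>.?L z j) = (+/j<p. c j ** z j)" if "c : p ->. (C t)" for c
   using B.finsum_corner_module[OF B.A_rmod eB(1) cz[OF that]] by simp
  have mns: "y --.?L x = y -- x" if "x : car ?L" for x y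
   using B.minus_corner_module(2)[OF B.A_rmod eB(1) that, of y] by (simp add: a_minus_def a_inv_def m_inv_def)
  have sumL: "(+/j<p. c j ** z j) : car ?L" if "c : p ->. (C t)" for c using L.sum_closed[of c "{..<p}" z] that zL unfolding D sum[OF that] by blast
  have "ok t z p" unfolding ok_def
  proof (intro conjI ballI impI allI)
   show "z : p ->. (PP t)" using zL Lc by blast
   fix a assume "a :. (PP t)"
   then obtain c where c: "c : p ->. (C t)" "a --.?L (+/.?L j<p. c j *>.?L z j) : ?U" using spans_modE[OF z(1), of a] unfolding Lc D by blast
   thus "EX c:p ->. (C t). a -- (+/j<p. c j ** z j) : tr AA (Suc t)" using sum[OF c(1)] mns[OF sumL[OF c(1)]] by auto
  next
   fix c j assume c: "c : p ->. (C t)" "(+/j<p. c j ** z j) : tr AA (Suc t)" and j: "j < p"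
   have "(+/.?L j<p. c j *>.?L z j) : ?U" using c(2) sumL[OF c(1)] unfolding sum[OF c(1)] by blast
   from nonunit_relationsD[OF z(2) this _ j] show "c j ~: Units (C t)" using c(1) unfolding D Units_corner_opposite by blast
  qed
  thus ?thesis by blast
 qed
 hence "ALL t:{1..n}. EX zp. ok t (fst zp) (snd zp)" by simp
 from bchoice[OF this] obtain zp where zp: "!!t. t : {1..n} ==> ok t (fst (zp t)) (snd (zp t))" by blast
 have "generators K A n e (%t. fst (zp t)) (%t. snd (zp t))"
 proof (unfold_locales, goal_cases)
  case (1 t j)
  thus ?case using zp[OF 1(1)] unfolding ok_def by blast
 next
  case (2 t a)
  thus ?case using zp[OF 2(1)] unfolding ok_def by blast
 next
  case (3 t c j)
  thus ?case using zp[OF 3(1)] unfolding ok_def by blast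
 qed
 thus ?thesis by blast
qed

context generators
begin

definition "bsum M t m = (+/.M j:{..<r t}. b t j *>.M m j)"

text \<open>For a submodule \<open>V\<close> of \<open>M e t\<close> this is \<open>V A\<close> plus
  the next trace. The normal form with one coefficient for each \<open>b t j\<close> makes it
  comparable with \<open>exact_at\<close>.\<close>

definition "hat M t V = {x : car M. EX m:{..<r t} -> V. x --.M bsum M t m : tr M (Suc t)}"

text \<open>The multiplication map \<open>M e t \<otimes> e t A \<rightarrow> M\<close> is injective modulo the next trace.\<close>

definition "exact_at M t <-> (ALL m:r t ->. (crm M (e t)).
 bsum M t m : tr M (Suc t) --> (ALL j<r t. m j : tr M (Suc t)))"

lemma exact_atD: "[|exact_at M t; m : r t ->. (crm M (e t)); bsum M t m : tr M (Suc t); j < r t|]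
  ==> m j : tr M (Suc t)" unfolding exact_at_def by blast

lemma bA: "[|t : {1..n}; j < r t|] ==> b t j :. A" using b_closed P_sel(1) by blast

context
 fixes M :: "('a, 'm) module" and t
 assumes M: "rmod A M" and t: "t : {1..n}"
begin

interpretation M: right_module A M by (rule M)
interpretation CM: right_module "C t" "crm M (e t)" by (rule crm_right_module[OF M et(1,2)[OF t]])

lemma bsum_closed: "m : r t ->. M ==> bsum M t m :. M" unfolding bsum_def using bA[OF t] by (intro M.finsum_closed) (auto simp: Pi_iff)

lemma bsum_submod: "subm W A M ==> m : {..<r t} -> W ==> bsum M t m : W"
 unfolding bsum_def using bA[OF t] M.submod_act[of W] by (intro M.submod_finsum[of W]) (auto simp: Pi_iff)

lemma bsum_cong: "m' : r t ->. M ==> (!!j. j < r t ==> m j = m' j) ==> bsum M t m = bsum M t m'"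
 unfolding bsum_def using bA[OF t] by (intro M.finsum_cong') (auto simp: Pi_iff)

lemma bsum_diff:
 assumes "m : r t ->. M" "m' : r t ->. M" shows "bsum M t (%j. m j --.M m' j) = bsum M t m --.M bsum M t m'"
proof -
 have "bsum M t (%j. m j --.M m' j) = (+/.M j:{..<r t}. b t j *>.M m j --.M b t j *>.M m' j)"
  unfolding bsum_def using assms bA[OF t] by (intro M.finsum_cong') (auto simp: Pi_iff M.act_diff)
 also have "... = bsum M t m --.M bsum M t m'" unfolding bsum_def using assms bA[OF t] by (intro M.finsum_diff) (auto simp: Pi_iff)
 finally show ?thesis .
qed

lemma bsum_add:
 assumes "m : r t ->. M" "m' : r t ->. M" shows "bsum M t (%j. m j ++.M m' j) = bsum M t m ++.M bsum M t m'"
proof -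
 have "bsum M t (%j. m j ++.M m' j) = (+/.M j:{..<r t}. b t j *>.M m j ++.M b t j *>.M m' j)"
  unfolding bsum_def using assms bA[OF t] by (intro M.finsum_cong') (auto simp: Pi_iff M.act_add_module)
 also have "... = bsum M t m ++.M bsum M t m'" unfolding bsum_def using assms bA[OF t] by (intro M.finsum_addf) (auto simp: Pi_iff)
 finally show ?thesis .
qed

text \<open>As \<open>e t\<close> fixes \<open>x\<close>, only \<open>e t a\<close> matters. It is
  expanded in the family \<open>b t\<close> modulo the next trace ideal, which moves
  \<open>x\<close> into the trace.\<close>

lemma bsum_orbit:
 assumes x: "x :. (crm M (e t))" and a: "a :. A" shows "EX c:r t ->. (C t). e t ** a -- (+/j:{..<r t}. c j ** b t j) : tr AA (Suc t) &
  a *>.M x --.M bsum M t (%j. c j *>.M x) : tr M (Suc t)"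
proof -
 have "e t ** a :. (PP t)" using a et[OF t] by (simp add: P_sel[OF t] flip: A.m_assoc)
 from b_span[OF t this] obtain c where c: "c : r t ->. (C t)"
  "e t ** a -- (+/j:{..<r t}. c j ** b t j) : tr AA (Suc t)" by blast
 have cA: "c j :. A" if "j < r t" for j using c(1) that by auto
 have xM: "x :. M" "e t *>.M x = x" using x by simp_all
 have cb: "(%j. c j ** b t j) : r t ->. A" using cA bA[OF t] by auto
 define s where "s = (+/j:{..<r t}. c j ** b t j)"
 have s: "s :. A" unfolding s_def by (rule A.finsum_closed[OF cb])
 have "s *>.M x = (+/.M j:{..<r t}. (c j ** b t j) *>.M x)" unfolding s_def by (rule M.finsum_act[OF xM(1) cb])
 also have "... = bsum M t (%j. c j *>.M x)" unfolding bsum_def by (rule M.finsum_cong') (use cA bA[OF t] xM(1) in "auto simp: M.act_mult")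
 finally have e1: "s *>.M x = bsum M t (%j. c j *>.M x)" .
 have "(e t ** a -- s) *>.M x = a *>.M x --.M s *>.M x" using a s et[OF t] xM by (simp add: M.diff_act M.act_mult)
 hence "a *>.M x --.M bsum M t (%j. c j *>.M x) : tr M (Suc t)" using tr_regular(2)[OF _ M c(2) xM(1)] unfolding e1[symmetric] s_def by simp
 thus ?thesis using c by blast
qed

context
 fixes V assumes V: "subm V (C t) (crm M (e t))"
begin

lemma V_carrier: "V <= car (crm M (e t))" "V <= car M" using CM.submod_subset[OF V] by (auto simp: subset_iff)

lemma V_Pi: "m : {..<r t} -> V ==> m : r t ->. M" using V_carrier(2) by blast

lemma hat_base: "tr M (Suc t) <= hat M t V"
proof
 fix x assume x: "x : tr M (Suc t)"
 have xM: "x :. M" by (rule tr_carrier[OF M _ x]) simp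
 have "bsum M t (%j. 0@M) = 0@M" unfolding bsum_def by (rule M.finsum_all_zero) (use bA[OF t] in simp)
 moreover have "0@M : V" using CM.submod_zero[OF V] by simp
 ultimately show "x : hat M t V" unfolding hat_def using x xM by (auto intro!: bexI[of _ "%j. 0@M"])
qed

lemma hat_orbit: "x : V ==> a :. A ==> a *>.M x : hat M t V"
proof -
 assume x: "x : V" and a: "a :. A"
 have xC: "x :. (crm M (e t))" using V_carrier(1) x by blast
 obtain c where c: "c : r t ->. (C t)" "a *>.M x --.M bsum M t (%j. c j *>.M x) : tr M (Suc t)" using bsum_orbit[OF xC a] by blast
 have "c j *>.M x : V" if "j < r t" for j using CM.submod_act[OF V funcset_mem[OF c(1)] x, of j] that by simp
 thus ?thesis unfolding hat_def using c(2) a xC by (auto intro!: bexI[of _ "%j. c j *>.M x"])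
qed

lemma hat_least: "subm W A M ==> tr M (Suc t) <= W ==> V <= W ==> hat M t V <= W"
proof
 fix x assume W: "subm W A M" "tr M (Suc t) <= W" "V <= W" and "x : hat M t V"
 then obtain m where x: "x :. M" "m : {..<r t} -> V" "x --.M bsum M t m : W" unfolding hat_def by blast
 have "bsum M t m : W" by (rule bsum_submod[OF W(1)]) (use x(2) W(3) in blast)
 thus "x : W" using M.submod_diff_iff[OF W(1) x(3,1) bsum_closed[OF V_Pi[OF x(2)]]] by blast
qed

lemma hat_submodule: "subm (hat M t V) A M"
proof -
 have T: "subm (tr M (Suc t)) A M" by (rule tr_submodule[OF M]) simp
 have add: "x ++.M y : hat M t V" if xy: "x : hat M t V" "y : hat M t V" for x y
 proof -
  obtain m m' where x: "x :. M" "m : {..<r t} -> V" "x --.M bsum M t m : tr M (Suc t)"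
   and y: "y :. M" "m' : {..<r t} -> V" "y --.M bsum M t m' : tr M (Suc t)" using xy unfolding hat_def by blast
  have "(x ++.M y) --.M bsum M t (%j. m j ++.M m' j) = (x --.M bsum M t m) ++.M (y --.M bsum M t m')"
   unfolding bsum_add[OF V_Pi[OF x(2)] V_Pi[OF y(2)]]
   using x(1) y(1) bsum_closed[OF V_Pi[OF x(2)]] bsum_closed[OF V_Pi[OF y(2)]] by (rule M.add_diff_add)
  hence "(x ++.M y) --.M bsum M t (%j. m j ++.M m' j) : tr M (Suc t)" using M.submod_add[OF T x(3) y(3)] by simp
  moreover have "(%j. m j ++.M m' j) : {..<r t} -> V" using CM.submod_add[OF V] x(2) y(2) by (auto simp: Pi_iff)
  ultimately show ?thesis unfolding hat_def using x(1) y(1) M.a_closed by blast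
 qed
 have zero: "0@M : hat M t V" using hat_base M.submod_zero[OF T] by auto
 have hM: "hat M t V <= car M" unfolding hat_def by blast
 have sum: "(+/.M j<q. f j) : hat M t V" if "!!j. j < q ==> f j : hat M t V" for q :: nat and f using that
 proof (induct q)
  case (Suc q)
  have "(+/.M j:{..<Suc q}. f j) = f q ++.M (+/.M j<q. f j)" unfolding lessThan_Suc using Suc(2) hM by (intro M.finsum_insert) (auto simp: subset_iff)
  thus ?case using add[OF Suc(2)[of q] Suc(1)] Suc(2) by simp
 qed (simp add: zero)
 show ?thesis
 proof (rule M.submodI)
  fix a x assume a: "a :. A" and "x : hat M t V"
  then obtain m where x: "x :. M" "m : {..<r t} -> V" "x --.M bsum M t m : tr M (Suc t)" unfolding hat_def by blast
  note mM = V_Pi[OF x(2)]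
  have "a *>.M bsum M t m = (+/.M j:{..<r t}. a *>.M (b t j *>.M m j))"
   unfolding bsum_def by (rule M.act_finsum[OF a]) (use mM bA[OF t] in "auto simp: Pi_iff")
  also have "... = (+/.M j:{..<r t}. (b t j ** a) *>.M m j)" by (rule M.finsum_cong') (use mM bA[OF t] a in "auto simp: Pi_iff M.act_mult")
  also have "... : hat M t V" by (rule sum, rule hat_orbit) (use x(2) bA[OF t] a in auto)
  finally have 1: "a *>.M bsum M t m : hat M t V" .
  have 2: "a *>.M (x --.M bsum M t m) : hat M t V" using M.submod_act[OF T a x(3)] hat_base by auto
  have "a *>.M (x --.M bsum M t m) ++.M a *>.M bsum M t m = a *>.M x"
   using a x(1) bsum_closed[OF mM] by (simp add: M.diff_add_cancel flip: M.act_add_module)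
  thus "a *>.M x : hat M t V" using add[OF 2 1] by simp
 qed (use zero add hM in auto)
qed

text \<open>Subtract from \<open>m\<close> coefficients in \<open>V\<close> that represent the same
  element. Exactness moves the difference into the trace, hence into \<open>V\<close>. In this sense
  \<open>V\<close> can be recovered from \<open>V A\<close>.\<close>

lemma exact_hat:
 assumes ex: "exact_at M t" and base: "tr M (Suc t) Int car (crm M (e t)) <= V"
  and m: "m : r t ->. (crm M (e t))" and mh: "bsum M t m : hat M t V" and j: "j < r t" shows "m j : V"
proof -
 obtain m' where m': "m' : {..<r t} -> V" "bsum M t m --.M bsum M t m' : tr M (Suc t)" using mh unfolding hat_def by blast
 have mM: "m : r t ->. M" using m by (auto simp: Pi_iff)
 have mC: "m' : r t ->. (crm M (e t))" using m'(1) V_carrier(1) by blast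
 have d: "(%j. m j --.M m' j) : r t ->. (crm M (e t))" using m mC et(1)[OF t] by (auto simp: Pi_iff M.act_diff)
 have "bsum M t (%j. m j --.M m' j) : tr M (Suc t)" using m'(2) unfolding bsum_diff[OF mM V_Pi[OF m'(1)]] .
 from exact_atD[OF ex d this j] have "m j --.M m' j : V" using base d j by blast
 moreover have "m j --.M m' j = m j --.(crm M (e t)) m' j" using minus_corner_module(2)[OF M et(1)[OF t], of "m' j" "m j"] mC j by (simp add: Pi_iff)
 ultimately show ?thesis using CM.submod_diff_iff[OF V, of "m j" "m' j"] m mC m'(1) j by (auto simp: Pi_iff)
qed

end

lemma tr_hat: "tr M t = hat M t (car (crm M (e t)))"
proof
 note CC = CM.submod_self
 show "tr M t <= hat M t (car (crm M (e t)))"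
 proof (rule tr_least[OF hat_submodule[OF CC]])
  fix j x assume j: "j : {t..n}" and x: "x :. M"
  show "e j *>.M x : hat M t (car (crm M (e t)))"
  proof (cases "j = t")
   case True
   have "e t *>.M x :. (crm M (e t))" using x et[OF t] M.act_mult[of "e t" "e t" x] by simp
   from hat_orbit[OF CC this et(1)[OF t]] show ?thesis using True x et[OF t] M.act_mult[of "e t" "e t" x] by simp
  next
   case False
   hence "e j *>.M x : tr M (Suc t)" using j x by (intro tr_gen) auto
   thus ?thesis using hat_base[OF CC] by blast
  qed
 qed
 have t1: "1 <= t" using t by simp
 show "hat M t (car (crm M (e t))) <= tr M t" by (rule hat_least[OF CC tr_submodule[OF M t1] tr_antimono[OF M t1]]) (use tr_fix[OF M t] in auto)
qed

end

section \<open>Exactness under submodules, quotients and extensions\<close>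

definition "exact M <-> (ALL t:{1..n}. exact_at M t)"

lemma bsum_map:
 assumes f: "lmap A M N f" and t: "t : {1..n}" and m: "m : r t ->. M" shows "f (bsum M t m) = bsum N t (%j. f (m j))"
proof -
 interpret f: linear_map A M N f by fact
 have "f (bsum M t m) = (+/.N j:{..<r t}. f (b t j *>.M m j))" unfolding bsum_def by (rule f.map_finsum) (use m bA[OF t] in auto)
 also have "... = bsum N t (%j. f (m j))" unfolding bsum_def by (rule f.N.finsum_cong') (use m bA[OF t] in "auto simp: Pi_iff f.map_act")
 finally show ?thesis .
qed

lemma bsum_restrict: 
 assumes M: "rmod A M" and U: "subm U A M" and t: "t : {1..n}" and m: "m : {..<r t} -> U" shows "bsum (M(|carrier := U|)) t m = bsum M t m"
proof -
 interpret M: right_module A M by fact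
 show ?thesis unfolding bsum_def using M.finsum_submod[OF U, of "%j. b t j *>.M m j" "{..<r t}"] M.submod_act[OF U] m bA[OF t] by (auto simp: Pi_iff)
qed

lemma trace_lift:
 assumes q: "lmap A M T q" "q ` car M = car T" and t: "t : {1..n}" and s: "1 <= s" and y: "y : tr T s" "e t *>.T y = y"
 shows "EX v. v :. (crm M (e t)) & v : tr M s & q v = y"
proof -
 interpret q: linear_map A M T q by fact
 obtain v where v: "v : tr M s" "q v = y" using tr_onto[OF q s y(1)] by blast
 have vM: "v :. M" by (rule tr_carrier[OF q.M.rax s v(1)])
 show ?thesis using q.M.submod_act[OF tr_submodule[OF q.M.rax s] et(1)[OF t] v(1)] q.map_act[OF et(1)[OF t] vM] v y(2)
   q.M.act_mult[of "e t" "e t" v] et[OF t] vM by (intro exI[of _ "e t *>.M v"]) simp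
qed

text \<open>Moving a relation in \<open>M\<close> whose coefficients lie in the trace of the quotient \<open>T\<close> into the kernel.\<close>

lemma relation_lift:
 assumes q: "lmap A M T q" "q ` car M = car T" and t: "t : {1..n}" and ex: "exact_at T t" and m: "m : r t ->. (crm M (e t))"
  and rel: "q (bsum M t m) : tr T (Suc t)" shows "EX v. v : r t ->. (crm M (e t)) & (ALL j<r t. v j : tr M (Suc t) & q (v j) = q (m j))"
proof -
 interpret q: linear_map A M T q by fact
 have mM: "m : r t ->. M" using m by (auto simp: Pi_iff)
 have qm: "(%j. q (m j)) : r t ->. (crm T (e t))" using m q.map_act[OF et(1)[OF t], symmetric] by (auto simp: Pi_iff)
 have "q (m j) : tr T (Suc t)" if "j < r t" for j by (rule exact_atD[OF ex qm _ that]) (use rel bsum_map[OF q(1) t mM] in simp)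
 hence "ALL j:{..<r t}. EX v. v :. (crm M (e t)) & v : tr M (Suc t) & q v = q (m j)" using qm by (intro ballI trace_lift[OF q t]) (auto simp: Pi_iff)
 from bchoice[OF this] show ?thesis by (auto simp: Pi_iff)
qed

text \<open>Descending induction on \<open>t\<close>. Write \<open>x\<close> with coefficients
  \<open>m\<close> modulo the following trace. By exactness of \<open>T\<close> their images lie in
  that trace and have lifts \<open>v\<close> there, so that \<open>m - v\<close> lies in the kernel.
  What remains of \<open>x\<close> is in the kernel and one trace deeper.\<close>

lemma kernel_trace:
 assumes q: "lmap A M T q" "q ` car M = car T" and ex: "!!s. [|t < s; s <= n|] ==> exact_at T s" and x: "x : akr M T q" "x : tr M (Suc t)"
 shows "x : tr (M(|carrier := akr M T q|)) (Suc t)" using ex x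
proof (induct "n - t" arbitrary: t x)
 case 0
 interpret q: linear_map A M T q by (rule q(1))
 interpret U: right_module A "M(|carrier := akr M T q|)" using q.submod_kernel by (rule q.M.submod_right_module)
 have "x = 0@M" using tr_top[OF q.M.rax, of "Suc t"] 0(1,4) by simp
 thus ?case using U.submod_zero[OF tr_submodule[OF U.rax, of "Suc t"]] by simp
next
 case (Suc k)
 interpret q: linear_map A M T q by (rule q(1))
 let ?U = "akr M T q"
 let ?MU = "M(|carrier := ?U|)"
 interpret U: right_module A ?MU using q.submod_kernel by (rule q.M.submod_right_module)
 let ?s = "Suc t"
 have s: "?s : {1..n}" using Suc(2) by simp
 note M = q.M.rax
 have T: "subm (tr M (Suc ?s)) A M" by (rule tr_submodule[OF M]) simp
 have xM: "x :. M" "q x = 0@T" using Suc(4) by (simp_all add: a_kernel_iff)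
 obtain m where m: "m : r ?s ->. (crm M (e ?s))" "x --.M bsum M ?s m : tr M (Suc ?s)" using Suc(5) unfolding tr_hat[OF M s] hat_def by blast
 have mM: "m : r ?s ->. M" using m(1) by (auto simp: Pi_iff)
 note mc = bsum_closed[OF M s mM]
 have "q (x --.M bsum M ?s m) : tr T (Suc ?s)" by (rule tr_lin[OF M q(1) _ m(2)]) simp
 hence "~-.T q (bsum M ?s m) : tr T (Suc ?s)" using q.map_diff[OF xM(1) mc] xM mc by (simp add: a_minus_def)
 from q.N.submod_minus[OF tr_submodule[OF q.N.rax] this]
 have "q (bsum M ?s m) : tr T (Suc ?s)" using mc by simp
 from relation_lift[OF q s _ m(1) this] obtain v where v: "v : r ?s ->. (crm M (e ?s))"
  "!!j. j < r ?s ==> v j : tr M (Suc ?s) & q (v j) = q (m j)" using Suc(3)[of ?s] s by auto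
 have vM: "v : r ?s ->. M" using v(1) by (auto simp: Pi_iff)
 \<comment> \<open>The new coefficients lie in the kernel and represent \<open>x\<close> up to the
   next trace.\<close>
 define u where "u j = m j --.M v j" for j
 have uU: "u j : ?U" "e ?s *>.M u j = u j" if "j < r ?s" for j
  using m(1) v that q.map_diff[of "m j" "v j"] et(1)[OF s] by (auto simp: u_def a_kernel_iff Pi_iff q.M.act_diff)
 have bu: "bsum M ?s u = bsum M ?s m --.M bsum M ?s v" unfolding u_def by (rule bsum_diff[OF M s mM vM])
 have bv: "bsum M ?s v : tr M (Suc ?s)" by (rule bsum_submod[OF M s T]) (use v(2) in blast)
 have uP: "u : {..<r ?s} -> ?U" using uU(1) by blast
 have bsU: "bsum M ?s u : ?U" by (rule bsum_submod[OF M s q.submod_kernel uP])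
 have "x --.M bsum M ?s u = (x --.M bsum M ?s m) ++.M bsum M ?s v"
 proof -
  have "x --.M (y --.M z) = (x --.M y) ++.M z" if "y :. M" "z :. M" for y z using xM(1) that by algebra
  thus ?thesis unfolding bu using mc bsum_closed[OF M s vM] by simp
 qed
 hence 1: "x --.M bsum M ?s u : tr M (Suc ?s)" using q.M.submod_add[OF T m(2) bv] by simp
 have 2: "x --.M bsum M ?s u : ?U" by (rule q.M.submod_diff[OF q.submod_kernel Suc(4) bsU])
 have "x --.M bsum M ?s u : tr ?MU (Suc ?s)" by (rule Suc(1)[of ?s]) (use Suc(2) Suc(3) 1 2 in auto)
 hence 3: "x --.M bsum M ?s u : tr ?MU ?s" using tr_antimono[OF U.rax, of ?s "Suc ?s"] by auto
 have S: "subm (tr ?MU ?s) A M" using tr_submodule[OF U.rax, of ?s] q.M.submod_submod_iff[OF q.submod_kernel, of "tr ?MU ?s"]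
   tr_carrier[OF U.rax, of ?s] by auto
 have "bsum M ?s u : tr ?MU ?s" by (rule bsum_submod[OF M s S]) (use uU tr_fix[OF U.rax s, of _ ?s] in auto)
 thus ?case using q.M.submod_diff_iff[OF S 3 xM(1)] bsum_closed[OF M s] uP q.M.submod_carrier[OF q.submod_kernel] by (auto simp: Pi_iff)
qed

text \<open>\<open>relation_lift\<close> moves the coefficients into the kernel without leaving the
  trace condition. By \<open>kernel_trace\<close> the result is a relation inside the kernel, which
  is exact.\<close>

lemma exact_at_extension:
 assumes q: "lmap A M T q" "q ` car M = car T" and t: "t : {1..n}" and ex: "!!s. [|t <= s; s <= n|] ==> exact_at T s"
  and U: "exact_at (M(|carrier := akr M T q|)) t" shows "exact_at M t" unfolding exact_at_def
proof (intro ballI impI allI)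
 interpret q: linear_map A M T q by (rule q(1))
 let ?U = "akr M T q"
 let ?MU = "M(|carrier := ?U|)"
 interpret U: right_module A ?MU using q.submod_kernel by (rule q.M.submod_right_module)
 note M = q.M.rax
 have T: "subm (tr M (Suc t)) A M" by (rule tr_submodule[OF M]) simp
 fix m j assume m: "m : r t ->. (crm M (e t))" and rel: "bsum M t m : tr M (Suc t)" and j: "j < r t"
 have mM: "m : r t ->. M" using m by (auto simp: Pi_iff)
 have "q (bsum M t m) : tr T (Suc t)" by (rule tr_lin[OF M q(1) _ rel]) simp
 from relation_lift[OF q t _ m this] obtain v where v: "v : r t ->. (crm M (e t))"
  "!!j. j < r t ==> v j : tr M (Suc t) & q (v j) = q (m j)" using ex[of t] t by auto
 have vM: "v : r t ->. M" using v(1) by (auto simp: Pi_iff)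
 define u where "u j = m j --.M v j" for j
 have uU: "u j : ?U" "e t *>.M u j = u j" if "j < r t" for j
  using m v that q.map_diff[of "m j" "v j"] et(1)[OF t] by (auto simp: u_def a_kernel_iff Pi_iff q.M.act_diff)
 have uP: "u : {..<r t} -> ?U" using uU(1) by blast
 have bu: "bsum M t u = bsum M t m --.M bsum M t v" unfolding u_def by (rule bsum_diff[OF M t mM vM])
 have "bsum M t v : tr M (Suc t)" by (rule bsum_submod[OF M t T]) (use v(2) in blast)
 hence 1: "bsum M t u : tr M (Suc t)" unfolding bu by (rule q.M.submod_diff[OF T rel])
 have "bsum M t u : tr ?MU (Suc t)" by (rule kernel_trace[OF q _ bsum_submod[OF M t q.submod_kernel uP] 1]) (use ex in simp)
 hence "bsum ?MU t u : tr ?MU (Suc t)" unfolding bsum_restrict[OF M q.submod_kernel t uP] .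
 from exact_atD[OF U _ this j] have 2: "u j : tr ?MU (Suc t)" using uU by auto
 have "u j : tr M (Suc t)" by (rule tr_sub(1)[OF M q.submod_kernel _ 2]) simp
 thus "m j : tr M (Suc t)" using q.M.submod_diff_iff[OF T, of "m j" "v j"] v(2)[OF j] mM vM j by (auto simp: u_def Pi_iff)
qed

lemma exact_at_quotient:
 assumes q: "lmap A M T q" "q ` car M = car T" and t: "t : {1..n}" and ker: "akr M T q <= tr M (Suc t)" and ex: "exact_at M t" shows "exact_at T t"
 unfolding exact_at_def
proof (intro ballI impI allI)
 interpret q: linear_map A M T q by (rule q(1))
 note M = q.M.rax and TT = q.N.rax
 have S: "subm (tr M (Suc t)) A M" by (rule tr_submodule[OF M]) simp
 fix m j assume m: "m : r t ->. (crm T (e t))" and rel: "bsum T t m : tr T (Suc t)" and j: "j < r t"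
 have "ALL j:{..<r t}. EX v. v :. (crm M (e t)) & v : tr M 1 & q v = m j"
  using m by (intro ballI trace_lift[OF q t]) (auto simp: Pi_iff tr_bot[OF TT, unfolded One_nat_def])
 from bchoice[OF this] obtain v where v0: "ALL j:{..<r t}. v j :. (crm M (e t)) & v j : tr M 1 & q (v j) = m j" by (rule exE)
 have v: "v : r t ->. (crm M (e t))" "!!j. j < r t ==> q (v j) = m j" using v0 by auto
 have vM: "v : r t ->. M" using v(1) by (auto simp: Pi_iff)
 note vc = bsum_closed[OF M t vM]
 have "q (bsum M t v) = bsum T t m" unfolding bsum_map[OF q(1) t vM] by (rule bsum_cong[OF TT t]) (use m v(2) in "auto simp: Pi_iff")
 then obtain w where w: "w : tr M (Suc t)" "q w = q (bsum M t v)" using tr_onto[OF q, of "Suc t"] rel by auto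
 have wM: "w :. M" by (rule q.M.submod_carrier[OF S w(1)])
 have "bsum M t v --.M w : akr M T q" using q.map_diff[OF vc wM] w(2) vc wM by (simp add: a_kernel_iff)
 hence "bsum M t v : tr M (Suc t)" using q.M.submod_diff_iff[OF S _ vc wM] ker w(1) by blast
 from exact_atD[OF ex v(1) this j] have "q (v j) : tr T (Suc t)" by (intro tr_lin[OF M q(1)]) simp_all
 thus "m j : tr T (Suc t)" using v(2)[OF j] by simp
qed

lemma exact_iso:
 assumes f: "lmap A M N f" "bij_betw f (car M) (car N)" and ex: "exact M" shows "exact N"
proof -
 interpret f: linear_map A M N f by (rule f(1))
 have k: "akr M N f <= tr M (Suc t)" for t using iso_kernel_zero[OF f(1)] f(2) f.M.submod_zero[OF tr_submodule[OF f.M.rax, of "Suc t"]]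
  by (simp add: bij_betw_def)
 show ?thesis using exact_at_quotient[OF f(1) bij_betw_imp_surj_on[OF f(2)] _ k] ex unfolding exact_def by blast
qed

lemma exact_at_submodule:
 assumes M: "rmod A M" and U: "subm U A M" and t: "t : {1..n}"
  and tr: "!!x. x : U ==> x : tr M (Suc t) ==> x : tr (M(|carrier := U|)) (Suc t)" and ex: "exact_at M t" shows "exact_at (M(|carrier := U|)) t"
 unfolding exact_at_def
proof (intro ballI impI allI)
 interpret M: right_module A M by fact
 fix m j assume m: "m : {..<r t} -> car (crm (M(|carrier := U|)) (e t))"
  and rel: "bsum (M(|carrier := U|)) t m : tr (M(|carrier := U|)) (Suc t)" and j: "j < r t"
 have mU: "m : {..<r t} -> U" and mC: "m : r t ->. (crm M (e t))" using m M.submod_carrier[OF U] by (auto simp: Pi_iff)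
 have "bsum M t m : tr M (Suc t)" using tr_sub(1)[OF M U _ rel] unfolding bsum_restrict[OF M U t mU] by simp
 from exact_atD[OF ex mC this j] show "m j : tr (M(|carrier := U|)) (Suc t)" using tr[of "m j"] mU j by auto
qed

text \<open>The coordinates of a dual basis carry relations in \<open>P\<close> to relations in
  \<open>A\<close>, and an element whose coordinates lie in the trace ideal lies in the
  trace.\<close>

lemma exact_at_projective:
 assumes ex: "exact_at AA t" and t: "t : {1..n}" and P: "rmod A P" and db: "dual_basis A P s x f" shows "exact_at P t" unfolding exact_at_def
proof (intro ballI impI allI)
 interpret P: right_module A P by (rule P)
 fix m j assume m: "m : r t ->. (crm P (e t))" and rel: "bsum P t m : tr P (Suc t)" and j: "j < r t"
 have mP: "m : r t ->. P" using m by (auto simp: Pi_iff)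
 have fm: "f u (m j) : tr AA (Suc t)" if u: "u < s" for u
 proof -
  have f: "lmap A P AA (f u)" by (rule lmapI[OF P A_rmod dual_basis_lin[OF db u]])
  interpret f: linear_map A P AA "f u" by (rule f)
  have "f u (bsum P t m) : tr AA (Suc t)" by (rule tr_lin[OF P f _ rel]) simp
  hence 1: "bsum AA t (%j. f u (m j)) : tr AA (Suc t)" using bsum_map[OF f t mP] by simp
  show ?thesis
   by (rule exact_atD[OF ex _ 1 j]) (use m f.map_act[OF et(1)[OF t], symmetric] f.closed in "auto simp: Pi_iff simp del: regular_module_sel(4)")
 qed
 have "m j = (+/.P u<s. f u (m j) *>.P x u)" by (rule dual_basis_sum[OF db]) (use mP j in auto)
 also have "... : tr P (Suc t)" by (rule P.submod_finsum[OF tr_submodule[OF P]]) (use fm tr_regular(2)[OF _ P] dual_basis_vec(2)[OF db] in auto)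
 finally show "m j : tr P (Suc t)" .
qed

section \<open>Exactness of standard and proper standard modules\<close>

context
 fixes t assumes t: "t : {1..n}"
begin

interpretation C: local_ring "C t" using idem(1)[OF t] by (rule corner_local)
interpretation AA: right_module A AA by (rule A_rmod)
interpretation P: right_module A "PP t" by (rule P_right_module[OF t])
interpretation CA: right_module "C t" "crm AA (e t)" by (rule crm_right_module[OF A_rmod et(1,2)[OF t]])

lemma nonunits_submodule: "subm (nonunits t) (C t) (crm AA (e t))"
proof (rule CA.submodI)
 show "0@(crm AA (e t)) : nonunits t" using C.zero_nonunit et[OF t] by (simp add: nonunits_def)
next
 fix x y assume "x : nonunits t" "y : nonunits t"
 thus "x ++.(crm AA (e t)) y : nonunits t" using C.nonunit_add[of x y] C.a_closed[of x y] by (simp add: nonunits_def)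
next
 fix a x assume "a :. (C t)" "x : nonunits t"
 thus "a *>.(crm AA (e t)) x : nonunits t" using C.nonunit_mult_right[of x a] C.m_closed[of x a] by (simp add: nonunits_def)
qed (auto simp: nonunits_def)

lemma trace_corner_submodule: "subm (tr AA (Suc t) Int car (C t)) (C t) (crm AA (e t))"
proof (rule CA.submodI)
 note J = tr_submodule[OF A_rmod, of "Suc t"]
 show "0@(crm AA (e t)) : tr AA (Suc t) Int car (C t)" using AA.submod_zero[OF J] et[OF t] by simp
 show "x ++.(crm AA (e t)) y : tr AA (Suc t) Int car (C t)"
  if "x : tr AA (Suc t) Int car (C t)" "y : tr AA (Suc t) Int car (C t)" for x y using AA.submod_add[OF J, of x y] C.a_closed[of x y] that by simp
 show "a *>.(crm AA (e t)) x : tr AA (Suc t) Int car (C t)"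
  if "a :. (C t)" "x : tr AA (Suc t) Int car (C t)" for a x using AA.submod_act[OF J, of a x] C.m_closed[of x a] that by simp
qed auto

lemma bsum_regular: "c : r t ->. A ==> bsum AA t c = (+/j:{..<r t}. c j ** b t j)" unfolding bsum_def by (simp cong: A.finsum_cong)

lemma std_ker_hat: "a :. (PP t) ==> a : std_ker t <-> a : hat AA t (tr AA (Suc t) Int car (C t))" using hat_base[OF A_rmod t trace_corner_submodule]
  hat_least[OF A_rmod t trace_corner_submodule tr_submodule[OF A_rmod, of "Suc t"]] unfolding std_ker_def by auto

lemma pstd_ker_hat:
 assumes a: "a :. (PP t)" shows "a : pstd_ker t <-> a : hat AA t (nonunits t)"
proof
 note N = nonunits_submodule
 note D = pstd_ker[OF t]
 have Hm: "subm (car (PP t) Int hat AA t (nonunits t)) A (PP t)"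
  using AA.submod_Int[OF P_submodule[OF t] hat_submodule[OF A_rmod t N]] unfolding P_submodule_iff[OF t] by simp
 have "nonunits t <= car (PP t) Int hat AA t (nonunits t)" using hat_orbit[OF A_rmod t N, of _ "\<one>"] by (auto simp: nonunits_def P_sel[OF t])
 moreover have "std_ker t <= car (PP t) Int hat AA t (nonunits t)" using hat_base[OF A_rmod t N] unfolding std_ker_def by blast
 ultimately show "a : pstd_ker t ==> a : hat AA t (nonunits t)" using D(5)[OF Hm] by blast
 assume "a : hat AA t (nonunits t)"
 then obtain c where c: "c : {..<r t} -> nonunits t" "a --.AA bsum AA t c : tr AA (Suc t)" unfolding hat_def by blast
 have DA: "subm (pstd_ker t) A AA" using D(1) P_submodule_iff[OF t] by blast
 have "bsum AA t c : pstd_ker t" by (rule bsum_submod[OF A_rmod t DA]) (use c(1) D(2) in blast)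
 moreover from this have "bsum AA t c :. (PP t)" by (rule P.submod_carrier[OF D(1)])
 moreover from this have "a --.AA bsum AA t c :. (PP t)" using AA.submod_diff[OF P_submodule[OF t] a] by blast
 hence "a --.AA bsum AA t c : pstd_ker t" using c(2) D(3) unfolding std_ker_def by blast
 ultimately show "a : pstd_ker t" using AA.submod_diff_iff[OF DA] a by (auto simp: P_sel[OF t])
qed

lemma cyclic_trace:
 assumes T: "cyclic t D T" and D: "std_ker t <= D" shows "rmod A T" "tr T (Suc t) = {0@T}" "tr T t = car T"
proof -
 obtain q where q: "lmap A (PP t) T q" "q ` car (PP t) = car T" and k: "!!a. a :. (PP t) ==> q a = 0@T <-> a : D"
  by (rule cyclicE[OF T]) (rule that, simp_all)
 interpret q: linear_map A "PP t" T q by (rule q(1))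
 note TT = q.N.rax
 show "rmod A T" by (rule TT)
 have t1: "1 <= t" using t by simp
 have "tr T (Suc t) <= {0@T}"
 proof
  fix y assume "y : tr T (Suc t)"
  then obtain x where x: "x : tr (PP t) (Suc t)" "q x = y" using tr_onto[OF q, of "Suc t"] by auto
  have "x : tr AA (Suc t)" "x :. (PP t)" using tr_sub[OF A_rmod P_submodule[OF t], of "Suc t" x] x(1) by (simp_all add: indec_projective_def)
  thus "y : {0@T}" using k[of x] D x(2) unfolding std_ker_def by auto
 qed
 thus "tr T (Suc t) = {0@T}" using q.N.submod_zero[OF tr_submodule[OF TT, of "Suc t"]] by auto
 have W: "subm {a : car (PP t). q a : tr T t} A (PP t)" by (rule q.submod_preimage[OF tr_submodule[OF TT t1]])
 have "e t *>.T q (e t) = q (e t)" using q.map_act[OF et(1)[OF t] et_P(1)[OF t]] et[OF t] by (simp add: P_sel[OF t])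
 hence "q (e t) : tr T t" by (rule tr_fix[OF TT t q.closed[OF et_P(1)[OF t]]]) simp
 hence "{a : car (PP t). q a : tr T t} = car (PP t)" using P_full[OF t W] et_P(1)[OF t] by blast
 hence "q ` car (PP t) <= tr T t" by blast
 thus "tr T t = car T" using q.N.submod_subset[OF tr_submodule[OF TT t1]] unfolding q(2) by (intro equalityI)
qed

text \<open>If \<open>s < t\<close>, the next trace is all of \<open>T\<close>, because
  \<open>T\<close> is generated at \<open>t\<close>. If \<open>s > t\<close>, the element lies in a
  trace that vanishes on \<open>T\<close>.\<close>

lemma cyclic_off:
 assumes T: "cyclic t D T" and D: "std_ker t <= D" and s: "s : {1..n}" "s ~= t" and y: "y :. (crm T (e s))" shows "y : tr T (Suc s)"
proof -
 note TT = cyclic_trace[OF T D]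
 interpret T: right_module A T by (rule TT(1))
 have y': "y :. T" "e s *>.T y = y" using y by simp_all
 show ?thesis
 proof (cases "s < t")
  case True
  thus ?thesis using y'(1) tr_antimono[OF TT(1), of "Suc s" t] TT(3) by auto
 next
  case False
  hence "y : tr T (Suc t)" using s by (intro tr_fix[OF TT(1) s(1) y']) simp
  thus ?thesis using TT(2) T.submod_zero[OF tr_submodule[OF TT(1), of "Suc s"]] by simp
 qed
qed

lemma cyclic_exact_off:
 assumes "cyclic t D T" "std_ker t <= D" "s : {1..n}" "s ~= t" shows "exact_at T s" unfolding exact_at_def using cyclic_off[OF assms] by blast

text \<open>A relation in \<open>T\<close> lifts to coefficients \<open>c\<close> in the corner, and
  modulo the trace ideal it agrees with one whose coefficients \<open>d\<close> are nonunits.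
  Minimality of the family \<open>b t\<close> makes the differences nonunits, hence also
  \<open>c\<close>, and nonunits vanish in \<open>T\<close>. This is the reason for choosing
  \<open>b t\<close> minimal.\<close>

lemma exact_proper_standard:
 assumes T: "cyclic t (pstd_ker t) T" shows "exact T"
proof -
 note D = pstd_ker[OF t]
 note TT = cyclic_trace[OF T D(3)]
 obtain q where q: "lmap A (PP t) T q" "q ` car (PP t) = car T" and k: "!!a. a :. (PP t) ==> q a = 0@T <-> a : pstd_ker t"
  by (rule cyclicE[OF T]) (rule that, simp_all)
 interpret q: linear_map A "PP t" T q by (rule q(1))
 have "exact_at T t" unfolding exact_at_def
 proof (intro ballI impI allI)
  fix m j assume m: "m : r t ->. (crm T (e t))" and rel: "bsum T t m : tr T (Suc t)" and j: "j < r t"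
  have "ALL j:{..<r t}. EX c. c :. (C t) & q c = m j"
  proof
   fix j assume "j : {..<r t}"
   hence mj: "m j :. T" "e t *>.T m j = m j" using m by (auto simp: Pi_iff)
   then obtain a where a: "a :. (PP t)" "q a = m j" using q(2) by (metis imageE)
   hence "a ** e t :. (C t)" using et[OF t] A.m_assoc[of a "e t" "e t"] A.m_assoc[of "e t" a "e t"] by (simp add: P_sel[OF t])
   thus "EX c. c :. (C t) & q c = m j" using q.map_act[OF et(1)[OF t] a(1)] mj(2) a(2)
    by (intro exI[of _ "a ** e t"]) (simp add: P_sel(4)[OF t] del: corner_sel(1))
  qed
  from bchoice[OF this] obtain c where c: "ALL j:{..<r t}. c j :. (C t) & q (c j) = m j" by (rule exE)
  have cP: "c : r t ->. (PP t)" and cA: "c : r t ->. A" and cC: "c : r t ->. (C t)" using c by (auto simp: P_sel[OF t])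
  have bc: "bsum (PP t) t c = bsum AA t c" using bsum_restrict[OF A_rmod P_submodule[OF t] t cP] by (simp add: indec_projective_def)
  have bP: "bsum (PP t) t c :. (PP t)" by (rule bsum_closed[OF P_right_module[OF t] t cP])
  have "q (bsum (PP t) t c) = bsum T t m" unfolding bsum_map[OF q(1) t cP] by (rule bsum_cong[OF TT(1) t]) (use m c in "auto simp: Pi_iff")
  hence "bsum AA t c : pstd_ker t" using rel k[OF bP] TT(2) bc by simp
  hence "bsum AA t c : hat AA t (nonunits t)" using pstd_ker_hat bP bc by simp
  then obtain d where d: "d : {..<r t} -> nonunits t" "bsum AA t c --.AA bsum AA t d : tr AA (Suc t)" unfolding hat_def by blast
  have dC: "d : r t ->. (C t)" and dA: "d : r t ->. A" using d(1) unfolding nonunits_def by (auto simp: Pi_iff)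
  have cd: "(%j. c j -- d j) : r t ->. (C t)"
   using C.minus_closed A.corner_diff[OF et(1,2)[OF t]] cC dC by (fastforce simp: Pi_iff simp del: corner_sel(1))
  have "bsum AA t (%j. c j -- d j) : tr AA (Suc t)" using d(2) bsum_diff[OF A_rmod t, of c d] cA dA by simp
  hence "(+/j:{..<r t}. (c j -- d j) ** b t j) : tr AA (Suc t)" using bsum_regular[of "%j. c j -- d j"] cA dA by (simp add: Pi_iff)
  from b_nonunit[OF t cd this j] have nu: "c j -- d j ~: Units (C t)" .
  have cj: "c j :. (C t)" "d j :. (C t)" "d j ~: Units (C t)" "c j -- d j :. (C t)"
   using cC d(1) dC cd j unfolding nonunits_def by (auto simp: Pi_iff)
  have "(c j -- d j) ++ d j = c j" using cj by (simp add: A.diff_add_cancel)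
  hence "c j ~: Units (C t)" using C.nonunit_add[OF cj(4,2) nu cj(3)] by simp
  hence "c j : pstd_ker t" using D(2) cj(1) unfolding nonunits_def by blast
  hence "m j = 0@T" using k[of "c j"] c cP j by (auto simp: Pi_iff)
  thus "m j : tr T (Suc t)" using TT(2) by simp
 qed
 thus ?thesis using cyclic_exact_off[OF T D(3)] unfolding exact_def by blast
qed

text \<open>The standard module is the projective \<open>e t A\<close> modulo its next trace, and
  dividing by a submodule of the next trace preserves exactness at \<open>t\<close>.\<close>

lemma exact_standard:
 assumes T: "cyclic t (std_ker t) T" and ex: "exact AA" shows "exact T"
proof -
 note TT = cyclic_trace[OF T subset_refl]
 obtain q where q: "lmap A (PP t) T q" "q ` car (PP t) = car T" and k: "!!a. a :. (PP t) ==> q a = 0@T <-> a : std_ker t"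
  by (rule cyclicE[OF T]) (rule that, simp_all)
 have db: "dual_basis A (PP t) 1 (%_. e t) (%_ a. a)" unfolding dual_basis_def
 proof (intro conjI ballI allI impI)
  show "lin A (PP t) AA (%a. a)" by (rule linI) (simp_all add: P_sel[OF t])
  fix p assume p: "p :. (PP t)"
  hence "p *>.(PP t) e t = p" by (simp add: P_sel[OF t])
  thus "p = (+/.(PP t) u:{..<1::nat}. p *>.(PP t) e t)" using p P.M.finsum_single[of "{..<1::nat}" 0 "%_. p"] by simp
 qed (use et_P(1)[OF t] in auto)
 have "akr (PP t) T q <= tr (PP t) (Suc t)"
 proof
  fix a assume "a : akr (PP t) T q"
  hence a: "a :. (PP t)" "a : tr AA (Suc t)" using k[of a] unfolding std_ker_def by (auto simp: a_kernel_iff)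
  have "a *>.(PP t) e t : tr (PP t) (Suc t)" by (rule tr_regular(2)[OF _ P_right_module[OF t] a(2) et_P(1)[OF t]]) simp
  thus "a : tr (PP t) (Suc t)" using a(1) by (simp add: P_sel[OF t])
 qed
 hence "exact_at T t" by (rule exact_at_quotient[OF q t _ exact_at_projective[OF _ t P_right_module[OF t] db]]) (use ex t in "simp add: exact_def")
 thus ?thesis using cyclic_exact_off[OF T subset_refl] unfolding exact_def by blast
qed

end

section \<open>From filtrations to exactness and back\<close>

lemma filtered_exact:
 assumes M: "M : filtered_by A Th" and Th: "!!T. T : Th ==> rmod A T & exact T" shows "exact M"
proof -
 have fg: "fgm A M" and ch: "(chain_step A M (%Q. EX T:Th. module_iso A Q T))\<^sup>*\<^sup>* {0@M} (car M)"
  using M unfolding filtered_by_iff by blast+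
 interpret M: right_module A M using fg by (rule fgmD)
 have "exact (M(|carrier := V|))" if "(chain_step A M (%Q. EX T:Th. module_iso A Q T))\<^sup>*\<^sup>* {0@M} V" for V using that
 proof (induct rule: rtranclp_induct)
  case base
  interpret Z: right_module A "M(|carrier := {0@M}|)" using M.submod_zero_set by (rule M.submod_right_module)
  have z: "0@M : tr (M(|carrier := {0@M}|)) (Suc s)" for s using Z.submod_zero[OF tr_submodule[OF Z.rax, of "Suc s"]] by simp
  have "m j = 0@M" if "m : {..<r s} -> car (crm (M(|carrier := {0@M}|)) (e s))" "j < r s" for m j s using that by (auto simp: Pi_iff)
  thus ?case unfolding exact_def exact_at_def using z by metis
 next
  case (step U V)
  then obtain T where T: "T : Th" "module_iso A (subquotient M V U) T" and UV: "subm U A M" "subm V A M" "U <= V" unfolding chain_step_def by blast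
  from Th[OF T(1)] obtain q where q: "lmap A (M(|carrier := V|)) T q" "q ` V = car T" "ALL x:V. q x = 0@T <-> x : U"
   using M.subquotient_iso_iff[OF UV, of T] T(2) by blast
  have k: "akr (M(|carrier := V|)) T q = U" using q(3) UV(3) by (auto simp: a_kernel_iff)
  show ?case unfolding exact_def
  proof
   fix s assume s: "s : {1..n}"
   show "exact_at (M(|carrier := V|)) s" by (rule exact_at_extension[OF q(1) _ s]) (use q(2) k step(3) s Th[OF T(1)] in "auto simp: exact_def")
  qed
 qed
 from this[OF ch] show ?thesis by simp
qed

lemma adjoin_iso:
 assumes M: "rmod A M" and t: "t : {1..n}" and U: "subm U A M" and m: "m :. (crm M (e t))" and T: "cyclic t D T"
  and D: "!!a. a :. (PP t) ==> a *>.M m : U <-> a : D" shows "module_iso A (subquotient M (adjoin A M U m) U) T"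
proof -
 interpret M: right_module A M by fact
 have mM: "m :. M" "e t *>.M m = m" using m by simp_all
 let ?V = "adjoin A M U m"
 note V = M.adjoin_submodule[OF U mM(1)]
 note pi = M.subquotient_map[OF U V(1,2)]
 let ?p = "%x. U +>.(M(|carrier := ?V|)) x"
 interpret p: linear_map A "M(|carrier := ?V|)" "subquotient M ?V U" ?p by (rule pi(1))
 obtain q where q: "lmap A (PP t) T q" "q ` car (PP t) = car T" and k: "!!a. a :. (PP t) ==> q a = 0@T <-> a : D"
  by (rule cyclicE[OF T]) (rule that, simp_all)
 interpret f: linear_map A "PP t" M "%a. a *>.M m" by (rule P_map[OF t M mM(1)])
 have aV: "a *>.M m : ?V" if "a :. A" for a by (rule M.submod_act[OF V(1) that V(3)])
 have PA: "a :. A" if "a :. (PP t)" for a using that by (simp add: P_sel[OF t])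
 have "lin A (PP t) (M(|carrier := ?V|)) (%a. a *>.M m)" by (rule lin_into[OF f.lin aV[OF PA]])
 hence g: "lmap A (PP t) (subquotient M ?V U) (%a. ?p (a *>.M m))" by (intro lmapI P_right_module[OF t] p.N.rax) (rule lin_comp[OF _ p.lin])
 have onto: "(%a. ?p (a *>.M m)) ` car (PP t) = car (subquotient M ?V U)"
 proof
  show "car (subquotient M ?V U) <= (%a. ?p (a *>.M m)) ` car (PP t)"
  proof
   fix y assume "y :. (subquotient M ?V U)"
   then obtain x where x: "x : ?V" "y = ?p x" unfolding pi(2)[symmetric] by blast
   then obtain a where a: "a :. A" "x --.M a *>.M m : U" unfolding adjoin_def by blast
   have xV: "x --.(M(|carrier := ?V|)) a *>.M m = x --.M a *>.M m" using M.minus_submod[OF V(1) aV[OF a(1)]] by (simp add: a_minus_def)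
   have "?p x --.(subquotient M ?V U) ?p (a *>.M m) = ?p (x --.M a *>.M m)" using p.map_diff[of x "a *>.M m"] x(1) aV[OF a(1)] by (simp add: xV)
   also have "... = 0@(subquotient M ?V U)" using pi(3)[of "x --.M a *>.M m"] a(2) V(2) by blast
   finally have "y = ?p (a *>.M m)"
    using p.N.M.diff_eq_zero_iff[of "?p x" "?p (a *>.M m)"] x aV[OF a(1)] p.closed[of x] p.closed[of "a *>.M m"] by simp
   moreover have "a *>.M m = (e t ** a) *>.M m" using M.act_mult[of "e t" a m] a(1) mM et[OF t] by simp
   moreover have "e t ** a :. (PP t)" using a(1) et[OF t] by (simp add: P_sel[OF t] flip: A.m_assoc)
   ultimately show "y : (%a. ?p (a *>.M m)) ` car (PP t)" by auto
  qed
 qed (use aV PA pi(2) in blast)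
 show ?thesis by (rule same_kernel_iso[OF g onto q]) (use k D pi(3) aV PA in simp)
qed

context
 fixes M :: "('a, 'm) module" and t
 assumes M: "rmod A M" and t: "t : {1..n}" and ex: "exact_at M t"
begin

interpretation M: right_module A M by (rule M)
interpretation CM: right_module "C t" "crm M (e t)" by (rule crm_right_module[OF M et(1,2)[OF t]])

lemma base_submodule: "subm (tr M (Suc t) Int car (crm M (e t))) (C t) (crm M (e t))"
 by (rule crm_submodule[OF M tr_submodule[OF M] et(1,2)[OF t]]) simp

lemma hat_adjoin:
 assumes V: "subm V (C t) (crm M (e t))" and m: "m :. (crm M (e t))" shows "hat M t (adjoin (C t) (crm M (e t)) V m) = adjoin A M (hat M t V) m"
proof
 let ?V = "adjoin (C t) (crm M (e t)) V m"
 have mM: "m :. M" using m by simp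
 note H = hat_submodule[OF M t V]
 note W = CM.adjoin_submodule[OF V m] and G = M.adjoin_submodule[OF H mM]
 have VH: "V' <= hat M t V'" if "subm V' (C t) (crm M (e t))" for V'
 proof
  fix x assume x: "x : V'"
  have "x :. M" using V_carrier(2)[OF M t that] x by blast
  thus "x : hat M t V'" using hat_orbit[OF M t that x A.one_closed] by (simp add: M.act_one)
 qed
 show "hat M t ?V <= adjoin A M (hat M t V) m"
 proof (rule hat_least[OF M t W(1) G(1)])
  show "tr M (Suc t) <= adjoin A M (hat M t V) m" using hat_base[OF M t V] G(2) by blast
  show "?V <= adjoin A M (hat M t V) m"
  proof
   fix x assume "x : ?V"
   then obtain c where c: "x :. M" "c :. (C t)" "x --.(crm M (e t)) c *>.M m : V" unfolding adjoin_def by auto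
   have "c *>.M m :. (crm M (e t))" using CM.act_closed[OF c(2) m] by simp
   hence "x --.M c *>.M m : hat M t V" using minus_corner_module(2)[OF M et(1)[OF t]] c(3) VH[OF V] by auto
   thus "x : adjoin A M (hat M t V) m" unfolding adjoin_def using c by auto
  qed
 qed
 show "adjoin A M (hat M t V) m <= hat M t ?V"
  by (rule M.adjoin_least[OF hat_submodule[OF M t W(1)] hat_least[OF M t V hat_submodule[OF M t W(1)] hat_base[OF M t W(1)]]])
   (use VH[OF W(1)] W(2,3) in auto)
qed

text \<open>The new factor is \<open>e t A\<close> modulo those \<open>a\<close> that move
  \<open>m\<close> into \<open>hat M t V\<close>. Expand \<open>a\<close> in the family
  \<open>b t\<close> with coefficients \<open>c j\<close>. By exactness the condition holds iff
  every \<open>c j\<close> moves \<open>m\<close> into \<open>V\<close>, so the factor depends only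
  on the annihilator of \<open>m\<close> modulo \<open>V\<close>.\<close>

lemma layer_step:
 assumes V: "subm V (C t) (crm M (e t))" and base: "tr M (Suc t) Int car (crm M (e t)) <= V"
  and m: "m :. (crm M (e t))" and T: "cyclic t D T" "T : Th" and D: "!!a. a :. (PP t) ==> a : D <-> a : hat AA t {c : car (C t). c *>.M m : V}"
 shows "chain_step A M (%Q. EX T:Th. module_iso A Q T) (hat M t V) (hat M t (adjoin (C t) (crm M (e t)) V m))"
proof -
 have mM: "m :. M" using m by simp
 note H = hat_submodule[OF M t V]
 note G = M.adjoin_submodule[OF H mM]
 have key: "a *>.M m : hat M t V <-> a : D" if aP: "a :. (PP t)" for a
 proof -
  have a: "a :. A" "e t ** a = a" using aP by (simp_all add: P_sel[OF t])
  have cm: "c j *>.M m :. (crm M (e t))" if "c : r t ->. (C t)" "j < r t" for c j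
   using CM.act_closed[OF _ m, of "c j"] that by (auto simp: Pi_iff simp del: corner_sel(1))
  have cmM: "(%j. c j *>.M m) : r t ->. M" if "c : r t ->. (C t)" for c using cm[OF that] by auto
  have "a : hat AA t {c : car (C t). c *>.M m : V}" if am: "a *>.M m : hat M t V"
  proof -
   obtain c where c: "c : r t ->. (C t)" "a -- (+/j:{..<r t}. c j ** b t j) : tr AA (Suc t)"
    "a *>.M m --.M bsum M t (%j. c j *>.M m) : tr M (Suc t)" using bsum_orbit[OF M t m a(1)] unfolding a(2) by blast
   have cA: "c : r t ->. A" using c(1) by auto
   have "a *>.M m --.M bsum M t (%j. c j *>.M m) : hat M t V" using c(3) hat_base[OF M t V] by blast
   hence "bsum M t (%j. c j *>.M m) : hat M t V" using M.submod_diff_iff[OF H] am a(1) mM bsum_closed[OF M t cmM[OF c(1)]] by auto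
   hence "c j *>.M m : V" if "j < r t" for j by (intro exact_hat[OF M t V ex base _ _ that]) (use cm[OF c(1)] in auto)
   hence "c : {..<r t} -> {c : car (C t). c *>.M m : V}" using c(1) by blast
   moreover have "a --.AA bsum AA t c : tr AA (Suc t)" using c(2) bsum_regular[OF t cA] by simp
   ultimately show ?thesis unfolding hat_def using a(1) by auto
  qed
  moreover have "a *>.M m : hat M t V" if ah: "a : hat AA t {c : car (C t). c *>.M m : V}"
  proof -
   obtain c where c: "c : {..<r t} -> {c : car (C t). c *>.M m : V}" "a --.AA bsum AA t c : tr AA (Suc t)" using ah unfolding hat_def by blast
   have cA: "c : r t ->. AA" using c(1) by auto
   interpret f: linear_map A AA M "%a. a *>.M m" by (intro lmapI A_rmod M M.lin_orbit mM)
   note bc = bsum_closed[OF A_rmod t cA]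
   have "(a --.AA bsum AA t c) *>.M m : tr M (Suc t)" by (rule tr_regular(2)[OF _ M c(2) mM]) simp
   hence "a *>.M m --.M bsum M t (%j. c j *>.M m) : hat M t V"
    using f.map_diff[of a "bsum AA t c"] bsum_map[OF f.linear_map_axioms t cA] a(1) bc hat_base[OF M t V] by auto
   moreover have "bsum M t (%j. c j *>.M m) : hat M t V"
   proof (rule bsum_submod[OF M t H])
    show "(%j. c j *>.M m) : {..<r t} -> hat M t V"
    proof
     fix j assume "j : {..<r t}"
     hence v: "c j *>.M m : V" using c(1) by blast
     hence "c j *>.M m :. M" using V_carrier(2)[OF M t V] by blast
     thus "c j *>.M m : hat M t V" using hat_orbit[OF M t V v A.one_closed] by (simp add: M.act_one)
    qed
   qed
   ultimately show ?thesis using M.submod_diff_iff[OF H] a(1) mM M.submod_carrier[OF H] by auto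
  qed
  ultimately show ?thesis using D[OF aP] by blast
 qed
 have "module_iso A (subquotient M (adjoin A M (hat M t V) m) (hat M t V)) T" by (rule adjoin_iso[OF M t H m T(1) key])
 thus ?thesis unfolding chain_step_def hat_adjoin[OF V m] using H G(1,2) T(2) by blast
qed

text \<open>Starting from the trace, adjoin one socle element of \<open>M e t\<close> modulo
  \<open>V\<close> after the other. Its annihilator is the set of nonunits, so every step
  contributes one proper standard module.\<close>

lemma proper_layer:
 assumes fg: "fgm A M" and T: "cyclic t (pstd_ker t) T" "T : Th"
 shows "(chain_step A M (%Q. EX T:Th. module_iso A Q T))\<^sup>*\<^sup>* (tr M (Suc t)) (tr M t)"
proof -
 let ?S = "chain_step A M (%Q. EX T:Th. module_iso A Q T)"
 let ?CM = "crm M (e t)"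
 let ?V0 = "tr M (Suc t) Int car ?CM"
 interpret Ct: fd_algebra K "C t" by (rule corner_fd[OF et(1,2)[OF t]])
 have fgC: "fgm (C t) ?CM" by (rule crm_fg[OF fg et(1,2)[OF t]])
 have loc: "local_ring (C t)" using idem(1)[OF t] by (rule corner_local)
 let ?r = "%V. rank K (kmod (C t) (?CM(|carrier := V|)))"
 have "?S\<^sup>*\<^sup>* (hat M t V) (hat M t (car ?CM))" if "subm V (C t) ?CM" "?V0 <= V" for V using that
 proof (induct "?r (car ?CM) - ?r V" arbitrary: V rule: less_induct)
  case less
  note V = less(2)
  show ?case
  proof (cases "V = car ?CM")
   case False
   from Ct.socle[OF loc fgC V False] obtain m where m: "m : car ?CM" "m ~: V"
    "ALL a:car (C t). a ~: Units (C t) --> a *>.?CM m : V" by blast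
   note W = CM.adjoin_submodule[OF V m(1)]
   let ?W = "adjoin (C t) ?CM V m"
   have "?r V < ?r ?W" by (rule Ct.rank_submodule_mono[OF fgC V W(1)]) (use W(2,3) m(2) in blast)
   moreover have "?r ?W <= ?r (car ?CM)" using Ct.rank_submodule_mono[OF fgC W(1) CM.submod_self] CM.submod_subset[OF W(1)]
    by (metis less_imp_le order_refl psubsetI)
   ultimately have rest: "?S\<^sup>*\<^sup>* (hat M t ?W) (hat M t (car ?CM))" by (intro less(1) W(1)) (use W(2) less(3) in auto)
   have "{c : car (C t). c *>.M m : V} = nonunits t"
   proof -
    have "c ~: Units (C t)" if c: "c :. (C t)" "c *>.M m : V" for c
    proof
     assume u: "c : Units (C t)"
     then obtain d where d: "d :. (C t)" "c ** d = e t" using CM.Units_r_inv_ex[OF u] by auto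
     have "d *>.?CM (c *>.M m) : V" by (rule CM.submod_act[OF V d(1) c(2)])
     moreover have "d *>.M (c *>.M m) = m" using M.act_mult[of c d m] c(1) d m(1) by simp
     ultimately show False using m(2) by simp
    qed
    thus ?thesis unfolding nonunits_def using m(3) by auto
   qed
   hence "?S (hat M t V) (hat M t ?W)" using pstd_ker_hat[OF t] by (intro layer_step[OF V less(3) m(1) T]) simp
   thus ?thesis using rest by (rule converse_rtranclp_into_rtranclp)
  qed simp
 qed
 from this[OF base_submodule subset_refl] have "?S\<^sup>*\<^sup>* (hat M t ?V0) (tr M t)" unfolding tr_hat[OF M t] .
 moreover have "hat M t ?V0 = tr M (Suc t)"
  using hat_base[OF M t base_submodule] hat_least[OF M t base_submodule tr_submodule[OF M, of "Suc t"]] by auto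
 ultimately show ?thesis by simp
qed

end

lemma layers_filtered:
 assumes fg: "fgm A M" and layer: "!!t. t : {1..n} ==> (chain_step A M (%Q. EX T:Th. module_iso A Q T))\<^sup>*\<^sup>* (tr M (Suc t)) (tr M t)"
 shows "M : filtered_by A Th"
proof -
 have M: "rmod A M" by (rule fgmD[OF fg])
 let ?S = "(chain_step A M (%Q. EX T:Th. module_iso A Q T))\<^sup>*\<^sup>*"
 have "?S (tr M (Suc n)) (tr M t)" if "1 <= t" "t <= Suc n" for t using that(2,1)
 proof (induct rule: inc_induct)
  case (step t)
  thus ?case using layer[of t] by (auto intro: rtranclp_trans)
 qed simp
 from this[of 1] show ?thesis unfolding filtered_by_iff using fg tr_top[OF M, of "Suc n"] tr_bot[OF M] by simp
qed

lemma exact_imp_proper_filtered: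
 assumes fg: "fgm A M" and ex: "exact M" shows "M : filtered_by A (proper_standard_modules A n e)"
proof (rule layers_filtered[OF fg])
 fix t assume t: "t : {1..n}"
 show "(chain_step A M (%Q. EX T:proper_standard_modules A n e. module_iso A Q T))\<^sup>*\<^sup>* (tr M (Suc t)) (tr M t)"
  by (rule proper_layer[OF fgmD[OF fg] t _ fg proper_standard_cyclic[OF t]]) (use ex t in "auto simp: exact_def proper_standard_modules_def")
qed

lemma proper_filtered_imp_exact:
 assumes "M : filtered_by A (proper_standard_modules A n e)" shows "exact M" using assms
proof (rule filtered_exact)
 fix T assume "T : proper_standard_modules A n e"
 then obtain t where t: "t : {1..n}" "T = proper_standard_module A n e t" unfolding proper_standard_modules_def by blast
 have c: "cyclic t (pstd_ker t) T" unfolding t(2) by (rule proper_standard_cyclic[OF t(1)])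
 show "rmod A T & exact T" using exact_proper_standard[OF t(1) c] cyclic_trace(1)[OF t(1) c pstd_ker(3)[OF t(1)]] by blast
qed

lemma standard_filtered_imp_exact:
 assumes "M : filtered_by A (standard_modules A n e)" and ex: "exact AA" shows "exact M" using assms(1)
proof (rule filtered_exact)
 fix T assume "T : standard_modules A n e"
 then obtain t where t: "t : {1..n}" "T = standard_module A n e t" unfolding standard_modules_def by blast
 have c: "cyclic t (std_ker t) T" unfolding t(2) by (rule standard_cyclic[OF t(1)])
 show "rmod A T & exact T" using exact_standard[OF t(1) c ex] cyclic_trace(1)[OF t(1) c subset_refl] by blast
qed

end

section \<open>Bases modulo a submodule\<close>

abbreviation lsum :: "('a, 'm) module => nat => (nat => 'a) => (nat => 'm) => 'm" where
 "lsum V p c z \<equiv> (+/.V i<p. c i *>.V z i)"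

lemma (in right_module) lsum_Suc:
 "[|c : Suc p ->. R; z : Suc p ->. M|] ==> lsum M (Suc p) c z = c p *>.M z p ++.M lsum M p c z"
 unfolding lessThan_Suc by (rule M.finsum_insert) (auto simp: Pi_iff)

lemma basis_mod_image:
 assumes q: "lmap R V V' q" "q ` car V = car V'" and b: "basis_mod R V W J v p" and W: "!!w. w :. V ==> w : W <-> q w : W'"
 shows "basis_mod R V' W' J (%i. q (v i)) p"
proof -
 interpret q: linear_map R V V' q by (rule q(1))
 note v = basis_modD(2)[OF b]
 have qs: "q (lsum V p c v) = lsum V' p c (%i. q (v i))" if "c : p ->. R" for c
 proof -
  have "q (lsum V p c v) = (+/.V' i<p. q (c i *>.V v i))" by (rule q.map_finsum) (use that v in auto)
  also have "... = lsum V' p c (%i. q (v i))" by (rule q.N.finsum_cong') (use that v in "auto simp: Pi_iff q.map_act")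
  finally show ?thesis .
 qed
 show ?thesis unfolding basis_mod_def spans_mod_def
 proof (intro conjI ballI impI allI)
  fix y assume "y :. V'"
  then obtain x where x: "x :. V" "y = q x" using q(2) by (metis imageE)
  obtain c where c: "c : p ->. R" "x --.V lsum V p c v : W" using basis_modD(1)[OF b] x(1) by (rule spans_modE)
  have s: "lsum V p c v :. V" using c(1) v by (rule q.M.sum_closed)
  hence "y --.V' lsum V' p c (%i. q (v i)) : W'" using W[of "x --.V lsum V p c v"] c x qs[OF c(1)] q.map_diff[OF x(1) s] by simp
  thus "EX c:p ->. R. y --.V' lsum V' p c (%i. q (v i)) : W'" using c(1) by blast
 next
  fix c i assume c: "c : p ->. R" "lsum V' p c (%i. q (v i)) : W'" and i: "i < p"
  have "lsum V p c v : W" using W[OF q.M.sum_closed[OF c(1) v]] c(2) qs[OF c(1)] by simp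
  thus "c i : J" using basis_modD(3)[OF b c(1)] i by blast
 qed (use v in auto)
qed

context right_module
begin

lemma basis_restrict:
 assumes W: "subm W R M" and b: "basis_mod R (M(|carrier := W|)) B' J y p" and sub: "B' <= B" "W Int B <= B'"
 shows "y : {..<p} -> W" "c : p ->. R ==> lsum M p c y : W"
  "w : W ==> EX c:p ->. R. w --.M lsum M p c y : B"
  "[|c : p ->. R; lsum M p c y : B; i < p|] ==> c i : J"
proof -
 show y: "y : {..<p} -> W" using basis_modD(2)[OF b] by simp
 have cy: "(%i. c i *>.M y i) : {..<p} -> W" if "c : p ->. R" for c using submod_act[OF W] that y by (auto simp: Pi_iff)
 have s: "lsum (M(|carrier := W|)) p c y = lsum M p c y" if "c : p ->. R" for c using finsum_submod[OF W cy[OF that]] by simp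
 show sW: "lsum M p c y : W" if "c : p ->. R" for c by (rule submod_finsum[OF W]) (use cy[OF that] in blast)
 show "EX c:p ->. R. w --.M lsum M p c y : B" if w: "w : W"
 proof -
  obtain c where c: "c : p ->. R" "w --.(M(|carrier := W|)) lsum (M(|carrier := W|)) p c y : B'"
   by (rule spans_modE[OF basis_modD(1)[OF b], of w]) (use w in auto)
  have "w --.M lsum M p c y : B'" using c(2) minus_submod[OF W sW[OF c(1)]] unfolding s[OF c(1)] by (simp add: a_minus_def)
  thus ?thesis using c(1) sub(1) by blast
 qed
 show "c i : J" if "c : p ->. R" "lsum M p c y : B" "i < p" for c i
  by (rule basis_modD(3)[OF b that(1) _ that(3)]) (use s[OF that(1)] sW[OF that(1)] that(2) sub(2) in auto)
qed

lemma basis_extend_same: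
 assumes W: "subm W R M" and b: "basis_mod R (M(|carrier := W|)) B' J y p" and B: "subm B R M" and sub: "B' <= B" "W Int B <= B'"
  and gen: "!!v. v :. M ==> EX w:W. v --.M w : B" shows "basis_mod R M B J y p" unfolding basis_mod_def spans_mod_def
proof (intro conjI ballI impI allI)
 note bs = basis_restrict[OF W b sub]
 show yM: "y : p ->. M" using bs(1) submod_subset[OF W] by blast
 fix v assume v: "v :. M"
 obtain w where w: "w : W" "v --.M w : B" using gen[OF v] by blast
 obtain c where c: "c : p ->. R" "w --.M lsum M p c y : B" using bs(3)[OF w(1)] by blast
 have "v --.M lsum M p c y : B" using submod_add[OF B w(2) c(2)] M.diff_add_diff[OF v submod_carrier[OF W w(1)] sum_closed[OF c(1) yM]] by simp
 thus "EX c:p ->. R. v --.M lsum M p c y : B" using c(1) by blast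
qed (rule basis_restrict(4)[OF W b sub])

text \<open>Modulo \<open>W\<close> and \<open>B\<close> the module is generated by \<open>g\<close>
  with annihilator \<open>J\<close>. It is thus an extension of a free module by a copy of
  \<open>R / J\<close>, and \<open>g\<close> completes the basis.\<close>

lemma basis_extend_one:
 assumes W: "subm W R M" and b: "basis_mod R (M(|carrier := W|)) B' J y p" and B: "subm B R M" and sub: "B' <= B" "W Int B <= B'" and g: "g :. M"
  and gen: "!!v. v :. M ==> EX c:car R. v --.M c *>.M g : W" and ind: "!!c w. c :. R ==> w : W ==> c *>.M g ++.M w : B ==> c : J"
  and J: "!!c. c : J ==> c *>.M g : B" shows "EX z. basis_mod R M B J z (Suc p)"
proof -
 note bs = basis_restrict[OF W b sub]
 let ?z = "%i. if i < p then y i else g"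
 have yM: "y : p ->. M" using bs(1) submod_subset[OF W] by blast
 have zM: "?z : Suc p ->. M" using yM g by (auto simp: Pi_iff)
 have zs: "lsum M (Suc p) c ?z = c p *>.M g ++.M lsum M p c y" if c: "c : Suc p ->. R" for c
 proof -
  have "lsum M p c ?z = lsum M p c y" by (rule M.finsum_cong') (use c yM in "auto simp: Pi_iff")
  thus ?thesis using lsum_Suc[OF c zM] by simp
 qed
 have "basis_mod R M B J ?z (Suc p)" unfolding basis_mod_def spans_mod_def
 proof (intro conjI ballI impI allI zM)
  fix v assume v: "v :. M"
  obtain a where a: "a :. R" "v --.M a *>.M g : W" using gen[OF v] by blast
  obtain c where c: "c : p ->. R" "(v --.M a *>.M g) --.M lsum M p c y : B" using bs(3)[OF a(2)] by blast
  let ?c = "%i. if i < p then c i else a"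
  have c': "?c : Suc p ->. R" using c(1) a(1) by (auto simp: Pi_iff)
  have "lsum M p ?c y = lsum M p c y" by (rule M.finsum_cong') (use c yM in "auto simp: Pi_iff")
  hence e: "lsum M (Suc p) ?c ?z = a *>.M g ++.M lsum M p c y" using zs[OF c'] by simp
  have "(x --.M s) --.M u = x --.M (s ++.M u)" if "x :. M" "s :. M" "u :. M" for x s u using that by algebra
  hence "v --.M lsum M (Suc p) ?c ?z : B" unfolding e using c v a(1) g yM sum_closed[OF c(1) yM] by simp
  thus "EX c:Suc p ->. R. v --.M lsum M (Suc p) c ?z : B" by (rule bexI[OF _ c'])
 next
  fix c i assume c: "c : Suc p ->. R" and rel: "lsum M (Suc p) c ?z : B" and i: "i < Suc p"
  have c1: "c : p ->. R" "c p :. R" using c by auto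
  have rel': "c p *>.M g ++.M lsum M p c y : B" using rel zs[OF c] by simp
  have cp: "c p : J" by (rule ind[OF c1(2) bs(2)[OF c1(1)] rel'])
  have s: "lsum M p c y :. M" by (rule sum_closed[OF c1(1) yM])
  have "(x ++.M u) --.M x = u" if "x :. M" "u :. M" for x u using that by algebra
  hence "lsum M p c y : B" using submod_diff[OF B rel' J[OF cp]] c1(2) g s by simp
  thus "c i : J" using bs(4)[OF c1(1)] cp i by (cases "i = p") auto
 qed
 thus ?thesis by blast
qed

lemma lsum_delta:
 assumes "a :. R" "x : p ->. M" "k < p" shows "lsum M p (%i. if i = k then a else 0@R) x = a *>.M x k"
 using assms by (subst M.finsum_single[of _ k]) (auto simp: Pi_iff)

text \<open>\<open>V k\<close> is \<open>B\<close> plus the span of the first \<open>k\<close> basis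
  elements. Each step has annihilator \<open>J\<close>, the shape that \<open>layer_step\<close>
  turns into a standard module.\<close>

lemma basis_flag:
 assumes b: "basis_mod R M B J x p" and B: "subm B R M" and JR: "J <= car R" and J: "!!c k. c : J ==> k < p ==> c *>.M x k : B"
 shows "EX V. V 0 = B & V p = car M & (ALL k<=p. subm (V k) R M & B <= V k) &
  (ALL k<p. V (Suc k) = adjoin R M (V k) (x k) & {c : car R. c *>.M x k : V k} = J)"
proof -
 note x = basis_modD(2)[OF b]
 have xk: "x k :. M" if "k < p" for k using x that by auto
 define V where "V = rec_nat B (%k W. adjoin R M W (x k))"
 have V: "V 0 = B" "V (Suc k) = adjoin R M (V k) (x k)" for k by (simp_all add: V_def)
 have sub: "subm (V k) R M & B <= V k" if "k <= p" for k using that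
 proof (induct k)
  case (Suc k)
  thus ?case using adjoin_submodule[of "V k" "x k"] xk[of k] unfolding V by auto
 qed (simp add: V B)
 let ?d = "%k a i. if i = k then a else 0@R"
 \<comment> \<open>Elements of \<open>V k\<close> have coordinates that vanish from \<open>k\<close>
   on.\<close>
 have mem: "EX c:p ->. R. (ALL i<p. k <= i --> c i = 0@R) & v --.M lsum M p c x : B" if "k <= p" "v : V k" for k v using that
 proof (induct k arbitrary: v)
  case 0
  have "lsum M p (%_. 0@R) x = 0@M" by (rule M.finsum_all_zero) (use xk in auto)
  thus ?case using 0 submod_carrier[OF B] unfolding V by (intro bexI[of _ "%_. 0@R"]) auto
 next
  case (Suc k)
  then obtain a where a: "v :. M" "a :. R" "v --.M a *>.M x k : V k" unfolding V adjoin_def by blast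
  have kp: "k < p" using Suc(2) by simp
  obtain c where c: "c : p ->. R" "ALL i<p. k <= i --> c i = 0@R"
   "(v --.M a *>.M x k) --.M lsum M p c x : B" using Suc(1)[OF _ a(3)] kp by auto
  have d: "?d k a : p ->. R" using a(2) by auto
  have "lsum M p (%i. c i ++.R ?d k a i) x = lsum M p c x ++.M a *>.M x k" unfolding sum_add[OF c(1) d x] lsum_delta[OF a(2) x kp] ..
  moreover have "(w --.M u) --.M s = w --.M (s ++.M u)" if "w :. M" "s :. M" "u :. M" for w s u using that by algebra
  ultimately have "v --.M lsum M p (%i. c i ++.R ?d k a i) x : B" using c(3) a xk[OF kp] sum_closed[OF c(1) x] by simp
  moreover have "(%i. c i ++.R ?d k a i) : p ->. R" using c(1) a(2) by auto
  moreover have "ALL i<p. Suc k <= i --> c i ++.R ?d k a i = 0@R" using c(2) by auto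
  ultimately show ?case by (intro bexI[of _ "%i. c i ++.R ?d k a i"] conjI)
 qed
 have "car M <= V p"
 proof
  fix v assume v: "v :. M"
  obtain c where c: "c : p ->. R" "v --.M lsum M p c x : B" using basis_modD(1)[OF b] v by (rule spans_modE)
  have Vp: "subm (V p) R M" using sub by blast
  have "x i : V p" if i: "i < p" for i
  proof -
   have "Suc i <= p" using i by simp
   thus ?thesis
   proof (induct rule: dec_induct)
    case base
    show ?case unfolding V using adjoin_submodule(3)[of "V i" "x i"] sub[of i] xk[OF i] i by simp
   next
    case (step k)
    thus ?case unfolding V using adjoin_submodule(2)[of "V k" "x k"] sub[of k] xk[of k] by auto
   qed
  qed
  hence "lsum M p c x : V p" by (intro submod_finsum[OF Vp] submod_act[OF Vp]) (use c(1) in auto)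
  thus "v : V p" using submod_diff_iff[OF Vp _ v sum_closed[OF c(1) x]] c(2) sub[of p] by blast
 qed
 hence "V p = car M" using submod_subset[of "V p"] sub[of p] by blast
 moreover have "{c : car R. c *>.M x k : V k} = J" if k: "k < p" for k
 proof -
  have "a : J" if a: "a :. R" "a *>.M x k : V k" for a
  proof -
   obtain c where c: "c : p ->. R" "ALL i<p. k <= i --> c i = 0@R" "a *>.M x k --.M lsum M p c x : B" using mem[OF _ a(2)] k by auto
   have d: "?d k a : p ->. R" using a(1) by auto
   have "lsum M p (%i. ?d k a i --.R c i) x : B" unfolding sum_diff[OF d c(1) x] lsum_delta[OF a(1) x k] by (rule c(3))
   from basis_modD(3)[OF b _ this k] show ?thesis using d c(1,2) k a(1) by (auto simp: Pi_iff)
  qed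
  thus ?thesis using J k JR sub[of k] by auto
 qed
 ultimately show ?thesis using V sub by (intro exI[of _ V]) simp
qed

end

text \<open>Coordinates with respect to the basis are unique only modulo \<open>J\<close>, so an
  arbitrary choice of them is linear up to \<open>J\<close>, as \<open>dual_basis_rel\<close>
  demands.\<close>

lemma (in relative_module) basis_dual:
 assumes b: "basis_mod R V U J x m" shows "EX gam. dual_basis_rel m x gam"
proof -
 note x = basis_modD(2)[OF b]
 have "ALL v:car V. EX c. c : m ->. R & v --.V lsum V m c x : U" using basis_modD(1)[OF b] unfolding spans_mod_def by blast
 from bchoice[OF this] obtain c where c: "!!v. v :. V ==> c v : m ->. R"
  "!!v. v :. V ==> v --.V lsum V m (c v) x : U" by blast
 have eq: "c v i --.R d i : J" if v: "v :. V" and d: "d : m ->. R" "v --.V lsum V m d x : U" and i: "i < m" for v d i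
 proof -
  have "lsum V m (%i. c v i --.R d i) x = (v --.V lsum V m d x) --.V (v --.V lsum V m (c v) x)" unfolding V.sum_diff[OF c(1)[OF v] d(1) x]
   by (rule V.M.diff_diff_diff[OF V.sum_closed[OF c(1)[OF v] x] V.sum_closed[OF d(1) x] v])
  hence "lsum V m (%i. c v i --.R d i) x : U" using V.submod_diff[OF U d(2) c(2)[OF v]] by simp
  from basis_modD(3)[OF b _ this i] show ?thesis using c(1)[OF v] d(1) by auto
 qed
 have "dual_basis_rel m x (%i v. c v i)" unfolding dual_basis_rel_def
 proof (intro conjI allI impI ballI x)
  fix i v w assume i: "i < m" and v: "v :. V" and w: "w :. V"
  have "(v ++.V w) --.V lsum V m (%i. c v i ++.R c w i) x = (v --.V lsum V m (c v) x) ++.V (w --.V lsum V m (c w) x)"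
   unfolding V.sum_add[OF c(1)[OF v] c(1)[OF w] x] using v w V.sum_closed[OF c(1)[OF v] x] V.sum_closed[OF c(1)[OF w] x] by (rule V.M.add_diff_add)
  also have "... : U" by (rule V.submod_add[OF U c(2)[OF v] c(2)[OF w]])
  finally show "c (v ++.V w) i --.R (c v i ++.R c w i) : J" using v w c(1) by (intro eq i) (auto simp: Pi_iff)
 next
  fix i a v assume i: "i < m" and a: "a :. R" and v: "v :. V"
  have "a *>.V v --.V lsum V m (%i. c v i **.R a) x = a *>.V (v --.V lsum V m (c v) x)"
   unfolding V.sum_act[OF c(1)[OF v] a x] using v a V.sum_closed[OF c(1)[OF v] x] by (simp add: V.act_diff)
  also have "... : U" by (rule V.submod_act[OF U a c(2)[OF v]])
  finally show "c (a *>.V v) i --.R c v i **.R a : J" using v a c(1) by (intro eq i) (auto simp: Pi_iff)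
 next
  fix i u assume i: "i < m" and u: "u : U"
  have uV: "u :. V" by (rule V.submod_carrier[OF U u])
  have "lsum V m (%_. 0@R) x = 0@V" by (rule V.M.finsum_all_zero) (use x in "auto simp: Pi_iff")
  hence "c u i --.R 0@R : J" using u uV by (intro eq i) auto
  thus "c u i : J" using c(1)[OF uV] i by (auto simp: Pi_iff)
 qed (use c in "auto simp: Pi_iff")
 thus ?thesis by blast
qed

text \<open>The index \<open>i\<close> encodes a pair by quotient and remainder, so that a doubly
  indexed family can be numbered.\<close>

lemma (in abelian_group) finsum_div_mod:
 fixes w m :: nat
 assumes "!!u k. u < w ==> k < m ==> f u k :. G" shows "(+/i:{..<w * m}. f (i div m) (i mod m)) = (+/u<w. +/k<m. f u k)" using assms
proof (induct w)
 case (Suc w)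
 have fc: "f (i div m) (i mod m) :. G" if "i < w * m + m" for i
 proof -
  have "0 < m" using that by (cases m) auto
  moreover have "i div m < Suc w" using that by (simp add: less_mult_imp_div_less add.commute)
  ultimately show ?thesis using Suc(2) by simp
 qed
 have "(+/i:{..<Suc w * m}. f (i div m) (i mod m)) = (+/i:{..<w * m + m}. f (i div m) (i mod m))" by (simp add: add.commute)
 also have "... = (+/i:{..<w * m}. f (i div m) (i mod m)) ++ (+/k<m. f ((w * m + k) div m) ((w * m + k) mod m))"
  by (rule finsum_split) (use fc in auto)
 also have "(+/k<m. f ((w * m + k) div m) ((w * m + k) mod m)) = (+/k<m. f w k)" by (rule finsum_cong') (use Suc(2) in auto)
 also have "(+/i:{..<w * m}. f (i div m) (i mod m)) = (+/u<w. +/k<m. f u k)" using Suc by simp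
 also have "... ++ (+/k<m. f w k) = (+/u:{..<Suc w}. +/k<m. f u k)"
  unfolding lessThan_Suc using Suc(2) by (subst finsum_insert) (auto intro!: finsum_closed simp: a_comm)
 finally show ?case .
qed simp

context generators
begin

abbreviation "CM M t \<equiv> crm M (e t)"
text \<open>\<open>C t\<close> modulo this ideal is the endomorphism ring of the standard module at
  \<open>t\<close>; freeness over it is expressed by the pair.\<close>

definition "Jc t = tr AA (Suc t) Int car (C t)"
definition "base M t = tr M (Suc t) Int car (CM M t)"

definition "free_at M t <-> (EX x p. basis_mod (C t) (CM M t) (base M t) (Jc t) x p)"

lemma baseI: "y : tr M (Suc t) ==> y :. (CM M t) ==> y : base M t" by (simp add: base_def del: crm_sel(1))

lemma CM_right_module: "rmod A M ==> t : {1..n} ==> rmod (C t) (CM M t)" using crm_right_module et by blast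

lemma base_sub: "rmod A M ==> t : {1..n} ==> subm (base M t) (C t) (CM M t)"
 unfolding base_def by (rule crm_submodule[OF _ tr_submodule et(1,2)]) simp_all

lemma CM_diff: "rmod A M ==> t : {1..n} ==> x :. (CM M t) ==> y --.(CM M t) x = y --.M x" by (rule minus_corner_module(2)[OF _ et(1)])

lemma CM_map:
 assumes q: "lmap A M T q" and t: "t : {1..n}" shows "lmap (C t) (CM M t) (CM T t) q"
proof -
 interpret q: linear_map A M T q by (rule q)
 show ?thesis
 proof (intro lmapI CM_right_module q.M.rax q.N.rax t linI)
  fix x assume "x :. (CM M t)"
  thus "q x :. (CM T t)" using q.map_act[OF et(1)[OF t], of x] by simp
 qed (simp_all add: q.map_add q.map_act)
qed

lemma rel_module:
 assumes M: "rmod A M" and t: "t : {1..n}" shows "relative_module (C t) (CM M t) (base M t) (Jc t)"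
proof -
 interpret C: local_ring "C t" using idem(1)[OF t] by (rule corner_local)
 interpret CM: right_module "C t" "CM M t" by (rule CM_right_module[OF M t])
 interpret AA: right_module A AA by (rule A_rmod)
 note J = tr_submodule[OF A_rmod, of "Suc t"]
 show ?thesis
 proof (intro relative_module.intro relative_module_axioms.intro C.local_ring_axioms CM.rax)
  show "subm (base M t) (C t) (CM M t)" by (rule base_sub[OF M t])
  show "0@(C t) : Jc t" using AA.submod_zero[OF J] et[OF t] by (simp add: Jc_def)
  show "a ++.(C t) b : Jc t" if "a : Jc t" "b : Jc t" for a b using AA.submod_add[OF J, of a b] C.a_closed[of a b] that by (simp add: Jc_def)
  show "a **.(C t) b : Jc t" if "a :. (C t)" "b : Jc t" for a b using tr_regular(3)[of "Suc t" b a] C.m_closed[of a b] that by (simp add: Jc_def)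
  show "a **.(C t) b : Jc t" if "a : Jc t" "b :. (C t)" for a b using tr_regular(4)[of "Suc t" a b] C.m_closed[of a b] that by (simp add: Jc_def)
  show "a *>.(CM M t) v : base M t" if "a : Jc t" "v :. (CM M t)" for a v
   by (rule baseI) (use tr_regular(2)[OF _ M, of "Suc t" a v] CM.act_closed[of a v] that in "simp_all add: Jc_def")
 qed (simp add: Jc_def)
qed

section \<open>Freeness and filtrations by standard modules\<close>

lemma free_zero:
 assumes M: "rmod A M" and t: "t : {1..n}" and z: "car M = {0@M}" shows "free_at M t"
proof -
 interpret CM: right_module "C t" "CM M t" by (rule CM_right_module[OF M t])
 have "x = 0@(CM M t)" if "x :. (CM M t)" for x using that z by simp
 hence "basis_mod (C t) (CM M t) (base M t) (Jc t) (%_. 0@M) 0"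
  unfolding basis_mod_def spans_mod_def using CM.submod_zero[OF base_sub[OF M t]] by (auto simp del: crm_sel(1,2))
 thus ?thesis unfolding free_at_def by blast
qed

text \<open>A basis of \<open>M e t\<close> modulo the trace yields a flag whose steps have
  annihilator \<open>Jc t\<close>. By \<open>layer_step\<close> and \<open>std_ker_hat\<close> every
  step contributes one standard module.\<close>

lemma free_standard_layer:
 assumes M: "rmod A M" and t: "t : {1..n}" and ex: "exact_at M t" and fr: "free_at M t" and T: "cyclic t (std_ker t) T" "T : Th"
 shows "(chain_step A M (%Q. EX T:Th. module_iso A Q T))\<^sup>*\<^sup>* (tr M (Suc t)) (tr M t)"
proof -
 let ?S = "chain_step A M (%Q. EX T:Th. module_iso A Q T)"
 interpret M: right_module A M by (rule M)
 interpret RM: relative_module "C t" "CM M t" "base M t" "Jc t" by (rule rel_module[OF M t])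
 obtain x p where b: "basis_mod (C t) (CM M t) (base M t) (Jc t) x p" using fr unfolding free_at_def by blast
 have x: "x k :. (CM M t)" if "k < p" for k using basis_modD(2)[OF b] that by blast
 obtain V where V: "V 0 = base M t" "V p = car (CM M t)"
  "!!k. k <= p ==> subm (V k) (C t) (CM M t) & base M t <= V k"
  "!!k. k < p ==> V (Suc k) = adjoin (C t) (CM M t) (V k) (x k) & {c : car (C t). c *>.(CM M t) x k : V k} = Jc t"
  using RM.V.basis_flag[OF b base_sub[OF M t] RM.J_sub RM.J_act[OF _ x]] by blast
 have "?S\<^sup>*\<^sup>* (hat M t (V 0)) (hat M t (V k))" if "k <= p" for k using that
 proof (induct k)
  case (Suc k)
  have k: "k < p" using Suc(2) by simp
  have "{c : car (C t). c *>.M x k : V k} = Jc t" using V(4)[OF k] by simp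
  hence "?S (hat M t (V k)) (hat M t (adjoin (C t) (CM M t) (V k) (x k)))" using std_ker_hat[OF t] V(3)[of k] k
   by (intro layer_step[OF M t ex _ _ x[OF k] T]) (simp_all add: Jc_def base_def)
  hence "?S (hat M t (V k)) (hat M t (V (Suc k)))" using V(4)[OF k] by simp
  thus ?case using Suc by (auto intro: rtranclp.rtrancl_into_rtrancl)
 qed simp
 from this[of p] have "?S\<^sup>*\<^sup>* (hat M t (base M t)) (tr M t)" unfolding tr_hat[OF M t] V by simp
 moreover have "hat M t (base M t) = tr M (Suc t)"
  using hat_base[OF M t base_sub[OF M t]] hat_least[OF M t base_sub[OF M t] tr_submodule[OF M, of "Suc t"]] by (auto simp: base_def)
 ultimately show ?thesis by simp
qed

text \<open>By \<open>kernel_trace\<close>, freeness of the kernel becomes a statement about a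
  submodule of \<open>CM M t\<close>, which the basis lemmas of the previous section can
  extend.\<close>

lemma kernel_base:
 assumes q: "lmap A M T q" "q ` car M = car T" and t: "t : {1..n}" and ex: "!!s. [|t < s; s <= n|] ==> exact_at T s"
 shows "base (M(|carrier := akr M T q|)) t = akr M T q Int base M t"
  "CM (M(|carrier := akr M T q|)) t = (CM M t)(|carrier := akr M T q Int car (CM M t)|)"
  "subm (akr M T q Int car (CM M t)) (C t) (CM M t)"
proof -
 interpret q: linear_map A M T q by (rule q(1))
 note M = q.M.rax
 have ker: "x :. M" if "x : akr M T q" for x using q.M.submod_carrier[OF q.submod_kernel that] .
 show "base (M(|carrier := akr M T q|)) t = akr M T q Int base M t"
  using kernel_trace[OF q ex] tr_sub(1)[OF M q.submod_kernel, of "Suc t"] ker unfolding base_def by auto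
 show "CM (M(|carrier := akr M T q|)) t = (CM M t)(|carrier := akr M T q Int car (CM M t)|)"
  using ker by (auto simp: crm_def intro: arg_cong[where f = "%U. M(|carrier := U|)"])
 show "subm (akr M T q Int car (CM M t)) (C t) (CM M t)" by (rule crm_submodule[OF M q.submod_kernel et(1,2)[OF t]])
qed

text \<open>A lift \<open>g\<close> of the generator of the standard module at \<open>t\<close> is
  one further basis element. A standard module at another index contributes nothing modulo the
  trace, by \<open>cyclic_off\<close>.\<close>

lemma free_extension:
 assumes q: "lmap A M T q" "q ` car M = car T" and t: "t : {1..n}" and ex: "!!s. [|t < s; s <= n|] ==> exact_at T s"
  and fr: "free_at (M(|carrier := akr M T q|)) t" and T: "cyclic t (std_ker t) T | car (CM T t) <= tr T (Suc t)" shows "free_at M t"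
proof -
 interpret q: linear_map A M T q by (rule q(1))
 note M = q.M.rax and TT = q.N.rax
 interpret RM: relative_module "C t" "CM M t" "base M t" "Jc t" by (rule rel_module[OF M t])
 let ?U = "akr M T q"
 let ?W = "?U Int car (CM M t)"
 have kb: "base (M(|carrier := ?U|)) t = ?U Int base M t" "CM (M(|carrier := ?U|)) t = (CM M t)(|carrier := ?W|)" and W: "subm ?W (C t) (CM M t)"
  by (rule kernel_base[OF q t], erule (1) ex)+
 obtain y p where y: "basis_mod (C t) ((CM M t)(|carrier := ?W|)) (?U Int base M t) (Jc t) y p" using fr unfolding free_at_def kb(1,2) by blast
 have sub: "?U Int base M t <= base M t" "?W Int base M t <= ?U Int base M t" by blast+
 from T show ?thesis
 proof
  assume T: "car (CM T t) <= tr T (Suc t)"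
  have "EX w:?W. v --.(CM M t) w : base M t" if v: "v :. (CM M t)" for v
  proof -
   have qv: "q v :. (CM T t)" using linear_map.closed[OF CM_map[OF q(1) t] v] .
   have "q v : tr T (Suc t)" using T qv by (rule subsetD)
   then obtain u where u: "u :. (CM M t)" "u : tr M (Suc t)" "q u = q v" using trace_lift[OF q t, of "Suc t" "q v"] qv by auto
   have vu: "v :. M" "u :. M" using u v by auto
   have d: "v --.M u :. (CM M t)" using RM.V.M.minus_closed[OF v u(1)] CM_diff[OF M t u(1)] by simp
   have "v --.M u : ?U" using q.map_diff[OF vu] u(3) vu by (simp add: a_kernel_iff)
   moreover have "v --.(CM M t) (v --.M u) = u" using CM_diff[OF M t d] q.M.M.diff_diff_cancel[OF vu] by simp
   moreover have "u : base M t" by (rule baseI[OF u(2,1)])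
   ultimately show ?thesis using d by (intro bexI[of _ "v --.M u"]) simp_all
  qed
  hence "basis_mod (C t) (CM M t) (base M t) (Jc t) y p" by (rule RM.V.basis_extend_same[OF W y base_sub[OF M t] sub])
  thus ?thesis unfolding free_at_def by blast
 next
  assume T: "cyclic t (std_ker t) T"
  obtain f where f: "lmap A (PP t) T f" "f ` car (PP t) = car T" and k: "!!a. a :. (PP t) ==> f a = 0@T <-> a : std_ker t"
   by (rule cyclicE[OF T]) (rule that, simp_all)
  interpret f: linear_map A "PP t" T f by (rule f(1))
  have fe: "a *>.T f (e t) = f a" if "a :. (PP t)" for a using f.map_act[of a "e t"] et_P(1)[OF t] that by (simp add: P_sel[OF t])
  have feC: "e t *>.T f (e t) = f (e t)" by (rule fe[OF et_P(1)[OF t]])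
  have "f (e t) : tr T 1" using f.closed[OF et_P(1)[OF t]] tr_bot[OF TT] by simp
  from trace_lift[OF q t _ this feC] obtain g where g: "g :. (CM M t)" "q g = f (e t)" by auto
  have gM: "g :. M" using g by simp
  have CP: "c :. (PP t)" if "c :. (C t)" for c using that by (simp add: P_sel[OF t])
  have qc: "q (c *>.M g) = f c" if "c :. (C t)" for c using q.map_act[of c g] that gM g(2) fe[OF CP[OF that]] by simp
  have cg: "c *>.M g :. (CM M t)" if "c :. (C t)" for c using RM.V.act_closed[OF that g(1)] by simp
  have "EX z. basis_mod (C t) (CM M t) (base M t) (Jc t) z (Suc p)"
  proof (rule RM.V.basis_extend_one[OF W y base_sub[OF M t] sub g(1)])
   fix v assume v: "v :. (CM M t)"
   have vM: "v :. M" "e t *>.M v = v" using v by simp_all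
   obtain a where a: "a :. (PP t)" "f a = q v" using q.closed[OF vM(1)] f(2) by (metis imageE)
   have aA: "a :. A" "e t ** a = a" using a(1) by (simp_all add: P_sel[OF t])
   have c: "a ** e t :. (C t)" using P_sandwich[OF t a(1) A.one_closed] aA by simp
   have "f (a ** e t) = q v" using f.map_act[OF et(1)[OF t] a(1)] a(2) q.map_act[OF et(1)[OF t] vM(1)] vM(2) by (simp add: P_sel[OF t])
   hence "q (v --.M (a ** e t) *>.M g) = 0@T" using q.map_diff[OF vM(1), of "(a ** e t) *>.M g"] qc[OF c] cg[OF c] vM(1) by simp
   hence "v --.M (a ** e t) *>.M g : ?U" using vM(1) cg[OF c] by (simp add: a_kernel_iff)
   moreover have "v --.M (a ** e t) *>.M g :. (CM M t)" using RM.V.M.minus_closed[OF v cg[OF c]] CM_diff[OF M t cg[OF c]] by simp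
   ultimately show "EX c:car (C t). v --.(CM M t) c *>.(CM M t) g : ?W" using c CM_diff[OF M t cg[OF c]] by (intro bexI[OF _ c]) simp
  next
   fix c w assume c: "c :. (C t)" and w: "w : ?W" and rel: "c *>.(CM M t) g ++.(CM M t) w : base M t"
   have "c *>.M g ++.M w : tr M (Suc t)" using rel unfolding base_def by simp
   from tr_lin[OF M q(1) _ this] have "q (c *>.M g ++.M w) = 0@T" using cyclic_trace(2)[OF t T subset_refl] by simp
   moreover have "w :. M" "q w = 0@T" "c *>.M g :. M" using w cg[OF c] by (simp_all add: a_kernel_iff)
   ultimately have "f c ++.T 0@T = 0@T" using q.map_add[of "c *>.M g" w] qc[OF c] by simp
   hence "f c = 0@T" using f.closed[OF CP[OF c]] by simp
   thus "c : Jc t" using k[OF CP[OF c]] c unfolding Jc_def std_ker_def by blast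
  next
   fix c assume "c : Jc t"
   thus "c *>.(CM M t) g : base M t" by (rule RM.J_act[OF _ g(1)])
  qed
  thus ?thesis unfolding free_at_def by blast
 qed
qed

lemma standard_filtered_imp_free:
 assumes M: "M : filtered_by A (standard_modules A n e)" and ex: "exact AA" and t: "t : {1..n}" shows "free_at M t"
proof -
 let ?S = "chain_step A M (%Q. EX T:standard_modules A n e. module_iso A Q T)"
 have fg: "fgm A M" and ch: "?S\<^sup>*\<^sup>* {0@M} (car M)" using M unfolding filtered_by_iff by blast+
 interpret M: right_module A M using fg by (rule fgmD)
 have "free_at (M(|carrier := V|)) t" if "?S\<^sup>*\<^sup>* {0@M} V" for V using that
 proof (induct rule: rtranclp_induct)
  case base
  show ?case by (rule free_zero[OF M.submod_right_module[OF M.submod_zero_set] t]) simp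
 next
  case (step U V)
  then obtain s where s: "s : {1..n}" "module_iso A (subquotient M V U) (standard_module A n e s)" and UV: "subm U A M" "subm V A M" "U <= V"
   unfolding chain_step_def standard_modules_def by blast
  let ?T = "standard_module A n e s"
  have c: "cyclic s (std_ker s) ?T" by (rule standard_cyclic[OF s(1)])
  from cyclic_trace(1)[OF s(1) c subset_refl] obtain q where q: "lmap A (M(|carrier := V|)) ?T q" "q ` V = car ?T" "ALL x:V. q x = 0@?T <-> x : U"
   using M.subquotient_iso_iff[OF UV, of ?T] s(2) by blast
  have k: "akr (M(|carrier := V|)) ?T q = U" using q(3) UV(3) by (auto simp: a_kernel_iff)
  have T: "cyclic t (std_ker t) ?T | car (CM ?T t) <= tr ?T (Suc t)" using cyclic_off[OF s(1) c subset_refl t] c by (cases "s = t") blast+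
  show ?case by (rule free_extension[OF q(1) _ t _ _ T]) (use q(2) k step(3) exact_standard[OF s(1) c ex] in "auto simp: exact_def")
 qed
 from this[OF ch] show ?thesis by simp
qed

lemma exact_free_imp_standard_filtered:
 assumes fg: "fgm A M" and ex: "exact M" and fr: "!!t. t : {1..n} ==> free_at M t" shows "M : filtered_by A (standard_modules A n e)"
proof (rule layers_filtered[OF fg])
 fix t assume t: "t : {1..n}"
 show "(chain_step A M (%Q. EX T:standard_modules A n e. module_iso A Q T))\<^sup>*\<^sup>* (tr M (Suc t)) (tr M t)"
  by (rule free_standard_layer[OF fgmD[OF fg] t _ fr[OF t] standard_cyclic[OF t]]) (use ex t in "auto simp: exact_def standard_modules_def")
qed

section \<open>Freeness along projective resolutions\<close>

lemma socle_element:
 assumes t: "t : {1..n}" shows "EX s. s :. (C t) & s ~: Jc t & (ALL a:car (C t). a ~: Units (C t) --> a ** s : Jc t)"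
proof -
 \<comment> \<open>A left socle element of the corner is a right socle element of the opposite
   corner.\<close>
 let ?B = "opposite_algebra A"
 let ?D = "corner ?B (e t)"
 interpret B: fd_algebra K ?B by (rule opposite)
 have eB: "e t : car ?B" "e t **.?B e t = e t" using et[OF t] by simp_all
 have "primitive_idempotent ?B (e t)" using idem(1)[OF t] unfolding primitive_idempotent_def opposite_sel by blast
 hence loc: "local_ring ?D" by (rule B.corner_local)
 interpret D: fd_algebra K ?D by (rule B.corner_fd[OF eB])
 interpret DD: right_module ?D "reg ?D" by (rule D.A_rmod)
 interpret AA: right_module A AA by (rule A_rmod)
 interpret R: relative_module "C t" "CM AA t" "base AA t" "Jc t" by (rule rel_module[OF A_rmod t])
 have DC: "car ?D = car (C t)" by auto
 have "subm (Jc t) ?D (reg ?D)" by (rule DD.submodI) (use R.J_sub R.J_zero R.J_add R.J_left DC in auto)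
 note sub = this
 have "e t :. (reg ?D)" using et[OF t] by simp
 moreover have "e t ~: Jc t" using e_notin_trace[OF t] unfolding Jc_def by blast
 ultimately have "Jc t ~= car (reg ?D)" by blast
 from D.socle[OF loc D.fg_regular sub this] obtain s where s: "s :. (reg ?D)" "s ~: Jc t"
  "ALL a:car ?D. a ~: Units ?D --> a *>.(reg ?D) s : Jc t" by blast
 have "a ** s : Jc t" if "a :. (C t)" "a ~: Units (C t)" for a using bspec[OF s(3), of a] that unfolding DC Units_corner_opposite by simp
 thus ?thesis using s(1,2) DC by auto
qed

text \<open>\<open>P\<close> is a retract of a free module, so \<open>P e t\<close> modulo the trace
  is a retract of copies of \<open>A e t\<close> modulo the trace, which is free. The generators are
  all products of a dual basis vector of \<open>P\<close> with a basis element of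
  \<open>A e t\<close>.\<close>

lemma projective_dual:
 assumes fr: "free_at AA t" and t: "t : {1..n}" and P: "rmod A P" and db: "dual_basis A P w y f"
 shows "EX m x gam. relative_module.dual_basis_rel (C t) (CM P t) (base P t) (Jc t) m x gam"
proof -
 interpret P: right_module A P by (rule P)
 interpret AA: right_module A AA by (rule A_rmod)
 interpret RA: relative_module "C t" "CM AA t" "base AA t" "Jc t" by (rule rel_module[OF A_rmod t])
 interpret RP: relative_module "C t" "CM P t" "base P t" "Jc t" by (rule rel_module[OF P t])
 obtain x m where "basis_mod (C t) (CM AA t) (base AA t) (Jc t) x m" using fr unfolding free_at_def by blast
 then obtain kap where kap: "RA.dual_basis_rel m x kap" using RA.basis_dual by blast
 have x: "x : m ->. (CM AA t)" and kapcl: "!!k v. [|k < m; v :. (CM AA t)|] ==> kap k v :. (C t)"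
  and kapsum: "!!v. v :. (CM AA t) ==> v --.(CM AA t) lsum (CM AA t) m (%k. kap k v) x : base AA t"
  and kapadd: "!!k v w. [|k < m; v :. (CM AA t); w :. (CM AA t)|] ==> kap k (v ++.(CM AA t) w) --.(C t) (kap k v ++.(C t) kap k w) : Jc t"
  and kapact: "!!k a v. [|k < m; a :. (C t); v :. (CM AA t)|] ==> kap k (a *>.(CM AA t) v) --.(C t) kap k v **.(C t) a : Jc t"
  and kapU: "!!k u. [|k < m; u : base AA t|] ==> kap k u : Jc t" using kap unfolding RA.dual_basis_rel_def by simp_all
 have f: "lmap A P AA (f u)" if "u < w" for u by (rule lmapI[OF P A_rmod dual_basis_lin[OF db that]])
 note fC = CM_map[OF f t]
 have fcl: "f u v :. (CM AA t)" if "u < w" "v :. (CM P t)" for u v using linear_map.closed[OF fC] that .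
 have yP: "y u :. P" if "u < w" for u using dual_basis_vec(2)[OF db that] .
 have xA: "x k :. A" "x k ** e t = x k" if "k < m" for k using x that by (auto simp: Pi_iff)
 have xy: "x k *>.P y u :. (CM P t)" if "k < m" "u < w" for k u using P.act_mult[of "x k" "e t" "y u"] xA[OF that(1)] yP[OF that(2)] et[OF t] by simp
 \<comment> \<open>The index \<open>i\<close> encodes the pair of \<open>k = i mod m\<close> and
   \<open>u = i div m\<close>.\<close>
 define X where "X i = x (i mod m) *>.P y (i div m)" for i
 define gam where "gam i v = kap (i mod m) (f (i div m) v)" for i v
 have im: "i mod m < m" "i div m < w" if "i < w * m" for i using that by (cases m; simp add: less_mult_imp_div_less)+
 have key: "v --.P lsum P (w * m) (%i. gam i v) X : tr P (Suc t)" if v: "v :. (CM P t)" for v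
 proof -
  have vP: "v :. P" using v by simp
  define a where "a u = f u v" for u
  have aC: "a u :. (CM AA t)" if "u < w" for u using fcl[OF that v] by (simp add: a_def del: crm_sel(1))
  have aA: "a u :. A" if "u < w" for u using aC[OF that] by simp
  have kapA: "kap k (a u) :. A" if "k < m" "u < w" for k u using kapcl[OF that(1) aC[OF that(2)]] by simp
  define s where "s u = (+/k<m. x k ** kap k (a u))" for u
  have s: "s u :. A" if "u < w" for u unfolding s_def using xA kapA that by (intro A.finsum_closed) auto
  have as: "a u -- s u : tr AA (Suc t)" if u: "u < w" for u
  proof -
   have sc: "(%k. kap k (a u) *>.(CM AA t) x k) : m ->. (CM AA t)"
    using RA.V.act_closed kapcl[OF _ aC[OF u]] x by (auto simp: Pi_iff simp del: crm_sel corner_sel)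
   have "lsum (CM AA t) m (%k. kap k (a u)) x = s u" unfolding finsum_corner_module[OF A_rmod et(1)[OF t] sc] s_def by simp
   moreover have "s u :. (CM AA t)" unfolding calculation[symmetric] by (rule RA.V.M.finsum_closed[OF sc])
   ultimately show ?thesis using kapsum[OF aC[OF u]] CM_diff[OF A_rmod t] unfolding base_def by simp
  qed
  have sy: "s u *>.P y u = (+/.P k<m. kap k (a u) *>.P (x k *>.P y u))" if u: "u < w" for u
  proof -
   have "s u *>.P y u = (+/.P k<m. (x k ** kap k (a u)) *>.P y u)" unfolding s_def by (rule P.finsum_act[OF yP[OF u]]) (use xA kapA u in auto)
   also have "... = (+/.P k<m. kap k (a u) *>.P (x k *>.P y u))" by (rule P.M.finsum_cong') (use xA kapA yP u in "auto simp: P.act_mult")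
   finally show ?thesis .
  qed
  have "lsum P (w * m) (%i. gam i v) X = (+/.P u<w. +/.P k<m. kap k (a u) *>.P (x k *>.P y u))"
   unfolding gam_def X_def a_def[symmetric] by (rule P.M.finsum_div_mod[of w m "%u k. kap k (a u) *>.P (x k *>.P y u)"]) (use kapA xA yP in auto)
  also have "... = (+/.P u<w. s u *>.P y u)" by (rule P.M.finsum_cong') (use sy s yP in auto)
  finally have e: "lsum P (w * m) (%i. gam i v) X = (+/.P u<w. s u *>.P y u)" .
  have "v = (+/.P u<w. a u *>.P y u)" unfolding a_def by (rule dual_basis_sum[OF db vP])
  hence "v --.P lsum P (w * m) (%i. gam i v) X = (+/.P u<w. a u *>.P y u) --.P (+/.P u<w. s u *>.P y u)" unfolding e by (rule arg_cong)
  also have "... = (+/.P u<w. a u *>.P y u --.P s u *>.P y u)" by (rule P.M.finsum_diff[symmetric]) (use aA s yP in auto)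
  also have "... : tr P (Suc t)"
  proof (rule P.submod_finsum[OF tr_submodule[OF P]])
   fix u assume u: "u : {..<w}"
   have "a u *>.P y u --.P s u *>.P y u = (a u -- s u) *>.P y u" using u aA s yP by (simp add: P.diff_act)
   thus "a u *>.P y u --.P s u *>.P y u : tr P (Suc t)" using tr_regular(2)[OF _ P as yP] u by simp
  qed simp
  finally show ?thesis .
 qed
 have XC: "X : (w * m) ->. (CM P t)" using xy im unfolding X_def by blast
 have gamC: "gam i v :. (C t)" if "i < w * m" "v :. (CM P t)" for i v
  unfolding gam_def by (rule kapcl[OF im(1)[OF that(1)] fcl[OF im(2)[OF that(1)] that(2)]])
 have "RP.dual_basis_rel (w * m) X gam" unfolding RP.dual_basis_rel_def
 proof (intro conjI allI impI ballI XC gamC)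
  fix v assume v: "v :. (CM P t)"
  have sc: "(%i. gam i v *>.(CM P t) X i) : (w * m) ->. (CM P t)"
   using RP.V.act_closed gamC[OF _ v] XC by (auto simp: Pi_iff simp del: crm_sel corner_sel)
  have 1: "lsum (CM P t) (w * m) (%i. gam i v) X = lsum P (w * m) (%i. gam i v) X" unfolding finsum_corner_module[OF P et(1)[OF t] sc] by simp
  have 2: "lsum (CM P t) (w * m) (%i. gam i v) X :. (CM P t)" by (rule RP.V.M.finsum_closed[OF sc])
  show "v --.(CM P t) lsum (CM P t) (w * m) (%i. gam i v) X : base P t"
   by (rule baseI) (use key[OF v] CM_diff[OF P t 2, of v] 1 RP.V.M.minus_closed[OF v 2] in auto)
 next
  fix i v v' assume i: "i < w * m" and v: "v :. (CM P t)" "v' :. (CM P t)"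
  show "gam i (v ++.(CM P t) v') --.(C t) (gam i v ++.(C t) gam i v') : Jc t"
   using kapadd[OF im(1)[OF i] fcl[OF im(2)[OF i] v(1)] fcl[OF im(2)[OF i] v(2)]] unfolding gam_def linear_map.map_add[OF fC[OF im(2)[OF i]] v] .
 next
  fix i a v assume i: "i < w * m" and a: "a :. (C t)" and v: "v :. (CM P t)"
  show "gam i (a *>.(CM P t) v) --.(C t) gam i v **.(C t) a : Jc t"
   using kapact[OF im(1)[OF i] a fcl[OF im(2)[OF i] v]] unfolding gam_def linear_map.map_act[OF fC[OF im(2)[OF i]] a v] .
 next
  fix i u assume i: "i < w * m" and u: "u : base P t"
  have "f (i div m) u : tr AA (Suc t)" by (rule tr_lin[OF P f[OF im(2)[OF i]]]) (use u in "simp_all add: base_def")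
  hence "f (i div m) u : base AA t" by (rule baseI) (use fcl[OF im(2)[OF i], of u] u in "auto simp: base_def")
  thus "gam i u : Jc t" unfolding gam_def by (rule kapU[OF im(1)[OF i]])
 qed
 thus ?thesis by blast
qed

text \<open>Exactness of \<open>X\<close> above \<open>t\<close> keeps the sequence from
  \<open>?Om\<close> over \<open>CM P t\<close> to \<open>CM X t\<close> exact modulo traces. Then
  \<open>quotient_basis\<close> makes the quotient free, and its basis is mapped to
  \<open>X\<close>.\<close>

lemma free_cokernel:
 assumes fr: "free_at AA t" and t: "t : {1..n}" and P: "fg_proj A P" and q: "lmap A P X q" "q ` car P = car X"
  and ex: "!!s. [|t < s; s <= n|] ==> exact_at X s" and Om: "free_at (P(|carrier := akr P X q|)) t" shows "free_at X t"
proof -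
 interpret q: linear_map A P X q by (rule q(1))
 note PP = q.M.rax and XX = q.N.rax
 interpret RP: relative_module "C t" "CM P t" "base P t" "Jc t" by (rule rel_module[OF PP t])
 interpret c: linear_map "C t" "CM P t" "CM X t" q by (rule CM_map[OF q(1) t])
 have fgP: "fgm A P" and "EX w y f. dual_basis A P w y f" using P unfolding fg_proj_def by blast+
 then obtain m x gam where db: "RP.dual_basis_rel m x gam" using projective_dual[OF fr t PP] by blast
 let ?U = "akr P X q"
 let ?Om = "?U Int car (CM P t)"
 have kb: "base (P(|carrier := ?U|)) t = ?U Int base P t" "CM (P(|carrier := ?U|)) t = (CM P t)(|carrier := ?Om|)" and W: "subm ?Om (C t) (CM P t)"
  by (rule kernel_base[OF q t], erule (1) ex)+
 have bU: "?U Int base P t = base P t Int ?Om" by (auto simp: base_def)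
 obtain y p where y: "basis_mod (C t) ((CM P t)(|carrier := ?Om|)) (base P t Int ?Om) (Jc t) y p" using Om unfolding free_at_def kb bU by blast
 have fg: "EX z p. spans_mod (C t) (CM P t) (base P t) z p"
 proof -
  have "EX z p. spans_mod (C t) (CM P t) {0@(CM P t)} z p" using crm_fg[OF fgP et(1,2)[OF t]] RP.V.fg_spans unfolding fg_right_module_def by blast
  thus ?thesis using spans_mod_mono[of "C t" "CM P t" _ _ _ "base P t"] RP.V.submod_zero[OF RP.U] by blast
 qed
 let ?W = "{v : car (CM P t). q v : base X t}"
 have onto: "q ` car (CM P t) = car (CM X t)"
 proof
  show "car (CM X t) <= q ` car (CM P t)"
  proof
   fix z assume z: "z :. (CM X t)"
   hence "z : tr X 1" "e t *>.X z = z" using tr_bot[OF XX] by simp_all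
   from trace_lift[OF q t _ this] show "z : q ` car (CM P t)" by blast
  qed
 qed (use c.closed in blast)
 have W_iff: "v : ?W <-> (EX om:?Om. v --.(CM P t) om : base P t)" if v: "v :. (CM P t)" for v
 proof
  have vP: "v :. P" using v by simp
  { assume "v : ?W"
   hence "q v : tr X (Suc t)" "e t *>.X q v = q v" using c.closed[OF v] by (simp_all add: base_def)
   from trace_lift[OF q t _ this] obtain u where u: "u :. (CM P t)" "u : tr P (Suc t)" "q u = q v" by auto
   have uP: "u :. P" using u(1) by simp
   have d: "v --.P u :. (CM P t)" using RP.V.M.minus_closed[OF v u(1)] CM_diff[OF PP t u(1)] by simp
   have "v --.P u : ?U" using q.map_diff[OF vP uP] u(3) vP uP by (simp add: a_kernel_iff)
   moreover have "v --.(CM P t) (v --.P u) = u" using CM_diff[OF PP t d] q.M.M.diff_diff_cancel[OF vP uP] by simp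
   moreover have "u : base P t" by (rule baseI[OF u(2,1)])
   ultimately show "EX om:?Om. v --.(CM P t) om : base P t" using d by (intro bexI[of _ "v --.P u"]) simp_all }
  { assume "EX om:?Om. v --.(CM P t) om : base P t"
   then obtain om where om: "om : ?U" "om :. (CM P t)" "v --.(CM P t) om : base P t" by blast
   have om': "om :. P" "q om = 0@X" using om(1) by (simp_all add: a_kernel_iff)
   have "v --.P om : tr P (Suc t)" using om(3) CM_diff[OF PP t om(2)] by (simp add: base_def)
   hence "q (v --.P om) : tr X (Suc t)" by (intro tr_lin[OF PP q(1)]) simp_all
   hence "q v : tr X (Suc t)" using q.map_diff[OF vP om'(1)] om'(2) q.closed[OF vP] by simp
   thus "v : ?W" using baseI[of "q v" X t] c.closed[OF v] v by blast }
 qed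
 obtain s where s: "s :. (C t)" "s ~: Jc t" "!!a. [|a :. (C t); a ~: Units (C t)|] ==> a **.(C t) s : Jc t" using socle_element[OF t] by auto
 obtain v p where v: "basis_mod (C t) (CM P t) ?W (Jc t) v p"
  using RP.quotient_basis[OF db fg W c.submod_preimage[OF base_sub[OF XX t]] W_iff y s] by blast
 have "basis_mod (C t) (CM X t) (base X t) (Jc t) (%i. q (v i)) p" by (rule basis_mod_image[OF c.linear_map_axioms onto v]) simp
 thus ?thesis unfolding free_at_def by blast
qed

lemma free_iso:
 assumes f: "lmap A M N f" "bij_betw f (car M) (car N)" and t: "t : {1..n}" and fr: "free_at M t" shows "free_at N t"
proof -
 interpret f: linear_map A M N f by (rule f(1))
 note M = f.M.rax and N = f.N.rax
 interpret c: linear_map "C t" "CM M t" "CM N t" f by (rule CM_map[OF f(1) t])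
 obtain g where g: "lmap A N M g" "!!x. x :. M ==> g (f x) = x" "!!y. y :. N ==> f (g y) = y" using bij_lin_inverse[OF f] by blast
 interpret d: linear_map "C t" "CM N t" "CM M t" g by (rule CM_map[OF g(1) t])
 obtain x p where x: "basis_mod (C t) (CM M t) (base M t) (Jc t) x p" using fr unfolding free_at_def by blast
 have onto: "f ` car (CM M t) = car (CM N t)"
 proof
  show "car (CM N t) <= f ` car (CM M t)"
  proof
   fix y assume y: "y :. (CM N t)"
   hence "f (g y) = y" using g(3) by simp
   thus "y : f ` car (CM M t)" using d.closed[OF y] by (metis image_eqI)
  qed
 qed (use c.closed in blast)
 have "w : base M t <-> f w : base N t" if w: "w :. (CM M t)" for w
  using tr_lin[OF M f(1), of "Suc t" w] tr_lin[OF N g(1), of "Suc t" "f w"] g(2)[of w] w c.closed[OF w] by (auto simp: base_def)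
 from basis_mod_image[OF c.linear_map_axioms onto x this] show ?thesis unfolding free_at_def by blast
qed

lemma exact_at_iso:
 assumes f: "lmap A M N f" "bij_betw f (car M) (car N)" and t: "t : {1..n}" and ex: "exact_at M t" shows "exact_at N t"
proof -
 interpret f: linear_map A M N f by (rule f(1))
 have "akr M N f <= tr M (Suc t)" using iso_kernel_zero[OF f(1)] f(2) f.M.submod_zero[OF tr_submodule[OF f.M.rax, of "Suc t"]]
  by (simp add: bij_betw_def)
 thus ?thesis using exact_at_quotient[OF f(1) bij_betw_imp_surj_on[OF f(2)] t _ ex] by blast
qed

text \<open>Exactness above \<open>t\<close> first passes from \<open>M\<close> to all syzygies,
  since submodules with exact quotient inherit their traces. Freeness then climbs back from a syzygy
  that is zero.\<close>

lemma finite_projective_dimension_free: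
 assumes fr: "free_at AA t" and exA: "exact AA" and t: "t : {1..n}" and M: "fgm A M"
  and fpd: "finite_projective_dimension A M" and ex: "!!s. [|t < s; s <= n|] ==> exact_at M s" shows "free_at M t"
proof -
 have MM: "rmod A M" by (rule fgmD[OF M])
 obtain P d eps l where res: "projective_resolution A M P d eps" and z: "!!i. i > l ==> car (P i) = {0@(P i)}"
  using fpd unfolding finite_projective_dimension_def by blast
 obtain N :: "('a, nat => 'k) module" and f where N: "fgm A N" "lin A M N f" "bij_betw f (car M) (car N)" using copy_module[OF M] by blast
 have f: "lmap A M N f" using MM fgmD[OF N(1)] N(2) by (rule lmapI)
 obtain X p where X: "resolution A X P p" "X 0 = N" using projective_resolution_to_resolution[OF res MM f N(3)] by force
 have Xi: "fg_proj A (P i)" "lmap A (P i) (X i) (p i)" "p i ` car (P i) = car (X i)"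
  "X (Suc i) = (P i)(|carrier := akr (P i) (X i) (p i)|)" for i using X(1) unfolding resolution_def by blast+
 have PM: "rmod A (P i)" for i by (rule fgmD[OF fg_proj_fg[OF Xi(1)]])
 have XM: "rmod A (X i)" for i using Xi(2)[of i] unfolding linear_map_def by blast
 have exX: "exact_at (X i) s" if "t < s" "s <= n" for i s using that
 proof (induct i arbitrary: s)
  case 0
  thus ?case using exact_at_iso[OF f N(3) _ ex] t X(2) by simp
 next
  case (Suc i)
  have s: "s : {1..n}" using Suc(2,3) by simp
  interpret q: linear_map A "P i" "X i" "p i" by (rule Xi(2))
  obtain w y g where "dual_basis A (P i) w y g" using Xi(1)[of i] unfolding fg_proj_def by blast
  hence exP: "exact_at (P i) s" using exA s by (intro exact_at_projective[OF _ s PM]) (auto simp: exact_def)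
  show ?case unfolding Xi(4)
  proof (rule exact_at_submodule[OF PM q.submod_kernel s _ exP])
   fix x assume "x : akr (P i) (X i) (p i)" "x : tr (P i) (Suc s)"
   thus "x : tr ((P i)(|carrier := akr (P i) (X i) (p i)|)) (Suc s)" by (intro kernel_trace[OF Xi(2,3)]) (use Suc(1,2) in auto)
  qed
 qed
 have "free_at (X i) t" if "i <= Suc l" for i using that
 proof (induct rule: inc_induct)
  case base
  interpret q: linear_map A "P (Suc l)" "X (Suc l)" "p (Suc l)" by (rule Xi(2))
  have "car (X (Suc l)) = {0@(X (Suc l))}" unfolding Xi(3)[symmetric] z[of "Suc l", simplified] by simp
  thus ?case by (rule free_zero[OF XM t])
 next
  case (step i)
  show ?case by (rule free_cokernel[OF fr t Xi(1-3)]) (use exX step(3) Xi(4) in auto)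
 qed
 hence "free_at N t" using X(2) by (metis le0)
 moreover obtain g where "lmap A N M g" "bij_betw g (car N) (car M)" using bij_lin_inverse[OF f N(3)] by blast
 ultimately show ?thesis using free_iso t by blast
qed

end

section \<open>Gorenstein projective modules and the trace filtration\<close>

locale stratified = generators K A n e b r + gorenstein_fd_algebra K A
 for K :: "'k ring" and A :: "('k, 'a) module" (structure) and n e b r +
 assumes strat: "properly_stratified A n e"
begin

lemma exact_AA: "exact AA" using strat unfolding properly_stratified_def by (intro proper_filtered_imp_exact) blast

lemma free_AA: "t : {1..n} ==> free_at AA t" using strat unfolding properly_stratified_def by (intro standard_filtered_imp_free exact_AA) blast+

text \<open>Functionals on \<open>G\<close> that vanish on its trace correspond to homomorphisms
  from \<open>G\<close> to the dual of \<open>A\<close> modulo the trace ideal. The condition says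
  that these factor through free modules.\<close>

definition "decomposes_at t G <-> (ALL phi. functional K (kmod A G) phi --> (ALL x:tr G t. phi x = 0@K) -->
 (EX (w :: nat) h psi. (ALL k<w. lin A G AA (h k) & functional K (kmod A AA) (psi k) & (ALL a:tr AA t. psi k a = 0@K)) &
  (ALL g:car G. phi g = (+/.K k<w. psi k (h k g)))))"

text \<open>By the hypothesis on traces \<open>G\<close> modulo its trace embeds into
  \<open>P\<close> modulo its trace. A functional therefore extends to one on \<open>P\<close> that
  vanishes on the trace, where a dual basis decomposes it.\<close>

lemma embedding_decomposes:
 assumes P: "fg_proj A P" and eta: "lmap A G P eta" and t: "1 <= t" and tr: "!!x. x :. G ==> eta x : tr P t ==> x : tr G t" shows "decomposes_at t G"
 unfolding decomposes_at_def
proof (intro allI impI)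
 fix phi assume phi: "functional K (kmod A G) phi" and phi0: "ALL x:tr G t. phi x = 0@K"
 interpret eta: linear_map A G P eta by (rule eta)
 note PP = eta.N.rax
 have fgP: "fgm A P" by (rule fg_proj_fg[OF P])
 obtain w y f where db: "dual_basis A P w y f" using P unfolding fg_proj_def by blast
 note T = tr_submodule[OF PP t]
 let ?Q = "quotient_module P (tr P t)" and ?pi = "%x. tr P t +>.P x"
 have pi: "lmap A P ?Q ?pi" using eta.N.quotient_right_module[OF T] by (intro lmapI PP)
 interpret pi: linear_map A P ?Q ?pi by (rule pi)
 interpret Q: fin_vector_space K "kmod A ?Q" using fg_quotient[OF fgP T] unfolding fg_right_module_iff by blast
 have c: "lmap A G ?Q (%x. ?pi (eta x))" by (intro lmapI eta.M.rax pi.N.rax lin_comp[OF eta.lin pi.lin])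
 interpret c: linear_map K "kmod A G" "kmod A ?Q" "%x. ?pi (eta x)" by (rule kmod_linear_map[OF c])
 let ?I = "(%x. ?pi (eta x)) ` car (kmod A G)"
 have I: "subm ?I K (kmod A ?Q)" by (rule c.submod_image[OF c.M.submod_self])
 interpret c': linear_map K "kmod A G" "(kmod A ?Q)(|carrier := ?I|)" "%x. ?pi (eta x)"
  by (intro lmapI c.M.rax Q.submod_right_module[OF I] lin_into[OF c.lin]) simp
 have "phi x = 0@K" if x: "x :. G" "?pi (eta x) = tr P t" for x using x tr phi0 eta.N.coset_zero_iff[OF T eta.closed[OF x(1)]] by blast
 then obtain phi1 where phi1: "functional K ((kmod A ?Q)(|carrier := ?I|)) phi1" "ALL x:car (kmod A G). phi1 (?pi (eta x)) = phi x"
  using c'.factor_through[OF K.regular_right_module phi] by auto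
 from Q.extend_lin[OF I phi1(1)] obtain phi2 where phi2: "functional K (kmod A ?Q) phi2" "ALL u:?I. phi2 u = phi1 u" by blast
 define Phi where "Phi x = phi2 (?pi x)" for x
 have Philin: "functional K (kmod A P) Phi" unfolding Phi_def by (rule lin_comp[OF kmod_lin[OF pi.lin] phi2(1)])
 interpret Phi: linear_map K "kmod A P" "reg K" Phi by (rule lmapI[OF kmod_right_module[OF PP] K.regular_right_module Philin])
 have Phi0: "Phi x = 0@K" if x: "x : tr P t" for x
 proof -
  have "x :. P" by (rule eta.N.submod_carrier[OF T x])
  hence "?pi x = 0@?Q" using eta.N.coset_zero_iff[OF T] x by simp
  moreover have "phi2 0@(kmod A ?Q) = 0@(reg K)" by (rule linear_map.map_zero[OF lmapI[OF Q.rax K.regular_right_module phi2(1)]])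
  ultimately show ?thesis unfolding Phi_def by simp
 qed
 have Phieta: "Phi (eta x) = phi x" if "x :. G" for x using that phi1(2) phi2(2) unfolding Phi_def by auto
 show "EX (w :: nat) h psi. (ALL k<w. lin A G AA (h k) & functional K (kmod A AA) (psi k) & (ALL a:tr AA t. psi k a = 0@K)) &
  (ALL g:car G. phi g = (+/.K k<w. psi k (h k g)))"
 proof (intro exI[of _ w] exI[of _ "%k x. f k (eta x)"] exI[of _ "%k a. Phi (a *>.P y k)"] conjI allI impI ballI)
  fix k assume k: "k < w"
  show "lin A G AA (%x. f k (eta x))" by (rule lin_comp[OF eta.lin dual_basis_lin[OF db k]])
  show "functional K (kmod A AA) (%a. Phi (a *>.P y k))" by (rule lin_comp[OF kmod_lin[OF eta.N.lin_orbit[OF dual_basis_vec(2)[OF db k]]] Philin])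
  show "Phi (a *>.P y k) = 0@K" if "a : tr AA t" for a by (rule Phi0[OF tr_regular(2)[OF t PP that dual_basis_vec(2)[OF db k]]])
 next
  fix g assume g: "g :. G"
  have "phi g = Phi (+/.P k<w. f k (eta g) *>.P y k)" using Phieta[OF g] dual_basis_sum[OF db eta.closed[OF g]] by simp
  also have "... = (+/.K k<w. Phi (f k (eta g) *>.P y k))"
   using Phi.map_finsum[of "%k. f k (eta g) *>.P y k" "{..<w}"] dual_basis_coef[OF db _ eta.closed[OF g]] dual_basis_vec(2)[OF db] by auto
  finally show "phi g = (+/.K k<w. Phi (f k (eta g) *>.P y k))" .
 qed
qed

text \<open>Injectivity follows from \<open>gp_torsionless\<close>: a homomorphism to
  \<open>A\<close> that is nonzero at \<open>x\<close> extends along \<open>eta\<close>, so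
  \<open>eta x\<close> is nonzero.\<close>

lemma gp_embedding:
 assumes G: "gp A G" obtains P :: "('a, nat => 'k) module" and eta G' q where "fg_proj A P" "lmap A G P eta" "inj_on eta (car G)"
  "lmap A P G' q" "q ` car P = car G'" "akr P G' q = eta ` car G" "gp A G'"
  "!!h. lin A G AA h ==> EX h'. lin A P AA h' & (ALL g:car G. h' (eta g) = h g)"
proof -
 obtain P :: "('a, nat => 'k) module" and eta G' q where c: "fg_proj A P & lmap A G P eta &
  lmap A P G' q & q ` car P = car G' & akr P G' q = eta ` car G & gp A G' &
  (ALL h. lin A G AA h --> (EX h'. lin A P AA h' & (ALL g:car G. h' (eta g) = h g)))" using gp_coker[OF G] by (elim exE) (rule that)
 interpret eta: linear_map A G P eta using c by blast
 have ext: "EX h'. lin A P AA h' & (ALL g:car G. h' (eta g) = h g)" if "lin A G AA h" for h using c that by simp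
 have "x = 0@G" if x: "x :. G" "eta x = 0@P" for x
 proof (rule ccontr)
  assume "x ~= 0@G"
  then obtain h where h: "lin A G AA h" "h x ~= \<zero>" using gp_torsionless[OF G x(1)] by blast
  obtain h' where h': "lin A P AA h'" "ALL g:car G. h' (eta g) = h g" using ext[OF h(1)] by blast
  have "h' 0@P = 0@AA" by (rule linear_map.map_zero[OF lmapI[OF eta.N.rax A_rmod h'(1)]])
  thus False using h(2) h'(2) x by auto
 qed
 hence "inj_on eta (car G)" unfolding eta.inj_iff by blast
 thus thesis using c ext by (intro that[of P eta G' q]) simp_all
qed

text \<open>The two claims alternate. Decomposition at \<open>t + 1\<close> shows that the embedding
  into \<open>P\<close> reflects the trace at \<open>t + 1\<close>, so \<open>G\<close> inherits
  exactness at \<open>t\<close> from \<open>P\<close>. This holds for every \<open>G\<close>, in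
  particular for the cokernel \<open>G'\<close>, whose exactness lets \<open>kernel_trace\<close>
  show that the embedding reflects the trace at \<open>t\<close>; this is decomposition at
  \<open>t\<close>. At \<open>n + 1\<close> the trace is zero.\<close>

lemma gp_exact_decomposes:
 assumes "1 <= t" "t <= Suc n" "gp A G" shows "(ALL s:{1..n}. t <= s --> exact_at G s) & decomposes_at t G" using assms(2,1,3)
proof (induct arbitrary: G rule: inc_induct)
 case base
 obtain P :: "('a, nat => 'k) module" and eta where P: "fg_proj A P" "lmap A G P eta" "inj_on eta (car G)"
  by (rule gp_embedding[OF base(2)]) (rule that; assumption)
 interpret eta: linear_map A G P eta by (rule P(2))
 have "x : tr G (Suc n)" if "x :. G" "eta x : tr P (Suc n)" for x
  using that P(3) eta.inj_iff eta.M.submod_zero[OF tr_submodule[OF eta.M.rax, of "Suc n"]]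
   tr_top[OF eta.N.rax, of "Suc n"] by auto
 thus ?case using embedding_decomposes[OF P(1,2), of "Suc n"] by auto
next
 case (step t)
 have t: "t : {1..n}" using step by simp
 have IH: "decomposes_at (Suc t) G" "!!s. [|s : {1..n}; Suc t <= s|] ==> exact_at G s" if "gp A G" for G using step(3)[OF _ that] by auto
 have exG: "exact_at G t" if G: "gp A G" for G
 proof -
  obtain P :: "('a, nat => 'k) module" and eta where P: "fg_proj A P" "lmap A G P eta"
   and ext: "!!h. lin A G AA h ==> EX h'. lin A P AA h' & (ALL g:car G. h' (eta g) = h g)" by (rule gp_embedding[OF G]) (rule that; assumption)
  interpret eta: linear_map A G P eta by (rule P(2))
  note GG = eta.M.rax and PP = eta.N.rax
  have T: "subm (tr G (Suc t)) A G" by (rule tr_submodule[OF GG]) simp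
  interpret V: fin_vector_space K "kmod A G" using gp_fg[OF G] unfolding fg_right_module_iff by blast
  \<comment> \<open>A functional separating \<open>x\<close> from the trace decomposes into terms
    \<open>psi k (h k x)\<close>. Each \<open>h k\<close> extends to \<open>P\<close> and hence maps
    \<open>x\<close> into the trace ideal, where \<open>psi k\<close> vanishes.\<close>
  have key: "x : tr G (Suc t)" if x: "x :. G" "eta x : tr P (Suc t)" for x
  proof (rule ccontr)
   assume "x ~: tr G (Suc t)"
   then obtain phi where phi: "functional K (kmod A G) phi" "ALL u:tr G (Suc t). phi u = 0@K" "phi x ~= 0@K"
    using V.separate[OF kmod_submodule[OF GG T]] x(1) by auto
   obtain w :: nat and h psi where h: "ALL k<w. lin A G AA (h k) & functional K (kmod A AA) (psi k) & (ALL a:tr AA (Suc t). psi k a = 0@K)"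
    "ALL g:car G. phi g = (+/.K k<w. psi k (h k g))" using IH(1)[OF G] phi(1,2) unfolding decomposes_at_def by blast
   have "psi k (h k x) = 0@K" if k: "k < w" for k
   proof -
    obtain h' where h': "lin A P AA h'" "ALL g:car G. h' (eta g) = h k g" using ext h(1) k by blast
    have "h' (eta x) : tr AA (Suc t)" by (rule tr_lin[OF PP lmapI[OF PP A_rmod h'(1)] _ x(2)]) simp
    thus ?thesis using h(1) h'(2) x(1) k by simp
   qed
   hence "phi x = 0@K" using h(2) x(1) K.finsum_all_zero[of "{..<w}" "%k. psi k (h k x)"] by simp
   thus False using phi(3) by blast
  qed
  obtain w y f where db: "dual_basis A P w y f" using P(1) unfolding fg_proj_def by blast
  have exP: "exact_at P t" using exact_AA t by (intro exact_at_projective[OF _ t PP db]) (simp add: exact_def)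
  show ?thesis unfolding exact_at_def
  proof (intro ballI impI allI)
   fix m j assume m: "m : r t ->. (CM G t)" and rel: "bsum G t m : tr G (Suc t)" and j: "j < r t"
   interpret c: linear_map "C t" "CM G t" "CM P t" eta by (rule CM_map[OF P(2) t])
   have mG: "m : r t ->. G" using m by (auto simp: Pi_iff)
   have etam: "(%j. eta (m j)) : r t ->. (CM P t)" using c.closed m by blast
   have "bsum P t (%j. eta (m j)) : tr P (Suc t)" unfolding bsum_map[OF P(2) t mG, symmetric] by (rule tr_lin[OF GG P(2) _ rel]) simp
   from exact_atD[OF exP etam this j] show "m j : tr G (Suc t)" using key[of "m j"] mG j by auto
  qed
 qed
 have exs: "exact_at G s" if "gp A G" "s : {1..n}" "t <= s" for G s using exG[OF that(1)] IH(2)[OF that(1,2)] that(3) by (cases "s = t") auto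
 obtain P :: "('a, nat => 'k) module" and eta G' q where P: "fg_proj A P" "lmap A G P eta" "inj_on eta (car G)"
  "lmap A P G' q" "q ` car P = car G'" "akr P G' q = eta ` car G" "gp A G'" by (rule gp_embedding[OF step(5)]) (rule that; assumption)
 interpret eta: linear_map A G P eta by (rule P(2))
 interpret q: linear_map A P G' q by (rule P(4))
 let ?N = "P(|carrier := eta ` car G|)"
 have eta': "lmap A G ?N eta" using eta.N.submod_right_module[OF q.submod_kernel] unfolding P(6)
  by (intro lmapI eta.M.rax lin_into[OF eta.lin]) simp_all
 have "x : tr G t" if x: "x :. G" "eta x : tr P t" for x
 proof -
  \<comment> \<open>\<open>kernel_trace\<close> speaks of the trace at a successor; with
    \<open>t - 1\<close> it asks for exactness of \<open>G'\<close> from \<open>t\<close> on, which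
    has just been shown.\<close>
  have "eta x : tr (P(|carrier := akr P G' q|)) (Suc (t - 1))" by (rule kernel_trace[OF P(4,5)]) (use exs[OF P(7)] x t P(6) in auto)
  hence "eta x : tr ?N t" using t unfolding P(6) by simp
  from tr_onto[OF eta' _ step(4) this] obtain x' where x': "x' : tr G t" "eta x' = eta x" by auto
  have "x' :. G" by (rule tr_carrier[OF eta.M.rax step(4) x'(1)])
  thus ?thesis using x' P(3) x(1) by (metis inj_onD)
 qed
 hence "decomposes_at t G" by (rule embedding_decomposes[OF P(1,2) step(4)])
 thus ?case using exs[OF step(5)] by blast
qed

lemma gp_exact: "gp A G ==> exact G" using gp_exact_decomposes[of 1 G] unfolding exact_def by simp

lemma gp_decomposes: "gp A G ==> 1 <= t ==> t <= Suc n ==> decomposes_at t G" using gp_exact_decomposes by blast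

lemma gorenstein_projective_filtered:
 assumes M: "gorenstein_projective A M" shows "M : filtered_by A (proper_standard_modules A n e)"
proof -
 have fg: "fgm A M" using M unfolding gorenstein_projective_def by blast
 obtain N :: "('a, nat => 'k) module" and f where N: "fgm A N" "lin A M N f" "bij_betw f (car M) (car N)" using copy_module[OF fg] by blast
 have f: "lmap A M N f" using fgmD[OF fg] fgmD[OF N(1)] N(2) by (rule lmapI)
 obtain g where g: "lmap A N M g" "bij_betw g (car N) (car M)" using bij_lin_inverse[OF f N(3)] by blast
 show ?thesis by (rule exact_imp_proper_filtered[OF fg exact_iso[OF g gp_exact[OF gorenstein_projective_imp_gp[OF M f N(3)]]]])
qed

section \<open>Standard modules have finite projective dimension\<close>

lemma zclass_chain:
 assumes M: "rmod A M" and ch: "(chain_step A M (%Q. EX T:Th. module_iso A Q T))\<^sup>*\<^sup>* U V"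
  and Th: "!!T. T : Th ==> zclass A T" and U: "zclass A (M(|carrier := U|))" shows "zclass A (M(|carrier := V|))" using ch
proof (induct rule: rtranclp_induct)
 case (step V W)
 interpret M: right_module A M by (rule M)
 obtain T where T: "T : Th" "module_iso A (subquotient M W V) T" and VW: "subm V A M" "subm W A M" "V <= W"
  using step(2) unfolding chain_step_def by blast
 obtain q where q: "lmap A (M(|carrier := W|)) T q" "q ` W = car T" "ALL x:W. q x = 0@T <-> x : V"
  using M.subquotient_iso_iff[OF VW zclass_right_module[OF Th[OF T(1)]]] T(2) by blast
 have "akr (M(|carrier := W|)) T q = V" using q(3) VW(3) by (auto simp: a_kernel_iff)
 thus ?case using step(3) q(2) by (intro zclass_extension[OF q(1) _ Th[OF T(1)]]) simp_all
qed (rule U)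

text \<open>The algebra modulo the trace ideal lies in the class as a cokernel, and left
  multiplication by \<open>e t\<close> exhibits the standard module as a direct summand of
  it.\<close>

lemma zclass_standard_step:
 assumes t: "t : {1..n}" and J: "zclass A (AA(|carrier := tr AA (Suc t)|))" and T: "cyclic t (std_ker t) T" shows "zclass A T"
proof -
 interpret AA: right_module A AA by (rule A_rmod)
 have S: "subm (tr AA (Suc t)) A AA" by (rule tr_submodule[OF A_rmod]) simp
 let ?Q = "quotient_module AA (tr AA (Suc t))" and ?pi = "%x. tr AA (Suc t) +>.AA x"
 have pi: "lmap A AA ?Q ?pi" using AA.quotient_right_module[OF S] by (intro lmapI AA.rax)
 interpret pi: linear_map A AA ?Q ?pi by (rule pi)
 have kpi: "?pi x = 0@?Q <-> x : tr AA (Suc t)" if "x :. A" for x using AA.coset_zero_iff[OF S, of x] that by simp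
 have "akr AA ?Q ?pi = tr AA (Suc t)" using kpi AA.submod_subset[OF S] by (auto simp: a_kernel_iff simp del: AA.quotient_sel)
 hence ZQ: "zclass A ?Q" using J by (intro zclass_cokernel[OF pi _ zclass_regular]) simp_all
 obtain f where f: "lmap A (PP t) T f" "f ` car (PP t) = car T" and k: "!!a. a :. (PP t) ==> f a = 0@T <-> a : std_ker t"
  by (rule cyclicE[OF T]) (rule that, simp_all)
 interpret f: linear_map A "PP t" T f by (rule f(1))
 have eP: "e t ** a :. (PP t)" if "a :. A" for a using that et[OF t] by (simp add: P_sel[OF t] flip: A.m_assoc)
 have l: "lin A AA (PP t) (%a. e t ** a)" by (rule linI) (use eP et[OF t] in "auto simp: P_sel[OF t] A.r_distr A.m_assoc")
 have "f (e t ** a) = 0@T" if a: "a :. AA" "?pi a = 0@?Q" for a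
 proof -
  have "a : tr AA (Suc t)" using a kpi by simp
  hence "e t ** a : std_ker t" using tr_regular(3)[of "Suc t" a "e t"] eP[of a] a(1) et[OF t] unfolding std_ker_def by simp
  thus ?thesis using k eP a(1) by simp
 qed
 then obtain r where r: "lin A ?Q T r" "ALL x:car AA. r (?pi x) = f (e t ** x)" using pi.factor_through[OF f.N.rax lin_comp[OF l f.lin]] by auto
 have i0: "lin A (PP t) ?Q ?pi" using lin_restrict[OF pi.lin AA.submod_subset[OF P_submodule[OF t]]] by (simp add: indec_projective_def)
 have "?pi a = 0@?Q" if a: "a :. (PP t)" "f a = 0@T" for a
  using k[OF a(1)] a(2) kpi[of a] a(1) unfolding std_ker_def by (simp add: P_sel[OF t] del: AA.quotient_sel)
 then obtain i where i: "lin A T ?Q i" "ALL x:car (PP t). i (f x) = ?pi x" using f.factor_through[OF pi.N.rax i0 f(2)] by auto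
 show ?thesis
 proof (rule zclass_retract[OF ZQ lmapI[OF pi.N.rax f.N.rax r(1)] i(1)])
  fix y assume "y :. T"
  then obtain a where a: "a :. (PP t)" "y = f a" using f(2) by (metis imageE)
  thus "r (i y) = y" using i(2) r(2) by (simp add: P_sel[OF t])
 qed
qed

text \<open>The layer of \<open>A\<close> at \<open>t\<close> is filtered by copies of the standard
  module at \<open>t\<close>, which is in the class as soon as the next trace ideal is.\<close>

lemma zclass_trace:
 assumes "1 <= t" "t <= Suc n" shows "zclass A (AA(|carrier := tr AA t|))" using assms(2,1)
proof (induct rule: inc_induct)
 case base
 interpret AA: right_module A AA by (rule A_rmod)
 show ?case using AA.submod_right_module[OF tr_submodule[OF A_rmod, of "Suc n"]] tr_top[OF A_rmod, of "Suc n"] by (intro zclass_zero) simp_all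
next
 case (step t)
 have t: "t : {1..n}" using step by simp
 note c = standard_cyclic[OF t]
 show ?case by (rule zclass_chain[OF A_rmod free_standard_layer[OF A_rmod t _ free_AA[OF t] c singletonI]])
   (use step(3) zclass_standard_step[OF t _ c] exact_AA t in "auto simp: exact_def")
qed

lemma standard_filtered_finite_projective_dimension:
 assumes M: "M : filtered_by A (standard_modules A n e)" shows "finite_projective_dimension A M"
proof -
 have fg: "fgm A M" and ch: "(chain_step A M (%Q. EX T:standard_modules A n e. module_iso A Q T))\<^sup>*\<^sup>* {0@M} (car M)"
  using M unfolding filtered_by_iff by blast+
 interpret M: right_module A M using fg by (rule fgmD)
 have "zclass A (M(|carrier := car M|))"
 proof (rule zclass_chain[OF M.rax ch])
  show "zclass A (M(|carrier := {0@M}|))" by (rule zclass_zero[OF M.submod_right_module[OF M.submod_zero_set]]) simp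
  fix T assume "T : standard_modules A n e"
  then obtain t where t: "t : {1..n}" "T = standard_module A n e t" unfolding standard_modules_def by blast
  show "zclass A T" unfolding t(2) by (rule zclass_standard_step[OF t(1) zclass_trace standard_cyclic[OF t(1)]]) (use t in auto)
 qed
 thus ?thesis using zclass_finite_projective_dimension[OF fg] by simp
qed

lemma standard_filtered_iff:
 assumes M: "fgm A M" shows "M : filtered_by A (standard_modules A n e) <->
  M : filtered_by A (proper_standard_modules A n e) & finite_projective_dimension A M"
proof
 assume "M : filtered_by A (standard_modules A n e)"
 thus "M : filtered_by A (proper_standard_modules A n e) & finite_projective_dimension A M"
  using standard_filtered_imp_exact[OF _ exact_AA] exact_imp_proper_filtered[OF M] standard_filtered_finite_projective_dimension by blast
next
 assume F: "M : filtered_by A (proper_standard_modules A n e) & finite_projective_dimension A M"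
 hence ex: "exact M" using proper_filtered_imp_exact by blast
 show "M : filtered_by A (standard_modules A n e)"
  by (rule exact_free_imp_standard_filtered[OF M ex finite_projective_dimension_free[OF free_AA exact_AA _ M]]) (use F ex in "auto simp: exact_def")
qed

end

section \<open>The dual of an algebra\<close>

lemma (in fin_vector_space) injective_rank_le:
 assumes f: "lmap K W V f" "inj_on f (car W)" shows "finitely_generated K W" "rank K W <= rank K V"
proof -
 interpret f: linear_map K W V f by (rule f(1))
 let ?I = "f ` car W"
 have I: "subm ?I K V" by (rule f.submod_image[OF f.M.submod_self])
 have f': "lmap K W (V(|carrier := ?I|)) f" by (intro lmapI f.M.rax submod_right_module[OF I] lin_into[OF f.lin]) simp
 have "bij_betw f (car W) (car (V(|carrier := ?I|)))" using f(2) by (simp add: bij_betw_def)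
 from bij_lin_inverse[OF f' this] obtain g where g: "lmap K (V(|carrier := ?I|)) W g"
  "bij_betw g (car (V(|carrier := ?I|))) (car W)" by blast
 note go = bij_betw_imp_surj_on[OF g(2)] and fgI = subspace_fg[OF I]
 show "finitely_generated K W" by (rule fg_image[OF g(1) go fgI])
 have "rank K (V(|carrier := ?I|)) <= rank K V"
 proof (cases "?I = car V")
  case True
  have "V(|carrier := car V|) = V" by simp
  thus ?thesis unfolding True by simp
 qed (use rank_less[OF I] in simp)
 thus "rank K W <= rank K V" using rank_image_le[OF g(1) go fgI] by simp
qed

lemma dual_module_sel [simp]:
 "0@(dual_module K A) = (%a:car A. 0@K)"
 "xi ++.(dual_module K A) zet = (%a:car A. xi a ++.K zet a)"
 "b *>.(dual_module K A) xi = (%a:car A. xi (b **.A a))" by (simp_all add: dual_module_def)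

context fd_algebra
begin

lemma dual_module_kdual: "dual_module K A = kdual K A (reg B)"
proof -
 have "functional K A xi <-> functional K (kmod A (reg B)) xi" for xi by (simp add: lin_def mult_scalar scalar_mult)
 thus ?thesis by (simp add: dual_module_def kdual_def module_homs_iff set_eq_iff)
qed

lemma dual_carrier: "xi : car (dual_module K A) <-> functional K VA xi & xi : extensional (car A)"
 unfolding dual_module_kdual by (simp add: lin_def scalar_central)

lemma regular_op: "rmod B (reg B)" "fgm B (reg B)" using fd_algebra.A_rmod[OF opposite] fd_algebra.fg_regular[OF opposite] .

lemma dual_closed: "xi :. (dual_module K A) ==> a :. A ==> xi a :. K" using functional_closed[of K VA xi a] by (simp add: dual_carrier)

lemma dual_restrict: "functional K VA xi ==> (%a:car A. xi a) :. (dual_module K A)"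
 using lin_cong[of VA "%a:car A. xi a" xi K "reg K"] VA_right_module by (simp add: dual_carrier)

lemma dual_eqI:
 "[|xi :. (dual_module K A); zet :. (dual_module K A); !!a. a :. A ==> xi a = zet a|] ==> xi = zet"
 by (rule extensionalityI[of _ "car A"]) (auto simp: dual_carrier)

lemma dual_right_module: "rmod A (dual_module K A)" unfolding dual_module_kdual by (rule kdual_right_module[OF regular_op(1)])

lemma dual_finsum:
 "[|F : J -> car (dual_module K A); a :. A|]
  ==> (+/.(dual_module K A) i:J. F i) a = (+/.K i:J. F i a)" unfolding dual_module_kdual using kdual_finsum[OF regular_op(1)] by simp

lemma dual_fg: "fgm A (dual_module K A)" unfolding dual_module_kdual by (rule kdual_fg(1)[OF regular_op(2)])

text \<open>An upper bound for the dimension of the dual suffices: with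
  \<open>injective_onto\<close> it makes an injective map from \<open>A\<close> to its dual
  bijective.\<close>

lemma dual_rank:
 "finitely_generated K (kmod A (dual_module K A)) & rank K (kmod A (dual_module K A)) <= rank K VA"
proof -
 have "lmap K VA (kmod A (reg B)) (%x. x)" by (intro lmapI VA_right_module opposite_kmod regular_op linI) (auto simp: scalar_central)
 from rank_image_le[OF this] have "rank K (kmod A (reg B)) <= rank K VA"
  using VA_space by (simp add: fin_vector_space_def fin_vector_space_axioms_def)
 thus ?thesis using kdual_fg[OF regular_op(2)] dual_fg fg_iff_kmod[OF dual_right_module]
  unfolding dual_module_kdual[symmetric] fg_right_module_def by simp
qed

end

section \<open>The dual of \<open>A e t\<close> modulo the next trace ideal\<close>

context stratified
begin

context
 fixes t assumes t: "t : {1..n}"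
begin

text \<open>The functionals on \<open>A e t\<close> that vanish on the next ideal of the stratification.\<close>

definition "XX = (dual_module K A)(|carrier := {xi : car (dual_module K A).
 (ALL a:tr AA (Suc t). xi a = 0@K) & (ALL a:car A. xi (a ** e t) = xi a)}|)"

interpretation D: right_module A "dual_module K A" by (rule dual_right_module)
interpretation AA: right_module A AA by (rule A_rmod)

lemma XX_sub:
 "subm (car XX) A (dual_module K A)" "rmod A XX" "fgm A XX"
 "XX = (dual_module K A)(|carrier := car XX|)"
proof -
 have J: "a :. A" if "a : tr AA (Suc t)" for a using tr_regular(1)[OF _ that] by simp
 have z: "0@(dual_module K A) :. (dual_module K A)" by (rule D.M.zero_closed)
 show sub: "subm (car XX) A (dual_module K A)"
 proof (rule D.submodI)
  fix xi zet assume "xi :. XX" "zet :. XX"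
  thus "xi ++.(dual_module K A) zet :. XX" unfolding XX_def using D.M.a_closed[of xi zet] J et[OF t] by simp
 next
  fix b xi assume b: "b :. A" and xi: "xi :. XX"
  have "xi (b ** (a ** e t)) = xi (b ** a)" if "a :. A" for a using xi b that et[OF t] unfolding XX_def by (simp flip: A.m_assoc)
  thus "b *>.(dual_module K A) xi :. XX" using xi D.act_closed[OF b, of xi] tr_regular(3)[of "Suc t" _ b] b J et[OF t] unfolding XX_def by simp
 next
  show "0@(dual_module K A) :. XX" unfolding XX_def using z J et[OF t] by simp
 qed (auto simp: XX_def)
 show eq: "XX = (dual_module K A)(|carrier := car XX|)" by (simp add: XX_def)
 show "rmod A XX" using D.submod_right_module[OF sub] unfolding eq[symmetric] .
 note dual_fg
 from fg_submodule[OF this sub] show "fgm A XX" unfolding eq[symmetric] .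
qed

lemma XX_sel: "0@XX = 0@(dual_module K A)" "xi ++.XX zet = xi ++.(dual_module K A) zet" "c *>.XX xi = c *>.(dual_module K A) xi"
 by (simp_all add: XX_def)

lemma XX_D:
 assumes "xi :. XX" shows "xi :. (dual_module K A)" "a : tr AA (Suc t) ==> xi a = 0@K" "a :. A ==> xi (a ** e t) = xi a"
 using assms by (simp_all add: XX_def)

lemma XX_trace: "tr XX (Suc t) = {0@XX}"
proof
 interpret X: right_module A XX by (rule XX_sub(2))
 show "tr XX (Suc t) <= {0@XX}"
 proof (rule tr_least[OF X.submod_zero_set])
  fix j xi assume j: "j : {Suc t..n}" and xi: "xi :. XX"
  have ej: "e j :. A" using idem(2)[of j] j t by simp
  have "e j *>.AA \<one> : tr AA (Suc t)" by (rule tr_gen[OF j]) simp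
  hence "e j ** a : tr AA (Suc t)" if "a :. A" for a using tr_regular(4)[of "Suc t" "e j" a] ej that by simp
  hence "e j *>.XX xi = 0@XX" unfolding XX_sel using XX_D(2)[OF xi] by (auto intro!: restrict_ext)
  thus "e j *>.XX xi : {0@XX}" by simp
 qed
 show "{0@XX} <= tr XX (Suc t)" using X.submod_zero[OF tr_submodule[OF X.rax, of "Suc t"]] by simp
qed

text \<open>A homomorphism \<open>f\<close> to \<open>XX\<close> is determined by the functional
  \<open>phi\<close>, its value at one. By \<open>XX_trace\<close> this functional vanishes on the
  trace of \<open>G\<close>, so \<open>gp_decomposes\<close> writes it as a sum of terms
  \<open>psi k (h k g)\<close>.\<close>

lemma zclass_XX: "zclass A XX"
proof (rule zclassI[OF XX_sub(2)])
 interpret X: right_module A XX by (rule XX_sub(2))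
 fix G f assume G: "gp A G" and f: "lin A G XX f"
 interpret f: linear_map A G XX f using gp_right_module[OF G] XX_sub(2) f by (rule lmapI)
 note GG = f.M.rax
 define phi where "phi g = f g \<one>" for g
 have fD: "f g :. (dual_module K A)" if "g :. G" for g by (rule XX_D(1)[OF f.closed[OF that]])
 have act: "phi (a *>.G g) = f g a" if "a :. A" "g :. G" for a g unfolding phi_def f.map_act[OF that] XX_sel using that by simp
 have "functional K (kmod A G) phi"
 proof (rule linI)
  fix l g assume l: "l :. K" and g: "g :. (kmod A G)"
  have "f g (l *> \<one>) = l *>.(reg K) f g \<one>" using lin_act[of K VA "reg K" "f g" l \<one>] fD[of g] g l by (simp add: dual_carrier)
  thus "phi (l *>.(kmod A G) g) = l *>.(reg K) phi g" using act[of "l *> \<one>" g] l g by (simp add: phi_def)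
 next
  fix g h assume gh: "g :. (kmod A G)" "h :. (kmod A G)"
  thus "phi (g ++.(kmod A G) h) = phi g ++.(reg K) phi h" using f.map_add[of g h] by (simp add: phi_def XX_sel)
 qed (use fD dual_closed in "auto simp: phi_def")
 moreover have "phi x = 0@K" if "x : tr G (Suc t)" for x using tr_lin[OF GG f.linear_map_axioms _ that] XX_trace by (simp add: phi_def XX_sel)
 ultimately obtain w :: nat and h psi where
  h: "ALL k<w. lin A G AA (h k) & functional K VA (psi k) & (ALL a:tr AA (Suc t). psi k a = 0@K)"
  and phieq: "ALL g:car G. phi g = (+/.K k<w. psi k (h k g))" using gp_decomposes[OF G, of "Suc t"] t unfolding decomposes_at_def by auto
 \<comment> \<open>Inserting \<open>e t\<close> puts the functional into \<open>XX\<close> and does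
   not change the sum, because the values of \<open>f\<close> absorb \<open>e t\<close>.\<close>
 define y where "y k = (%a:car A. psi k (a ** e t))" for k
 have y: "y k :. XX" if k: "k < w" for k
 proof -
  have "y k :. (dual_module K A)" unfolding y_def using dual_restrict[OF lin_comp[OF VA_mult_right[OF et(1)[OF t]]]] h k by blast
  thus ?thesis using h k tr_regular(1,4)[of "Suc t"] et[OF t] by (simp add: XX_def y_def A.m_assoc)
 qed
 have hA: "h k g :. A" if "k < w" "g :. G" for k g using lin_closed[of A G AA "h k" g] h that by simp
 show "factors_free A G XX f"
 proof (rule factors_freeI[where s = w and h = h and y = y])
  fix g assume g: "g :. G"
  have hy: "(%k. h k g *>.XX y k) : w ->. XX" using hA[OF _ g] y X.act_closed by blast
  have s: "(+/.XX k<w. h k g *>.XX y k) = (+/.(dual_module K A) k<w. h k g *>.XX y k)"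
   using D.finsum_submod[OF XX_sub(1) hy] unfolding XX_sub(4)[symmetric] .
  have hyD: "(%k. h k g *>.XX y k) : w ->. (dual_module K A)" using hy XX_D(1) by blast
  show "f g = (+/.XX k<w. h k g *>.XX y k)"
  proof (rule dual_eqI[OF fD[OF g]])
   show "(+/.XX k<w. h k g *>.XX y k) :. (dual_module K A)" by (rule XX_D(1)[OF X.M.finsum_closed[OF hy]])
   fix a assume a: "a :. A"
   have "f g a = phi ((a ** e t) *>.G g)" using act[of "a ** e t" g] XX_D(3)[OF f.closed[OF g] a] a g et[OF t] by simp
   also have "... = (+/.K k<w. psi k (h k ((a ** e t) *>.G g)))" using phieq f.M.act_closed[OF _ g, of "a ** e t"] a et[OF t] by simp
   also have "... = (+/.K k<w. (h k g *>.XX y k) a)"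
   proof (rule K.finsum_cong'[OF refl])
    show "(%k. (h k g *>.XX y k) a) : w ->. K" using hyD dual_closed a by blast
    fix k assume k: "k : {..<w}"
    have "h k ((a ** e t) *>.G g) = h k g ** (a ** e t)" using lin_act[of A G AA "h k" "a ** e t" g] h k a g et[OF t] by simp
    thus "psi k (h k ((a ** e t) *>.G g)) = (h k g *>.XX y k) a" using hA[of k g] k a g et[OF t] by (simp add: XX_sel y_def A.m_assoc)
   qed
   also have "... = (+/.XX k<w. h k g *>.XX y k) a" unfolding s by (rule dual_finsum[OF hyD a, symmetric])
   finally show "f g a = (+/.XX k<w. h k g *>.XX y k) a" .
  qed
 qed (use h y in auto)
qed

text \<open>\<open>XX\<close> has finite projective dimension and is trivially exact above
  \<open>t\<close>, so it is free at \<open>t\<close>. The trace of \<open>XX\<close> being zero,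
  this concerns the functionals on \<open>C t\<close> modulo \<open>Jc t\<close>. A basis element
  has annihilator in \<open>Jc t\<close>, which is the asserted nondegeneracy.\<close>

lemma nondegenerate_functional:
 "EX chi. functional K VA chi & (ALL a:tr AA (Suc t). chi a = 0@K) &
  (ALL c:car (C t). (ALL d:car (C t). chi (c ** d) = 0@K) --> c : tr AA (Suc t))"
proof -
 interpret X: right_module A XX by (rule XX_sub(2))
 interpret CX: right_module "C t" "CM XX t" by (rule CM_right_module[OF XX_sub(2) t])
 have b0: "base XX t = {0@XX}" unfolding base_def XX_trace using et(1)[OF t] by auto
 have "exact_at XX s" if "t < s" "s <= n" for s
 proof -
  have s: "s : {1..n}" using that t by simp
  have "m : tr XX (Suc s)" if m: "m :. (CM XX s)" for m
  proof -
   have "m : tr XX (Suc t)" using tr_fix[OF XX_sub(2) s, of m "Suc t"] m `t < s` by simp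
   thus ?thesis using X.submod_zero[OF tr_submodule[OF XX_sub(2), of "Suc s"]] XX_trace by simp
  qed
  thus ?thesis unfolding exact_at_def by blast
 qed
 from finite_projective_dimension_free[OF free_AA[OF t] exact_AA t XX_sub(3) zclass_finite_projective_dimension[OF XX_sub(3) zclass_XX] this]
 have "free_at XX t" by blast
 then obtain x p where x: "basis_mod (C t) (CM XX t) {0@XX} (Jc t) x p" unfolding free_at_def b0 by blast
 interpret V: fin_vector_space K VA by (rule VA_space)
 have J: "subm (tr AA (Suc t)) A AA" by (rule tr_submodule[OF A_rmod]) simp
 obtain phi where phi: "functional K VA phi" "ALL u:tr AA (Suc t). phi u = 0@K" "phi (e t) ~= 0@K"
  using V.separate[OF kmod_submodule[OF A_rmod J], of "e t"] e_notin_trace[OF t] et[OF t] by auto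
 \<comment> \<open>A functional that is nonzero at \<open>e t\<close> yields a nonzero element of
   \<open>XX\<close> fixed by \<open>e t\<close>.\<close>
 have "p ~= 0"
 proof
  assume p: "p = 0"
  define xi where "xi = (%a:car A. phi (e t ** (a ** e t)))"
  have "xi :. (dual_module K A)"
   unfolding xi_def by (rule dual_restrict[OF lin_comp[OF lin_comp[OF VA_mult_right VA_mult_left] phi(1)]]) (use et[OF t] in auto)
  hence xiX: "xi :. XX" using phi(2) tr_regular(1,3,4)[of "Suc t"] et[OF t] by (simp add: XX_def xi_def A.m_assoc)
  have "e t ** (e t ** a ** e t) = e t ** (a ** e t)" if "a :. A" for a using et[OF t] that by (simp flip: A.m_assoc)
  hence "e t *>.XX xi = xi" unfolding XX_sel xi_def using et[OF t] by (auto intro!: restrict_ext)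
  hence xiC: "xi :. (CM XX t)" using xiX by simp
  obtain c where "xi --.(CM XX t) lsum (CM XX t) p c x : {0@XX}" by (rule spans_modE[OF basis_modD(1)[OF x] xiC]) (rule that)
  hence "xi --.(CM XX t) 0@(CM XX t) = 0@XX" unfolding p by simp
  hence "xi = 0@XX" using CX.M.diff_zero[OF xiC] by metis
  hence "xi (e t) = 0@K" using et(1)[OF t] by (simp add: XX_sel)
  moreover have "xi (e t) = phi (e t)" using et[OF t] by (simp add: xi_def)
  ultimately show False using phi(3) by simp
 qed
 hence p: "0 < p" by simp
 have xC: "x : p ->. (CM XX t)" by (rule basis_modD(2)[OF x])
 define chi where "chi = x 0"
 have chiX: "chi :. XX" using xC p by (auto simp: chi_def Pi_iff)
 have "c : tr AA (Suc t)" if c: "c :. (C t)" and z: "ALL d:car (C t). chi (c ** d) = 0@K" for c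
 proof -
  have cA: "c :. A" "c ** e t = c" using c by simp_all
  have "chi (c ** a) = 0@K" if a: "a :. A" for a
  proof -
   have "chi (c ** a) = chi (c ** a ** e t)" by (rule XX_D(3)[OF chiX, symmetric]) (use a cA in simp)
   also have "c ** a ** e t = c ** (e t ** a ** e t)" using a cA et[OF t] by (simp flip: A.m_assoc)
   finally show ?thesis using z A.corner_sandwich[OF et(1,2)[OF t] a] by simp
  qed
  hence "c *>.XX chi = 0@XX" unfolding XX_sel by (auto intro!: restrict_ext)
  hence "lsum (CM XX t) p (%i. if i = 0 then c else 0@(C t)) x : {0@XX}" using CX.lsum_delta[OF c xC p] by (simp add: chi_def)
  from basis_modD(3)[OF x _ this p] have "c : Jc t" using c CX.R.zero_closed by auto
  thus ?thesis unfolding Jc_def by blast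
 qed
 thus ?thesis using XX_D(1,2)[OF chiX] by (intro exI[of _ chi]) (auto simp: dual_carrier)
qed

end

end

section \<open>Endomorphism algebras\<close>

lemma End_algebra_sel [simp]:
 "f : car (End_algebra A T) <-> lin A T T f & f : extensional (car T)"
 "f **.(End_algebra A T) g = compose (car T) f g" "1@(End_algebra A T) = (%x:car T. x)"
 "0@(End_algebra A T) = (%x:car T. 0@T)"
 "f ++.(End_algebra A T) g = (%x:car T. f x ++.T g x)"
 "l *>.(End_algebra A T) f = (%x:car T. (l *>.A 1@A) *>.T f x)" by (simp_all add: End_algebra_def module_homs_iff)

context fd_algebra
begin

text \<open>Evaluation at the generator \<open>u\<close> embeds the endomorphisms into
  \<open>T\<close>, which bounds their dimension.\<close>

lemma End_fd:
 assumes T: "fgm A T" and u: "u :. T" "!!x. x :. T ==> EX a:car A. x = a *>.T u" shows "fd_algebra K (End_algebra A T)"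
proof -
 let ?E = "End_algebra A T"
 interpret T: right_module A T using T by (rule fgmD)
 interpret V: fin_vector_space K "kmod A T" using T unfolding fg_right_module_iff by blast
 note TT = T.rax
 have restr: "(%x:car T. f x) : car ?E" if "lin A T T f" for f using lin_cong[of T "%x:car T. f x" f A T] that TT by simp
 have cl: "f x :. T" if "f : car ?E" "x :. T" for f x using lin_closed[of A T T f x] that by simp
 have eqI: "f = g" if "f : car ?E" "g : car ?E" "!!x. x :. T ==> f x = g x" for f g by (rule extensionalityI[of _ "car T"]) (use that in auto)
 have scal: "lin A T T (%x. (l *>.A 1@A) *>.T f x)" if l: "l :. K" and f: "lin A T T f" for l f
 proof (rule linI)
  fix a x assume a: "a :. A" and x: "x :. T"
  have y: "f x :. T" by (rule lin_closed[OF f x])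
  have "(l *>.A 1@A) *>.T (a *>.T f x) = a *>.T ((l *>.A 1@A) *>.T f x)" using l a y scalar_central[OF l a] by (simp flip: T.act_mult)
  thus "(l *>.A 1@A) *>.T f (a *>.T x) = a *>.T ((l *>.A 1@A) *>.T f x)" using lin_act[OF f a x] by simp
 qed (use l lin_closed[OF f] lin_add[OF f] in "auto simp: T.act_add_module")
 interpret G: abelian_group ?E
 proof (rule abelian_groupI)
  show "f ++.?E g : car ?E" if "f : car ?E" "g : car ?E" for f g using restr[OF T.lin_pointwise_add[of T f g]] that by simp
  show "0@?E : car ?E" using restr[OF T.lin_pointwise_zero] by simp
  show "EX g:car ?E. g ++.?E f = 0@?E" if "f : car ?E" for f using restr[OF T.lin_pointwise_minus[of T f]] cl[OF that] that
   by (intro bexI[of _ "%x:car T. ~-.T f x"]) (auto intro!: restrict_ext simp: T.M.l_neg)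
  show "0@?E ++.?E f = f" if "f : car ?E" for f using cl[OF that] that by (auto simp: fun_eq_iff extensional_def)
 qed (auto intro!: restrict_ext simp: cl T.M.a_ac simp del: End_algebra_sel(1))
 interpret E: ring ?E
 proof (rule ringI[OF G.abelian_group_axioms monoidI])
  show comp: "f **.?E g : car ?E" if "f : car ?E" "g : car ?E" for f g using restr[OF lin_comp[of A T T g T f]] that by (simp add: compose_def)
  show "1@?E : car ?E" using restr[OF lin_id] by simp
  show "(f ++.?E g) **.?E h = f **.?E h ++.?E g **.?E h"
   if "f : car ?E" "g : car ?E" "h : car ?E" for f g h unfolding End_algebra_sel compose_def by (rule restrict_ext) (use cl[OF that(3)] in simp)
  show "h **.?E (f ++.?E g) = h **.?E f ++.?E h **.?E g"
   if "f : car ?E" "g : car ?E" "h : car ?E" for f g h unfolding End_algebra_sel compose_def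
   by (rule restrict_ext) (use cl[OF that(1)] cl[OF that(2)] lin_add[of A T T h] that(3) in simp)
  show "f **.?E g **.?E h = f **.?E (g **.?E h)"
   if "f : car ?E" "g : car ?E" "h : car ?E" for f g h unfolding End_algebra_sel compose_def by (rule restrict_ext) (use cl[OF that(3)] in simp)
  show "1@?E **.?E f = f" if "f : car ?E" for f
   using cl[OF that] that unfolding End_algebra_sel compose_def by (auto simp: fun_eq_iff extensional_def)
  show "f **.?E 1@?E = f" if "f : car ?E" for f using that unfolding End_algebra_sel compose_def by (auto simp: fun_eq_iff extensional_def)
 qed
 interpret M: Module.module K ?E
 proof (rule moduleI[OF K.is_cring G.abelian_group_axioms])
  fix l f assume l: "l :. K" and f: "f : car ?E"
  show "l *>.?E f : car ?E" using restr[OF scal[OF l, of f]] f by simp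
  show "(l ++.K m) *>.?E f = l *>.?E f ++.?E m *>.?E f" if "m :. K" for m
   unfolding End_algebra_sel by (rule restrict_ext) (use l that cl[OF f] in "simp add: smult_l_distr T.act_add_ring")
  show "l *>.?E (f ++.?E g) = l *>.?E f ++.?E l *>.?E g" if "g : car ?E" for g
   unfolding End_algebra_sel by (rule restrict_ext) (use l cl[OF that] cl[OF f] in "simp add: T.act_add_module")
  show "(l **.K m) *>.?E f = l *>.?E (m *>.?E f)" if m: "m :. K" for m
  proof -
   have "(l **.K m) *>.A 1@A = (m *>.A 1@A) **.A (l *>.A 1@A)" using l m by (simp add: mult_scalar smult_assoc1)
   thus ?thesis unfolding End_algebra_sel by (intro restrict_ext) (use l m cl[OF f] in "simp add: T.act_mult")
  qed
 next
  show "1@K *>.?E f = f" if "f : car ?E" for f using cl[OF that] that by (auto simp: fun_eq_iff extensional_def T.act_one)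
 qed
 interpret EK: right_module K ?E by (rule module_imp_right_module[OF M.module_axioms])
 have ev: "lmap K ?E (kmod A T) (%f. f u)" by (intro lmapI EK.rax V.rax linI) (use u(1) cl in auto)
 interpret ev: linear_map K ?E "kmod A T" "%f. f u" by (rule ev)
 have "inj_on (%f. f u) (car ?E)"
 proof (rule inj_onI, rule eqI)
  fix f g x assume f: "f : car ?E" and g: "g : car ?E" and fg: "f u = g u" and x: "x :. T"
  obtain a where a: "a :. A" "x = a *>.T u" using u(2)[OF x] by blast
  show "f x = g x" using lin_act[of A T T f a u] lin_act[of A T T g a u] f g fg a u(1) by simp
 qed
 hence "finitely_generated K ?E" by (rule V.injective_rank_le(1)[OF ev])
 moreover have "(l *>.?E f) **.?E g = l *>.?E (f **.?E g)"
  if "l :. K" "f : car ?E" "g : car ?E" for l f g unfolding End_algebra_sel compose_def by (rule restrict_ext) (use cl[OF that(3)] in simp)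
 moreover have "f **.?E (l *>.?E g) = l *>.?E (f **.?E g)"
  if "l :. K" "f : car ?E" "g : car ?E" for l f g
  unfolding End_algebra_sel compose_def by (rule restrict_ext) (use cl[OF that(3)] that lin_act[of A T T f] in simp)
 ultimately show ?thesis by unfold_locales
qed

end

context stratified
begin

text \<open>An endomorphism \<open>g\<close> is determined by \<open>g u\<close>, the image of some
  \<open>c\<close> in \<open>C t\<close>, and \<open>phi g\<close> is the value of
  \<open>chi\<close> at \<open>c\<close>. Nondegeneracy of \<open>chi\<close> makes the map
  \<open>Phi\<close> from \<open>E\<close> to its dual injective, and by dimension it is
  bijective.\<close>

lemma standard_frobenius:
 assumes t: "t : {1..n}" shows "frobenius_algebra K (End_algebra A (standard_module A n e t))"
proof -
 define T where "T = standard_module A n e t"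
 define E where "E = End_algebra A T"
 obtain f where f: "lmap A (PP t) T f" "f ` car (PP t) = car T" and k: "!!a. a :. (PP t) ==> f a = 0@T <-> a : std_ker t"
  by (rule cyclicE[OF standard_cyclic[OF t, folded T_def]]) (rule that, simp_all)
 interpret f: linear_map A "PP t" T f by (rule f(1))
 note TT = f.N.rax
 have fgT: "fgm A T"
 proof (rule fg_lin_image[OF _ TT f.lin f(2)])
  show "fgm A (PP t)" using fg_submodule[OF fg_regular P_submodule[OF t]] by (simp add: indec_projective_def)
 qed
 define u where "u = f (e t)"
 have uT: "u :. T" unfolding u_def by (rule f.closed[OF et_P(1)[OF t]])
 have PA: "a :. A" "e t ** a = a" if "a :. (PP t)" for a using that by (simp_all add: P_sel[OF t])
 have fu: "a *>.T u = f a" if "a :. (PP t)" for a using f.map_act[OF PA(1)[OF that] et_P(1)[OF t]] PA[OF that] by (simp add: u_def P_sel[OF t])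
 have gen: "EX a:car (PP t). x = a *>.T u" if "x :. T" for x using that f(2) fu by (metis imageE)
 interpret E: fd_algebra K E unfolding E_def using gen PA by (intro End_fd[OF fgT uT]) blast
 have Ecl: "g x :. T" if "g :. E" "x :. T" for g x using lin_closed[of A T T g x] that by (simp add: E_def)
 have Eact: "g (a *>.T x) = a *>.T g x" if "g :. E" "a :. A" "x :. T" for g a x using lin_act[of A T T g a x] that by (simp add: E_def)
 have CP: "c :. (PP t)" if "c :. (C t)" for c using that by (simp add: P_sel[OF t])
 have Eu: "EX c:car (C t). g u = f c" if g: "g :. E" for g
 proof -
  obtain a where a: "a :. (PP t)" "g u = f a" using gen[OF Ecl[OF g uT]] fu by auto
  have "e t *>.T u = u" using fu[OF et_P(1)[OF t]] by (simp add: u_def)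
  hence "g u = e t *>.T g u" using Eact[OF g et(1)[OF t] uT] by simp
  also have "... = f (a ** e t)" using f.map_act[OF et(1)[OF t] a(1)] a(2) by (simp add: P_sel[OF t])
  finally show ?thesis using P_sandwich[OF t a(1) A.one_closed] PA[OF a(1)] by (intro bexI[of _ "a ** e t"]) simp_all
 qed
 \<comment> \<open>Left multiplication by \<open>d\<close> preserves \<open>std_ker t\<close> and so
   induces an endomorphism of the standard module.\<close>
 have Ed: "EX x:car E. x u = f d" if d: "d :. (C t)" for d
 proof -
  have dA: "d :. A" "e t ** d = d" "d ** e t = d" using d by simp_all
  have dP: "d ** a :. (PP t)" if "a :. (PP t)" for a using PA(1)[OF that] dA et[OF t] by (simp add: P_sel[OF t] flip: A.m_assoc)
  have "lin A (PP t) (PP t) (%a. d ** a)"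
  proof (rule linI)
   fix x y assume "x :. (PP t)" "y :. (PP t)"
   thus "d ** (x ++.(PP t) y) = d ** x ++.(PP t) d ** y" using PA(1) dA(1) by (simp add: P_sel(3)[OF t] A.r_distr)
  next
   fix a x assume "a :. A" "x :. (PP t)"
   thus "d ** (a *>.(PP t) x) = a *>.(PP t) (d ** x)" using PA(1) dA(1) by (simp add: P_sel(4)[OF t] A.m_assoc)
  qed (rule dP)
  from lin_comp[OF this f.lin] have l: "lin A (PP t) T (%a. f (d ** a))" .
  have "f (d ** a) = 0@T" if a: "a :. (PP t)" "f a = 0@T" for a
   using k[OF a(1)] a(2) k[OF dP[OF a(1)]] dP[OF a(1)] tr_regular(3)[of "Suc t" a d] dA(1) unfolding std_ker_def by simp
  then obtain h where h: "lin A T T h" "ALL a:car (PP t). h (f a) = f (d ** a)" using f.factor_through[OF TT l f(2)] by auto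
  have "(%x:car T. h x) :. E" using lin_cong[of T "%x:car T. h x" h A T] h(1) TT by (simp add: E_def)
  moreover have "(%x:car T. h x) u = f d" using h(2) et_P(1)[OF t] uT dA(3) by (simp add: u_def)
  ultimately show ?thesis by blast
 qed
 obtain chi where chi: "functional K VA chi" "ALL a:tr AA (Suc t). chi a = 0@K"
  and nondeg: "!!c. [|c :. (C t); ALL d:car (C t). chi (c ** d) = 0@K |] ==> c : tr AA (Suc t)" using nondegenerate_functional[OF t] by blast
 interpret fK: linear_map K "kmod A (PP t)" "kmod A T" f by (rule kmod_linear_map[OF f(1)])
 have "functional K (kmod A (PP t)) chi"
 proof -
  have "lin K (VA(|carrier := car (PP t)|)) (reg K) chi" by (rule lin_restrict[OF chi(1)]) (auto simp: P_sel[OF t])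
  thus ?thesis by (simp add: indec_projective_def kmod_def)
 qed
 \<comment> \<open>\<open>chi\<close> vanishes on the trace ideal, hence on the kernel of
   \<open>f\<close>, and descends to the standard module.\<close>
 hence "EX X. functional K (kmod A T) X & (ALL a:car (kmod A (PP t)). X (f a) = chi a)"
  by (rule fK.factor_through[OF K.regular_right_module]) (use f(2) k chi(2) in "auto simp: std_ker_def")
 then obtain X where X: "functional K (kmod A T) X" "!!a. a :. (PP t) ==> X (f a) = chi a" by auto
 define phi where "phi g = X (g u)" for g
 have "functional K (kmod E (reg E)) phi"
 proof (rule linI)
  fix l g assume l: "l :. K" and g: "g :. (kmod E (reg E))"
  have "l *>.(kmod E (reg E)) g = l *>.E g" using E.mult_scalar[OF l] g by simp
  hence "phi (l *>.(kmod E (reg E)) g) = X (l *>.(kmod A T) g u)" using uT by (simp add: phi_def E_def)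
  thus "phi (l *>.(kmod E (reg E)) g) = l *>.(reg K) phi g" using lin_act[OF X(1) l, of "g u"] Ecl[OF _ uT] g by (simp add: phi_def)
 next
  fix g h assume "g :. (kmod E (reg E))" "h :. (kmod E (reg E))"
  thus "phi (g ++.(kmod E (reg E)) h) = phi g ++.(reg K) phi h" using lin_add[OF X(1), of "g u" "h u"] Ecl[OF _ uT] uT by (simp add: phi_def E_def)
 qed (use functional_closed[OF X(1)] Ecl[OF _ uT] in "simp add: phi_def")
 note phi = this
 let ?D = "dual_module K E"
 define Phi where "Phi g = (%x:car E. phi (g **.E x))" for g
 have phiadd: "phi (g ++.E h) = phi g ++.K phi h" if "g :. E" "h :. E" for g h using lin_add[OF phi, of g h] that by simp
 have "lin E (reg E) ?D Phi"
 proof (rule linI)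
  fix g assume g: "g :. (reg E)"
  thus "Phi g : car ?D" unfolding Phi_def by (intro E.dual_restrict lin_comp[OF E.VA_mult_left phi]) simp
  fix h assume h: "h :. (reg E)"
  have "phi ((g ++.E h) **.E x) = phi (g **.E x) ++.K phi (h **.E x)" if "x :. E" for x
   using g h that phiadd[of "g **.E x" "h **.E x"] by (simp add: E.A.l_distr)
  thus "Phi (g ++.(reg E) h) = Phi g ++.?D Phi h" unfolding Phi_def dual_module_sel regular_module_sel by (intro restrict_ext) simp
 next
  fix y g assume y: "y :. E" and g: "g :. (reg E)"
  have "phi (g **.E y **.E x) = phi (g **.E (y **.E x))" if "x :. E" for x using y g that by (simp add: E.A.m_assoc)
  thus "Phi (y *>.(reg E) g) = y *>.?D Phi g" unfolding Phi_def dual_module_sel regular_module_sel using y by (intro restrict_ext) simp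
 qed
 hence Phi: "lmap E (reg E) ?D Phi" by (intro lmapI E.A_rmod E.dual_right_module)
 interpret Phi: linear_map E "reg E" ?D Phi by (rule Phi)
 have inj: "inj_on Phi (car (reg E))" unfolding Phi.inj_iff
 proof (intro ballI impI)
  fix g assume g0: "g :. (reg E)" and z: "Phi g = 0@?D"
  have g: "g :. E" using g0 by simp
  obtain c where c: "c :. (C t)" "g u = f c" using Eu[OF g] by blast
  \<comment> \<open>If \<open>x\<close> is the endomorphism that belongs to \<open>d\<close>, then
    the composite of \<open>g\<close> and \<open>x\<close> belongs to \<open>c d\<close>.\<close>
  have "chi (c ** d) = 0@K" if d: "d :. (C t)" for d
  proof -
   obtain x where x: "x :. E" "x u = f d" using Ed[OF d] by blast
   have "phi (g **.E x) = 0@K" using fun_cong[OF z, of x] x(1) by (simp add: Phi_def)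
   hence "X (g (x u)) = 0@K" using uT by (simp add: phi_def E_def compose_def)
   moreover have "g (x u) = d *>.T f c" using Eact[OF g _ uT, of d] x(2) fu[OF CP[OF d]] c(2) d by simp
   moreover have "d *>.T f c = f (c ** d)" using f.map_act[of d c] CP[OF c(1)] d by (simp add: P_sel[OF t])
   moreover have "c ** d :. (PP t)" using c(1) d et[OF t] by (simp add: P_sel[OF t] flip: A.m_assoc)
   ultimately show ?thesis using X(2) by simp
  qed
  hence "c : std_ker t" using nondeg[OF c(1)] CP[OF c(1)] unfolding std_ker_def by blast
  hence gu: "g u = 0@T" using k[OF CP[OF c(1)]] c(2) by simp
  have "g x = 0@T" if "x :. T" for x
  proof -
   obtain a where "a :. (PP t)" "x = a *>.T u" using gen[OF `x : car T`] by blast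
   thus ?thesis using Eact[OF g PA(1) uT, of a] gu PA(1) by simp
  qed
  thus "g = 0@(reg E)" using g by (auto simp: E_def fun_eq_iff extensional_def)
 qed
 interpret VE: fin_vector_space K "kmod E (reg E)" by (rule E.VA_space)
 have "Phi ` car (reg E) = car ?D" using VE.injective_onto[OF E.kmod_linear_map[OF Phi]] inj E.dual_rank by simp
 hence "bij_betw Phi (car (reg E)) (car ?D)" using inj unfolding bij_betw_def by blast
 from bij_lin_inverse[OF Phi this] obtain Psi where "lmap E ?D (reg E) Psi" "bij_betw Psi (car ?D) (car (reg E))" by blast
 hence "module_iso E ?D (reg E)" by (intro module_isoI[OF E.dual_right_module linear_map.lin])
 thus ?thesis unfolding frobenius_algebra_def using E.fd_algebra_axioms by (simp add: E_def T_def)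
qed

end

theorem mainTheorem2:
  fixes K :: "'k ring" and A :: "('k, 'a) module" and n :: nat and e :: "nat \<Rightarrow> 'a"
  assumes "fd_algebra K A"
    and "gorenstein_algebra A"
    and "properly_stratified A n e"
  shows "(\<forall>M :: ('a, 'm) module. gorenstein_projective A M \<longrightarrow>
            M \<in> filtered_by A (proper_standard_modules A n e)) \<and>
         (\<forall>M :: ('a, 'm) module. fg_right_module A M \<longrightarrow>
            (M \<in> filtered_by A (standard_modules A n e) \<longleftrightarrow>
             M \<in> filtered_by A (proper_standard_modules A n e) \<and>
             finite_projective_dimension A M)) \<and>
         (\<forall>i\<in>{1..n}. frobenius_algebra K (End_algebra A (standard_module A n e i)))"
proof -
 interpret fd_algebra K A by (rule assms(1))
 interpret idempotents K A n e using assms(1,3) by (simp add: idempotents_def idempotents_axioms_def properly_stratified_def)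
 obtain b r where gen: "generators K A n e b r" using generators_exist by blast
 interpret stratified K A n e b r
  using gen assms by (simp add: stratified_def stratified_axioms_def gorenstein_fd_algebra_def gorenstein_fd_algebra_axioms_def)
 show ?thesis using gorenstein_projective_filtered standard_filtered_iff standard_frobenius by blast
qed

end
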